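(* $\mathbf{M^j}$ is a definitional extension of $\mathbf{BIM}+\mathrm{CF_d}$.
   Context: $\mathbf{BIM}$ (Basic Intuitionistic Mathematics, W. Veldman): two-sorted intuitionistic system with number variables and function variables (one-place number-theoretic functions), number equality primitive, $u=v:\equiv\forall x\,u(x)=v(x)$, no $\lambda$-abstraction. Constants: $0$, a unary constant for the constant-zero function, one for the identity, successor $S$, a binary pairing function $J$ onto $\mathbb{N}$ and its projections $K,L$. With $\alpha(m,n)$ for $\alpha(J(m,n))$ (more arguments via iterated pairing), axioms: equality axioms, induction for all formulas, axioms on the constants, closure of functions under composition, pairing and primitive recursion ($\forall\alpha\forall\beta\exists\gamma\forall m\forall n[\gamma(m,0)=\alpha(m)\,\&\,\gamma(m,S(n))=\beta(m,n,\gamma(m,n))]$), and unbounded search $\forall\alpha[\forall m\exists n\,\alpha(m,n)=0\to\exists\gamma\forall m[\alpha(m,\gamma(m))=0\,\&\,\forall n<\gamma(m)\,\alpha(m,n)\neq0]]$. $\mathbf{IA_1}$: two-sorted intuitionistic arithmetic with $0,',+,\cdot$ and finitely many further primitive recursive function(al) constants (exponentiation, factorial, predecessor, cut-off subtraction, min, max, $\mathrm{sg}$, $\overline{\mathrm{sg}}$, $|a-b|$, remainder, quotient, bounded sums/products/min/max of function values, prime enumeration, exponent, length, concatenation, $\overline{\alpha}(x)$, $\widetilde{\alpha}(x)$, $a\circ b$, Kleene's $\mathrm{ccp}$), application and $\lambda$-abstraction; axioms: Peano axioms, equality axioms, defining equations, $x=y\to\alpha(x)=\alpha(y)$, $\lambda$-conversion,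 induction for all formulas. $\mathbf{M}=\mathbf{IA_1}+\mathrm{AC_{00}!}$. $\mathbf{M^j}$ is the extension of $\mathbf{M}$ by constants $J,K,L$ for a primitive recursive pairing function onto $\mathbb{N}$ and its primitive recursive inverses, with defining axioms. $\mathrm{AC_{00}!}$: $\forall x\exists! y\,A(x,y)\to\exists\alpha\forall x\,A(x,\alpha(x))$. $\mathrm{CF_d}$: $\forall x(B(x)\vee\neg B(x))\to\exists\beta\forall x[\beta(x)\le 1\,\&\,(\beta(x)=0\leftrightarrow B(x))]$. $S_2$ is a definitional extension of $S_1$ if there is an effective translation $E\mapsto E'$ from formulas of $S_2$ to formulas of $S_1$ with $E'\equiv E$ for $E$ in the language of $S_1$, $S_2\vdash E'\leftrightarrow E$, $\Gamma\vdash_{S_2}E\Rightarrow\Gamma'\vdash_{S_1}E'$, and $'$ commuting with the logical operations. *)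

theory Defs
  imports Main "HOL-Library.Nat_Bijection"
begin

section \<open>Two-sorted syntax\<close>

text \<open>
  Number terms and function terms (functors), with separate de Bruijn indices for number
  variables (NV) and function variables (FV). The constants Suc, K, L are functors; J and the
  constants for primitive recursive functionals (Cst) take arguments. Cst i is the i-th
  constant of a list of primitive recursive definitions, applied to a list of number terms and
  a list of functors. Lam binds number variable 0.
\<close>

datatype trm = NV nat | Zero | Ap fnc trm | J trm trm | Cst nat "trm list" "fnc list"
     and fnc = FV nat | Succ | PK | PL | Lam trm

abbreviation S :: "trm \<Rightarrow> trm" where "S t \<equiv> Ap Succ t"
abbreviation One :: trm where "One \<equiv> S Zero"

text \<open>All and Ex bind number variable 0, FAll and FEx bind function variable 0.\<close>

datatype fm =
    Eq trm trm (infix "\<doteq>" 50)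
  | Neg fm ("\<^bold>\<not> _" [40] 40)
  | And fm fm (infixr "\<^bold>\<and>" 35)
  | Or fm fm (infixr "\<^bold>\<or>" 30)
  | Imp fm fm (infixr "\<^bold>\<longrightarrow>" 25)
  | All fm | Ex fm | FAll fm | FEx fm

definition Iff :: "fm \<Rightarrow> fm \<Rightarrow> fm" (infixr "\<^bold>\<longleftrightarrow>" 25) where
  "(A \<^bold>\<longleftrightarrow> B) = ((A \<^bold>\<longrightarrow> B) \<^bold>\<and> (B \<^bold>\<longrightarrow> A))"

definition up :: "(nat \<Rightarrow> nat) \<Rightarrow> nat \<Rightarrow> nat" where
  "up r = case_nat 0 (\<lambda>n. Suc (r n))"

primrec ren_trm :: "trm \<Rightarrow> (nat \<Rightarrow> nat) \<Rightarrow> (nat \<Rightarrow> nat) \<Rightarrow> trm"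
    and ren_fnc :: "fnc \<Rightarrow> (nat \<Rightarrow> nat) \<Rightarrow> (nat \<Rightarrow> nat) \<Rightarrow> fnc" where
  "ren_trm (NV n) r q = NV (r n)"
| "ren_trm Zero r q = Zero"
| "ren_trm (Ap u t) r q = Ap (ren_fnc u r q) (ren_trm t r q)"
| "ren_trm (J s t) r q = J (ren_trm s r q) (ren_trm t r q)"
| "ren_trm (Cst i ts us) r q =
     Cst i (map (\<lambda>t. ren_trm t r q) ts) (map (\<lambda>u. ren_fnc u r q) us)"
| "ren_fnc (FV n) r q = FV (q n)"
| "ren_fnc Succ r q = Succ"
| "ren_fnc PK r q = PK"
| "ren_fnc PL r q = PL"
| "ren_fnc (Lam t) r q = Lam (ren_trm t (up r) q)"

type_synonym nsub = "nat \<Rightarrow> trm"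
type_synonym fsub = "nat \<Rightarrow> fnc"

text \<open>A simultaneous substitution for both sorts, passed under a number binder
  (nn, nf) and under a function binder (fn, ff).\<close>

definition nn :: "nsub \<Rightarrow> nsub" where
  "nn \<sigma> = case_nat (NV 0) (\<lambda>n. ren_trm (\<sigma> n) Suc id)"
definition nf :: "fsub \<Rightarrow> fsub" where
  "nf \<tau> = (\<lambda>n. ren_fnc (\<tau> n) Suc id)"
definition fn :: "nsub \<Rightarrow> nsub" where
  "fn \<sigma> = (\<lambda>n. ren_trm (\<sigma> n) id Suc)"
definition ff :: "fsub \<Rightarrow> fsub" where
  "ff \<tau> = case_nat (FV 0) (\<lambda>n. ren_fnc (\<tau> n) id Suc)"

primrec sub_trm :: "trm \<Rightarrow> nsub \<Rightarrow> fsub \<Rightarrow> trm"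
    and sub_fnc :: "fnc \<Rightarrow> nsub \<Rightarrow> fsub \<Rightarrow> fnc" where
  "sub_trm (NV n) \<sigma> \<tau> = \<sigma> n"
| "sub_trm Zero \<sigma> \<tau> = Zero"
| "sub_trm (Ap u t) \<sigma> \<tau> = Ap (sub_fnc u \<sigma> \<tau>) (sub_trm t \<sigma> \<tau>)"
| "sub_trm (J s t) \<sigma> \<tau> = J (sub_trm s \<sigma> \<tau>) (sub_trm t \<sigma> \<tau>)"
| "sub_trm (Cst i ts us) \<sigma> \<tau> =
     Cst i (map (\<lambda>t. sub_trm t \<sigma> \<tau>) ts) (map (\<lambda>u. sub_fnc u \<sigma> \<tau>) us)"
| "sub_fnc (FV n) \<sigma> \<tau> = \<tau> n"
| "sub_fnc Succ \<sigma> \<tau> = Succ"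
| "sub_fnc PK \<sigma> \<tau> = PK"
| "sub_fnc PL \<sigma> \<tau> = PL"
| "sub_fnc (Lam t) \<sigma> \<tau> = Lam (sub_trm t (nn \<sigma>) (nf \<tau>))"

primrec sub :: "fm \<Rightarrow> nsub \<Rightarrow> fsub \<Rightarrow> fm" where
  "sub (s \<doteq> t) \<sigma> \<tau> = (sub_trm s \<sigma> \<tau> \<doteq> sub_trm t \<sigma> \<tau>)"
| "sub (\<^bold>\<not> A) \<sigma> \<tau> = (\<^bold>\<not> sub A \<sigma> \<tau>)"
| "sub (A \<^bold>\<and> B) \<sigma> \<tau> = (sub A \<sigma> \<tau> \<^bold>\<and> sub B \<sigma> \<tau>)"
| "sub (A \<^bold>\<or> B) \<sigma> \<tau> = (sub A \<sigma> \<tau> \<^bold>\<or> sub B \<sigma> \<tau>)"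
| "sub (A \<^bold>\<longrightarrow> B) \<sigma> \<tau> = (sub A \<sigma> \<tau> \<^bold>\<longrightarrow> sub B \<sigma> \<tau>)"
| "sub (All A) \<sigma> \<tau> = All (sub A (nn \<sigma>) (nf \<tau>))"
| "sub (Ex A) \<sigma> \<tau> = Ex (sub A (nn \<sigma>) (nf \<tau>))"
| "sub (FAll A) \<sigma> \<tau> = FAll (sub A (fn \<sigma>) (ff \<tau>))"
| "sub (FEx A) \<sigma> \<tau> = FEx (sub A (fn \<sigma>) (ff \<tau>))"

definition inst :: "fm \<Rightarrow> trm \<Rightarrow> fm" where
  "inst A t = sub A (case_nat t NV) FV"
definition finst :: "fm \<Rightarrow> fnc \<Rightarrow> fm" where
  "finst A u = sub A NV (case_nat u FV)"
definition lift :: "fm \<Rightarrow> fm" where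
  "lift A = sub A (\<lambda>n. NV (Suc n)) FV"
definition flift :: "fm \<Rightarrow> fm" where
  "flift A = sub A NV (\<lambda>n. FV (Suc n))"

section \<open>Formal systems and intuitionistic derivability\<close>

record system =
  terms :: "trm set"
  functors :: "fnc set"
  axioms :: "fm set"

primrec over :: "trm set \<Rightarrow> fm \<Rightarrow> bool" where
  "over T (s \<doteq> t) = (s \<in> T \<and> t \<in> T)"
| "over T (\<^bold>\<not> A) = over T A"
| "over T (A \<^bold>\<and> B) = (over T A \<and> over T B)"
| "over T (A \<^bold>\<or> B) = (over T A \<and> over T B)"
| "over T (A \<^bold>\<longrightarrow> B) = (over T A \<and> over T B)"
| "over T (All A) = over T A"
| "over T (Ex A) = over T A"
| "over T (FAll A) = over T A"
| "over T (FEx A) = over T A"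

definition formulas :: "system \<Rightarrow> fm set" where
  "formulas T = {A. over (terms T) A}"

text \<open>
  Natural deduction for two-sorted intuitionistic predicate logic, inside the language of the
  system. The free variables of the assumptions are held constant (the assumptions, but not
  the axioms, are lifted when passing an eigenvariable); open axioms thus amount to their
  universal closures.
\<close>

inductive derives :: "system \<Rightarrow> fm set \<Rightarrow> fm \<Rightarrow> bool" ("_ \<parallel> _ \<turnstile> _" [51, 51, 25] 24)
  for T :: system where
  assm: "A \<in> \<Gamma> \<Longrightarrow> A \<in> formulas T \<Longrightarrow> T \<parallel> \<Gamma> \<turnstile> A"
| ax: "A \<in> axioms T \<Longrightarrow> A \<in> formulas T \<Longrightarrow> T \<parallel> \<Gamma> \<turnstile> A"
| negI: "T \<parallel> insert A \<Gamma> \<turnstile> B \<Longrightarrow> T \<parallel> insert A \<Gamma> \<turnstile> \<^bold>\<not> B \<Longrightarrow> A \<in> formulas T \<Longrightarrow> T \<parallel> \<Gamma> \<turnstile> \<^bold>\<not> A"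
| negE: "T \<parallel> \<Gamma> \<turnstile> \<^bold>\<not> A \<Longrightarrow> T \<parallel> \<Gamma> \<turnstile> A \<Longrightarrow> B \<in> formulas T \<Longrightarrow> T \<parallel> \<Gamma> \<turnstile> B"
| andI: "T \<parallel> \<Gamma> \<turnstile> A \<Longrightarrow> T \<parallel> \<Gamma> \<turnstile> B \<Longrightarrow> T \<parallel> \<Gamma> \<turnstile> A \<^bold>\<and> B"
| andE1: "T \<parallel> \<Gamma> \<turnstile> A \<^bold>\<and> B \<Longrightarrow> T \<parallel> \<Gamma> \<turnstile> A"
| andE2: "T \<parallel> \<Gamma> \<turnstile> A \<^bold>\<and> B \<Longrightarrow> T \<parallel> \<Gamma> \<turnstile> B"
| orI1: "T \<parallel> \<Gamma> \<turnstile> A \<Longrightarrow> B \<in> formulas T \<Longrightarrow> T \<parallel> \<Gamma> \<turnstile> A \<^bold>\<or> B"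
| orI2: "T \<parallel> \<Gamma> \<turnstile> B \<Longrightarrow> A \<in> formulas T \<Longrightarrow> T \<parallel> \<Gamma> \<turnstile> A \<^bold>\<or> B"
| orE: "T \<parallel> \<Gamma> \<turnstile> A \<^bold>\<or> B \<Longrightarrow> T \<parallel> insert A \<Gamma> \<turnstile> C \<Longrightarrow> T \<parallel> insert B \<Gamma> \<turnstile> C \<Longrightarrow> T \<parallel> \<Gamma> \<turnstile> C"
| impI: "T \<parallel> insert A \<Gamma> \<turnstile> B \<Longrightarrow> A \<in> formulas T \<Longrightarrow> T \<parallel> \<Gamma> \<turnstile> A \<^bold>\<longrightarrow> B"
| impE: "T \<parallel> \<Gamma> \<turnstile> A \<^bold>\<longrightarrow> B \<Longrightarrow> T \<parallel> \<Gamma> \<turnstile> A \<Longrightarrow> T \<parallel> \<Gamma> \<turnstile> B"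
| allI: "T \<parallel> lift ` \<Gamma> \<turnstile> A \<Longrightarrow> T \<parallel> \<Gamma> \<turnstile> All A"
| allE: "T \<parallel> \<Gamma> \<turnstile> All A \<Longrightarrow> t \<in> terms T \<Longrightarrow> T \<parallel> \<Gamma> \<turnstile> inst A t"
| exI: "T \<parallel> \<Gamma> \<turnstile> inst A t \<Longrightarrow> t \<in> terms T \<Longrightarrow> A \<in> formulas T \<Longrightarrow> T \<parallel> \<Gamma> \<turnstile> Ex A"
| exE: "T \<parallel> \<Gamma> \<turnstile> Ex A \<Longrightarrow> T \<parallel> insert A (lift ` \<Gamma>) \<turnstile> lift C \<Longrightarrow> T \<parallel> \<Gamma> \<turnstile> C"
| fallI: "T \<parallel> flift ` \<Gamma> \<turnstile> A \<Longrightarrow> T \<parallel> \<Gamma> \<turnstile> FAll A"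
| fallE: "T \<parallel> \<Gamma> \<turnstile> FAll A \<Longrightarrow> u \<in> functors T \<Longrightarrow> T \<parallel> \<Gamma> \<turnstile> finst A u"
| fexI: "T \<parallel> \<Gamma> \<turnstile> finst A u \<Longrightarrow> u \<in> functors T \<Longrightarrow> A \<in> formulas T \<Longrightarrow> T \<parallel> \<Gamma> \<turnstile> FEx A"
| fexE: "T \<parallel> \<Gamma> \<turnstile> FEx A \<Longrightarrow> T \<parallel> insert A (flift ` \<Gamma>) \<turnstile> flift C \<Longrightarrow> T \<parallel> \<Gamma> \<turnstile> C"

section \<open>Axioms common to the systems\<close>

text \<open>Schemas take a formula A whose number variable 0 is the variable x of A(x); for
  AC00! the variables x, y of A(x,y) are number variables 1 and 0.\<close>

definition arith_axioms :: "fm set" where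
  "arith_axioms =
    {NV 0 \<doteq> NV 0,
     NV 0 \<doteq> NV 1 \<^bold>\<longrightarrow> NV 0 \<doteq> NV 2 \<^bold>\<longrightarrow> NV 1 \<doteq> NV 2,
     NV 0 \<doteq> NV 1 \<^bold>\<longrightarrow> Ap (FV 0) (NV 0) \<doteq> Ap (FV 0) (NV 1),
     \<^bold>\<not> S (NV 0) \<doteq> Zero,
     S (NV 0) \<doteq> S (NV 1) \<^bold>\<longrightarrow> NV 0 \<doteq> NV 1}"

text \<open>
  J is axiomatized only as a bijective pairing with inverses K, L, in the same way in BIM and in
  Mj. Fixing a particular pairing in Mj alone would already make Mj prove closed equations such
  as \<open>J(0,0) = 0\<close> that BIM does not prove.
\<close>

definition pairing_axioms :: "fm set" where
  "pairing_axioms =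
    {NV 0 \<doteq> NV 1 \<^bold>\<and> NV 2 \<doteq> NV 3 \<^bold>\<longrightarrow> J (NV 0) (NV 2) \<doteq> J (NV 1) (NV 3),
     Ap PK (J (NV 0) (NV 1)) \<doteq> NV 0,
     Ap PL (J (NV 0) (NV 1)) \<doteq> NV 1,
     J (Ap PK (NV 0)) (Ap PL (NV 0)) \<doteq> NV 0}"

definition induction_axiom :: "fm \<Rightarrow> fm" where
  "induction_axiom A =
    (inst A Zero \<^bold>\<and> All (A \<^bold>\<longrightarrow> sub A (case_nat (S (NV 0)) (\<lambda>n. NV (Suc n))) FV) \<^bold>\<longrightarrow> All A)"

text \<open>With A(y) having y as number variable 0: there is y such that A(y) and, for all z,
  A(z) implies y = z.\<close>

definition Ex1 :: "fm \<Rightarrow> fm" where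
  "Ex1 A = Ex (A \<^bold>\<and> All (sub A (case_nat (NV 0) (\<lambda>n. NV (Suc (Suc n)))) FV \<^bold>\<longrightarrow> NV 1 \<doteq> NV 0))"

definition AC00u :: "fm \<Rightarrow> fm" where
  "AC00u A = (All (Ex1 A) \<^bold>\<longrightarrow>
    FEx (All (sub A (case_nat (Ap (FV 0) (NV 0)) NV) (\<lambda>n. FV (Suc n)))))"

section \<open>BIM and CFd\<close>

text \<open>
  The constants of BIM for the constant-zero function and the identity are identified with the
  closed functors \<open>\<lambda>x. 0\<close> and \<open>\<lambda>x. x\<close>, so that the language of BIM is literally part of
  that of Mj; these are the only functors of BIM built with Lam, and their only axioms in BIM are
  the two defining equations.
\<close>

definition ZeroF :: fnc where "ZeroF = Lam Zero"
definition IdF :: fnc where "IdF = Lam (NV 0)"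

primrec bim_trm :: "trm \<Rightarrow> bool" and bim_fnc :: "fnc \<Rightarrow> bool" where
  "bim_trm (NV n) = True"
| "bim_trm Zero = True"
| "bim_trm (Ap u t) = (bim_fnc u \<and> bim_trm t)"
| "bim_trm (J s t) = (bim_trm s \<and> bim_trm t)"
| "bim_trm (Cst i ts us) = False"
| "bim_fnc (FV n) = True"
| "bim_fnc Succ = True"
| "bim_fnc PK = True"
| "bim_fnc PL = True"
| "bim_fnc (Lam t) = (Lam t = ZeroF \<or> Lam t = IdF)"

text \<open>
  BIM has neither + nor <. Here a < b is the usual \<open>\<exists>c. S c + a = b\<close>, where
  \<open>S c + a = b\<close> is written with a function g satisfying the recursion equations of
  \<open>\<lambda>k. S c + k\<close>.
\<close>

definition less_fm :: "trm \<Rightarrow> trm \<Rightarrow> fm" (infix "\<^bold><" 50) where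
  "(a \<^bold>< b) = Ex (FEx (
     Ap (FV 0) Zero \<doteq> S (NV 0)
     \<^bold>\<and> All (Ap (FV 0) (S (NV 0)) \<doteq> S (Ap (FV 0) (NV 0)))
     \<^bold>\<and> Ap (FV 0) (ren_trm a Suc Suc) \<doteq> ren_trm b Suc Suc))"

definition le_fm :: "trm \<Rightarrow> trm \<Rightarrow> fm" (infix "\<^bold>\<le>" 50) where
  "(a \<^bold>\<le> b) = (a \<^bold>< b \<^bold>\<or> a \<doteq> b)"

definition bim_constant_axioms :: "fm set" where
  "bim_constant_axioms =
    pairing_axioms \<union> {Ap ZeroF (NV 0) \<doteq> Zero, Ap IdF (NV 0) \<doteq> NV 0}"

text \<open>In the next axioms \<open>\<alpha>\<close>, \<open>\<beta>\<close>, \<open>\<gamma>\<close> are FV 2, FV 1, FV 0, and m, n are NV 1, NV 0;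
  \<open>\<alpha>(m,n)\<close> is \<open>\<alpha>(J(m,n))\<close> and \<open>\<beta>(m,n,p)\<close> is \<open>\<beta>(J(J(m,n),p))\<close>.\<close>

definition composition_axiom :: fm where
  "composition_axiom = FAll (FAll (FEx (All (
     Ap (FV 0) (NV 0) \<doteq> Ap (FV 2) (Ap (FV 1) (NV 0))))))"

definition fun_pairing_axiom :: fm where
  "fun_pairing_axiom = FAll (FAll (FEx (All (
     Ap (FV 0) (NV 0) \<doteq> J (Ap (FV 2) (NV 0)) (Ap (FV 1) (NV 0))))))"

definition primrec_axiom :: fm where
  "primrec_axiom = FAll (FAll (FEx (All (All (
     Ap (FV 0) (J (NV 1) Zero) \<doteq> Ap (FV 2) (NV 1)
     \<^bold>\<and> Ap (FV 0) (J (NV 1) (S (NV 0)))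
         \<doteq> Ap (FV 1) (J (J (NV 1) (NV 0)) (Ap (FV 0) (J (NV 1) (NV 0)))))))))"

text \<open>Here \<open>\<alpha>\<close> is FV 0 in the premise and FV 1, next to \<open>\<gamma>\<close> = FV 0, in the conclusion.\<close>

definition search_axiom :: fm where
  "search_axiom = FAll (
     All (Ex (Ap (FV 0) (J (NV 1) (NV 0)) \<doteq> Zero)) \<^bold>\<longrightarrow>
     FEx (All (
       Ap (FV 1) (J (NV 0) (Ap (FV 0) (NV 0))) \<doteq> Zero
       \<^bold>\<and> All (NV 0 \<^bold>< Ap (FV 0) (NV 1) \<^bold>\<longrightarrow> \<^bold>\<not> Ap (FV 1) (J (NV 1) (NV 0)) \<doteq> Zero))))"

definition BIM :: system where
  "BIM = \<lparr>terms = {t. bim_trm t}, functors = {u. bim_fnc u},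
     axioms = arith_axioms \<union> bim_constant_axioms
       \<union> {composition_axiom, fun_pairing_axiom, primrec_axiom, search_axiom}
       \<union> {induction_axiom A | A. over {t. bim_trm t} A}\<rparr>"

definition CFd :: "fm \<Rightarrow> fm" where
  "CFd B = (All (B \<^bold>\<or> \<^bold>\<not> B) \<^bold>\<longrightarrow>
     FEx (All (Ap (FV 0) (NV 0) \<^bold>\<le> One \<^bold>\<and> (Ap (FV 0) (NV 0) \<doteq> Zero \<^bold>\<longleftrightarrow> flift B))))"

definition BIM_CFd :: system where
  "BIM_CFd = BIM\<lparr>axioms := axioms BIM \<union> {CFd B | B. B \<in> formulas BIM}\<rparr>"

section \<open>Primitive recursive definitions and the systems IA1, M, Mj\<close>

text \<open>
  A function(al) constant f with l function arguments is introduced from earlier constants by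
  an explicit definition with k number arguments,
    \<open>f(a\<^sub>0,\<dots>; \<alpha>\<^sub>0,\<dots>) = p\<close>,
  or by a primitive recursion with k + 1 number arguments,
    \<open>f(0,a\<^sub>0,\<dots>; \<alpha>\<^sub>0,\<dots>) = q\<close>, \<open>f(y',a\<^sub>0,\<dots>; \<alpha>\<^sub>0,\<dots>) = r(y, f(y,a\<^sub>0,\<dots>; \<alpha>\<^sub>0,\<dots>), a\<^sub>0,\<dots>; \<alpha>\<^sub>0,\<dots>)\<close>.
  In p and q, NV i is \<open>a\<^sub>i\<close>; in r, NV 0 is y, NV 1 is the previous value and NV (i + 2) is
  \<open>a\<^sub>i\<close>; always FV i is \<open>\<alpha>\<^sub>i\<close>. The recursion argument comes first in the argument list of Cst.
\<close>

datatype prdef = Expl nat nat trm | Rec nat nat trm trm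

fun arity :: "prdef \<Rightarrow> nat \<times> nat" where
  "arity (Expl k l p) = (k, l)"
| "arity (Rec k l q r) = (Suc k, l)"

text \<open>Terms over constants with the given arities; j says whether J, K, L are in the language.\<close>

primrec ia_trm :: "bool \<Rightarrow> (nat \<times> nat) list \<Rightarrow> trm \<Rightarrow> bool"
    and ia_fnc :: "bool \<Rightarrow> (nat \<times> nat) list \<Rightarrow> fnc \<Rightarrow> bool" where
  "ia_trm j ar (NV n) = True"
| "ia_trm j ar Zero = True"
| "ia_trm j ar (Ap u t) = (ia_fnc j ar u \<and> ia_trm j ar t)"
| "ia_trm j ar (J s t) = (j \<and> ia_trm j ar s \<and> ia_trm j ar t)"
| "ia_trm j ar (Cst i ts us) =
     (i < length ar \<and> ar ! i = (length ts, length us)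
      \<and> list_all (ia_trm j ar) ts \<and> list_all (ia_fnc j ar) us)"
| "ia_fnc j ar (FV n) = True"
| "ia_fnc j ar Succ = True"
| "ia_fnc j ar PK = j"
| "ia_fnc j ar PL = j"
| "ia_fnc j ar (Lam t) = ia_trm j ar t"

primrec below_trm :: "trm \<Rightarrow> nat \<Rightarrow> nat \<Rightarrow> bool"
    and below_fnc :: "fnc \<Rightarrow> nat \<Rightarrow> nat \<Rightarrow> bool" where
  "below_trm (NV n) k l = (n < k)"
| "below_trm Zero k l = True"
| "below_trm (Ap u t) k l = (below_fnc u k l \<and> below_trm t k l)"
| "below_trm (J s t) k l = (below_trm s k l \<and> below_trm t k l)"
| "below_trm (Cst i ts us) k l =
     (list_all (\<lambda>t. below_trm t k l) ts \<and> list_all (\<lambda>u. below_fnc u k l) us)"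
| "below_fnc (FV n) k l = (n < l)"
| "below_fnc Succ k l = True"
| "below_fnc PK k l = True"
| "below_fnc PL k l = True"
| "below_fnc (Lam t) k l = below_trm t (Suc k) l"

fun prdef_over :: "(nat \<times> nat) list \<Rightarrow> prdef \<Rightarrow> bool" where
  "prdef_over ar (Expl k l p) = (ia_trm False ar p \<and> below_trm p k l)"
| "prdef_over ar (Rec k l q r) =
     (ia_trm False ar q \<and> below_trm q k l \<and> ia_trm False ar r \<and> below_trm r (k + 2) l)"

definition pr_definitions :: "prdef list \<Rightarrow> bool" where
  "pr_definitions ds \<longleftrightarrow> (\<forall>i < length ds. prdef_over (map arity (take i ds)) (ds ! i))"

fun defining_axioms :: "nat \<Rightarrow> prdef \<Rightarrow> fm set" where
  "defining_axioms i (Expl k l p) = {Cst i (map NV [0..<k]) (map FV [0..<l]) \<doteq> p}"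
| "defining_axioms i (Rec k l q r) =
    {Cst i (Zero # map NV [0..<k]) (map FV [0..<l]) \<doteq> q,
     Cst i (S (NV 0) # map NV [1..<Suc k]) (map FV [0..<l]) \<doteq>
       sub_trm r
         (case_nat (NV 0)
           (case_nat (Cst i (NV 0 # map NV [1..<Suc k]) (map FV [0..<l])) (\<lambda>n. NV (Suc n)))) FV}"

text \<open>The \<open>\<lambda>\<close>-conversion axioms \<open>(\<lambda>x. s)(t) = s[t/x]\<close>.\<close>

definition conversion_axiom :: "trm \<Rightarrow> trm \<Rightarrow> fm" where
  "conversion_axiom s t = (Ap (Lam s) t \<doteq> sub_trm s (case_nat t NV) FV)"

text \<open>The axioms of IA1 for the constants ds (+ and \<open>\<cdot>\<close> belong to ds), with the schemas
  taken over the language given by j.\<close>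

definition IA1_axioms :: "bool \<Rightarrow> prdef list \<Rightarrow> fm set" where
  "IA1_axioms j ds = arith_axioms
     \<union> (\<Union>i < length ds. defining_axioms i (ds ! i))
     \<union> {conversion_axiom s t | s t. ia_trm j (map arity ds) s \<and> ia_trm j (map arity ds) t}
     \<union> {induction_axiom A | A. over {t. ia_trm j (map arity ds) t} A}"

definition M_axioms :: "bool \<Rightarrow> prdef list \<Rightarrow> fm set" where
  "M_axioms j ds = IA1_axioms j ds \<union> {AC00u A | A. over {t. ia_trm j (map arity ds) t} A}"

definition IA1 :: "prdef list \<Rightarrow> system" where
  "IA1 ds = \<lparr>terms = {t. ia_trm False (map arity ds) t},
     functors = {u. ia_fnc False (map arity ds) u}, axioms = IA1_axioms False ds\<rparr>"

definition M :: "prdef list \<Rightarrow> system" where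
  "M ds = (IA1 ds)\<lparr>axioms := M_axioms False ds\<rparr>"

definition Mj :: "prdef list \<Rightarrow> system" where
  "Mj ds = \<lparr>terms = {t. ia_trm True (map arity ds) t},
     functors = {u. ia_fnc True (map arity ds) u},
     axioms = M_axioms True ds \<union> pairing_axioms\<rparr>"

subsection \<open>The constants of IA1\<close>

definition Plus where "Plus s t = Cst 0 [t, s] []"
definition Times where "Times s t = Cst 1 [t, s] []"
definition Power where "Power s t = Cst 2 [t, s] []"
definition Fact where "Fact s = Cst 3 [s] []"
definition Pred where "Pred s = Cst 4 [s] []"
definition Monus where "Monus s t = Cst 5 [t, s] []"
definition MinT where "MinT s t = Cst 6 [s, t] []"
definition MaxT where "MaxT s t = Cst 7 [s, t] []"
definition Sgbar where "Sgbar s = Cst 8 [s] []"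
definition Sg where "Sg s = Cst 9 [s] []"
definition AbsDiff where "AbsDiff s t = Cst 10 [s, t] []"
definition Rm where "Rm s t = Cst 11 [s, t] []"
definition Quot where "Quot s t = Cst 12 [s, t] []"
definition SumB where "SumB t u = Cst 13 [t] [u]"      \<comment> \<open>\<open>\<Sum>y<t. u(y)\<close>\<close>
definition ProdB where "ProdB t u = Cst 14 [t] [u]"    \<comment> \<open>\<open>\<Prod>y<t. u(y)\<close>\<close>
definition MinB where "MinB t u = Cst 15 [t] [u]"      \<comment> \<open>minimum of \<open>u(y)\<close> for \<open>y \<le> t\<close>\<close>
definition MaxB where "MaxB t u = Cst 16 [t] [u]"      \<comment> \<open>maximum of \<open>u(y)\<close> for \<open>y \<le> t\<close>\<close>
definition PrimeN where "PrimeN t = Cst 17 [t] []"     \<comment> \<open>the t-th prime, \<open>p\<^sub>0 = 2\<close>\<close>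
definition Expo where "Expo s t = Cst 18 [s, t] []"    \<comment> \<open>exponent of the t-th prime in s, 0 for s = 0\<close>
definition Lh where "Lh s = Cst 19 [s] []"             \<comment> \<open>number of nonzero exponents of s\<close>
definition Conc where "Conc s t = Cst 20 [s, t] []"    \<comment> \<open>\<open>s * t\<close>\<close>
definition Bar where "Bar t u = Cst 21 [t] [u]"        \<comment> \<open>product of \<open>p\<^sub>i\<close> to the \<open>u(i) + 1\<close>, \<open>i < t\<close>\<close>
definition Tilde where "Tilde t u = Cst 22 [t] [u]"    \<comment> \<open>product of \<open>p\<^sub>i\<close> to the \<open>u(i)\<close>, \<open>i < t\<close>\<close>
definition Circ where "Circ s t = Cst 23 [s, t] []"    \<comment> \<open>\<open>s \<circ> t\<close>, componentwise maximum of exponents\<close>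

text \<open>
  The least x < z with R(x) = 0, and z if there is none, as \<open>\<Sum>x<z. \<Prod>c<x'. sg(R(c))\<close>.
  R sits under two binders: its variable c is NV 0, and outer variables are shifted by 2.
\<close>

definition Mu :: "trm \<Rightarrow> trm \<Rightarrow> trm" where
  "Mu z R = SumB z (Lam (ProdB (S (NV 0)) (Lam (Sg R))))"

definition kleene_defs :: "prdef list" where
  "kleene_defs =
   [Rec 1 0 (NV 0) (S (NV 1)),
    Rec 1 0 Zero (Plus (NV 1) (NV 2)),
    Rec 1 0 One (Times (NV 1) (NV 2)),
    Rec 0 0 One (Times (NV 1) (S (NV 0))),
    Rec 0 0 Zero (NV 0),
    Rec 1 0 (NV 0) (Pred (NV 1)),
    Expl 2 0 (Monus (NV 1) (Monus (NV 1) (NV 0))),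
    Expl 2 0 (Plus (Monus (NV 0) (NV 1)) (NV 1)),
    Rec 0 0 One Zero,
    Rec 0 0 Zero One,
    Expl 2 0 (Plus (Monus (NV 0) (NV 1)) (Monus (NV 1) (NV 0))),
    Rec 1 0 Zero (Times (S (NV 1)) (Sg (AbsDiff (NV 2) (S (NV 1))))),
    Rec 1 0 Zero (Plus (NV 1) (Sgbar (AbsDiff (NV 2) (S (Rm (NV 0) (NV 2)))))),
    Rec 0 1 Zero (Plus (NV 1) (Ap (FV 0) (NV 0))),
    Rec 0 1 One (Times (NV 1) (Ap (FV 0) (NV 0))),
    Rec 0 1 (Ap (FV 0) Zero) (MinT (NV 1) (Ap (FV 0) (S (NV 0)))),
    Rec 0 1 (Ap (FV 0) Zero) (MaxT (NV 1) (Ap (FV 0) (S (NV 0)))),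
    \<comment> \<open>\<open>p\<^sub>i\<^sub>+\<^sub>1\<close> is the least \<open>b < p\<^sub>i! + 2\<close> such that \<open>p\<^sub>i < b\<close>, \<open>1 < b\<close> and no d with \<open>1 < d < b\<close> divides b\<close>
    Rec 0 0 (S One) (Mu (S (S (Fact (NV 1))))
      (Plus (Monus (S (NV 3)) (NV 0))
        (Plus (Sgbar (Monus (NV 0) One))
          (SumB (NV 0) (Lam (Times (Sgbar (Rm (NV 1) (NV 0))) (Sg (Monus (NV 0) One)))))))),
    \<comment> \<open>\<open>(a)\<^sub>i\<close> is the least \<open>x < a\<close> such that \<open>p\<^sub>i\<close> to the x divides a but \<open>p\<^sub>i\<close> to the \<open>x + 1\<close> does not\<close>
    Expl 2 0 (Mu (NV 0)
      (Plus (Sg (Rm (NV 2) (Power (PrimeN (NV 3)) (NV 0))))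
        (Sgbar (Rm (NV 2) (Power (PrimeN (NV 3)) (S (NV 0))))))),
    Expl 1 0 (SumB (NV 0) (Lam (Sg (Expo (NV 1) (NV 0))))),
    Expl 2 0 (Times (NV 0) (ProdB (Lh (NV 1))
      (Lam (Power (PrimeN (Plus (Lh (NV 1)) (NV 0))) (Expo (NV 2) (NV 0)))))),
    Expl 1 1 (ProdB (NV 0) (Lam (Power (PrimeN (NV 0)) (S (Ap (FV 0) (NV 0)))))),
    Expl 1 1 (ProdB (NV 0) (Lam (Power (PrimeN (NV 0)) (Ap (FV 0) (NV 0))))),
    Expl 2 0 (ProdB (MaxT (NV 0) (NV 1))
      (Lam (Power (PrimeN (NV 0)) (MaxT (Expo (NV 1) (NV 0)) (Expo (NV 2) (NV 0))))))]"

text \<open>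
  The list of constants is open-ended: IA1 is taken with these constants followed by any
  finite list of further primitive recursive ones (such as Kleene's ccp).
\<close>

definition kleene_constants :: "prdef list \<Rightarrow> bool" where
  "kleene_constants ds \<longleftrightarrow> pr_definitions ds \<and> (\<exists>es. ds = kleene_defs @ es)"

lemmas kleene_constant_defs = Plus_def Times_def Power_def Fact_def Pred_def Monus_def MinT_def
  MaxT_def Sgbar_def Sg_def AbsDiff_def Rm_def Quot_def SumB_def ProdB_def MinB_def MaxB_def
  PrimeN_def Expo_def Lh_def Conc_def Bar_def Tilde_def Circ_def Mu_def

lemma kleene_constants_kleene_defs: "kleene_constants kleene_defs"
proof -
  have "\<forall>i \<in> set [0..<24]. prdef_over (map arity (take i kleene_defs)) (kleene_defs ! i)"
    by (simp add: kleene_defs_def kleene_constant_defs upt_rec numeral_2_eq_2)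
  then have "pr_definitions kleene_defs"
    by (auto simp: pr_definitions_def kleene_defs_def)
  then show ?thesis by (auto simp: kleene_constants_def)
qed

section \<open>Effective translations and definitional extensions\<close>

text \<open>Total recursive functions of n arguments (given as a list of length n).\<close>

inductive recursive :: "nat \<Rightarrow> (nat list \<Rightarrow> nat) \<Rightarrow> bool" where
  zero: "recursive n (\<lambda>xs. 0)"
| succ: "recursive 1 (\<lambda>xs. Suc (xs ! 0))"
| proj: "i < n \<Longrightarrow> recursive n (\<lambda>xs. xs ! i)"
| comp: "recursive (length gs) f \<Longrightarrow> (\<forall>g \<in> set gs. recursive n g) \<Longrightarrow>
    recursive n (\<lambda>xs. f (map (\<lambda>g. g xs) gs))"
| prec: "recursive n f \<Longrightarrow> recursive (n + 2) g \<Longrightarrow>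
    recursive (Suc n) (\<lambda>xs. rec_nat (f (tl xs)) (\<lambda>y v. g (y # v # tl xs)) (hd xs))"
| mu: "recursive (Suc n) f \<Longrightarrow> (\<forall>xs. length xs = n \<longrightarrow> (\<exists>y. f (y # xs) = 0)) \<Longrightarrow>
    recursive n (\<lambda>xs. LEAST y. f (y # xs) = 0)"

primrec code_trm :: "trm \<Rightarrow> nat" and code_fnc :: "fnc \<Rightarrow> nat" where
  "code_trm (NV n) = prod_encode (0, n)"
| "code_trm Zero = prod_encode (1, 0)"
| "code_trm (Ap u t) = prod_encode (2, prod_encode (code_fnc u, code_trm t))"
| "code_trm (J s t) = prod_encode (3, prod_encode (code_trm s, code_trm t))"
| "code_trm (Cst i ts us) = prod_encode (4, prod_encode (i,
     prod_encode (list_encode (map code_trm ts), list_encode (map code_fnc us))))"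
| "code_fnc (FV n) = prod_encode (0, n)"
| "code_fnc Succ = prod_encode (1, 0)"
| "code_fnc PK = prod_encode (2, 0)"
| "code_fnc PL = prod_encode (3, 0)"
| "code_fnc (Lam t) = prod_encode (4, code_trm t)"

primrec code_fm :: "fm \<Rightarrow> nat" where
  "code_fm (s \<doteq> t) = prod_encode (0, prod_encode (code_trm s, code_trm t))"
| "code_fm (\<^bold>\<not> A) = prod_encode (1, code_fm A)"
| "code_fm (A \<^bold>\<and> B) = prod_encode (2, prod_encode (code_fm A, code_fm B))"
| "code_fm (A \<^bold>\<or> B) = prod_encode (3, prod_encode (code_fm A, code_fm B))"
| "code_fm (A \<^bold>\<longrightarrow> B) = prod_encode (4, prod_encode (code_fm A, code_fm B))"
| "code_fm (All A) = prod_encode (5, code_fm A)"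
| "code_fm (Ex A) = prod_encode (6, code_fm A)"
| "code_fm (FAll A) = prod_encode (7, code_fm A)"
| "code_fm (FEx A) = prod_encode (8, code_fm A)"

definition effective_on :: "fm set \<Rightarrow> (fm \<Rightarrow> fm) \<Rightarrow> bool" where
  "effective_on X tr \<longleftrightarrow>
    (\<exists>F. recursive 1 F \<and> (\<forall>E \<in> X. F [code_fm E] = code_fm (tr E)))"

definition commutes_with_logic :: "fm set \<Rightarrow> (fm \<Rightarrow> fm) \<Rightarrow> bool" where
  "commutes_with_logic X tr \<longleftrightarrow>
    (\<forall>A \<in> X. \<forall>B \<in> X.
       tr (\<^bold>\<not> A) = (\<^bold>\<not> tr A) \<and> tr (A \<^bold>\<and> B) = (tr A \<^bold>\<and> tr B) \<and>
       tr (A \<^bold>\<or> B) = (tr A \<^bold>\<or> tr B) \<and> tr (A \<^bold>\<longrightarrow> B) = (tr A \<^bold>\<longrightarrow> tr B) \<and>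
       tr (All A) = All (tr A) \<and> tr (Ex A) = Ex (tr A) \<and>
       tr (FAll A) = FAll (tr A) \<and> tr (FEx A) = FEx (tr A))"

definition extends :: "system \<Rightarrow> system \<Rightarrow> bool" where
  "extends S2 S1 \<longleftrightarrow>
    terms S1 \<subseteq> terms S2 \<and> functors S1 \<subseteq> functors S2 \<and>
    (\<forall>\<Gamma> E. \<Gamma> \<subseteq> formulas S1 \<longrightarrow> (S1 \<parallel> \<Gamma> \<turnstile> E) \<longrightarrow> (S2 \<parallel> \<Gamma> \<turnstile> E))"

definition definitional_extension :: "system \<Rightarrow> system \<Rightarrow> bool" where
  "definitional_extension S2 S1 \<longleftrightarrow> extends S2 S1 \<and>
    (\<exists>tr. effective_on (formulas S2) tr
       \<and> (\<forall>E \<in> formulas S2. tr E \<in> formulas S1)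
       \<and> (\<forall>E \<in> formulas S1. tr E = E)
       \<and> (\<forall>E \<in> formulas S2. S2 \<parallel> {} \<turnstile> tr E \<^bold>\<longleftrightarrow> E)
       \<and> (\<forall>\<Gamma> E. \<Gamma> \<subseteq> formulas S2 \<longrightarrow> E \<in> formulas S2 \<longrightarrow> (S2 \<parallel> \<Gamma> \<turnstile> E) \<longrightarrow> (S1 \<parallel> tr ` \<Gamma> \<turnstile> tr E))
       \<and> commutes_with_logic (formulas S2) tr)"

end

theory Submission
  imports Defs "HOL-Library.Countable"
begin

text \<open>
  Derivability is characterized by Kripke models: the worlds are the prime theories of a system,
  and what is forced at every world is derivable. All arguments about BIM + CFd and Mj then take
  place in such models.

  An equation between terms of Mj is translated by means of formulas of BIM that define the graphs
  of the terms relative to a function coding the values of the variables; a constant defined by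
  recursion is described by the existence of a function that satisfies the recursion equations.
  BIM + CFd proves \<open>AC\<^sub>0\<^sub>0!\<close>: if y is unique with A(x,y), then A(x,y) is decidable, because equality
  of numbers is, so that CFd provides a characteristic function and unbounded search finds y. Hence in
  models of BIM + CFd the graphs are total and functional, the functors denote functions, and the
  translated axioms of Mj are forced. Conversely unique choice proves the axioms of BIM and CFd in Mj, and
  there the graph of a term is satisfied exactly by the value of the term, so that every formula is
  equivalent to its translation. On codes the translation is a course-of-values recursion.
\<close>

section \<open>Substitution\<close>

text \<open>A world is a set of formulas of the system itself and its individuals are terms, so
  forcing coincides with membership and soundness costs no semantic work; what is gained is that
  intuitionistic arguments become classical reasoning about all worlds above a given one. Two
  systems with different axioms have to be handled, hence the locale \<open>choice_model\<close>:
  arithmetic plus unique choice for formulas of BIM, which BIM + CFd and Mj both satisfy. The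
  obstacle to translating an equation is the functors: one built with \<open>Lam\<close> has no name
  in BIM, and substituting into it moves terms under binders. Evaluating \<open>Lam t\<close> at x
  as \<open>t\<close> in an environment with x pushed on top removes the binder, and packing the
  environment into one function keeps the number of free variables of the graph bounded. The
  translation then respects substitution only up to equivalence, which is proved as a fact about
  values (\<open>ev_sub\<close>, \<open>force_tr_sub\<close>). Only equations are changed, and those
  of BIM not at all; this gives the identity on BIM and commutation with the logical
  operations.\<close>

abbreviation push :: "'a \<Rightarrow> (nat \<Rightarrow> 'a) \<Rightarrow> nat \<Rightarrow> 'a" (infixr "\<rhd>" 65) where
  "d \<rhd> \<sigma> \<equiv> case_nat d \<sigma>"

lemma up_comp: "up r' \<circ> up r = up (r' \<circ> r)"
  by (auto simp: up_def fun_eq_iff split: nat.splits)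

lemma up_id [simp]: "up id = id"
  by (auto simp: up_def fun_eq_iff split: nat.splits)

lemma up_Suc: "up r \<circ> Suc = Suc \<circ> r"
  by (auto simp: up_def)

text \<open>Under a binder the law for two substitutions needs both mixed laws, and renaming after
  substitution needs the law for two renamings; hence the order of what follows.\<close>

lemma ren_ren:
  "ren_trm (ren_trm t r q) r' q' = ren_trm t (r' \<circ> r) (q' \<circ> q)"
  "ren_fnc (ren_fnc u r q) r' q' = ren_fnc u (r' \<circ> r) (q' \<circ> q)"
  by (induction t and u arbitrary: r q r' q' and r q r' q') (auto simp: up_comp)

lemma nn_up: "nn \<sigma> \<circ> up r = nn (\<sigma> \<circ> r)" "nf \<tau> \<circ> q = nf (\<tau> \<circ> q)"
  by (auto simp: nn_def nf_def up_def fun_eq_iff split: nat.splits)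

lemma sub_ren:
  "sub_trm (ren_trm t r q) \<sigma> \<tau> = sub_trm t (\<sigma> \<circ> r) (\<tau> \<circ> q)"
  "sub_fnc (ren_fnc u r q) \<sigma> \<tau> = sub_fnc u (\<sigma> \<circ> r) (\<tau> \<circ> q)"
  by (induction t and u arbitrary: r q \<sigma> \<tau> and r q \<sigma> \<tau>) (auto simp: nn_up)

lemma ren_nn:
  "(\<lambda>n. ren_trm (nn \<sigma> n) (up r) q) = nn (\<lambda>n. ren_trm (\<sigma> n) r q)"
  "(\<lambda>n. ren_fnc (nf \<tau> n) (up r) q) = nf (\<lambda>n. ren_fnc (\<tau> n) r q)"
  by (auto simp: nn_def nf_def ren_ren up_Suc fun_eq_iff split: nat.splits) (auto simp: up_def)

lemma ren_sub:
  "ren_trm (sub_trm t \<sigma> \<tau>) r q = sub_trm t (\<lambda>n. ren_trm (\<sigma> n) r q) (\<lambda>n. ren_fnc (\<tau> n) r q)"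
  "ren_fnc (sub_fnc u \<sigma> \<tau>) r q = sub_fnc u (\<lambda>n. ren_trm (\<sigma> n) r q) (\<lambda>n. ren_fnc (\<tau> n) r q)"
  by (induction t and u arbitrary: r q \<sigma> \<tau> and r q \<sigma> \<tau>) (auto simp: ren_nn)

lemma sub_nn:
  "(\<lambda>n. sub_trm (nn \<sigma> n) (nn \<sigma>') (nf \<tau>')) = nn (\<lambda>n. sub_trm (\<sigma> n) \<sigma>' \<tau>')"
  "(\<lambda>n. sub_fnc (nf \<tau> n) (nn \<sigma>') (nf \<tau>')) = nf (\<lambda>n. sub_fnc (\<tau> n) \<sigma>' \<tau>')"
  by (auto simp: nn_def nf_def sub_ren ren_sub comp_def fun_eq_iff split: nat.splits)

lemma sub_fn:
  "(\<lambda>n. sub_trm (fn \<sigma> n) (fn \<sigma>') (ff \<tau>')) = fn (\<lambda>n. sub_trm (\<sigma> n) \<sigma>' \<tau>')"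
  "(\<lambda>n. sub_fnc (ff \<tau> n) (fn \<sigma>') (ff \<tau>')) = ff (\<lambda>n. sub_fnc (\<tau> n) \<sigma>' \<tau>')"
  by (auto simp: fn_def ff_def sub_ren ren_sub comp_def fun_eq_iff split: nat.splits)

lemma sub_sub:
  "sub_trm (sub_trm t \<sigma> \<tau>) \<sigma>' \<tau>' = sub_trm t (\<lambda>n. sub_trm (\<sigma> n) \<sigma>' \<tau>') (\<lambda>n. sub_fnc (\<tau> n) \<sigma>' \<tau>')"
  "sub_fnc (sub_fnc u \<sigma> \<tau>) \<sigma>' \<tau>' = sub_fnc u (\<lambda>n. sub_trm (\<sigma> n) \<sigma>' \<tau>') (\<lambda>n. sub_fnc (\<tau> n) \<sigma>' \<tau>')"
  by (induction t and u arbitrary: \<sigma> \<tau> \<sigma>' \<tau>' and \<sigma> \<tau> \<sigma>' \<tau>') (auto simp: sub_nn)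

lemma sub_sub_fm:
  "sub (sub A \<sigma> \<tau>) \<sigma>' \<tau>' = sub A (\<lambda>n. sub_trm (\<sigma> n) \<sigma>' \<tau>') (\<lambda>n. sub_fnc (\<tau> n) \<sigma>' \<tau>')"
  by (induction A arbitrary: \<sigma> \<tau> \<sigma>' \<tau>') (auto simp: sub_sub sub_nn sub_fn)

lemma id_subst [simp]: "nn NV = NV" "nf FV = FV" "fn NV = NV" "ff FV = FV"
  by (auto simp: nn_def nf_def fn_def ff_def fun_eq_iff split: nat.splits)

lemma sub_id [simp]: "sub_trm t NV FV = t" "sub_fnc u NV FV = u"
  by (induction t and u) (auto simp: map_idI)

lemma sub_id_fm [simp]: "sub A NV FV = A"
  by (induction A) auto

text \<open>Lets results on closure and support that are proved for substitutions apply to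
  renamings.\<close>

lemma ren_eq_sub:
  "ren_trm t r q = sub_trm t (\<lambda>n. NV (r n)) (\<lambda>n. FV (q n))"
  "ren_fnc u r q = sub_fnc u (\<lambda>n. NV (r n)) (\<lambda>n. FV (q n))"
  using ren_sub(1)[of t NV FV r q] ren_sub(2)[of u NV FV r q] by auto

lemma sub_Suc:
  "sub_trm (ren_trm t Suc id) (d \<rhd> \<sigma>) \<tau> = sub_trm t \<sigma> \<tau>"
  "sub_fnc (ren_fnc u Suc id) (d \<rhd> \<sigma>) \<tau> = sub_fnc u \<sigma> \<tau>"
  "sub_trm (ren_trm t id Suc) \<sigma> (f \<rhd> \<tau>) = sub_trm t \<sigma> \<tau>"
  "sub_fnc (ren_fnc u id Suc) \<sigma> (f \<rhd> \<tau>) = sub_fnc u \<sigma> \<tau>"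
  by (auto simp: sub_ren comp_def)

text \<open>The bridge between de Bruijn binders and environments: because of it, instances of a
  quantified formula are described by \<open>\<rhd>\<close> and shifting disappears from the later
  arguments.\<close>

lemma sub_nn_push:
  "sub (sub A (nn \<sigma>) (nf \<tau>)) (d \<rhd> \<sigma>') \<tau>' =
   sub A (d \<rhd> (\<lambda>n. sub_trm (\<sigma> n) \<sigma>' \<tau>')) (\<lambda>n. sub_fnc (\<tau> n) \<sigma>' \<tau>')"
  unfolding sub_sub_fm
  by (rule arg_cong2[where f="sub A"]) (auto simp: nn_def nf_def sub_Suc fun_eq_iff split: nat.splits)

lemma sub_ff_push:
  "sub (sub A (fn \<sigma>) (ff \<tau>)) \<sigma>' (f \<rhd> \<tau>') =
   sub A (\<lambda>n. sub_trm (\<sigma> n) \<sigma>' \<tau>') (f \<rhd> (\<lambda>n. sub_fnc (\<tau> n) \<sigma>' \<tau>'))"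
  unfolding sub_sub_fm
  by (rule arg_cong2[where f="sub A"]) (auto simp: fn_def ff_def sub_Suc fun_eq_iff split: nat.splits)

lemma inst_nn: "inst (sub A (nn \<sigma>) (nf \<tau>)) d = sub A (d \<rhd> \<sigma>) \<tau>"
  by (simp add: inst_def sub_nn_push)

lemma finst_ff: "finst (sub A (fn \<sigma>) (ff \<tau>)) f = sub A \<sigma> (f \<rhd> \<tau>)"
  by (simp add: finst_def sub_ff_push)

lemma sub_push:
  "(\<lambda>n. sub_trm ((d \<rhd> \<rho>) n) \<sigma> \<tau>) = sub_trm d \<sigma> \<tau> \<rhd> (\<lambda>n. sub_trm (\<rho> n) \<sigma> \<tau>)"
  "(\<lambda>n. sub_fnc ((f \<rhd> \<theta>) n) \<sigma> \<tau>) = sub_fnc f \<sigma> \<tau> \<rhd> (\<lambda>n. sub_fnc (\<theta> n) \<sigma> \<tau>)"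
  by (auto simp: fun_eq_iff split: nat.splits)

lemma sub_inst: "sub (inst A t) \<sigma> \<tau> = sub A (sub_trm t \<sigma> \<tau> \<rhd> \<sigma>) \<tau>"
  by (simp add: inst_def sub_sub_fm sub_push)

lemma sub_finst: "sub (finst A u) \<sigma> \<tau> = sub A \<sigma> (sub_fnc u \<sigma> \<tau> \<rhd> \<tau>)"
  by (simp add: finst_def sub_sub_fm sub_push)

lemma sub_inst': "sub (inst A t) \<sigma> \<tau> = inst (sub A (nn \<sigma>) (nf \<tau>)) (sub_trm t \<sigma> \<tau>)"
  by (simp add: sub_inst inst_nn)

lemma sub_finst': "sub (finst A u) \<sigma> \<tau> = finst (sub A (fn \<sigma>) (ff \<tau>)) (sub_fnc u \<sigma> \<tau>)"
  by (simp add: sub_finst finst_ff)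

lemma sub_lift: "sub (lift A) \<sigma> \<tau> = sub A (\<lambda>n. \<sigma> (Suc n)) \<tau>"
  by (simp add: lift_def sub_sub_fm)

lemma sub_flift: "sub (flift A) \<sigma> \<tau> = sub A \<sigma> (\<lambda>n. \<tau> (Suc n))"
  by (simp add: flift_def sub_sub_fm)

lemma lift_sub: "lift (sub A \<sigma> \<tau>) = sub (lift A) (nn \<sigma>) (nf \<tau>)"
  by (simp add: lift_def sub_sub_fm nn_def nf_def ren_eq_sub)

lemma flift_sub: "flift (sub A \<sigma> \<tau>) = sub (flift A) (fn \<sigma>) (ff \<tau>)"
  by (simp add: flift_def sub_sub_fm fn_def ff_def ren_eq_sub)

section \<open>Supports of terms and formulas\<close>

text \<open>Support is defined through substitutions, so that free variables need not be computed.\<close>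

definition fixes_on :: "nat set \<Rightarrow> nsub \<Rightarrow> fsub \<Rightarrow> bool" where
  "fixes_on X \<sigma> \<tau> \<longleftrightarrow> (\<forall>n\<in>X. \<sigma> n = NV n \<and> \<tau> n = FV n)"

definition supp_trm :: "nat set \<Rightarrow> trm \<Rightarrow> bool" where
  "supp_trm X t \<longleftrightarrow> (\<forall>\<sigma> \<tau>. fixes_on X \<sigma> \<tau> \<longrightarrow> sub_trm t \<sigma> \<tau> = t)"
definition supp_fnc :: "nat set \<Rightarrow> fnc \<Rightarrow> bool" where
  "supp_fnc X u \<longleftrightarrow> (\<forall>\<sigma> \<tau>. fixes_on X \<sigma> \<tau> \<longrightarrow> sub_fnc u \<sigma> \<tau> = u)"
definition supp :: "nat set \<Rightarrow> fm \<Rightarrow> bool" where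
  "supp X A \<longleftrightarrow> (\<forall>\<sigma> \<tau>. fixes_on X \<sigma> \<tau> \<longrightarrow> sub A \<sigma> \<tau> = A)"

lemmas supp_defs = supp_trm_def supp_fnc_def supp_def

lemma fixes_on_mono: "X \<subseteq> Y \<Longrightarrow> fixes_on Y \<sigma> \<tau> \<Longrightarrow> fixes_on X \<sigma> \<tau>"
  by (auto simp: fixes_on_def)

lemma supp_mono:
  "X \<subseteq> Y \<Longrightarrow> supp_trm X t \<Longrightarrow> supp_trm Y t"
  "X \<subseteq> Y \<Longrightarrow> supp_fnc X u \<Longrightarrow> supp_fnc Y u"
  "X \<subseteq> Y \<Longrightarrow> supp X A \<Longrightarrow> supp Y A"
  by (auto simp: supp_defs dest: fixes_on_mono)

lemma supp_trm_simps:
  "supp_trm X (NV n) \<longleftrightarrow> n \<in> X" "supp_trm X Zero"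
  "supp_fnc X (FV n) \<longleftrightarrow> n \<in> X" "supp_fnc X Succ" "supp_fnc X PK" "supp_fnc X PL"
  "supp_trm X (Ap u t) \<longleftrightarrow> supp_fnc X u \<and> supp_trm X t"
  "supp_trm X (J s t) \<longleftrightarrow> supp_trm X s \<and> supp_trm X t"
proof -
  \<comment> \<open>This substitution fixes X and sends every other variable to a constant, so a
    variable that survives it lies in X.\<close>
  have *: "fixes_on X (\<lambda>n. if n \<in> X then NV n else Zero) (\<lambda>n. if n \<in> X then FV n else Succ)"
    by (auto simp: fixes_on_def)
  have "supp_trm X (NV n) \<Longrightarrow> n \<in> X"
    unfolding supp_trm_def by (drule spec2, drule mp, rule *) (simp split: if_splits)
  then show "supp_trm X (NV n) \<longleftrightarrow> n \<in> X" by (auto simp: supp_defs fixes_on_def)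
  have "supp_fnc X (FV n) \<Longrightarrow> n \<in> X"
    unfolding supp_fnc_def by (drule spec2, drule mp, rule *) (simp split: if_splits)
  then show "supp_fnc X (FV n) \<longleftrightarrow> n \<in> X" by (auto simp: supp_defs fixes_on_def)
qed (auto simp: supp_defs)

lemma supp_simps:
  "supp X (s \<doteq> t) \<longleftrightarrow> supp_trm X s \<and> supp_trm X t"
  "supp X (\<^bold>\<not> A) \<longleftrightarrow> supp X A"
  "supp X (A \<^bold>\<and> B) \<longleftrightarrow> supp X A \<and> supp X B"
  "supp X (A \<^bold>\<or> B) \<longleftrightarrow> supp X A \<and> supp X B"
  "supp X (A \<^bold>\<longrightarrow> B) \<longleftrightarrow> supp X A \<and> supp X B"
  by (auto simp: supp_defs)

lemma supp_sub:
  assumes "\<And>n. supp_trm X (\<sigma> n)" "\<And>n. supp_fnc X (\<tau> n)"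
  shows "supp X (sub A \<sigma> \<tau>)" "supp_trm X (sub_trm t \<sigma> \<tau>)" "supp_fnc X (sub_fnc u \<sigma> \<tau>)"
  using assms by (auto simp: supp_defs sub_sub_fm sub_sub)

text \<open>Replacing all variables outside X by constants leaves a supported expression unchanged,
  and after that replacement two substitutions that agree on X cannot differ.\<close>

lemma supp_agree:
  assumes "\<forall>n\<in>X. \<sigma> n = \<sigma>' n \<and> \<tau> n = \<tau>' n"
  shows "supp X A \<Longrightarrow> sub A \<sigma> \<tau> = sub A \<sigma>' \<tau>'"
    "supp_trm X t \<Longrightarrow> sub_trm t \<sigma> \<tau> = sub_trm t \<sigma>' \<tau>'"
    "supp_fnc X u \<Longrightarrow> sub_fnc u \<sigma> \<tau> = sub_fnc u \<sigma>' \<tau>'"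
proof -
  let ?\<rho> = "\<lambda>n. if n \<in> X then NV n else Zero" and ?\<theta> = "\<lambda>n. if n \<in> X then FV n else Succ"
  have *: "fixes_on X ?\<rho> ?\<theta>"
    by (auto simp: fixes_on_def)
  have "(\<lambda>n. sub_trm (?\<rho> n) \<sigma> \<tau>) = (\<lambda>n. sub_trm (?\<rho> n) \<sigma>' \<tau>')"
    "(\<lambda>n. sub_fnc (?\<theta> n) \<sigma> \<tau>) = (\<lambda>n. sub_fnc (?\<theta> n) \<sigma>' \<tau>')"
    using assms by (auto simp: fun_eq_iff)
  then have **: "sub (sub A ?\<rho> ?\<theta>) \<sigma> \<tau> = sub (sub A ?\<rho> ?\<theta>) \<sigma>' \<tau>'"
    "sub_trm (sub_trm t ?\<rho> ?\<theta>) \<sigma> \<tau> = sub_trm (sub_trm t ?\<rho> ?\<theta>) \<sigma>' \<tau>'"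
    "sub_fnc (sub_fnc u ?\<rho> ?\<theta>) \<sigma> \<tau> = sub_fnc (sub_fnc u ?\<rho> ?\<theta>) \<sigma>' \<tau>'" for A t u
    by (simp_all only: sub_sub_fm sub_sub)
  show "sub A \<sigma> \<tau> = sub A \<sigma>' \<tau>'" if "supp X A"
    using **(1)[of A] that[unfolded supp_def, rule_format, OF *] by simp
  show "sub_trm t \<sigma> \<tau> = sub_trm t \<sigma>' \<tau>'" if "supp_trm X t"
    using **(2)[of t] that[unfolded supp_trm_def, rule_format, OF *] by simp
  show "sub_fnc u \<sigma> \<tau> = sub_fnc u \<sigma>' \<tau>'" if "supp_fnc X u"
    using **(3)[of u] that[unfolded supp_fnc_def, rule_format, OF *] by simp
qed

lemma supp_inst:
  assumes "supp X (All A) \<or> supp X (Ex A)" "supp_trm X t" shows "supp X (inst A t)"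
  using assms by (auto simp: supp_defs sub_inst')

lemma supp_finst:
  assumes "supp X (FAll A) \<or> supp X (FEx A)" "supp_fnc X u" shows "supp X (finst A u)"
  using assms by (auto simp: supp_defs sub_finst')

text \<open>Stated for initial segments because a binder shifts indices by one: a positive index
  below k comes from an index that is again below k.\<close>

lemma fixes_on_push:
  "fixes_on {..<k} \<sigma> \<tau> \<Longrightarrow> fixes_on {..<k} (nn \<sigma>) (nf \<tau>)"
  "fixes_on {..<k} \<sigma> \<tau> \<Longrightarrow> fixes_on {..<k} (fn \<sigma>) (ff \<tau>)"
  by (auto simp: fixes_on_def nn_def nf_def fn_def ff_def split: nat.splits)

text \<open>The bound is required to work from k onward, so that finitely many bounds combine by a
  maximum.\<close>

lemma finite_supp_list: "(\<And>x. x \<in> set xs \<Longrightarrow> \<exists>k. \<forall>m\<ge>k. P x m) \<Longrightarrow> \<exists>k::nat. \<forall>m\<ge>k. \<forall>x\<in>set xs. P x m"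
proof (induction xs)
  case (Cons a xs)
  have "\<exists>k. \<forall>m\<ge>k. \<forall>x\<in>set xs. P x m" using Cons.prems by (intro Cons.IH) simp
  then obtain k where "\<forall>m\<ge>k. \<forall>x\<in>set xs. P x m" by blast
  moreover obtain k' where "\<forall>m\<ge>k'. P a m" using Cons.prems[of a] by auto
  ultimately have "\<forall>m\<ge>max k k'. \<forall>x\<in>set (a # xs). P x m" by simp
  then show ?case by blast
qed auto

lemma finite_supp_trm_aux:
  "\<exists>k. \<forall>m\<ge>k. supp_trm {..<m} t" "\<exists>k. \<forall>m\<ge>k. supp_fnc {..<m} u"
proof (induction t and u)
  case (NV n) show ?case by (rule HOL.exI[of _ "Suc n"]) (auto simp: supp_trm_simps)
next
  case (FV n) show ?case by (rule HOL.exI[of _ "Suc n"]) (auto simp: supp_trm_simps)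
next
  case (Ap u t)
  then obtain k k' where "\<forall>m\<ge>k. supp_fnc {..<m} u" "\<forall>m\<ge>k'. supp_trm {..<m} t" by blast
  then show ?case by (intro HOL.exI[of _ "max k k'"]) (auto simp: supp_trm_simps)
next
  case (J s t)
  then obtain k k' where "\<forall>m\<ge>k. supp_trm {..<m} s" "\<forall>m\<ge>k'. supp_trm {..<m} t" by blast
  then show ?case by (intro HOL.exI[of _ "max k k'"]) (auto simp: supp_trm_simps)
next
  case (Cst i ts us)
  obtain k where k: "\<forall>m\<ge>k. \<forall>t\<in>set ts. supp_trm {..<m} t"
    using finite_supp_list[of ts "\<lambda>t m. supp_trm {..<m} t"] Cst by auto
  obtain k' where k': "\<forall>m\<ge>k'. \<forall>t\<in>set us. supp_fnc {..<m} t"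
    using finite_supp_list[of us "\<lambda>t m. supp_fnc {..<m} t"] Cst by auto
  show ?case using k k'
    by (intro HOL.exI[of _ "max k k'"]) (auto simp: supp_trm_def supp_fnc_def intro!: map_idI)
next
  case (Lam t)
  then show ?case by (simp add: supp_trm_def supp_fnc_def) (meson fixes_on_push(1))
qed (auto simp: supp_trm_simps)

text \<open>A bound for the body of a quantified formula is also one for the formula. Finiteness is
  what allows a theorem to be closed by quantifiers and what leaves fresh variables over.\<close>

lemma finite_supp: "\<exists>k. supp {..<k} A"
proof -
  have *: "\<exists>k. supp {..<k} A \<and> supp {..<k} B"
    if "supp {..<k} A" "supp {..<k'} B" for A B and k k' :: nat
    by (rule HOL.exI[of _ "max k k'"])
      (use that in \<open>auto intro: supp_mono(3)[of "{..<k}"] supp_mono(3)[of "{..<k'}"]\<close>)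
  show ?thesis
  proof (induction A)
    case (Eq s t)
    obtain k k' where "\<forall>m\<ge>k. supp_trm {..<m} s" "\<forall>m\<ge>k'. supp_trm {..<m} t"
      using finite_supp_trm_aux(1) by blast
    then show ?case by (intro HOL.exI[of _ "max k k'"]) (auto simp: supp_simps)
  next
    case (All A) then show ?case by (auto simp: supp_def dest: fixes_on_push(1))
  next
    case (Ex A) then show ?case by (auto simp: supp_def dest: fixes_on_push(1))
  next
    case (FAll A) then show ?case by (auto simp: supp_def dest: fixes_on_push(2))
  next
    case (FEx A) then show ?case by (auto simp: supp_def dest: fixes_on_push(2))
  qed (auto simp: supp_simps intro: *)
qed

section \<open>Derivations\<close>

text \<open>Beyond the basic symbols the language only has to be closed under substitution, so the
  metatheory is proved once and serves BIM, BIM + CFd and Mj.\<close>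

locale lang =
  fixes T :: system
  assumes terms_base [simp]: "\<And>n. NV n \<in> terms T" "Zero \<in> terms T"
      "\<And>u t. u \<in> functors T \<Longrightarrow> t \<in> terms T \<Longrightarrow> Ap u t \<in> terms T"
      "\<And>s t. s \<in> terms T \<Longrightarrow> t \<in> terms T \<Longrightarrow> J s t \<in> terms T"
    and functors_base [simp]: "\<And>n. FV n \<in> functors T" "Succ \<in> functors T" "PK \<in> functors T"
      "PL \<in> functors T" "ZeroF \<in> functors T" "IdF \<in> functors T"
    and sub_closed: "\<And>t \<sigma> \<tau>. (\<And>n. \<sigma> n \<in> terms T) \<Longrightarrow> (\<And>n. \<tau> n \<in> functors T) \<Longrightarrow>
        t \<in> terms T \<Longrightarrow> sub_trm t \<sigma> \<tau> \<in> terms T"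
      "\<And>u \<sigma> \<tau>. (\<And>n. \<sigma> n \<in> terms T) \<Longrightarrow> (\<And>n. \<tau> n \<in> functors T) \<Longrightarrow>
        u \<in> functors T \<Longrightarrow> sub_fnc u \<sigma> \<tau> \<in> functors T"
begin

definition tsub :: "nsub \<Rightarrow> fsub \<Rightarrow> bool" where
  "tsub \<sigma> \<tau> \<longleftrightarrow> (\<forall>n. \<sigma> n \<in> terms T) \<and> (\<forall>n. \<tau> n \<in> functors T)"

lemma formulas_simps [simp]:
  "(s \<doteq> t) \<in> formulas T \<longleftrightarrow> s \<in> terms T \<and> t \<in> terms T"
  "(\<^bold>\<not> A) \<in> formulas T \<longleftrightarrow> A \<in> formulas T"
  "(A \<^bold>\<and> B) \<in> formulas T \<longleftrightarrow> A \<in> formulas T \<and> B \<in> formulas T"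
  "(A \<^bold>\<or> B) \<in> formulas T \<longleftrightarrow> A \<in> formulas T \<and> B \<in> formulas T"
  "(A \<^bold>\<longrightarrow> B) \<in> formulas T \<longleftrightarrow> A \<in> formulas T \<and> B \<in> formulas T"
  "All A \<in> formulas T \<longleftrightarrow> A \<in> formulas T"
  "Ex A \<in> formulas T \<longleftrightarrow> A \<in> formulas T"
  "FAll A \<in> formulas T \<longleftrightarrow> A \<in> formulas T"
  "FEx A \<in> formulas T \<longleftrightarrow> A \<in> formulas T"
  by (auto simp: formulas_def)

lemma tsub_nn: "tsub \<sigma> \<tau> \<Longrightarrow> tsub (nn \<sigma>) (nf \<tau>)"
  by (auto simp: tsub_def nn_def nf_def ren_eq_sub intro!: sub_closed split: nat.splits)

lemma tsub_ff: "tsub \<sigma> \<tau> \<Longrightarrow> tsub (fn \<sigma>) (ff \<tau>)"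
  by (auto simp: tsub_def fn_def ff_def ren_eq_sub intro!: sub_closed split: nat.splits)

lemma sub_formulas: "tsub \<sigma> \<tau> \<Longrightarrow> A \<in> formulas T \<Longrightarrow> sub A \<sigma> \<tau> \<in> formulas T"
  by (induction A arbitrary: \<sigma> \<tau>) (auto simp: sub_closed tsub_nn tsub_ff, auto simp: tsub_def sub_closed)

lemma tsub_base [simp]: "tsub NV FV" "tsub (\<lambda>n. NV (f n)) (\<lambda>n. FV (g n))"
    "tsub (\<lambda>n. NV (f n)) FV" "tsub NV (\<lambda>n. FV (g n))"
  by (auto simp: tsub_def)

lemma tsub_push: "tsub \<sigma> \<tau> \<Longrightarrow> t \<in> terms T \<Longrightarrow> tsub (t \<rhd> \<sigma>) \<tau>"
  "tsub \<sigma> \<tau> \<Longrightarrow> u \<in> functors T \<Longrightarrow> tsub \<sigma> (u \<rhd> \<tau>)"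
  by (auto simp: tsub_def split: nat.splits)

lemma inst_formulas: "A \<in> formulas T \<Longrightarrow> t \<in> terms T \<Longrightarrow> inst A t \<in> formulas T"
  "A \<in> formulas T \<Longrightarrow> u \<in> functors T \<Longrightarrow> finst A u \<in> formulas T"
  unfolding inst_def finst_def by (auto intro!: sub_formulas tsub_push)

lemma lift_formulas [simp]: "lift A \<in> formulas T \<longleftrightarrow> A \<in> formulas T"
  "flift A \<in> formulas T \<longleftrightarrow> A \<in> formulas T"
proof -
  have "sub (lift A) (Zero \<rhd> NV) FV = A" "sub (flift A) NV (Succ \<rhd> FV) = A"
    by (auto simp: sub_lift sub_flift)
  then show "lift A \<in> formulas T \<longleftrightarrow> A \<in> formulas T" "flift A \<in> formulas T \<longleftrightarrow> A \<in> formulas T"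
    by (metis sub_formulas tsub_push(1) tsub_base(1) terms_base(2) lift_def tsub_base(3),
        metis sub_formulas tsub_push(2) tsub_base(1) functors_base(2) flift_def tsub_base(4))
qed

lemma derives_formulas: "T \<parallel> \<Gamma> \<turnstile> A \<Longrightarrow> A \<in> formulas T"
  by (induction rule: derives.induct) (auto intro: inst_formulas)

text \<open>Axioms may be open, and an instance of an axiom need not be an axiom; so a theorem is
  first generalized over finitely many variables and then instantiated. Derivability from every set
  of assumptions is required because \<open>allI\<close> changes the set.\<close>

lemma theorem_sub:
  assumes "\<And>\<Gamma>. T \<parallel> \<Gamma> \<turnstile> A" "tsub \<sigma> \<tau>" shows "T \<parallel> \<Gamma> \<turnstile> sub A \<sigma> \<tau>"
proof -
  \<comment> \<open>One number quantifier is introduced and removed at a time; variables from k on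
    are lowered by k because that many binders have been removed.\<close>
  have all: "T \<parallel> \<Gamma> \<turnstile> sub A (\<lambda>n. if n < k then \<sigma> n else NV (n - k)) FV"
    if "\<And>\<Gamma>. T \<parallel> \<Gamma> \<turnstile> A" "tsub \<sigma> \<tau>" for A \<Gamma> k \<sigma> \<tau>
    using that
  proof (induction k arbitrary: A \<sigma>)
    case 0 then show ?case by simp
  next
    case (Suc k)
    have "T \<parallel> \<Gamma> \<turnstile> sub (All A) (\<lambda>n. if n < k then \<sigma> (Suc n) else NV (n - k)) FV"
      by (rule Suc.IH) (rule derives.allI, rule Suc.prems(1), use Suc.prems(2) in \<open>simp add: tsub_def\<close>)
    then have "T \<parallel> \<Gamma> \<turnstile> All (sub A (nn (\<lambda>n. if n < k then \<sigma> (Suc n) else NV (n - k))) (nf FV))"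
      by simp
    from derives.allE[OF this, of "\<sigma> 0", unfolded inst_nn]
    have "T \<parallel> \<Gamma> \<turnstile> sub A (\<sigma> 0 \<rhd> (\<lambda>n. if n < k then \<sigma> (Suc n) else NV (n - k))) FV"
      using Suc.prems(2) by (simp add: tsub_def)
    moreover have "(\<sigma> 0 \<rhd> (\<lambda>n. if n < k then \<sigma> (Suc n) else NV (n - k)))
      = (\<lambda>n. if n < Suc k then \<sigma> n else NV (n - Suc k))"
      by (auto simp: fun_eq_iff split: nat.splits)
    ultimately show ?case by simp
  qed
  have fall: "T \<parallel> \<Gamma> \<turnstile> sub A \<sigma> (\<lambda>n. if n < k then \<tau> n else FV (n - k))"
    if "\<And>\<Gamma>. T \<parallel> \<Gamma> \<turnstile> sub ((FAll ^^ k) A) \<sigma> FV" "tsub \<sigma> \<tau>" for A \<Gamma> k \<sigma> \<tau>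
    using that
  proof (induction k arbitrary: A \<tau>)
    case 0 then show ?case by simp
  next
    case (Suc k)
    have "T \<parallel> \<Gamma> \<turnstile> sub (FAll A) \<sigma> (\<lambda>n. if n < k then \<tau> (Suc n) else FV (n - k))"
      by (rule Suc.IH, fold funpow_Suc_right[THEN fun_cong, simplified comp_def], rule Suc.prems(1))
        (use Suc.prems(2) in \<open>simp add: tsub_def\<close>)
    then have "T \<parallel> \<Gamma> \<turnstile> FAll (sub A (fn \<sigma>) (ff (\<lambda>n. if n < k then \<tau> (Suc n) else FV (n - k))))"
      by simp
    from derives.fallE[OF this, of "\<tau> 0", unfolded finst_ff]
    have "T \<parallel> \<Gamma> \<turnstile> sub A \<sigma> (\<tau> 0 \<rhd> (\<lambda>n. if n < k then \<tau> (Suc n) else FV (n - k)))"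
      using Suc.prems(2) by (simp add: tsub_def)
    moreover have "(\<tau> 0 \<rhd> (\<lambda>n. if n < k then \<tau> (Suc n) else FV (n - k)))
      = (\<lambda>n. if n < Suc k then \<tau> n else FV (n - Suc k))"
      by (auto simp: fun_eq_iff split: nat.splits)
    ultimately show ?case by simp
  qed
  obtain k where k: "supp {..<k} A" using finite_supp by blast
  \<comment> \<open>The function variables are quantified before the number substitution is carried
    out, which therefore acts under these quantifiers; \<open>fall\<close> then instantiates
    them.\<close>
  have "T \<parallel> \<Gamma> \<turnstile> (FAll ^^ l) A" for l \<Gamma>
    by (induction l arbitrary: \<Gamma>) (simp_all add: assms(1) derives.fallI)
  then have "T \<parallel> \<Gamma> \<turnstile> sub ((FAll ^^ k) A) (\<lambda>n. if n < m then \<sigma> n else NV (n - m)) FV" for m \<Gamma>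
    by (rule all) (use assms(2) in auto)
  then have "T \<parallel> \<Gamma> \<turnstile> sub A (\<lambda>n. if n < k then \<sigma> n else NV (n - k)) (\<lambda>n. if n < k then \<tau> n else FV (n - k))"
    by (rule fall) (use assms(2) in \<open>auto simp: tsub_def\<close>)
  also have "sub A (\<lambda>n. if n < k then \<sigma> n else NV (n - k)) (\<lambda>n. if n < k then \<tau> n else FV (n - k)) = sub A \<sigma> \<tau>"
    by (rule supp_agree(1)[OF _ k]) auto
  finally show ?thesis .
qed

text \<open>Allowing any set that contains the substituted assumptions makes weakening the case of
  the identity, and later lets a named variable be turned into an eigenvariable.\<close>

lemma derives_sub:
  "T \<parallel> \<Gamma> \<turnstile> A \<Longrightarrow> tsub \<sigma> \<tau> \<Longrightarrow> (\<And>B. B \<in> \<Gamma> \<Longrightarrow> sub B \<sigma> \<tau> \<in> \<Delta>) \<Longrightarrow> T \<parallel> \<Delta> \<turnstile> sub A \<sigma> \<tau>"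
proof (induction arbitrary: \<Delta> \<sigma> \<tau> rule: derives.induct)
  case (assm A \<Gamma>) then show ?case by (simp add: derives.assm sub_formulas)
next
  \<comment> \<open>The instance need not be an axiom, so \<open>theorem_sub\<close> is
    required.\<close>
  case (ax A \<Gamma>) then show ?case by (simp add: theorem_sub derives.ax)
next
  case (negI A \<Gamma> B)
  have "T \<parallel> insert (sub A \<sigma> \<tau>) \<Delta> \<turnstile> sub B \<sigma> \<tau>" "T \<parallel> insert (sub A \<sigma> \<tau>) \<Delta> \<turnstile> sub (\<^bold>\<not> B) \<sigma> \<tau>"
    by (rule negI.IH; use negI.prems in auto)+
  then show ?case using negI sub_formulas by (auto intro: derives.negI)
next
  case (negE \<Gamma> A B)
  have "T \<parallel> \<Delta> \<turnstile> sub (\<^bold>\<not> A) \<sigma> \<tau>" "T \<parallel> \<Delta> \<turnstile> sub A \<sigma> \<tau>"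
    by (rule negE.IH; use negE.prems in auto)+
  then show ?case using negE sub_formulas by (metis derives.negE sub.simps(2))
next
  case (andI \<Gamma> A B) then show ?case by (simp add: derives.andI)
next
  case (andE1 \<Gamma> A B) then show ?case by (metis derives.andE1 sub.simps(3))
next
  case (andE2 \<Gamma> A B) then show ?case by (metis derives.andE2 sub.simps(3))
next
  case (orI1 \<Gamma> A B) then show ?case by (simp add: derives.orI1 sub_formulas)
next
  case (orI2 \<Gamma> A B) then show ?case by (simp add: derives.orI2 sub_formulas)
next
  case (orE \<Gamma> A B C)
  have "T \<parallel> \<Delta> \<turnstile> sub (A \<^bold>\<or> B) \<sigma> \<tau>" "T \<parallel> insert (sub A \<sigma> \<tau>) \<Delta> \<turnstile> sub C \<sigma> \<tau>"
    "T \<parallel> insert (sub B \<sigma> \<tau>) \<Delta> \<turnstile> sub C \<sigma> \<tau>"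
    by (rule orE.IH; use orE.prems in auto)+
  then show ?case by (metis derives.orE sub.simps(4))
next
  case (impI A \<Gamma> B)
  have "T \<parallel> insert (sub A \<sigma> \<tau>) \<Delta> \<turnstile> sub B \<sigma> \<tau>"
    by (rule impI.IH) (use impI.prems in auto)
  then show ?case using impI by (simp add: derives.impI sub_formulas)
next
  case (impE \<Gamma> A B) then show ?case by (metis derives.impE sub.simps(5))
next
  case (allI \<Gamma> A)
  have "T \<parallel> lift ` \<Delta> \<turnstile> sub A (nn \<sigma>) (nf \<tau>)"
    by (rule allI.IH) (use allI.prems in \<open>auto simp: tsub_nn simp flip: lift_sub\<close>)
  then show ?case by (simp add: derives.allI)
next
  case (allE \<Gamma> A t)
  then have "T \<parallel> \<Delta> \<turnstile> All (sub A (nn \<sigma>) (nf \<tau>))" by auto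
  then show ?case unfolding sub_inst'
    by (rule derives.allE) (use allE in \<open>auto simp: tsub_def sub_closed\<close>)
next
  case (exI \<Gamma> A t)
  have "T \<parallel> \<Delta> \<turnstile> inst (sub A (nn \<sigma>) (nf \<tau>)) (sub_trm t \<sigma> \<tau>)"
    using exI by (auto simp: sub_inst')
  then show ?case
    unfolding sub.simps
    by (rule derives.exI) (use exI sub_formulas[OF tsub_nn, of \<sigma> \<tau> A] in \<open>auto simp: tsub_def sub_closed\<close>)
next
  case (exE \<Gamma> A C)
  have "T \<parallel> \<Delta> \<turnstile> Ex (sub A (nn \<sigma>) (nf \<tau>))" using exE by auto
  then show ?case
  proof (rule derives.exE)
    show "T \<parallel> insert (sub A (nn \<sigma>) (nf \<tau>)) (lift ` \<Delta>) \<turnstile> lift (sub C \<sigma> \<tau>)"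
      unfolding lift_sub
      by (rule exE.IH(2)) (use exE.prems in \<open>auto simp: tsub_nn simp flip: lift_sub\<close>)
  qed
next
  case (fallI \<Gamma> A)
  have "T \<parallel> flift ` \<Delta> \<turnstile> sub A (fn \<sigma>) (ff \<tau>)"
    by (rule fallI.IH) (use fallI.prems in \<open>auto simp: tsub_ff simp flip: flift_sub\<close>)
  then show ?case by (simp add: derives.fallI)
next
  case (fallE \<Gamma> A u)
  then have "T \<parallel> \<Delta> \<turnstile> FAll (sub A (fn \<sigma>) (ff \<tau>))" by auto
  then show ?case unfolding sub_finst'
    by (rule derives.fallE) (use fallE in \<open>auto simp: tsub_def sub_closed\<close>)
next
  case (fexI \<Gamma> A u)
  have "T \<parallel> \<Delta> \<turnstile> finst (sub A (fn \<sigma>) (ff \<tau>)) (sub_fnc u \<sigma> \<tau>)"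
    using fexI by (auto simp: sub_finst')
  then show ?case
    unfolding sub.simps
    by (rule derives.fexI) (use fexI sub_formulas[OF tsub_ff, of \<sigma> \<tau> A] in \<open>auto simp: tsub_def sub_closed\<close>)
next
  case (fexE \<Gamma> A C)
  have "T \<parallel> \<Delta> \<turnstile> FEx (sub A (fn \<sigma>) (ff \<tau>))" using fexE by auto
  then show ?case
  proof (rule derives.fexE)
    show "T \<parallel> insert (sub A (fn \<sigma>) (ff \<tau>)) (flift ` \<Delta>) \<turnstile> flift (sub C \<sigma> \<tau>)"
      unfolding flift_sub
      by (rule fexE.IH(2)) (use fexE.prems in \<open>auto simp: tsub_ff simp flip: flift_sub\<close>)
  qed
qed

lemma derives_weaken: "T \<parallel> \<Gamma> \<turnstile> A \<Longrightarrow> \<Gamma> \<subseteq> \<Delta> \<Longrightarrow> T \<parallel> \<Delta> \<turnstile> A"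
  using derives_sub[of \<Gamma> A NV FV \<Delta>] by auto

lemma derives_cut: "T \<parallel> \<Gamma> \<turnstile> A \<Longrightarrow> T \<parallel> insert A \<Gamma> \<turnstile> C \<Longrightarrow> T \<parallel> \<Gamma> \<turnstile> C"
  by (meson derives.impE derives.impI derives_formulas)

lemma finite_subset_insert_image:
  assumes "finite \<Delta>" "\<Delta> \<subseteq> insert A (f ` \<Gamma>)"
  shows "\<exists>\<Delta>'. finite \<Delta>' \<and> \<Delta>' \<subseteq> \<Gamma> \<and> \<Delta> \<subseteq> insert A (f ` \<Delta>')"
proof -
  have "finite (\<Delta> - {A})" "\<Delta> - {A} \<subseteq> f ` \<Gamma>" using assms by auto
  then obtain \<Delta>' where "finite \<Delta>'" "\<Delta>' \<subseteq> \<Gamma>" "\<Delta> - {A} = f ` \<Delta>'"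
    by (meson finite_subset_image)
  then show ?thesis by blast
qed

text \<open>Compactness, used for the limit of a chain: a derivation from the union already lives at
  some stage.\<close>

lemma derives_finite: "T \<parallel> \<Gamma> \<turnstile> A \<Longrightarrow> \<exists>\<Delta>. finite \<Delta> \<and> \<Delta> \<subseteq> \<Gamma> \<and> (T \<parallel> \<Delta> \<turnstile> A)"
proof (induction rule: derives.induct)
  case (assm A \<Gamma>) then show ?case by (intro HOL.exI[of _ "{A}"]) (simp add: derives.assm)
next
  case (ax A \<Gamma>) then show ?case by (intro HOL.exI[of _ "{}"]) (simp add: derives.ax)
next
  case (negI A \<Gamma> B)
  then obtain \<Delta> \<Delta>' where *: "finite \<Delta>" "\<Delta> \<subseteq> insert A \<Gamma>" "T \<parallel> \<Delta> \<turnstile> B"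
    "finite \<Delta>'" "\<Delta>' \<subseteq> insert A \<Gamma>" "T \<parallel> \<Delta>' \<turnstile> \<^bold>\<not> B" by metis
  let ?\<Delta> = "(\<Delta> \<union> \<Delta>') - {A}"
  have "T \<parallel> insert A ?\<Delta> \<turnstile> B" "T \<parallel> insert A ?\<Delta> \<turnstile> \<^bold>\<not> B"
    by (rule derives_weaken[OF *(3)], blast, rule derives_weaken[OF *(6)], blast)
  from derives.negI[OF this negI(3)] show ?case using * by (intro HOL.exI[of _ ?\<Delta>]) auto
next
  case (negE \<Gamma> A B)
  then obtain \<Delta> \<Delta>' where *: "finite \<Delta>" "\<Delta> \<subseteq> \<Gamma>" "T \<parallel> \<Delta> \<turnstile> \<^bold>\<not> A"
    "finite \<Delta>'" "\<Delta>' \<subseteq> \<Gamma>" "T \<parallel> \<Delta>' \<turnstile> A" by metis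
  have "T \<parallel> \<Delta> \<union> \<Delta>' \<turnstile> \<^bold>\<not> A" "T \<parallel> \<Delta> \<union> \<Delta>' \<turnstile> A"
    by (rule derives_weaken[OF *(3)], blast, rule derives_weaken[OF *(6)], blast)
  from derives.negE[OF this negE(3)] show ?case using * by (intro HOL.exI[of _ "\<Delta> \<union> \<Delta>'"]) auto
next
  case (andI \<Gamma> A B)
  then obtain \<Delta> \<Delta>' where *: "finite \<Delta>" "\<Delta> \<subseteq> \<Gamma>" "T \<parallel> \<Delta> \<turnstile> A"
    "finite \<Delta>'" "\<Delta>' \<subseteq> \<Gamma>" "T \<parallel> \<Delta>' \<turnstile> B" by metis
  have "T \<parallel> \<Delta> \<union> \<Delta>' \<turnstile> A" "T \<parallel> \<Delta> \<union> \<Delta>' \<turnstile> B"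
    by (rule derives_weaken[OF *(3)], blast, rule derives_weaken[OF *(6)], blast)
  from derives.andI[OF this] show ?case using * by (intro HOL.exI[of _ "\<Delta> \<union> \<Delta>'"]) auto
next
  case (orE \<Gamma> A B C)
  then obtain \<Delta> \<Delta>' \<Delta>'' where *: "finite \<Delta>" "\<Delta> \<subseteq> \<Gamma>" "T \<parallel> \<Delta> \<turnstile> A \<^bold>\<or> B"
    "finite \<Delta>'" "\<Delta>' \<subseteq> insert A \<Gamma>" "T \<parallel> \<Delta>' \<turnstile> C"
    "finite \<Delta>''" "\<Delta>'' \<subseteq> insert B \<Gamma>" "T \<parallel> \<Delta>'' \<turnstile> C" by metis
  let ?\<Delta> = "\<Delta> \<union> (\<Delta>' - {A}) \<union> (\<Delta>'' - {B})"
  have "T \<parallel> ?\<Delta> \<turnstile> A \<^bold>\<or> B" "T \<parallel> insert A ?\<Delta> \<turnstile> C" "T \<parallel> insert B ?\<Delta> \<turnstile> C"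
    by (rule derives_weaken[OF *(3)], blast, rule derives_weaken[OF *(6)], blast,
        rule derives_weaken[OF *(9)], blast)
  from derives.orE[OF this] show ?case using * by (intro HOL.exI[of _ ?\<Delta>]) auto
next
  case (impI A \<Gamma> B)
  then obtain \<Delta> where *: "finite \<Delta>" "\<Delta> \<subseteq> insert A \<Gamma>" "T \<parallel> \<Delta> \<turnstile> B" by metis
  have "T \<parallel> insert A (\<Delta> - {A}) \<turnstile> B" by (rule derives_weaken[OF *(3)]) blast
  from derives.impI[OF this impI(2)] show ?case using * by (intro HOL.exI[of _ "\<Delta> - {A}"]) auto
next
  case (impE \<Gamma> A B)
  then obtain \<Delta> \<Delta>' where *: "finite \<Delta>" "\<Delta> \<subseteq> \<Gamma>" "T \<parallel> \<Delta> \<turnstile> A \<^bold>\<longrightarrow> B"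
    "finite \<Delta>'" "\<Delta>' \<subseteq> \<Gamma>" "T \<parallel> \<Delta>' \<turnstile> A" by metis
  have "T \<parallel> \<Delta> \<union> \<Delta>' \<turnstile> A \<^bold>\<longrightarrow> B" "T \<parallel> \<Delta> \<union> \<Delta>' \<turnstile> A"
    by (rule derives_weaken[OF *(3)], blast, rule derives_weaken[OF *(6)], blast)
  from derives.impE[OF this] show ?case using * by (intro HOL.exI[of _ "\<Delta> \<union> \<Delta>'"]) auto
next
  case (allI \<Gamma> A)
  then show ?case by (metis derives.allI finite_subset_image)
next
  case (fallI \<Gamma> A)
  then show ?case by (metis derives.fallI finite_subset_image)
next
  case (exE \<Gamma> A C)
  then obtain \<Delta> \<Delta>' where *: "finite \<Delta>" "\<Delta> \<subseteq> \<Gamma>" "T \<parallel> \<Delta> \<turnstile> Ex A"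
    "finite \<Delta>'" "\<Delta>' \<subseteq> insert A (lift ` \<Gamma>)" "T \<parallel> \<Delta>' \<turnstile> lift C" by metis
  then obtain \<Delta>'' where **: "finite \<Delta>''" "\<Delta>'' \<subseteq> \<Gamma>" "\<Delta>' \<subseteq> insert A (lift ` \<Delta>'')"
    by (meson finite_subset_insert_image)
  have "T \<parallel> \<Delta> \<union> \<Delta>'' \<turnstile> Ex A" "T \<parallel> insert A (lift ` (\<Delta> \<union> \<Delta>'')) \<turnstile> lift C"
    by (rule derives_weaken[OF *(3)], blast, rule derives_weaken[OF *(6)], use ** in blast)
  from derives.exE[OF this] show ?case using * ** by (intro HOL.exI[of _ "\<Delta> \<union> \<Delta>''"]) auto
next
  case (fexE \<Gamma> A C)
  then obtain \<Delta> \<Delta>' where *: "finite \<Delta>" "\<Delta> \<subseteq> \<Gamma>" "T \<parallel> \<Delta> \<turnstile> FEx A"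
    "finite \<Delta>'" "\<Delta>' \<subseteq> insert A (flift ` \<Gamma>)" "T \<parallel> \<Delta>' \<turnstile> flift C" by metis
  then obtain \<Delta>'' where **: "finite \<Delta>''" "\<Delta>'' \<subseteq> \<Gamma>" "\<Delta>' \<subseteq> insert A (flift ` \<Delta>'')"
    by (meson finite_subset_insert_image)
  have "T \<parallel> \<Delta> \<union> \<Delta>'' \<turnstile> FEx A" "T \<parallel> insert A (flift ` (\<Delta> \<union> \<Delta>'')) \<turnstile> flift C"
    by (rule derives_weaken[OF *(3)], blast, rule derives_weaken[OF *(6)], use ** in blast)
  from derives.fexE[OF this] show ?case using * ** by (intro HOL.exI[of _ "\<Delta> \<union> \<Delta>''"]) auto
qed (meson derives.intros)+

end

section \<open>Kripke semantics\<close>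

instance trm :: countable by countable_datatype
instance fnc :: countable by countable_datatype
instance fm :: countable by countable_datatype

text \<open>\<open>vs\<close> holds the variables, of both sorts, that the world may mention. Its
  complement is kept infinite, so that later worlds can take new variables as constants.\<close>

datatype world = World (vs: "nat set") (th: "fm set")

context lang
begin

definition worlds :: "world set" where
  "worlds = {w. infinite (- vs w) \<and> th w \<subseteq> formulas T \<and> (\<forall>A\<in>th w. supp (vs w) A)
     \<and> (\<forall>A. (T \<parallel> th w \<turnstile> A) \<longrightarrow> supp (vs w) A \<longrightarrow> A \<in> th w)
     \<and> (\<forall>A. A \<in> th w \<longrightarrow> (\<^bold>\<not> A) \<notin> th w)
     \<and> (\<forall>A B. (A \<^bold>\<or> B) \<in> th w \<longrightarrow> A \<in> th w \<or> B \<in> th w)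
     \<and> (\<forall>A. Ex A \<in> th w \<longrightarrow> (\<exists>t\<in>terms T. supp_trm (vs w) t \<and> inst A t \<in> th w))
     \<and> (\<forall>A. FEx A \<in> th w \<longrightarrow> (\<exists>u\<in>functors T. supp_fnc (vs w) u \<and> finst A u \<in> th w))}"

definition acc :: "world \<Rightarrow> world \<Rightarrow> bool" (infix "\<sqsubseteq>" 50) where
  "w \<sqsubseteq> w' \<longleftrightarrow> w \<in> worlds \<and> w' \<in> worlds \<and> vs w \<subseteq> vs w' \<and> th w \<subseteq> th w'"

definition dom_n :: "world \<Rightarrow> trm set" where
  "dom_n w = {t \<in> terms T. w \<in> worlds \<and> supp_trm (vs w) t}"
definition dom_f :: "world \<Rightarrow> fnc set" where
  "dom_f w = {u \<in> functors T. w \<in> worlds \<and> supp_fnc (vs w) u}"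

definition eqv :: "world \<Rightarrow> trm \<Rightarrow> trm \<Rightarrow> bool" where
  "eqv w s t \<longleftrightarrow> w \<in> worlds \<and> (s \<doteq> t) \<in> th w"

definition env :: "world \<Rightarrow> nsub \<Rightarrow> fsub \<Rightarrow> bool" where
  "env w \<sigma> \<tau> \<longleftrightarrow> w \<in> worlds \<and> (\<forall>n. \<sigma> n \<in> dom_n w) \<and> (\<forall>n. \<tau> n \<in> dom_f w)"

text \<open>Individuals are terms and functors, so an environment is a pair of substitutions and
  only equations look into the theory.\<close>

primrec force :: "world \<Rightarrow> nsub \<Rightarrow> fsub \<Rightarrow> fm \<Rightarrow> bool" where
  "force w \<sigma> \<tau> (s \<doteq> t) \<longleftrightarrow> eqv w (sub_trm s \<sigma> \<tau>) (sub_trm t \<sigma> \<tau>)"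
| "force w \<sigma> \<tau> (\<^bold>\<not> A) \<longleftrightarrow> (\<forall>w'. w \<sqsubseteq> w' \<longrightarrow> \<not> force w' \<sigma> \<tau> A)"
| "force w \<sigma> \<tau> (A \<^bold>\<and> B) \<longleftrightarrow> force w \<sigma> \<tau> A \<and> force w \<sigma> \<tau> B"
| "force w \<sigma> \<tau> (A \<^bold>\<or> B) \<longleftrightarrow> force w \<sigma> \<tau> A \<or> force w \<sigma> \<tau> B"
| "force w \<sigma> \<tau> (A \<^bold>\<longrightarrow> B) \<longleftrightarrow> (\<forall>w'. w \<sqsubseteq> w' \<longrightarrow> force w' \<sigma> \<tau> A \<longrightarrow> force w' \<sigma> \<tau> B)"
| "force w \<sigma> \<tau> (All A) \<longleftrightarrow> (\<forall>w'. w \<sqsubseteq> w' \<longrightarrow> (\<forall>d\<in>dom_n w'. force w' (d \<rhd> \<sigma>) \<tau> A))"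
| "force w \<sigma> \<tau> (Ex A) \<longleftrightarrow> (\<exists>d\<in>dom_n w. force w (d \<rhd> \<sigma>) \<tau> A)"
| "force w \<sigma> \<tau> (FAll A) \<longleftrightarrow> (\<forall>w'. w \<sqsubseteq> w' \<longrightarrow> (\<forall>f\<in>dom_f w'. force w' \<sigma> (f \<rhd> \<tau>) A))"
| "force w \<sigma> \<tau> (FEx A) \<longleftrightarrow> (\<exists>f\<in>dom_f w. force w \<sigma> (f \<rhd> \<tau>) A)"

lemma acc_trans [trans]: "w \<sqsubseteq> w' \<Longrightarrow> w' \<sqsubseteq> w'' \<Longrightarrow> w \<sqsubseteq> w''"
  by (auto simp: acc_def)

lemma acc_refl: "w \<sqsubseteq> w \<longleftrightarrow> w \<in> worlds"
  by (auto simp: acc_def)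

lemma dom_mono: "w \<sqsubseteq> w' \<Longrightarrow> t \<in> dom_n w \<Longrightarrow> t \<in> dom_n w'"
  "w \<sqsubseteq> w' \<Longrightarrow> u \<in> dom_f w \<Longrightarrow> u \<in> dom_f w'"
  by (auto simp: acc_def dom_n_def dom_f_def elim: supp_mono)

lemma env_mono: "w \<sqsubseteq> w' \<Longrightarrow> env w \<sigma> \<tau> \<Longrightarrow> env w' \<sigma> \<tau>"
  by (auto simp: env_def dom_mono) (auto simp: acc_def)

lemma env_worlds: "env w \<sigma> \<tau> \<Longrightarrow> w \<in> worlds"
  by (simp add: env_def)

lemma env_push: "env w (d \<rhd> \<sigma>) \<tau> \<longleftrightarrow> d \<in> dom_n w \<and> env w \<sigma> \<tau>"
  "env w \<sigma> (f \<rhd> \<tau>) \<longleftrightarrow> f \<in> dom_f w \<and> env w \<sigma> \<tau>"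
  unfolding env_def by (auto split: nat.splits)

lemma eqv_mono: "w \<sqsubseteq> w' \<Longrightarrow> eqv w s t \<Longrightarrow> eqv w' s t"
  by (auto simp: eqv_def acc_def)

lemma force_mono: "force w \<sigma> \<tau> A \<Longrightarrow> w \<sqsubseteq> w' \<Longrightarrow> force w' \<sigma> \<tau> A"
proof (induction A arbitrary: w w' \<sigma> \<tau>)
  case (Eq s t) then show ?case by (auto intro: eqv_mono)
next
  case (Ex A) then show ?case by (metis dom_mono(1) force.simps(7))
next
  case (FEx A) then show ?case by (metis dom_mono(2) force.simps(9))
qed (auto, (meson acc_trans)+)

lemma force_sub:
  "force w \<sigma> \<tau> (sub A \<rho> \<theta>) \<longleftrightarrow> force w (\<lambda>n. sub_trm (\<rho> n) \<sigma> \<tau>) (\<lambda>n. sub_fnc (\<theta> n) \<sigma> \<tau>) A"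
proof (induction A arbitrary: w \<sigma> \<tau> \<rho> \<theta>)
  case (Eq s t) then show ?case by (simp add: sub_sub)
next
  case (All A)
  have "(\<lambda>n. sub_trm (nn \<rho> n) (d \<rhd> \<sigma>) \<tau>) = d \<rhd> (\<lambda>n. sub_trm (\<rho> n) \<sigma> \<tau>)"
    "(\<lambda>n. sub_fnc (nf \<theta> n) (d \<rhd> \<sigma>) \<tau>) = (\<lambda>n. sub_fnc (\<theta> n) \<sigma> \<tau>)" for d
    by (auto simp: nn_def nf_def sub_Suc fun_eq_iff split: nat.splits)
  then show ?case by (simp add: All)
next
  case (Ex A)
  have "(\<lambda>n. sub_trm (nn \<rho> n) (d \<rhd> \<sigma>) \<tau>) = d \<rhd> (\<lambda>n. sub_trm (\<rho> n) \<sigma> \<tau>)"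
    "(\<lambda>n. sub_fnc (nf \<theta> n) (d \<rhd> \<sigma>) \<tau>) = (\<lambda>n. sub_fnc (\<theta> n) \<sigma> \<tau>)" for d
    by (auto simp: nn_def nf_def sub_Suc fun_eq_iff split: nat.splits)
  then show ?case by (simp add: Ex)
next
  case (FAll A)
  have "(\<lambda>n. sub_trm (fn \<rho> n) \<sigma> (d \<rhd> \<tau>)) = (\<lambda>n. sub_trm (\<rho> n) \<sigma> \<tau>)"
    "(\<lambda>n. sub_fnc (ff \<theta> n) \<sigma> (d \<rhd> \<tau>)) = d \<rhd> (\<lambda>n. sub_fnc (\<theta> n) \<sigma> \<tau>)" for d
    by (auto simp: fn_def ff_def sub_Suc fun_eq_iff split: nat.splits)
  then show ?case by (simp add: FAll)
next
  case (FEx A)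
  have "(\<lambda>n. sub_trm (fn \<rho> n) \<sigma> (d \<rhd> \<tau>)) = (\<lambda>n. sub_trm (\<rho> n) \<sigma> \<tau>)"
    "(\<lambda>n. sub_fnc (ff \<theta> n) \<sigma> (d \<rhd> \<tau>)) = d \<rhd> (\<lambda>n. sub_fnc (\<theta> n) \<sigma> \<tau>)" for d
    by (auto simp: fn_def ff_def sub_Suc fun_eq_iff split: nat.splits)
  then show ?case by (simp add: FEx)
qed auto

subsection \<open>Fresh variables\<close>

text \<open>The substitution turns the named variable c into an eigenvariable: on formulas without c
  it acts as \<open>lift\<close>, and on the instance at c it restores the body.\<close>

lemma fresh_n:
  fixes c defines "\<sigma> \<equiv> (\<lambda>n. if n = c then NV 0 else NV (Suc n))"
  assumes "c \<notin> Z"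
  shows "supp Z A \<Longrightarrow> sub A \<sigma> FV = lift A"
    "supp Z (Ex B) \<or> supp Z (All B) \<Longrightarrow> sub (inst B (NV c)) \<sigma> FV = B"
proof -
  show "supp Z A \<Longrightarrow> sub A \<sigma> FV = lift A"
    unfolding lift_def using assms by (intro supp_agree(1)[of Z]) auto
  let ?\<rho> = "\<lambda>n. if n = c then Zero else NV n"
  assume "supp Z (Ex B) \<or> supp Z (All B)"
  moreover have "fixes_on Z ?\<rho> FV" using assms by (auto simp: fixes_on_def)
  \<comment> \<open>The quantified formula does not contain c, so overwriting c in its body changes
    nothing; in the instance, c then stems from the instantiation alone.\<close>
  ultimately have *: "sub B (nn ?\<rho>) (nf FV) = B"
    unfolding supp_def by (metis sub.simps(6,7) fm.inject(6,7))
  have "sub (inst B (NV c)) \<sigma> FV = sub (sub B (nn ?\<rho>) (nf FV)) (NV 0 \<rhd> \<sigma>) FV"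
    unfolding * by (simp add: sub_inst \<sigma>_def)
  also have "\<dots> = sub B (nn ?\<rho>) (nf FV)"
    unfolding sub_nn_push
    by (rule arg_cong2[where f="sub B"]) (auto simp: nn_def \<sigma>_def fun_eq_iff split: nat.splits)
  finally show "sub (inst B (NV c)) \<sigma> FV = B" unfolding * .
qed

lemma fresh_f:
  fixes c defines "\<tau> \<equiv> (\<lambda>n. if n = c then FV 0 else FV (Suc n))"
  assumes "c \<notin> Z"
  shows "supp Z A \<Longrightarrow> sub A NV \<tau> = flift A"
    "supp Z (FEx B) \<or> supp Z (FAll B) \<Longrightarrow> sub (finst B (FV c)) NV \<tau> = B"
proof -
  show "supp Z A \<Longrightarrow> sub A NV \<tau> = flift A"
    unfolding flift_def using assms by (intro supp_agree(1)[of Z]) auto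
  let ?\<rho> = "\<lambda>n. if n = c then Succ else FV n"
  assume "supp Z (FEx B) \<or> supp Z (FAll B)"
  moreover have "fixes_on Z NV ?\<rho>" using assms by (auto simp: fixes_on_def)
  ultimately have *: "sub B (fn NV) (ff ?\<rho>) = B"
    unfolding supp_def by (metis sub.simps(8,9) fm.inject(8,9))
  have "sub (finst B (FV c)) NV \<tau> = sub (sub B (fn NV) (ff ?\<rho>)) NV (FV 0 \<rhd> \<tau>)"
    unfolding * by (simp add: sub_finst \<tau>_def)
  also have "\<dots> = sub B (fn NV) (ff ?\<rho>)"
    unfolding sub_ff_push
    by (rule arg_cong2[where f="sub B"]) (auto simp: ff_def \<tau>_def fun_eq_iff split: nat.splits)
  finally show "sub (finst B (FV c)) NV \<tau> = B" unfolding * .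
qed

text \<open>A variable outside the support Z acts as a Henkin constant: a witness for
  \<open>Ex B\<close> under this name yields no new conclusion supported by Z.\<close>

lemma fresh_ex:
  assumes "T \<parallel> insert (inst B (NV c)) \<Theta> \<turnstile> C" "Ex B \<in> \<Theta>" "Ex B \<in> formulas T"
    "\<And>A. A \<in> insert C \<Theta> \<Longrightarrow> supp Z A" "c \<notin> Z"
  shows "T \<parallel> \<Theta> \<turnstile> C"
proof (rule derives.exE)
  show "T \<parallel> \<Theta> \<turnstile> Ex B" using assms by (intro derives.assm)
  let ?\<sigma> = "\<lambda>n. if n = c then NV 0 else NV (Suc n)"
  have "T \<parallel> insert B (lift ` \<Theta>) \<turnstile> sub C ?\<sigma> FV"
  proof (rule derives_sub[OF assms(1)])
    fix A assume "A \<in> insert (inst B (NV c)) \<Theta>"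
    then show "sub A ?\<sigma> FV \<in> insert B (lift ` \<Theta>)"
      using fresh_n[OF assms(5)] assms(2,4) by auto
  qed (auto simp: tsub_def)
  then show "T \<parallel> insert B (lift ` \<Theta>) \<turnstile> lift C"
    using fresh_n[OF assms(5)] assms(4) by auto
qed

lemma fresh_fex:
  assumes "T \<parallel> insert (finst B (FV c)) \<Theta> \<turnstile> C" "FEx B \<in> \<Theta>" "FEx B \<in> formulas T"
    "\<And>A. A \<in> insert C \<Theta> \<Longrightarrow> supp Z A" "c \<notin> Z"
  shows "T \<parallel> \<Theta> \<turnstile> C"
proof (rule derives.fexE)
  show "T \<parallel> \<Theta> \<turnstile> FEx B" using assms by (intro derives.assm)
  let ?\<sigma> = "\<lambda>n. if n = c then FV 0 else FV (Suc n)"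
  have "T \<parallel> insert B (flift ` \<Theta>) \<turnstile> sub C NV ?\<sigma>"
  proof (rule derives_sub[OF assms(1)])
    fix A assume "A \<in> insert (finst B (FV c)) \<Theta>"
    then show "sub A NV ?\<sigma> \<in> insert B (flift ` \<Theta>)"
      using fresh_f[OF assms(5)] assms(2,4) by auto
  qed (auto simp: tsub_def)
  then show "T \<parallel> insert B (flift ` \<Theta>) \<turnstile> flift C"
    using fresh_f[OF assms(5)] assms(4) by auto
qed

lemma fresh_all:
  assumes "T \<parallel> \<Theta> \<turnstile> inst B (NV c)" "\<And>A. A \<in> insert (All B) \<Theta> \<Longrightarrow> supp Z A" "c \<notin> Z"
  shows "T \<parallel> \<Theta> \<turnstile> All B"
proof (rule derives.allI)
  let ?\<sigma> = "\<lambda>n. if n = c then NV 0 else NV (Suc n)"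
  have "T \<parallel> lift ` \<Theta> \<turnstile> sub (inst B (NV c)) ?\<sigma> FV"
    by (rule derives_sub[OF assms(1)]) (use fresh_n[OF assms(3)] assms(2) in \<open>auto simp: tsub_def\<close>)
  then show "T \<parallel> lift ` \<Theta> \<turnstile> B"
    using fresh_n(2)[OF assms(3), of B] assms(2) by auto
qed

lemma fresh_fall:
  assumes "T \<parallel> \<Theta> \<turnstile> finst B (FV c)" "\<And>A. A \<in> insert (FAll B) \<Theta> \<Longrightarrow> supp Z A" "c \<notin> Z"
  shows "T \<parallel> \<Theta> \<turnstile> FAll B"
proof (rule derives.fallI)
  let ?\<sigma> = "\<lambda>n. if n = c then FV 0 else FV (Suc n)"
  have "T \<parallel> flift ` \<Theta> \<turnstile> sub (finst B (FV c)) NV ?\<sigma>"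
    by (rule derives_sub[OF assms(1)]) (use fresh_f[OF assms(3)] assms(2) in \<open>auto simp: tsub_def\<close>)
  then show "T \<parallel> flift ` \<Theta> \<turnstile> B"
    using fresh_f(2)[OF assms(3), of B] assms(2) by auto
qed

subsection \<open>Prime extensions\<close>

text \<open>X supports the initial theory, and Y is the reservoir that also holds the witnesses. The
  finite Z records that only finitely many variables outside X have been used, so a fresh one is
  always left.\<close>

definition partial_world :: "nat set \<Rightarrow> nat set \<Rightarrow> fm \<Rightarrow> fm set \<Rightarrow> bool" where
  "partial_world X Y C \<Theta> \<longleftrightarrow> \<Theta> \<subseteq> formulas T \<and> (\<forall>A\<in>\<Theta>. supp Y A) \<and> \<not> (T \<parallel> \<Theta> \<turnstile> C)
     \<and> (\<exists>Z. finite Z \<and> (\<forall>A\<in>\<Theta>. supp (X \<union> Z) A))"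

text \<open>Both alternatives persist when the sets grow, so the limit of the construction decides
  every formula over Y.\<close>

definition decided :: "fm \<Rightarrow> fm set \<Rightarrow> fm \<Rightarrow> nat set \<Rightarrow> fm set \<Rightarrow> bool" where
  "decided C \<Theta> A Y \<Theta>' \<longleftrightarrow> (T \<parallel> insert A \<Theta> \<turnstile> C) \<or>
     A \<in> \<Theta>' \<and> (\<forall>B. A = Ex B \<longrightarrow> (\<exists>c\<in>Y. inst B (NV c) \<in> \<Theta>'))
       \<and> (\<forall>B. A = FEx B \<longrightarrow> (\<exists>c\<in>Y. finst B (FV c) \<in> \<Theta>'))"

lemma partial_world_step:
  assumes "partial_world X Y C \<Theta>" "X \<subseteq> Y" "infinite (Y - X)" "supp X C"
    and A: "A \<in> formulas T" "supp Y A"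
  shows "\<exists>\<Theta>'. \<Theta> \<subseteq> \<Theta>' \<and> partial_world X Y C \<Theta>' \<and> decided C \<Theta> A Y \<Theta>'"
proof (cases "T \<parallel> insert A \<Theta> \<turnstile> C")
  case True
  then show ?thesis using assms(1) by (auto simp: decided_def)
next
  case False
  obtain Z where Z: "finite Z" "\<forall>A\<in>\<Theta>. supp (X \<union> Z) A" using assms(1) by (auto simp: partial_world_def)
  obtain k where k: "supp {..<k} A" using finite_supp by blast
  let ?Z = "Z \<union> {..<k}"
  have suppZ: "supp (X \<union> ?Z) B" if "B \<in> insert C (insert A \<Theta>)" for B
    using that Z(2) k assms(4) supp_mono(3)[of "X \<union> Z" "X \<union> ?Z" B]
      supp_mono(3)[of X "X \<union> ?Z" B] supp_mono(3)[of "{..<k}" "X \<union> ?Z" B] by auto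
  \<comment> \<open>The witness must avoid X, the variables used so far and those of A
    itself.\<close>
  have "infinite ((Y - X) - ?Z)" by (rule Diff_infinite_finite) (use assms(3) Z(1) in auto)
  then obtain c where c: "c \<in> Y" "c \<notin> X \<union> ?Z"
    by (metis Diff_iff UnE ex_in_conv finite.emptyI)
  have base: "insert A \<Theta> \<subseteq> formulas T" "\<forall>A\<in>insert A \<Theta>. supp Y A"
    using assms(1) A by (auto simp: partial_world_def)
  consider (Ex) B where "A = Ex B" | (FEx) B where "A = FEx B"
    | (other) "\<forall>B. A \<noteq> Ex B" "\<forall>B. A \<noteq> FEx B" by blast
  then show ?thesis
  proof cases
    case Ex
    let ?\<Theta> = "insert (inst B (NV c)) (insert A \<Theta>)"
    have "\<not> (T \<parallel> ?\<Theta> \<turnstile> C)"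
      using fresh_ex[of B c "insert A \<Theta>" C "X \<union> ?Z"] False Ex A suppZ c(2) by auto
    moreover have "supp Y (inst B (NV c))"
      using A(2) c(1) unfolding Ex by (intro supp_inst) (auto simp: supp_trm_simps)
    moreover have "supp (X \<union> insert c ?Z) (inst B (NV c))"
      using supp_mono(3)[OF _ suppZ[of A], of "X \<union> insert c ?Z"] unfolding Ex
      by (intro supp_inst) (auto simp: supp_trm_simps)
    moreover have "supp (X \<union> insert c ?Z) B" if "B \<in> insert A \<Theta>" for B
      using supp_mono(3)[OF _ suppZ[of B], of "X \<union> insert c ?Z"] that by auto
    ultimately have "partial_world X Y C ?\<Theta>"
      using base A Z(1) Ex unfolding partial_world_def
      by (intro conjI HOL.exI[of _ "insert c ?Z"]) (auto simp: inst_formulas)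
    then show ?thesis using Ex c(1) by (intro HOL.exI[of _ ?\<Theta>]) (auto simp: decided_def)
  next
    case FEx
    let ?\<Theta> = "insert (finst B (FV c)) (insert A \<Theta>)"
    have "\<not> (T \<parallel> ?\<Theta> \<turnstile> C)"
      using fresh_fex[of B c "insert A \<Theta>" C "X \<union> ?Z"] False FEx A suppZ c(2) by auto
    moreover have "supp Y (finst B (FV c))"
      using A(2) c(1) unfolding FEx by (intro supp_finst) (auto simp: supp_trm_simps)
    moreover have "supp (X \<union> insert c ?Z) (finst B (FV c))"
      using supp_mono(3)[OF _ suppZ[of A], of "X \<union> insert c ?Z"] unfolding FEx
      by (intro supp_finst) (auto simp: supp_trm_simps)
    moreover have "supp (X \<union> insert c ?Z) B" if "B \<in> insert A \<Theta>" for B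
      using supp_mono(3)[OF _ suppZ[of B], of "X \<union> insert c ?Z"] that by auto
    ultimately have "partial_world X Y C ?\<Theta>"
      using base A Z(1) FEx unfolding partial_world_def
      by (intro conjI HOL.exI[of _ "insert c ?Z"]) (auto simp: inst_formulas)
    then show ?thesis using FEx c(1) by (intro HOL.exI[of _ ?\<Theta>]) (auto simp: decided_def)
  next
    case other
    have "partial_world X Y C (insert A \<Theta>)"
      using base False Z(1) suppZ unfolding partial_world_def
      by (intro conjI HOL.exI[of _ ?Z]) auto
    then show ?thesis using other by (intro HOL.exI[of _ "insert A \<Theta>"]) (auto simp: decided_def)
  qed
qed

lemma infinite_halves:
  assumes "infinite (U :: nat set)" shows "\<exists>V\<subseteq>U. infinite V \<and> infinite (U - V)"
proof -
  obtain f :: "nat \<Rightarrow> nat" where f: "inj f" "range f \<subseteq> U" using infinite_countable_subset[OF assms] by blast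
  have "inj (\<lambda>n. f (2 * n))" "inj (\<lambda>n. f (Suc (2 * n)))"
    by (rule injI, drule injD[OF f(1)], simp)+
  then have *: "infinite (range (\<lambda>n. f (2 * n)))" "infinite (range (\<lambda>n. f (Suc (2 * n))))"
    by (auto dest: finite_imageD)
  have "f (Suc (2 * n)) \<noteq> f (2 * m)" for n m
    using f(1) by (simp add: inj_eq) presburger
  then have "range (\<lambda>n. f (Suc (2 * n))) \<subseteq> U - range (\<lambda>n. f (2 * n))"
    using f(2) by fastforce
  then have "infinite (U - range (\<lambda>n. f (2 * n)))" using *(2) by (rule infinite_super)
  then show ?thesis using f(2) *(1) by (intro HOL.exI[of _ "range (\<lambda>n. f (2 * n))"]) auto
qed

text \<open>Lindenbaum's construction along an enumeration of the formulas, each being added unless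
  C would follow. Primeness holds because two rejected disjuncts would derive C from the
  disjunction.\<close>

lemma prime_extension:
  assumes X: "infinite (- X)" and \<Theta>: "\<Theta> \<subseteq> formulas T" "\<And>A. A \<in> \<Theta> \<Longrightarrow> supp X A"
    and C: "\<not> (T \<parallel> \<Theta> \<turnstile> C)" "supp X C" "C \<in> formulas T"
  shows "\<exists>w\<in>worlds. X \<subseteq> vs w \<and> \<Theta> \<subseteq> th w \<and> C \<notin> th w"
proof -
  obtain U where U: "U \<subseteq> - X" "infinite U" "infinite (- X - U)"
    using infinite_halves[OF X] by blast
  define Y where "Y = X \<union> U"
  have "Y - X = U" "- Y = - X - U" using U(1) by (auto simp: Y_def)
  then have Y: "X \<subseteq> Y" "infinite (Y - X)" "infinite (- Y)"
    using U(2,3) by (auto simp: Y_def)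
  have pw: "partial_world X Y C \<Theta>"
    unfolding partial_world_def using \<Theta> C(1) supp_mono(3)[OF Y(1)]
    by (auto intro!: HOL.exI[of _ "{}"])
  \<comment> \<open>The n-th formula is treated at step n, provided that it belongs to the system
    and is supported by Y.\<close>
  let ?P = "\<lambda>n \<Theta>' \<Theta>''. \<Theta>' \<subseteq> \<Theta>'' \<and> (from_nat n \<in> formulas T \<longrightarrow> supp Y (from_nat n) \<longrightarrow> decided C \<Theta>' (from_nat n) Y \<Theta>'')"
  have "\<exists>f. \<forall>n. (partial_world X Y C (f n) \<and> \<Theta> \<subseteq> f n) \<and> ?P n (f n) (f (Suc n))"
  proof (rule dependent_nat_choice)
    show "\<exists>x. partial_world X Y C x \<and> \<Theta> \<subseteq> x" using pw by blast
    show "\<exists>y. (partial_world X Y C y \<and> \<Theta> \<subseteq> y) \<and> ?P n x y"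
      if "partial_world X Y C x \<and> \<Theta> \<subseteq> x" for x n
      using partial_world_step[OF _ Y(1,2) C(2), of x "from_nat n"] that by blast
  qed
  then obtain f where f: "\<And>n. partial_world X Y C (f n)" "\<And>n. \<Theta> \<subseteq> f n" "\<And>n. f n \<subseteq> f (Suc n)"
    "\<And>n. from_nat n \<in> formulas T \<Longrightarrow> supp Y (from_nat n) \<Longrightarrow> decided C (f n) (from_nat n) Y (f (Suc n))"
    by blast
  have mono: "mono f" using f(3) by (simp add: mono_iff_le_Suc)
  define \<Omega> where "\<Omega> = (\<Union>n. f n)"
  have f\<Omega>: "f n \<subseteq> \<Omega>" for n by (auto simp: \<Omega>_def)
  have fin: "\<exists>n. \<Delta> \<subseteq> f n" if "finite \<Delta>" "\<Delta> \<subseteq> \<Omega>" for \<Delta>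
    using that
  proof (induction rule: finite_induct)
    case (insert x \<Delta>)
    then obtain n m where "\<Delta> \<subseteq> f n" "x \<in> f m" by (auto simp: \<Omega>_def)
    then have "insert x \<Delta> \<subseteq> f (max n m)"
      using monoD[OF mono, of n "max n m"] monoD[OF mono, of m "max n m"] by auto
    then show ?case by blast
  qed auto
  have noC: "\<not> (T \<parallel> \<Omega> \<turnstile> C)"
    by (meson derives_finite derives_weaken f(1) fin partial_world_def)
  have dec: "decided C \<Omega> A Y \<Omega>" if "A \<in> formulas T" "supp Y A" for A
    using f(4)[of "to_nat A"] that f\<Omega> derives_weaken[of "insert A (f (to_nat A))" C "insert A \<Omega>"]
    by (simp add: decided_def) blast
  have form: "\<Omega> \<subseteq> formulas T" "\<And>A. A \<in> \<Omega> \<Longrightarrow> supp Y A"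
    using f(1) by (auto simp: \<Omega>_def partial_world_def)
  have cl: "A \<in> \<Omega>" if "T \<parallel> \<Omega> \<turnstile> A" "supp Y A" for A
    using dec[OF derives_formulas[OF that(1)] that(2)] derives_cut[OF that(1), of C] noC
    by (auto simp: decided_def)
  have "(World Y \<Omega>) \<in> worlds"
    unfolding worlds_def
  proof (clarsimp, intro conjI HOL.allI HOL.impI ballI)
    show "infinite (- Y)" by (rule Y(3))
    show "\<Omega> \<subseteq> formulas T" by (rule form(1))
    show "supp Y A" if "A \<in> \<Omega>" for A by (rule form(2)[OF that])
    show "A \<in> \<Omega>" if "T \<parallel> \<Omega> \<turnstile> A" "supp Y A" for A by (rule cl[OF that])
    show "(\<^bold>\<not> A) \<notin> \<Omega>" if "A \<in> \<Omega>" for A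
      using noC form(1) that C(3) by (meson derives.assm derives.negE subsetD)
    show "A \<in> \<Omega> \<or> B \<in> \<Omega>" if "(A \<^bold>\<or> B) \<in> \<Omega>" for A B
    proof (rule ccontr)
      assume "\<not> ?thesis"
      moreover have "A \<in> formulas T" "B \<in> formulas T" "supp Y A" "supp Y B"
        using subsetD[OF form(1) that] form(2)[OF that] by (auto simp: supp_simps)
      ultimately have "T \<parallel> insert A \<Omega> \<turnstile> C" "T \<parallel> insert B \<Omega> \<turnstile> C"
        using dec[of A] dec[of B] by (auto simp: decided_def)
      moreover have "T \<parallel> \<Omega> \<turnstile> A \<^bold>\<or> B" using that form(1) by (intro derives.assm) auto
      ultimately show False using noC derives.orE by blast
    qed
    show "\<exists>t\<in>terms T. supp_trm Y t \<and> inst A t \<in> \<Omega>" if "Ex A \<in> \<Omega>" for A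
    proof -
      have "\<exists>c\<in>Y. inst A (NV c) \<in> \<Omega>"
        using dec[of "Ex A"] subsetD[OF form(1) that] form(2)[OF that] that noC
        by (auto simp: decided_def insert_absorb)
      then show ?thesis by (metis supp_trm_simps(1,3) terms_base(1) functors_base(1))
    qed
    show "\<exists>u\<in>functors T. supp_fnc Y u \<and> finst A u \<in> \<Omega>" if "FEx A \<in> \<Omega>" for A
    proof -
      have "\<exists>c\<in>Y. finst A (FV c) \<in> \<Omega>"
        using dec[of "FEx A"] subsetD[OF form(1) that] form(2)[OF that] that noC
        by (auto simp: decided_def insert_absorb)
      then show ?thesis by (metis supp_trm_simps(1,3) terms_base(1) functors_base(1))
    qed
  qed
  moreover have "C \<notin> \<Omega>" using noC C(3) derives.assm by blast
  moreover have "\<Theta> \<subseteq> \<Omega>" using f(2) f\<Omega> by blast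
  ultimately show ?thesis using Y by (intro bexI[of _ "World Y \<Omega>"]) auto
qed

subsection \<open>Completeness\<close>

context
  fixes w assumes w: "w \<in> worlds"
begin

lemma world_assm: "A \<in> th w \<Longrightarrow> T \<parallel> th w \<turnstile> A"
  using w by (auto simp: worlds_def intro: derives.assm)

lemma world_supp: "A \<in> th w \<Longrightarrow> supp (vs w) A"
  using w by (auto simp: worlds_def)

lemma world_formulas: "th w \<subseteq> formulas T"
  using w by (auto simp: worlds_def)

lemma world_consistent: "A \<in> th w \<Longrightarrow> (\<^bold>\<not> A) \<notin> th w"
  using w by (auto simp: worlds_def)

lemma world_prime: "(A \<^bold>\<or> B) \<in> th w \<Longrightarrow> A \<in> th w \<or> B \<in> th w"
  using w unfolding worlds_def by blast

lemma world_infinite: "infinite (- vs w)"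
  using w by (auto simp: worlds_def)

lemma world_closed: "T \<parallel> th w \<turnstile> A \<Longrightarrow> supp (vs w) A \<Longrightarrow> A \<in> th w"
  using w by (auto simp: worlds_def)

lemma world_extend:
  assumes "A \<in> formulas T" "supp (vs w) A" "\<not> (T \<parallel> insert A (th w) \<turnstile> C)"
    "supp (vs w) C" "C \<in> formulas T"
  shows "\<exists>w'. w \<sqsubseteq> w' \<and> A \<in> th w' \<and> C \<notin> th w'"
proof -
  have "\<exists>w'\<in>worlds. vs w \<subseteq> vs w' \<and> insert A (th w) \<subseteq> th w' \<and> C \<notin> th w'"
    by (rule prime_extension[OF world_infinite])
      (use assms world_formulas world_supp in auto)
  then show ?thesis using w unfolding acc_def by blast
qed

text \<open>Supplies a counterexample to a universal statement at an individual that w itself does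
  not have.\<close>

lemma world_fresh:
  assumes "\<not> (T \<parallel> th w \<turnstile> C)" "supp (insert c (vs w)) C" "C \<in> formulas T" "c \<notin> vs w"
  shows "\<exists>w'. w \<sqsubseteq> w' \<and> c \<in> vs w' \<and> C \<notin> th w'"
proof -
  have "infinite (- insert c (vs w))" using world_infinite by (simp add: Compl_insert)
  then have "\<exists>w'\<in>worlds. insert c (vs w) \<subseteq> vs w' \<and> th w \<subseteq> th w' \<and> C \<notin> th w'"
    by (rule prime_extension)
      (use assms world_formulas world_supp supp_mono(3)[of "vs w" "insert c (vs w)"] in auto)
  then show ?thesis using w unfolding acc_def by blast
qed

end

lemma env_sub:
  assumes "env w \<sigma> \<tau>"
  shows "A \<in> formulas T \<Longrightarrow> sub A \<sigma> \<tau> \<in> formulas T" "supp (vs w) (sub A \<sigma> \<tau>)" "tsub \<sigma> \<tau>"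
    "t \<in> terms T \<Longrightarrow> sub_trm t \<sigma> \<tau> \<in> dom_n w" "u \<in> functors T \<Longrightarrow> sub_fnc u \<sigma> \<tau> \<in> dom_f w"
proof -
  show ts: "tsub \<sigma> \<tau>" using assms by (auto simp: env_def tsub_def dom_n_def dom_f_def)
  show "A \<in> formulas T \<Longrightarrow> sub A \<sigma> \<tau> \<in> formulas T" using ts by (rule sub_formulas)
  show "supp (vs w) (sub A \<sigma> \<tau>)"
    using assms by (intro supp_sub) (auto simp: env_def dom_n_def dom_f_def)
  show "t \<in> terms T \<Longrightarrow> sub_trm t \<sigma> \<tau> \<in> dom_n w" "u \<in> functors T \<Longrightarrow> sub_fnc u \<sigma> \<tau> \<in> dom_f w"
    using assms by (auto simp: env_def dom_n_def dom_f_def intro!: sub_closed supp_sub)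
qed

text \<open>The work lies where forcing quantifies over later worlds: if a negation, implication or
  generalization is missing from the theory, \<open>world_extend\<close> or
  \<open>world_fresh\<close> yields a later world that refutes it.\<close>

lemma truth:
  "A \<in> formulas T \<Longrightarrow> env w \<sigma> \<tau> \<Longrightarrow> force w \<sigma> \<tau> A \<longleftrightarrow> sub A \<sigma> \<tau> \<in> th w"
proof (induction A arbitrary: w \<sigma> \<tau>)
  case (Eq s t)
  then show ?case by (simp add: eqv_def env_worlds)
next
  case (Neg A)
  have w: "w \<in> worlds" using Neg.prems(2) by (rule env_worlds)
  let ?A = "sub A \<sigma> \<tau>"
  have A: "A \<in> formulas T" "?A \<in> formulas T" "supp (vs w) ?A"
    using Neg.prems env_sub[OF Neg.prems(2)] by auto
  have IH: "force w' \<sigma> \<tau> A \<longleftrightarrow> ?A \<in> th w'" if "w \<sqsubseteq> w'" for w'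
    using Neg.IH[OF A(1) env_mono[OF that Neg.prems(2)]] .
  have "(\<forall>w'. w \<sqsubseteq> w' \<longrightarrow> ?A \<notin> th w') \<longleftrightarrow> (\<^bold>\<not> ?A) \<in> th w"
  proof
    assume *: "\<forall>w'. w \<sqsubseteq> w' \<longrightarrow> ?A \<notin> th w'"
    \<comment> \<open>The language has no falsum; the negation itself serves as the formula that the
      extension avoids.\<close>
    have "T \<parallel> insert ?A (th w) \<turnstile> \<^bold>\<not> ?A"
    proof (rule ccontr)
      assume "\<not> ?thesis"
      then obtain w' where "w \<sqsubseteq> w'" "?A \<in> th w'"
        using world_extend[OF w A(2,3), of "\<^bold>\<not> ?A"] A(2,3) unfolding supp_simps formulas_simps by blast
      then show False using * by blast
    qed
    then have "T \<parallel> th w \<turnstile> \<^bold>\<not> ?A"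
      using A(2) by (metis derives.negI derives.assm insertI1)
    then show "(\<^bold>\<not> ?A) \<in> th w" using world_closed[OF w] A by (simp add: supp_simps)
  next
    show "(\<^bold>\<not> ?A) \<in> th w \<Longrightarrow> \<forall>w'. w \<sqsubseteq> w' \<longrightarrow> ?A \<notin> th w'"
      using world_consistent unfolding acc_def by blast
  qed
  then show ?case unfolding force.simps sub.simps using IH by blast
next
  case (And A B)
  have w: "w \<in> worlds" using And.prems(2) by (rule env_worlds)
  let ?A = "sub A \<sigma> \<tau>" and ?B = "sub B \<sigma> \<tau>"
  have A: "supp (vs w) ?A" "supp (vs w) ?B"
    using env_sub(2)[OF And.prems(2)] by auto
  have "(?A \<^bold>\<and> ?B) \<in> th w \<longleftrightarrow> ?A \<in> th w \<and> ?B \<in> th w"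
    using world_closed[OF w derives.andI[OF world_assm[OF w] world_assm[OF w]], of ?A ?B]
      world_closed[OF w derives.andE1[OF world_assm[OF w]], of ?A ?B]
      world_closed[OF w derives.andE2[OF world_assm[OF w]], of ?A ?B] A supp_simps(3) by blast
  then show ?case using And by simp
next
  case (Or A B)
  have w: "w \<in> worlds" using Or.prems(2) by (rule env_worlds)
  let ?A = "sub A \<sigma> \<tau>" and ?B = "sub B \<sigma> \<tau>"
  have A: "supp (vs w) ?A" "supp (vs w) ?B" "?A \<in> formulas T" "?B \<in> formulas T"
    using Or.prems env_sub[OF Or.prems(2)] by auto
  have "(?A \<^bold>\<or> ?B) \<in> th w \<longleftrightarrow> ?A \<in> th w \<or> ?B \<in> th w"
    using world_closed[OF w derives.orI1[OF world_assm[OF w] A(4)]]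
      world_closed[OF w derives.orI2[OF world_assm[OF w] A(3)]]
      world_prime[OF w] A(1,2) supp_simps(4) by blast
  then show ?case using Or by simp
next
  case (Imp A B)
  have w: "w \<in> worlds" using Imp.prems(2) by (rule env_worlds)
  let ?A = "sub A \<sigma> \<tau>" and ?B = "sub B \<sigma> \<tau>"
  have A: "A \<in> formulas T" "?A \<in> formulas T" "supp (vs w) ?A"
    "B \<in> formulas T" "?B \<in> formulas T" "supp (vs w) ?B"
    using Imp.prems env_sub[OF Imp.prems(2)] by auto
  have IH: "force w' \<sigma> \<tau> A \<longleftrightarrow> ?A \<in> th w'" "force w' \<sigma> \<tau> B \<longleftrightarrow> ?B \<in> th w'" if "w \<sqsubseteq> w'" for w'
    using Imp.IH(1)[OF A(1) env_mono[OF that Imp.prems(2)]]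
      Imp.IH(2)[OF A(4) env_mono[OF that Imp.prems(2)]] by auto
  have "(\<forall>w'. w \<sqsubseteq> w' \<longrightarrow> ?A \<in> th w' \<longrightarrow> ?B \<in> th w') \<longleftrightarrow> (?A \<^bold>\<longrightarrow> ?B) \<in> th w"
  proof
    assume *: "\<forall>w'. w \<sqsubseteq> w' \<longrightarrow> ?A \<in> th w' \<longrightarrow> ?B \<in> th w'"
    have "T \<parallel> insert ?A (th w) \<turnstile> ?B"
    proof (rule ccontr)
      assume "\<not> ?thesis"
      then obtain w' where "w \<sqsubseteq> w'" "?A \<in> th w'" "?B \<notin> th w'"
        using world_extend[OF w A(2,3) _ A(6,5)] by blast
      then show False using * by blast
    qed
    then have "T \<parallel> th w \<turnstile> ?A \<^bold>\<longrightarrow> ?B" using A(2) by (rule derives.impI)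
    then show "(?A \<^bold>\<longrightarrow> ?B) \<in> th w" using world_closed[OF w] A by (simp add: supp_simps)
  next
    assume *: "(?A \<^bold>\<longrightarrow> ?B) \<in> th w"
    show "\<forall>w'. w \<sqsubseteq> w' \<longrightarrow> ?A \<in> th w' \<longrightarrow> ?B \<in> th w'"
    proof clarify
      fix w' assume w': "w \<sqsubseteq> w'" "?A \<in> th w'"
      then have "w' \<in> worlds" "(?A \<^bold>\<longrightarrow> ?B) \<in> th w'" using * unfolding acc_def by blast+
      from world_closed[OF this(1) derives.impE[OF world_assm[OF this] world_assm[OF this(1) w'(2)]]]
        world_supp[OF this]
      show "?B \<in> th w'" unfolding supp_simps by blast
    qed
  qed
  then show ?case unfolding force.simps sub.simps using IH by blast
next
  case (All A)
  have w: "w \<in> worlds" using All.prems(2) by (rule env_worlds)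
  let ?A = "sub A (nn \<sigma>) (nf \<tau>)"
  have A: "A \<in> formulas T" "?A \<in> formulas T" "supp (vs w) (All ?A)"
    using All.prems env_sub[OF All.prems(2)] env_sub(2)[OF All.prems(2), of "All A"]
    by (auto intro: sub_formulas tsub_nn)
  have IH: "force w' (d \<rhd> \<sigma>) \<tau> A \<longleftrightarrow> inst ?A d \<in> th w'" if "w \<sqsubseteq> w'" "d \<in> dom_n w'" for w' d
    unfolding inst_nn
    by (rule All.IH[OF A(1)]) (use that env_mono[OF that(1) All.prems(2)] in \<open>simp add: env_push\<close>)
  have "(\<forall>w'. w \<sqsubseteq> w' \<longrightarrow> (\<forall>d\<in>dom_n w'. inst ?A d \<in> th w')) \<longleftrightarrow> All ?A \<in> th w"
  proof
    assume *: "\<forall>w'. w \<sqsubseteq> w' \<longrightarrow> (\<forall>d\<in>dom_n w'. inst ?A d \<in> th w')"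
    obtain c where c: "c \<notin> vs w"
      using world_infinite[OF w] by (metis ComplD ex_in_conv finite.emptyI)
    have "supp (insert c (vs w)) (inst ?A (NV c))"
      using supp_mono(3)[OF _ A(3), of "insert c (vs w)"]
      by (intro supp_inst) (auto simp: supp_trm_simps)
    then have "T \<parallel> th w \<turnstile> inst ?A (NV c)"
      using world_fresh[OF w _ _ _ c, of "inst ?A (NV c)"] * inst_formulas(1)[OF A(2)]
      unfolding dom_n_def by (metis (mono_tags, lifting) mem_Collect_eq acc_def supp_trm_simps(1) terms_base(1))
    then have "T \<parallel> th w \<turnstile> All ?A"
      by (rule fresh_all[where Z="vs w"]) (use A c world_supp[OF w] in auto)
    then show "All ?A \<in> th w" using world_closed[OF w] A by simp
  next
    assume *: "All ?A \<in> th w"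
    show "\<forall>w'. w \<sqsubseteq> w' \<longrightarrow> (\<forall>d\<in>dom_n w'. inst ?A d \<in> th w')"
    proof clarify
      fix w' d assume w': "w \<sqsubseteq> w'" "d \<in> dom_n w'"
      then have "w' \<in> worlds" "All ?A \<in> th w'" using * unfolding acc_def by blast+
      from world_closed[OF this(1) derives.allE[OF world_assm[OF this]]] world_supp[OF this] w'(2)
      show "inst ?A d \<in> th w'" unfolding dom_n_def by (simp add: supp_inst)
    qed
  qed
  then show ?case unfolding force.simps sub.simps using IH by blast
next
  case (Ex A)
  have w: "w \<in> worlds" using Ex.prems(2) by (rule env_worlds)
  let ?A = "sub A (nn \<sigma>) (nf \<tau>)"
  have A: "A \<in> formulas T" "?A \<in> formulas T" "supp (vs w) (Ex ?A)"
    using Ex.prems env_sub[OF Ex.prems(2)] env_sub(2)[OF Ex.prems(2), of "Ex A"]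
    by (auto intro: sub_formulas tsub_nn)
  have IH: "force w (d \<rhd> \<sigma>) \<tau> A \<longleftrightarrow> inst ?A d \<in> th w" if "d \<in> dom_n w" for d
    unfolding inst_nn
    by (rule Ex.IH[OF A(1)]) (use that Ex.prems(2) in \<open>simp add: env_push\<close>)
  have "Ex ?A \<in> th w" if "d \<in> dom_n w" "inst ?A d \<in> th w" for d
    using world_closed[OF w derives.exI[OF world_assm[OF w that(2)] _ A(2)]] that A
    by (auto simp: dom_n_def)
  moreover have "\<exists>d\<in>dom_n w. inst ?A d \<in> th w" if "Ex ?A \<in> th w"
    using w that unfolding worlds_def dom_n_def mem_Collect_eq by blast
  ultimately show ?case unfolding force.simps sub.simps using IH by blast
next
  case (FAll A)
  have w: "w \<in> worlds" using FAll.prems(2) by (rule env_worlds)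
  let ?A = "sub A (fn \<sigma>) (ff \<tau>)"
  have A: "A \<in> formulas T" "?A \<in> formulas T" "supp (vs w) (FAll ?A)"
    using FAll.prems env_sub[OF FAll.prems(2)] env_sub(2)[OF FAll.prems(2), of "FAll A"]
    by (auto intro: sub_formulas tsub_ff)
  have IH: "force w' \<sigma> (d \<rhd> \<tau>) A \<longleftrightarrow> finst ?A d \<in> th w'" if "w \<sqsubseteq> w'" "d \<in> dom_f w'" for w' d
    unfolding finst_ff
    by (rule FAll.IH[OF A(1)]) (use that env_mono[OF that(1) FAll.prems(2)] in \<open>simp add: env_push\<close>)
  have "(\<forall>w'. w \<sqsubseteq> w' \<longrightarrow> (\<forall>d\<in>dom_f w'. finst ?A d \<in> th w')) \<longleftrightarrow> FAll ?A \<in> th w"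
  proof
    assume *: "\<forall>w'. w \<sqsubseteq> w' \<longrightarrow> (\<forall>d\<in>dom_f w'. finst ?A d \<in> th w')"
    obtain c where c: "c \<notin> vs w"
      using world_infinite[OF w] by (metis ComplD ex_in_conv finite.emptyI)
    have "supp (insert c (vs w)) (finst ?A (FV c))"
      using supp_mono(3)[OF _ A(3), of "insert c (vs w)"]
      by (intro supp_finst) (auto simp: supp_trm_simps)
    then have "T \<parallel> th w \<turnstile> finst ?A (FV c)"
      using world_fresh[OF w _ _ _ c, of "finst ?A (FV c)"] * inst_formulas(2)[OF A(2)]
      unfolding dom_f_def by (metis (mono_tags, lifting) mem_Collect_eq acc_def supp_trm_simps(3) functors_base(1))
    then have "T \<parallel> th w \<turnstile> FAll ?A"
      by (rule fresh_fall[where Z="vs w"]) (use A c world_supp[OF w] in auto)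
    then show "FAll ?A \<in> th w" using world_closed[OF w] A by simp
  next
    assume *: "FAll ?A \<in> th w"
    show "\<forall>w'. w \<sqsubseteq> w' \<longrightarrow> (\<forall>d\<in>dom_f w'. finst ?A d \<in> th w')"
    proof clarify
      fix w' d assume w': "w \<sqsubseteq> w'" "d \<in> dom_f w'"
      then have "w' \<in> worlds" "FAll ?A \<in> th w'" using * unfolding acc_def by blast+
      from world_closed[OF this(1) derives.fallE[OF world_assm[OF this]]] world_supp[OF this] w'(2)
      show "finst ?A d \<in> th w'" unfolding dom_f_def by (simp add: supp_finst)
    qed
  qed
  then show ?case unfolding force.simps sub.simps using IH by blast
next
  case (FEx A)
  have w: "w \<in> worlds" using FEx.prems(2) by (rule env_worlds)
  let ?A = "sub A (fn \<sigma>) (ff \<tau>)"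
  have A: "A \<in> formulas T" "?A \<in> formulas T" "supp (vs w) (FEx ?A)"
    using FEx.prems env_sub[OF FEx.prems(2)] env_sub(2)[OF FEx.prems(2), of "FEx A"]
    by (auto intro: sub_formulas tsub_ff)
  have IH: "force w \<sigma> (d \<rhd> \<tau>) A \<longleftrightarrow> finst ?A d \<in> th w" if "d \<in> dom_f w" for d
    unfolding finst_ff
    by (rule FEx.IH[OF A(1)]) (use that FEx.prems(2) in \<open>simp add: env_push\<close>)
  have "FEx ?A \<in> th w" if "d \<in> dom_f w" "finst ?A d \<in> th w" for d
    using world_closed[OF w derives.fexI[OF world_assm[OF w that(2)] _ A(2)]] that A
    by (auto simp: dom_f_def)
  moreover have "\<exists>d\<in>dom_f w. finst ?A d \<in> th w" if "FEx ?A \<in> th w"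
    using w that unfolding worlds_def dom_f_def mem_Collect_eq by blast
  ultimately show ?case unfolding force.simps sub.simps using IH by blast
qed

lemma sound: "T \<parallel> {} \<turnstile> A \<Longrightarrow> env w \<sigma> \<tau> \<Longrightarrow> force w \<sigma> \<tau> A"
  using truth[of A w \<sigma> \<tau>] derives_formulas[of "{}" A] env_sub[of w \<sigma> \<tau>]
    derives_sub[of "{}" A \<sigma> \<tau> "th w"] world_closed[of w] env_worlds by auto

text \<open>A world omits infinitely many variables whereas \<Gamma> may contain all of them. The
  variables are therefore first moved to the even numbers; halving the indices undoes this.\<close>

lemma complete:
  assumes "\<Gamma> \<subseteq> formulas T" "A \<in> formulas T"
    "\<And>w \<sigma> \<tau>. env w \<sigma> \<tau> \<Longrightarrow> (\<And>B. B \<in> \<Gamma> \<Longrightarrow> force w \<sigma> \<tau> B) \<Longrightarrow> force w \<sigma> \<tau> A"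
  shows "T \<parallel> \<Gamma> \<turnstile> A"
proof (rule ccontr)
  assume nd: "\<not> (T \<parallel> \<Gamma> \<turnstile> A)"
  let ?\<sigma> = "\<lambda>n. NV (2 * n)" and ?\<tau> = "\<lambda>n. FV (2 * n)"
  let ?s = "\<lambda>B. sub B ?\<sigma> ?\<tau>"
  let ?X = "range (\<lambda>n::nat. 2 * n)"
  have inv: "sub (?s B) (\<lambda>n. NV (n div 2)) (\<lambda>n. FV (n div 2)) = B" for B
    by (simp add: sub_sub_fm)
  have "\<not> (T \<parallel> ?s ` \<Gamma> \<turnstile> ?s A)"
  proof
    assume "T \<parallel> ?s ` \<Gamma> \<turnstile> ?s A"
    then have "T \<parallel> \<Gamma> \<turnstile> sub (?s A) (\<lambda>n. NV (n div 2)) (\<lambda>n. FV (n div 2))"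
      by (rule derives_sub) (use inv in auto)
    then show False using nd inv by simp
  qed
  moreover have "infinite (- ?X)"
  proof
    assume "finite (- ?X)"
    moreover have "range (\<lambda>n::nat. Suc (2 * n)) \<subseteq> - ?X" by auto presburger
    ultimately have "finite (range (\<lambda>n::nat. Suc (2 * n)))" by (rule finite_subset[rotated])
    then show False by (simp add: finite_image_iff inj_on_def)
  qed
  moreover have supp: "supp ?X (?s B)" for B
    by (rule supp_sub) (auto simp: supp_trm_simps)
  moreover have "?s B \<in> formulas T" if "B \<in> formulas T" for B
    using that by (auto intro: sub_formulas)
  ultimately have "\<exists>w\<in>worlds. ?X \<subseteq> vs w \<and> ?s ` \<Gamma> \<subseteq> th w \<and> ?s A \<notin> th w"
    by (intro prime_extension) (use assms(1,2) in auto)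
  then obtain w where w: "w \<in> worlds" "?X \<subseteq> vs w" "?s ` \<Gamma> \<subseteq> th w" "?s A \<notin> th w"
    by blast
  have env: "env w ?\<sigma> ?\<tau>"
    using w(1,2) by (auto simp: env_def dom_n_def dom_f_def supp_trm_simps)
  then have "force w ?\<sigma> ?\<tau> A"
    by (rule assms(3)) (use assms(1) w(3) truth[OF _ env] in auto)
  then show False using truth[OF assms(2) env] w(4) by simp
qed

end

section \<open>Arithmetic in Kripke models\<close>

lemma sub_ZeroF: "sub_fnc ZeroF \<sigma> \<tau> = ZeroF" and sub_IdF: "sub_fnc IdF \<sigma> \<tau> = IdF"
  by (simp_all add: ZeroF_def IdF_def nn_def)

lemma bim_closed:
  assumes "\<And>n. bim_trm (\<sigma> n)" "\<And>n. bim_fnc (\<tau> n)"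
  shows "bim_trm t \<Longrightarrow> bim_trm (sub_trm t \<sigma> \<tau>)" "bim_fnc u \<Longrightarrow> bim_fnc (sub_fnc u \<sigma> \<tau>)"
  using assms
proof (induction t and u arbitrary: \<sigma> \<tau> and \<sigma> \<tau>)
  case (Lam t)
  then show ?case by (auto simp: ZeroF_def IdF_def nn_def)
qed auto

lemma BIM_simps [simp]: "terms BIM = {t. bim_trm t}" "functors BIM = {u. bim_fnc u}"
  by (simp_all add: BIM_def)

global_interpretation bim: lang BIM
  by unfold_locales (auto intro: bim_closed simp: ZeroF_def IdF_def)

lemma bim_ren: "bim_trm t \<Longrightarrow> bim_trm (ren_trm t r q)"
  by (simp add: ren_eq_sub bim_closed)

lemma (in lang) bim_terms: "bim_trm t \<Longrightarrow> t \<in> terms T" "bim_fnc u \<Longrightarrow> u \<in> functors T"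
  by (induction t and u) (auto simp: ZeroF_def[symmetric] IdF_def[symmetric])

lemma (in lang) bim_formulas: "A \<in> formulas BIM \<Longrightarrow> A \<in> formulas T"
  by (induction A) (auto simp: bim_terms)

text \<open>Induction is required for formulas of BIM only, so that BIM + CFd and Mj are both
  instances. Properties proved by induction below are accordingly written as formulas of
  BIM.\<close>

locale arith_model = lang +
  assumes arith_ax: "\<And>A. A \<in> arith_axioms \<union> bim_constant_axioms \<Longrightarrow> T \<parallel> {} \<turnstile> A"
    and induction_ax: "\<And>A. A \<in> formulas BIM \<Longrightarrow> T \<parallel> {} \<turnstile> induction_axiom A"
begin

section \<open>Equality, zero, successor and pairing in a world\<close>

lemma arith_force:
  "A \<in> arith_axioms \<union> bim_constant_axioms \<Longrightarrow> env w \<sigma> \<tau> \<Longrightarrow> force w \<sigma> \<tau> A"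
  using sound[OF arith_ax] by blast

lemma env_base: "w \<in> worlds \<Longrightarrow> env w (\<lambda>_. Zero) (\<lambda>_. Succ)"
  by (auto simp: env_def dom_n_def dom_f_def supp_trm_simps)

lemma dom_worlds: "a \<in> dom_n w \<Longrightarrow> w \<in> worlds" "f \<in> dom_f w \<Longrightarrow> w \<in> worlds"
  by (auto simp: dom_n_def dom_f_def)

lemma dom_intros:
  "w \<in> worlds \<Longrightarrow> Zero \<in> dom_n w"
  "f \<in> dom_f w \<Longrightarrow> a \<in> dom_n w \<Longrightarrow> Ap f a \<in> dom_n w"
  "a \<in> dom_n w \<Longrightarrow> b \<in> dom_n w \<Longrightarrow> J a b \<in> dom_n w"
  "w \<in> worlds \<Longrightarrow> Succ \<in> dom_f w" "w \<in> worlds \<Longrightarrow> PK \<in> dom_f w" "w \<in> worlds \<Longrightarrow> PL \<in> dom_f w"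
  by (auto simp: dom_n_def dom_f_def supp_trm_simps)

lemma unary_dom: "a \<in> dom_n w \<Longrightarrow> S a \<in> dom_n w" "a \<in> dom_n w \<Longrightarrow> Ap PK a \<in> dom_n w"
  "a \<in> dom_n w \<Longrightarrow> Ap PL a \<in> dom_n w" "a \<in> dom_n w \<Longrightarrow> Zero \<in> dom_n w"
  by (auto simp: dom_n_def supp_trm_simps)

lemma eqv_dom:
  assumes "eqv w a b" shows "a \<in> dom_n w" "b \<in> dom_n w" "w \<in> worlds"
proof -
  have w: "w \<in> worlds" "(a \<doteq> b) \<in> th w" using assms by (auto simp: eqv_def)
  then have "(a \<doteq> b) \<in> formulas T" "supp (vs w) (a \<doteq> b)"
    using world_formulas world_supp by blast+
  then show "a \<in> dom_n w" "b \<in> dom_n w" "w \<in> worlds" using w by (auto simp: dom_n_def supp_simps)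
qed

lemma env_dom: "env w \<sigma> \<tau> \<Longrightarrow> \<sigma> n \<in> dom_n w" "env w \<sigma> \<tau> \<Longrightarrow> \<tau> n \<in> dom_f w"
  by (auto simp: env_def)

lemma eqv_refl: "a \<in> dom_n w \<Longrightarrow> eqv w a a"
  using arith_force[of "NV 0 \<doteq> NV 0" w "a \<rhd> (\<lambda>_. Zero)" "\<lambda>_. Succ"] env_base dom_worlds
  by (auto simp: arith_axioms_def env_push)

lemma eqv_euclid: "eqv w a b \<Longrightarrow> eqv w a c \<Longrightarrow> eqv w b c"
  using arith_force[of "NV 0 \<doteq> NV 1 \<^bold>\<longrightarrow> NV 0 \<doteq> NV 2 \<^bold>\<longrightarrow> NV 1 \<doteq> NV 2" w "a \<rhd> b \<rhd> c \<rhd> (\<lambda>_. Zero)" "\<lambda>_. Succ"]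
    env_base eqv_dom[of w a b] eqv_dom[of w a c] acc_refl
  by (auto simp: arith_axioms_def env_push)

lemma eqv_sym: "eqv w a b \<Longrightarrow> eqv w b a"
  by (rule eqv_euclid[OF _ eqv_refl]) (auto dest: eqv_dom)

lemma eqv_trans [trans]: "eqv w a b \<Longrightarrow> eqv w b c \<Longrightarrow> eqv w a c"
  by (rule eqv_euclid[OF eqv_sym])

lemma eqv_join: "eqv w a c \<Longrightarrow> eqv w b c \<Longrightarrow> eqv w a b"
  by (rule eqv_trans[OF _ eqv_sym])

lemma eqv_Ap: "eqv w a b \<Longrightarrow> f \<in> dom_f w \<Longrightarrow> eqv w (Ap f a) (Ap f b)"
  using arith_force[of "NV 0 \<doteq> NV 1 \<^bold>\<longrightarrow> Ap (FV 0) (NV 0) \<doteq> Ap (FV 0) (NV 1)" w "a \<rhd> b \<rhd> (\<lambda>_. Zero)" "f \<rhd> (\<lambda>_. Succ)"]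
    env_base eqv_dom[of w a b] acc_refl
  by (auto simp: arith_axioms_def env_push)

lemma eqv_S: "eqv w a b \<Longrightarrow> eqv w (S a) (S b)"
  by (rule eqv_Ap) (auto intro: dom_intros dest: eqv_dom)

lemma eqv_J: "eqv w a b \<Longrightarrow> eqv w c d \<Longrightarrow> eqv w (J a c) (J b d)"
  using arith_force[of "NV 0 \<doteq> NV 1 \<^bold>\<and> NV 2 \<doteq> NV 3 \<^bold>\<longrightarrow> J (NV 0) (NV 2) \<doteq> J (NV 1) (NV 3)" w "a \<rhd> b \<rhd> c \<rhd> d \<rhd> (\<lambda>_. Zero)" "\<lambda>_. Succ"]
    env_base eqv_dom[of w a b] eqv_dom[of w c d] acc_refl
  by (auto simp: bim_constant_axioms_def pairing_axioms_def env_push)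

lemma S_ne_Zero: "a \<in> dom_n w \<Longrightarrow> \<not> eqv w (S a) Zero"
  using arith_force[of "\<^bold>\<not> S (NV 0) \<doteq> Zero" w "a \<rhd> (\<lambda>_. Zero)" "\<lambda>_. Succ"]
    env_base[of w] dom_worlds(1)[of a w] acc_refl[of w]
  by (auto simp: arith_axioms_def env_push)

lemma Zero_S: "eqv w a Zero \<Longrightarrow> eqv w a (S b) \<Longrightarrow> b \<in> dom_n w \<Longrightarrow> False"
  using S_ne_Zero eqv_euclid by blast

lemma S_inj: "eqv w (S a) (S b) \<Longrightarrow> a \<in> dom_n w \<Longrightarrow> b \<in> dom_n w \<Longrightarrow> eqv w a b"
  using arith_force[of "S (NV 0) \<doteq> S (NV 1) \<^bold>\<longrightarrow> NV 0 \<doteq> NV 1" w "a \<rhd> b \<rhd> (\<lambda>_. Zero)" "\<lambda>_. Succ"]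
    env_base[of w] dom_worlds(1)[of a w] acc_refl[of w]
  by (auto simp: arith_axioms_def env_push)

lemma PK_J: "a \<in> dom_n w \<Longrightarrow> b \<in> dom_n w \<Longrightarrow> eqv w (Ap PK (J a b)) a"
  and PL_J: "a \<in> dom_n w \<Longrightarrow> b \<in> dom_n w \<Longrightarrow> eqv w (Ap PL (J a b)) b"
  using arith_force[of "Ap PK (J (NV 0) (NV 1)) \<doteq> NV 0" w "a \<rhd> b \<rhd> (\<lambda>_. Zero)" "\<lambda>_. Succ"]
    arith_force[of "Ap PL (J (NV 0) (NV 1)) \<doteq> NV 1" w "a \<rhd> b \<rhd> (\<lambda>_. Zero)" "\<lambda>_. Succ"]
    env_base[of w] dom_worlds(1)[of a w] acc_refl[of w]
  by (auto simp: bim_constant_axioms_def pairing_axioms_def env_push)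

lemma ZeroF_eq: "a \<in> dom_n w \<Longrightarrow> eqv w (Ap ZeroF a) Zero"
  and IdF_eq: "a \<in> dom_n w \<Longrightarrow> eqv w (Ap IdF a) a"
  using arith_force[of "Ap ZeroF (NV 0) \<doteq> Zero" w "a \<rhd> (\<lambda>_. Zero)" "\<lambda>_. Succ"]
    arith_force[of "Ap IdF (NV 0) \<doteq> NV 0" w "a \<rhd> (\<lambda>_. Zero)" "\<lambda>_. Succ"]
    env_base[of w] dom_worlds(1)[of a w] acc_refl[of w]
  by (auto simp: bim_constant_axioms_def env_push ZeroF_def IdF_def nn_def)

text \<open>The semantic form of the induction axiom. The step is required at all later worlds
  because the premise of the axiom is an implication under a quantifier.\<close>

lemma induct_dom:
  assumes "A \<in> formulas BIM" "env w \<sigma> \<tau>" "force w (Zero \<rhd> \<sigma>) \<tau> A"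
    and "\<And>w' d. w \<sqsubseteq> w' \<Longrightarrow> d \<in> dom_n w' \<Longrightarrow> force w' (d \<rhd> \<sigma>) \<tau> A \<Longrightarrow> force w' (S d \<rhd> \<sigma>) \<tau> A"
    and "d \<in> dom_n w"
  shows "force w (d \<rhd> \<sigma>) \<tau> A"
proof -
  have *: "(\<lambda>n. sub_trm ((S (NV 0) \<rhd> (\<lambda>n. NV (Suc n))) n) (d \<rhd> \<sigma>) \<tau>) = (S d \<rhd> \<sigma>)" for d
    by (auto simp: fun_eq_iff split: nat.splits)
  have "force w \<sigma> \<tau> (induction_axiom A)"
    using sound[OF induction_ax] assms(1,2) by blast
  moreover have "w \<sqsubseteq> w" using assms(2) by (simp add: acc_refl env_worlds)
  moreover have "force w \<sigma> \<tau> (inst A Zero)"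
    using assms(3) by (simp add: inst_def force_sub sub_push)
  moreover have "force w \<sigma> \<tau> (All (A \<^bold>\<longrightarrow> sub A (S (NV 0) \<rhd> (\<lambda>n. NV (Suc n))) FV))"
    unfolding force.simps force_sub * using assms(4) by (auto intro: acc_trans dom_mono)
  ultimately have "force w \<sigma> \<tau> (All A)"
    unfolding induction_axiom_def force.simps by blast
  then show ?thesis using assms(5) \<open>w \<sqsubseteq> w\<close> by auto
qed

section \<open>Extensional equality and congruence\<close>

definition exteq :: "world \<Rightarrow> fnc \<Rightarrow> fnc \<Rightarrow> bool" where
  "exteq w f g \<longleftrightarrow> f \<in> dom_f w \<and> g \<in> dom_f w \<and> (\<forall>w' x. w \<sqsubseteq> w' \<longrightarrow> x \<in> dom_n w' \<longrightarrow> eqv w' (Ap f x) (Ap g x))"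

definition enveq :: "world \<Rightarrow> nsub \<Rightarrow> fsub \<Rightarrow> nsub \<Rightarrow> fsub \<Rightarrow> bool" where
  "enveq w \<sigma> \<tau> \<sigma>' \<tau>' \<longleftrightarrow> (\<forall>n. eqv w (\<sigma> n) (\<sigma>' n)) \<and> (\<forall>n. exteq w (\<tau> n) (\<tau>' n))"

lemma exteq_refl: "f \<in> dom_f w \<Longrightarrow> exteq w f f"
  unfolding exteq_def by (blast intro: eqv_refl dom_intros dom_mono)

lemma exteq_sym: "exteq w f g \<Longrightarrow> exteq w g f"
  unfolding exteq_def using eqv_sym by blast

lemma exteq_mono: "exteq w f g \<Longrightarrow> w \<sqsubseteq> w' \<Longrightarrow> exteq w' f g"
  unfolding exteq_def using acc_trans dom_mono by blast

lemma exteq_Ap: "exteq w f g \<Longrightarrow> eqv w a b \<Longrightarrow> eqv w (Ap f a) (Ap g b)"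
proof (rule eqv_trans)
  assume *: "exteq w f g" "eqv w a b"
  then have "w \<sqsubseteq> w" "b \<in> dom_n w" using eqv_dom acc_refl by blast+
  then show "eqv w (Ap f b) (Ap g b)" using * unfolding exteq_def by blast
  show "eqv w (Ap f a) (Ap f b)" using * eqv_Ap unfolding exteq_def by blast
qed

lemma enveq_mono: "enveq w \<sigma> \<tau> \<sigma>' \<tau>' \<Longrightarrow> w \<sqsubseteq> w' \<Longrightarrow> enveq w' \<sigma> \<tau> \<sigma>' \<tau>'"
  unfolding enveq_def using exteq_mono eqv_mono by blast

lemma enveq_sym: "enveq w \<sigma> \<tau> \<sigma>' \<tau>' \<Longrightarrow> enveq w \<sigma>' \<tau>' \<sigma> \<tau>"
  unfolding enveq_def using exteq_sym eqv_sym by blast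

lemma enveq_refl: "env w \<sigma> \<tau> \<Longrightarrow> enveq w \<sigma> \<tau> \<sigma> \<tau>"
  unfolding enveq_def env_def using exteq_refl eqv_refl by blast

lemma enveq_push:
  "enveq w \<sigma> \<tau> \<sigma>' \<tau>' \<Longrightarrow> eqv w a b \<Longrightarrow> enveq w (a \<rhd> \<sigma>) \<tau> (b \<rhd> \<sigma>') \<tau>'"
  "enveq w \<sigma> \<tau> \<sigma>' \<tau>' \<Longrightarrow> exteq w f g \<Longrightarrow> enveq w \<sigma> (f \<rhd> \<tau>) \<sigma>' (g \<rhd> \<tau>')"
  by (auto simp: enveq_def split: nat.splits)

lemma bim_trm_cong:
  assumes "enveq w \<sigma> \<tau> \<sigma>' \<tau>'"
  shows "bim_trm t \<Longrightarrow> eqv w (sub_trm t \<sigma> \<tau>) (sub_trm t \<sigma>' \<tau>')"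
    "bim_fnc u \<Longrightarrow> exteq w (sub_fnc u \<sigma> \<tau>) (sub_fnc u \<sigma>' \<tau>')"
proof -
  have w: "w \<in> worlds" using assms eqv_dom(3) unfolding enveq_def by blast
  show "bim_trm t \<Longrightarrow> eqv w (sub_trm t \<sigma> \<tau>) (sub_trm t \<sigma>' \<tau>')"
    "bim_fnc u \<Longrightarrow> exteq w (sub_fnc u \<sigma> \<tau>) (sub_fnc u \<sigma>' \<tau>')"
  proof (induction t and u)
    case (NV n) then show ?case using assms by (simp add: enveq_def)
  next
    case Zero then show ?case by (simp add: w dom_intros eqv_refl)
  next
    case (Ap u t) then show ?case by (simp add: exteq_Ap)
  next
    case (J s t) then show ?case by (simp add: eqv_J)
  next
    case (FV n) then show ?case using assms by (simp add: enveq_def)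
  next
    case Succ then show ?case by (simp add: w dom_intros exteq_refl)
  next
    case PK then show ?case by (simp add: w dom_intros exteq_refl)
  next
    case PL then show ?case by (simp add: w dom_intros exteq_refl)
  next
    case (Lam t)
    then have "Lam t = ZeroF \<or> Lam t = IdF" by simp
    moreover have "ZeroF \<in> dom_f w" "IdF \<in> dom_f w"
      using w by (auto simp: dom_f_def supp_fnc_def sub_ZeroF sub_IdF)
    ultimately show ?case using exteq_refl by (auto simp: ZeroF_def IdF_def nn_def)
  qed auto
qed

text \<open>In a formula of BIM a functor occurs only applied to an argument, so extensional
  equality of functions suffices. Constants with function arguments offer no such guarantee at this
  point.\<close>

lemma force_cong_imp:
  "A \<in> formulas BIM \<Longrightarrow> enveq w \<sigma> \<tau> \<sigma>' \<tau>' \<Longrightarrow> force w \<sigma> \<tau> A \<Longrightarrow> force w \<sigma>' \<tau>' A"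
proof (induction A arbitrary: w \<sigma> \<tau> \<sigma>' \<tau>')
  case (Eq s t)
  then have "eqv w (sub_trm s \<sigma> \<tau>) (sub_trm s \<sigma>' \<tau>')" "eqv w (sub_trm t \<sigma> \<tau>) (sub_trm t \<sigma>' \<tau>')"
    using bim_trm_cong by auto
  from eqv_trans[OF eqv_trans[OF eqv_sym[OF this(1)]] this(2)] show ?case using Eq.prems(3) by simp
next
  case (Neg A) then show ?case by (simp) (meson enveq_mono enveq_sym)
next
  case (Imp A B) then show ?case by (simp) (meson enveq_mono enveq_sym)
next
  case (All A) then show ?case by (simp) (meson enveq_mono enveq_push(1) eqv_refl)
next
  case (Ex A) then show ?case by (simp) (meson enveq_push(1) eqv_refl)
next
  case (FAll A) then show ?case by (simp) (meson enveq_mono enveq_push(2) exteq_refl)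
next
  case (FEx A) then show ?case by (simp) (meson enveq_push(2) exteq_refl)
qed (simp; meson)+

lemma force_cong:
  "A \<in> formulas BIM \<Longrightarrow> enveq w \<sigma> \<tau> \<sigma>' \<tau>' \<Longrightarrow> force w \<sigma> \<tau> A \<longleftrightarrow> force w \<sigma>' \<tau>' A"
  using force_cong_imp enveq_sym by blast

text \<open>An induction whose hypothesis is not consulted; it only splits cases.\<close>

lemma zero_or_succ:
  assumes "d \<in> dom_n w"
  shows "eqv w d Zero \<or> (\<exists>d'\<in>dom_n w. eqv w d (S d'))"
proof -
  have w: "w \<in> worlds" using assms dom_worlds by blast
  have "force w (d \<rhd> (\<lambda>_. Zero)) (\<lambda>_. Succ) (NV 0 \<doteq> Zero \<^bold>\<or> Ex (NV 1 \<doteq> S (NV 0)))"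
    by (rule induct_dom[OF _ env_base[OF w]])
      (use assms w in \<open>auto intro!: eqv_refl dom_intros bexI dest: dom_worlds\<close>)
  then show ?thesis by simp
qed

abbreviation neqv :: "world \<Rightarrow> trm \<Rightarrow> trm \<Rightarrow> bool" where
  "neqv w a b \<equiv> \<forall>w'. w \<sqsubseteq> w' \<longrightarrow> \<not> eqv w' a b"

text \<open>Induction on a with b universally quantified, so that the step can compare successors by
  their predecessors. Updating functions, extending approximations and searching for least zeros all
  rest on this decision.\<close>

lemma eqv_decidable:
  assumes "a \<in> dom_n w" "b \<in> dom_n w"
  shows "eqv w a b \<or> neqv w a b"
proof -
  have w: "w \<in> worlds" using assms dom_worlds by blast
  let ?A = "All (NV 1 \<doteq> NV 0 \<^bold>\<or> \<^bold>\<not> NV 1 \<doteq> NV 0)"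
  have "force w (a \<rhd> (\<lambda>_. Zero)) (\<lambda>_. Succ) ?A"
  proof (rule induct_dom[OF _ env_base[OF w]])
    have "eqv w' Zero d \<or> neqv w' Zero d" if d: "d \<in> dom_n w'" for w' d
    proof (cases "eqv w' d Zero")
      case False
      then obtain d' where "d' \<in> dom_n w'" "eqv w' d (S d')" using zero_or_succ[OF d] by blast
      then show ?thesis by (meson S_ne_Zero dom_mono(1) eqv_euclid eqv_mono eqv_sym)
    qed (simp add: eqv_sym)
    then show "force w (Zero \<rhd> (\<lambda>_. Zero)) (\<lambda>_. Succ) ?A" by simp
  next
    fix w' a assume w': "w \<sqsubseteq> w'" "a \<in> dom_n w'" "force w' (a \<rhd> (\<lambda>_. Zero)) (\<lambda>_. Succ) ?A"
    have "eqv w'' (S a) d \<or> neqv w'' (S a) d" if d: "w' \<sqsubseteq> w''" "d \<in> dom_n w''" for w'' d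
      using zero_or_succ[OF d(2)]
    proof
      assume "eqv w'' d Zero"
      moreover have "a \<in> dom_n v" if "w'' \<sqsubseteq> v" for v using that d(1) w'(2) dom_mono by blast
      ultimately show ?thesis by (meson S_ne_Zero eqv_mono eqv_trans)
    next
      assume "\<exists>d'\<in>dom_n w''. eqv w'' d (S d')"
      then obtain d' where d': "d' \<in> dom_n w''" "eqv w'' d (S d')" by blast
      have "eqv w'' a d' \<or> neqv w'' a d'" using w'(3) d(1) d'(1) by auto
      then show ?thesis
      proof
        assume "eqv w'' a d'"
        then have "eqv w'' (S a) (S d')" by (rule eqv_S)
        then show ?thesis using d'(2) eqv_sym eqv_trans by blast
      next
        assume n: "neqv w'' a d'"
        have "\<not> eqv v (S a) d" if v: "w'' \<sqsubseteq> v" for v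
        proof
          assume "eqv v (S a) d"
          then have "eqv v (S a) (S d')" using eqv_mono[OF v d'(2)] eqv_trans by blast
          then have "eqv v a d'" using S_inj dom_mono v w'(2) d d'(1) by blast
          then show False using n v by blast
        qed
        then show ?thesis by blast
      qed
    qed
    then show "force w' (S a \<rhd> (\<lambda>_. Zero)) (\<lambda>_. Succ) ?A" by simp
  qed (use assms in auto)
  then show ?thesis using assms(2) w by (auto simp: acc_refl)
qed

end

section \<open>Models with unique choice\<close>

text \<open>The common interface of the two systems: BIM + CFd reaches it through search, Mj has it
  as an axiom schema.\<close>

locale choice_model = arith_model +
  assumes choice_ax: "\<And>A. A \<in> formulas BIM \<Longrightarrow> T \<parallel> {} \<turnstile> AC00u A"
begin

text \<open>Uniqueness is asked of two values at one world; monotonicity of forcing then covers the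
  later worlds over which \<open>Ex1\<close> ranges.\<close>

lemma unique_choice:
  assumes "A \<in> formulas BIM" "env w \<sigma> \<tau>"
    and ex: "\<And>w' x. w \<sqsubseteq> w' \<Longrightarrow> x \<in> dom_n w' \<Longrightarrow> \<exists>y\<in>dom_n w'. force w' (y \<rhd> x \<rhd> \<sigma>) \<tau> A"
    and un: "\<And>w' x y z. w \<sqsubseteq> w' \<Longrightarrow> x \<in> dom_n w' \<Longrightarrow> y \<in> dom_n w' \<Longrightarrow> z \<in> dom_n w' \<Longrightarrow>
      force w' (y \<rhd> x \<rhd> \<sigma>) \<tau> A \<Longrightarrow> force w' (z \<rhd> x \<rhd> \<sigma>) \<tau> A \<Longrightarrow> eqv w' y z"
  shows "\<exists>f\<in>dom_f w. \<forall>w' x. w \<sqsubseteq> w' \<longrightarrow> x \<in> dom_n w' \<longrightarrow> force w' (Ap f x \<rhd> x \<rhd> \<sigma>) \<tau> A"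
proof -
  have w: "w \<sqsubseteq> w" using assms(2) by (simp add: acc_refl env_worlds)
  \<comment> \<open>This and the next equivalence read the two substitution instances inside
    \<open>AC00u\<close> as environments.\<close>
  have 1: "force w' (z \<rhd> y \<rhd> x \<rhd> \<sigma>) \<tau> (sub A (NV 0 \<rhd> (\<lambda>n. NV (Suc (Suc n)))) FV) \<longleftrightarrow> force w' (z \<rhd> x \<rhd> \<sigma>) \<tau> A"
    for w' x y z by (simp add: force_sub sub_push)
  have 2: "force w' (x \<rhd> \<sigma>) (f \<rhd> \<tau>) (sub A (Ap (FV 0) (NV 0) \<rhd> NV) (\<lambda>n. FV (Suc n)))
    \<longleftrightarrow> force w' (Ap f x \<rhd> x \<rhd> \<sigma>) \<tau> A" for w' x f by (simp add: force_sub sub_push)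
  have "force w' (x \<rhd> \<sigma>) \<tau> (Ex1 A)" if w': "w \<sqsubseteq> w'" "x \<in> dom_n w'" for w' x
  proof -
    obtain y where y: "y \<in> dom_n w'" "force w' (y \<rhd> x \<rhd> \<sigma>) \<tau> A" using ex[OF w'] by blast
    have "eqv w'' y z" if w'': "w' \<sqsubseteq> w''" "z \<in> dom_n w''" "force w'' (z \<rhd> x \<rhd> \<sigma>) \<tau> A" for w'' z
      using un[of w'' x y z] w'' w' y acc_trans dom_mono force_mono by blast
    then have "\<forall>w''. w' \<sqsubseteq> w'' \<longrightarrow> (\<forall>z\<in>dom_n w''. \<forall>v. w'' \<sqsubseteq> v \<longrightarrow> force v (z \<rhd> x \<rhd> \<sigma>) \<tau> A \<longrightarrow> eqv v y z)"
      using acc_trans dom_mono by blast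
    then show ?thesis unfolding Ex1_def force.simps 1 using y by auto
  qed
  then have "force w \<sigma> \<tau> (All (Ex1 A))" by simp
  moreover have "force w \<sigma> \<tau> (AC00u A)" using sound[OF choice_ax] assms(1,2) by blast
  ultimately have "force w \<sigma> \<tau> (FEx (All (sub A (Ap (FV 0) (NV 0) \<rhd> NV) (\<lambda>n. FV (Suc n)))))"
    unfolding AC00u_def using w by (auto simp del: force.simps(6,9))
  then show ?thesis unfolding force.simps 2 by blast
qed

section \<open>Functions defined explicitly and by cases\<close>

text \<open>Takes the place of abstraction for terms of BIM: the relation y = t is total and
  single-valued in y.\<close>

lemma explicit_definition:
  assumes "bim_trm t" "env w \<sigma> \<tau>"
  shows "\<exists>f\<in>dom_f w. \<forall>w' x. w \<sqsubseteq> w' \<longrightarrow> x \<in> dom_n w' \<longrightarrow> eqv w' (Ap f x) (sub_trm t (x \<rhd> \<sigma>) \<tau>)"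
proof -
  have 1: "sub_trm (ren_trm t Suc id) (y \<rhd> \<sigma>) \<tau> = sub_trm t \<sigma> \<tau>" for y \<sigma> by (simp add: sub_Suc)
  have d: "sub_trm t (x \<rhd> \<sigma>) \<tau> \<in> dom_n w'" if "w \<sqsubseteq> w'" "x \<in> dom_n w'" for w' x
    using env_sub(4)[of w' "x \<rhd> \<sigma>" \<tau> t] that assms bim_terms env_mono by (simp add: env_push)
  have "\<exists>f\<in>dom_f w. \<forall>w' x. w \<sqsubseteq> w' \<longrightarrow> x \<in> dom_n w' \<longrightarrow>
    force w' (Ap f x \<rhd> x \<rhd> \<sigma>) \<tau> (NV 0 \<doteq> ren_trm t Suc id)"
  proof (rule unique_choice)
    show "\<exists>y\<in>dom_n w'. force w' (y \<rhd> x \<rhd> \<sigma>) \<tau> (NV 0 \<doteq> ren_trm t Suc id)"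
      if "w \<sqsubseteq> w'" "x \<in> dom_n w'" for w' x
      unfolding force.simps 1 using eqv_refl[OF d[OF that]] d[OF that] by auto
    show "eqv w' y z" if "force w' (y \<rhd> x \<rhd> \<sigma>) \<tau> (NV 0 \<doteq> ren_trm t Suc id)"
      "force w' (z \<rhd> x \<rhd> \<sigma>) \<tau> (NV 0 \<doteq> ren_trm t Suc id)" for w' x y z
      using that unfolding force.simps 1 by (auto intro: eqv_join)
  qed (use assms(2) bim_ren[OF assms(1)] in auto)
  then show ?thesis unfolding force.simps 1 by simp
qed

text \<open>Definition by cases on zero and successor; injectivity of the successor makes the graph
  single-valued.\<close>

lemma cons_function:
  assumes x: "x \<in> dom_n w" and f: "f \<in> dom_f w"
  shows "\<exists>h\<in>dom_f w. eqv w (Ap h Zero) x \<and> (\<forall>w' z. w \<sqsubseteq> w' \<longrightarrow> z \<in> dom_n w' \<longrightarrow> eqv w' (Ap h (S z)) (Ap f z))"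
proof -
  have w: "w \<in> worlds" using assms dom_worlds by blast
  let ?A = "(NV 1 \<doteq> Zero \<^bold>\<and> NV 0 \<doteq> NV 2) \<^bold>\<or> Ex (NV 2 \<doteq> S (NV 0) \<^bold>\<and> NV 1 \<doteq> Ap (FV 0) (NV 0))"
  let ?\<sigma> = "x \<rhd> (\<lambda>_. Zero)" and ?\<tau> = "f \<rhd> (\<lambda>_. Succ)"
  have A: "force w' (y \<rhd> z \<rhd> ?\<sigma>) ?\<tau> ?A \<longleftrightarrow> eqv w' z Zero \<and> eqv w' y x \<or>
    (\<exists>d\<in>dom_n w'. eqv w' z (S d) \<and> eqv w' y (Ap f d))" for w' y z
    by simp
  have fAp: "Ap f d \<in> dom_n w'" if "w \<sqsubseteq> w'" "d \<in> dom_n w'" for w' d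
    using dom_intros(2) dom_mono(2)[OF that(1) f] that by blast
  have "\<exists>h\<in>dom_f w. \<forall>w' z. w \<sqsubseteq> w' \<longrightarrow> z \<in> dom_n w' \<longrightarrow> force w' (Ap h z \<rhd> z \<rhd> ?\<sigma>) ?\<tau> ?A"
  proof (rule unique_choice)
    show "env w ?\<sigma> ?\<tau>" using assms env_base[OF w] by (simp add: env_push)
    show "\<exists>y\<in>dom_n w'. force w' (y \<rhd> z \<rhd> ?\<sigma>) ?\<tau> ?A" if "w \<sqsubseteq> w'" "z \<in> dom_n w'" for w' z
      using zero_or_succ[OF that(2)]
    proof
      assume "eqv w' z Zero"
      then show ?thesis unfolding A using dom_mono(1)[OF that(1) x] eqv_refl by blast
    next
      assume "\<exists>d\<in>dom_n w'. eqv w' z (S d)"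
      then show ?thesis unfolding A using fAp[OF that(1)] eqv_refl by blast
    qed
    fix w' y y' z assume w': "w \<sqsubseteq> w'" "z \<in> dom_n w'"
      "force w' (y \<rhd> z \<rhd> ?\<sigma>) ?\<tau> ?A" "force w' (y' \<rhd> z \<rhd> ?\<sigma>) ?\<tau> ?A"
    from w'(3,4)[unfolded A] show "eqv w' y y'"
    proof (elim disjE conjE bexE)
      assume "eqv w' y x" "eqv w' y' x" then show ?thesis by (rule eqv_join)
    next
      fix d d' assume d: "d \<in> dom_n w'" "d' \<in> dom_n w'" "eqv w' z (S d)" "eqv w' z (S d')"
        "eqv w' y (Ap f d)" "eqv w' y' (Ap f d')"
      have "eqv w' d d'" using S_inj[OF eqv_euclid[OF d(3,4)]] d by blast
      from eqv_Ap[OF this dom_mono(2)[OF w'(1) f]] show ?thesis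
        by (rule eqv_trans[OF d(5) eqv_join[OF _ d(6)]])
    qed (metis Zero_S)+
  qed simp
  then obtain h where h: "h \<in> dom_f w"
    "\<And>w' z. w \<sqsubseteq> w' \<Longrightarrow> z \<in> dom_n w' \<Longrightarrow> eqv w' z Zero \<and> eqv w' (Ap h z) x \<or>
    (\<exists>d\<in>dom_n w'. eqv w' z (S d) \<and> eqv w' (Ap h z) (Ap f d))"
    unfolding A by blast
  have "eqv w (Ap h Zero) x"
    using h(2)[of w Zero] w dom_intros(1)[OF w] Zero_S[OF eqv_refl] by (auto simp: acc_refl)
  moreover have "eqv w' (Ap h (S z)) (Ap f z)" if w': "w \<sqsubseteq> w'" "z \<in> dom_n w'" for w' z
  proof -
    have "S z \<in> dom_n w'" using w'(2) by (rule unary_dom)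
    then obtain d where d: "d \<in> dom_n w'" "eqv w' (S z) (S d)" "eqv w' (Ap h (S z)) (Ap f d)"
      using h(2)[OF w'(1)] S_ne_Zero[OF w'(2)] by blast
    have "eqv w' d z" using eqv_sym[OF S_inj[OF d(2) w'(2) d(1)]] .
    from eqv_Ap[OF this dom_mono(2)[OF w'(1) f]] show ?thesis by (rule eqv_trans[OF d(3)])
  qed
  ultimately show ?thesis using h(1) by blast
qed

text \<open>Seen as a matrix whose rows are indexed by the first component, h has f as row 0 and the
  rows of g moved down by one.\<close>

lemma join_functions:
  assumes f: "f \<in> dom_f w" and g: "g \<in> dom_f w"
  shows "\<exists>h\<in>dom_f w. (\<forall>w' z. w \<sqsubseteq> w' \<longrightarrow> z \<in> dom_n w' \<longrightarrow> eqv w' (Ap h (J Zero z)) (Ap f z)) \<and>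
    (\<forall>w' a v. w \<sqsubseteq> w' \<longrightarrow> a \<in> dom_n w' \<longrightarrow> v \<in> dom_n w' \<longrightarrow> eqv w' (Ap h (J (S a) v)) (Ap g (J a v)))"
proof -
  have w: "w \<in> worlds" using assms dom_worlds by blast
  let ?A = "(Ap PK (NV 1) \<doteq> Zero \<^bold>\<and> NV 0 \<doteq> Ap (FV 0) (Ap PL (NV 1))) \<^bold>\<or>
    Ex (Ap PK (NV 2) \<doteq> S (NV 0) \<^bold>\<and> NV 1 \<doteq> Ap (FV 1) (J (NV 0) (Ap PL (NV 2))))"
  let ?\<sigma> = "(\<lambda>_. Zero)" and ?\<tau> = "f \<rhd> g \<rhd> (\<lambda>_. Succ)"
  have A: "force w' (y \<rhd> z \<rhd> ?\<sigma>) ?\<tau> ?A \<longleftrightarrow> eqv w' (Ap PK z) Zero \<and> eqv w' y (Ap f (Ap PL z)) \<or>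
    (\<exists>d\<in>dom_n w'. eqv w' (Ap PK z) (S d) \<and> eqv w' y (Ap g (J d (Ap PL z))))" for w' y z
    by simp
  note fg = dom_mono(2)[OF _ f] dom_mono(2)[OF _ g]
  have PKL: "Ap PK z \<in> dom_n w'" "Ap PL z \<in> dom_n w'" if "z \<in> dom_n w'" for w' z
    using that by (auto intro: unary_dom)
  have "\<exists>h\<in>dom_f w. \<forall>w' z. w \<sqsubseteq> w' \<longrightarrow> z \<in> dom_n w' \<longrightarrow> force w' (Ap h z \<rhd> z \<rhd> ?\<sigma>) ?\<tau> ?A"
  proof (rule unique_choice)
    show "env w ?\<sigma> ?\<tau>" using assms env_base[OF w] by (simp add: env_push)
    show "\<exists>y\<in>dom_n w'. force w' (y \<rhd> z \<rhd> ?\<sigma>) ?\<tau> ?A" if w': "w \<sqsubseteq> w'" "z \<in> dom_n w'" for w' z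
    proof -
      have *: "Ap f (Ap PL z) \<in> dom_n w'" "\<forall>d\<in>dom_n w'. Ap g (J d (Ap PL z)) \<in> dom_n w'"
        using fg[OF w'(1)] PKL[OF w'(2)] by (auto intro!: dom_intros(2,3))
      from zero_or_succ[OF PKL(1)[OF w'(2)]] show ?thesis
      proof
        assume "eqv w' (Ap PK z) Zero"
        then show ?thesis unfolding A using *(1) eqv_refl by blast
      next
        assume "\<exists>d\<in>dom_n w'. eqv w' (Ap PK z) (S d)"
        then show ?thesis unfolding A using *(2) eqv_refl by blast
      qed
    qed
    fix w' y y' z assume w': "w \<sqsubseteq> w'" "z \<in> dom_n w'"
      "force w' (y \<rhd> z \<rhd> ?\<sigma>) ?\<tau> ?A" "force w' (y' \<rhd> z \<rhd> ?\<sigma>) ?\<tau> ?A"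
    from w'(3,4)[unfolded A] show "eqv w' y y'"
    proof (elim disjE conjE bexE)
      assume "eqv w' y (Ap f (Ap PL z))" "eqv w' y' (Ap f (Ap PL z))"
      then show ?thesis by (rule eqv_join)
    next
      fix d d' assume d: "d \<in> dom_n w'" "d' \<in> dom_n w'" "eqv w' (Ap PK z) (S d)" "eqv w' (Ap PK z) (S d')"
        "eqv w' y (Ap g (J d (Ap PL z)))" "eqv w' y' (Ap g (J d' (Ap PL z)))"
      have "eqv w' d d'" using S_inj[OF eqv_euclid[OF d(3,4)]] d by blast
      from eqv_Ap[OF eqv_J[OF this eqv_refl[OF PKL(2)[OF w'(2)]]] fg(2)[OF w'(1)]]
      show ?thesis by (rule eqv_trans[OF d(5) eqv_join[OF _ d(6)]])
    qed (metis Zero_S)+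
  qed simp
  then obtain h where h: "h \<in> dom_f w"
    "\<And>w' z. w \<sqsubseteq> w' \<Longrightarrow> z \<in> dom_n w' \<Longrightarrow> eqv w' (Ap PK z) Zero \<and> eqv w' (Ap h z) (Ap f (Ap PL z)) \<or>
    (\<exists>d\<in>dom_n w'. eqv w' (Ap PK z) (S d) \<and> eqv w' (Ap h z) (Ap g (J d (Ap PL z))))"
    unfolding A by blast
  have "eqv w' (Ap h (J Zero z)) (Ap f z)" if w': "w \<sqsubseteq> w'" "z \<in> dom_n w'" for w' z
  proof -
    have z: "Zero \<in> dom_n w'" "J Zero z \<in> dom_n w'" using w'(2) by (auto intro: unary_dom dom_intros(3))
    have "eqv w' (Ap h (J Zero z)) (Ap f (Ap PL (J Zero z)))"
      using h(2)[OF w'(1) z(2)] Zero_S[OF PK_J[OF z(1) w'(2)]] by blast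
    then show ?thesis by (rule eqv_trans[OF _ eqv_Ap[OF PL_J[OF z(1) w'(2)] fg(1)[OF w'(1)]]])
  qed
  moreover have "eqv w' (Ap h (J (S a) v)) (Ap g (J a v))"
    if w': "w \<sqsubseteq> w'" "a \<in> dom_n w'" "v \<in> dom_n w'" for w' a v
  proof -
    have z: "S a \<in> dom_n w'" "J (S a) v \<in> dom_n w'" using w'(2,3) by (auto intro: unary_dom dom_intros(3))
    obtain d where d: "d \<in> dom_n w'" "eqv w' (Ap PK (J (S a) v)) (S d)"
      "eqv w' (Ap h (J (S a) v)) (Ap g (J d (Ap PL (J (S a) v))))"
      using h(2)[OF w'(1) z(2)] Zero_S[OF _ PK_J[OF z(1) w'(3)] w'(2)] by blast
    have "eqv w' d a"
      using S_inj[OF eqv_euclid[OF d(2) PK_J[OF z(1) w'(3)]] d(1) w'(2)] .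
    from eqv_Ap[OF eqv_J[OF this PL_J[OF z(1) w'(3)]] fg(2)[OF w'(1)]]
    show ?thesis by (rule eqv_trans[OF d(3)])
  qed
  ultimately show ?thesis using h(1) by blast
qed

text \<open>The case distinction on z = a is legitimate because equality is decidable.\<close>

lemma update_function:
  assumes f: "f \<in> dom_f w" and a: "a \<in> dom_n w" and x: "x \<in> dom_n w"
  shows "\<exists>h\<in>dom_f w. \<forall>w' z. w \<sqsubseteq> w' \<longrightarrow> z \<in> dom_n w' \<longrightarrow>
    (eqv w' z a \<longrightarrow> eqv w' (Ap h z) x) \<and> (neqv w' z a \<longrightarrow> eqv w' (Ap h z) (Ap f z))"
proof -
  have w: "w \<in> worlds" using assms dom_worlds by blast
  let ?A = "(NV 1 \<doteq> NV 2 \<^bold>\<and> NV 0 \<doteq> NV 3) \<^bold>\<or> (\<^bold>\<not> NV 1 \<doteq> NV 2 \<^bold>\<and> NV 0 \<doteq> Ap (FV 0) (NV 1))"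
  let ?\<sigma> = "a \<rhd> x \<rhd> (\<lambda>_. Zero)" and ?\<tau> = "f \<rhd> (\<lambda>_. Succ)"
  have A: "force w' (y \<rhd> z \<rhd> ?\<sigma>) ?\<tau> ?A \<longleftrightarrow> eqv w' z a \<and> eqv w' y x \<or> neqv w' z a \<and> eqv w' y (Ap f z)" for w' y z
    by simp
  have "\<exists>h\<in>dom_f w. \<forall>w' z. w \<sqsubseteq> w' \<longrightarrow> z \<in> dom_n w' \<longrightarrow> force w' (Ap h z \<rhd> z \<rhd> ?\<sigma>) ?\<tau> ?A"
  proof (rule unique_choice)
    show "env w ?\<sigma> ?\<tau>" using assms env_base[OF w] by (simp add: env_push)
    show "\<exists>y\<in>dom_n w'. force w' (y \<rhd> z \<rhd> ?\<sigma>) ?\<tau> ?A" if w': "w \<sqsubseteq> w'" "z \<in> dom_n w'" for w' z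
      using eqv_decidable[OF w'(2) dom_mono(1)[OF w'(1) a]]
    proof
      assume "eqv w' z a"
      then show ?thesis unfolding A using dom_mono(1)[OF w'(1) x] eqv_refl by blast
    next
      assume "neqv w' z a"
      then show ?thesis unfolding A
        using eqv_refl[OF dom_intros(2)[OF dom_mono(2)[OF w'(1) f] w'(2)]] eqv_dom by blast
    qed
    fix w' y y' z assume w': "w \<sqsubseteq> w'" "z \<in> dom_n w'"
      "force w' (y \<rhd> z \<rhd> ?\<sigma>) ?\<tau> ?A" "force w' (y' \<rhd> z \<rhd> ?\<sigma>) ?\<tau> ?A"
    then have "w' \<in> worlds" using dom_worlds(1) by blast
    then have no: False if "eqv w' z a" "neqv w' z a" using that by (simp add: acc_refl)
    from w'(3,4)[unfolded A] show "eqv w' y y'"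
    proof (elim disjE conjE)
      assume "eqv w' y x" "eqv w' y' x" then show ?thesis by (rule eqv_join)
    next
      assume "eqv w' y (Ap f z)" "eqv w' y' (Ap f z)" then show ?thesis by (rule eqv_join)
    qed (use no in blast)+
  qed simp
  then obtain h where h: "h \<in> dom_f w" "\<And>w' z. w \<sqsubseteq> w' \<Longrightarrow> z \<in> dom_n w' \<Longrightarrow>
    eqv w' z a \<and> eqv w' (Ap h z) x \<or> neqv w' z a \<and> eqv w' (Ap h z) (Ap f z)"
    unfolding A by blast
  have "\<not> (eqv w' z a \<and> neqv w' z a)" for w' z
    using eqv_dom(3) acc_refl by blast
  then show ?thesis using h by meson
qed

end

primrec num :: "nat \<Rightarrow> trm" where
  "num 0 = Zero" | "num (Suc n) = S (num n)"

lemma sub_num [simp]: "sub_trm (num n) \<sigma> \<tau> = num n" "bim_trm (num n)"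
  by (induction n) simp_all

context choice_model
begin

lemma All_Imp_iff:
  "(\<forall>w'. w \<sqsubseteq> w' \<longrightarrow> (\<forall>k\<in>dom_n w'. \<forall>w''. w' \<sqsubseteq> w'' \<longrightarrow> P w'' k \<longrightarrow> Q w'' k)) \<longleftrightarrow>
   (\<forall>w' k. w \<sqsubseteq> w' \<longrightarrow> k \<in> dom_n w' \<longrightarrow> P w' k \<longrightarrow> Q w' k)"
  by (meson acc_refl acc_trans dom_mono(1) dom_worlds(1))

text \<open>The equation between the two values is itself a formula of BIM, so functions obeying the
  same recursion can be compared without writing an induction formula each time.\<close>

lemma fun_eqv_induct:
  assumes f: "f \<in> dom_f w" and g: "g \<in> dom_f w" and "eqv w (Ap f Zero) (Ap g Zero)"
    and "\<And>w' n. w \<sqsubseteq> w' \<Longrightarrow> n \<in> dom_n w' \<Longrightarrow> eqv w' (Ap f n) (Ap g n) \<Longrightarrow> eqv w' (Ap f (S n)) (Ap g (S n))"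
    and "n \<in> dom_n w"
  shows "eqv w (Ap f n) (Ap g n)"
proof -
  have "env w (\<lambda>_. Zero) (f \<rhd> g \<rhd> (\<lambda>_. Succ))"
    using f g env_base dom_worlds by (simp add: env_push)
  then have "force w (n \<rhd> (\<lambda>_. Zero)) (f \<rhd> g \<rhd> (\<lambda>_. Succ)) (Ap (FV 0) (NV 0) \<doteq> Ap (FV 1) (NV 0))"
    by (rule induct_dom[rotated]) (use assms in auto)
  then show ?thesis by simp
qed

subsection \<open>Recursion\<close>

text \<open>An approximation to the function defined by recursion is a function \<open>\<delta>\<close> that satisfies the
  recursion equations on a set of numbers that is closed under predecessors and contains n; the
  set is given by the zeros of \<open>\<chi>\<close>. This avoids the order relation.\<close>

definition approx :: "world \<Rightarrow> trm \<Rightarrow> fnc \<Rightarrow> fnc \<Rightarrow> fnc \<Rightarrow> trm \<Rightarrow> bool" where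
  "approx w x g \<chi> \<delta> n \<longleftrightarrow> eqv w (Ap \<chi> n) Zero \<and> eqv w (Ap \<delta> Zero) x \<and>
    (\<forall>w' k. w \<sqsubseteq> w' \<longrightarrow> k \<in> dom_n w' \<longrightarrow> eqv w' (Ap \<chi> (S k)) Zero \<longrightarrow>
      eqv w' (Ap \<chi> k) Zero \<and> eqv w' (Ap \<delta> (S k)) (Ap g (J k (Ap \<delta> k))))"

text \<open>NV 2 is the initial value x, NV 1 the stage n and NV 0 the value at n; FV 0, FV 1 and FV
  2 are \<delta>, \<chi> and g.\<close>

definition approx_fm :: fm where
  "approx_fm = (Ap (FV 1) (NV 1) \<doteq> Zero \<^bold>\<and> Ap (FV 0) Zero \<doteq> NV 2 \<^bold>\<and>
    All (Ap (FV 1) (S (NV 0)) \<doteq> Zero \<^bold>\<longrightarrow> Ap (FV 1) (NV 0) \<doteq> Zero \<^bold>\<and>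
      Ap (FV 0) (S (NV 0)) \<doteq> Ap (FV 2) (J (NV 0) (Ap (FV 0) (NV 0)))) \<^bold>\<and>
    NV 0 \<doteq> Ap (FV 0) (NV 1))"

lemma force_approx_fm:
  "force w (y \<rhd> n \<rhd> x \<rhd> \<sigma>) (\<delta> \<rhd> \<chi> \<rhd> g \<rhd> \<tau>) approx_fm \<longleftrightarrow> approx w x g \<chi> \<delta> n \<and> eqv w y (Ap \<delta> n)"
  by (simp add: approx_fm_def approx_def All_Imp_iff)

lemma ne_S: "n \<in> dom_n w \<Longrightarrow> neqv w n (S n)"
proof -
  assume n: "n \<in> dom_n w"
  then have w: "w \<in> worlds" using dom_worlds by blast
  have "force w (n \<rhd> (\<lambda>_. Zero)) (\<lambda>_. Succ) (\<^bold>\<not> NV 0 \<doteq> S (NV 0))"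
  proof (rule induct_dom[OF _ env_base[OF w]])
    show "force w (Zero \<rhd> (\<lambda>_. Zero)) (\<lambda>_. Succ) (\<^bold>\<not> NV 0 \<doteq> S (NV 0))"
      using S_ne_Zero eqv_sym eqv_dom by (simp add: acc_def) (metis unary_dom(4))
  next
    fix w' d assume "w \<sqsubseteq> w'" "d \<in> dom_n w'" and IH: "force w' (d \<rhd> (\<lambda>_. Zero)) (\<lambda>_. Succ) (\<^bold>\<not> NV 0 \<doteq> S (NV 0))"
    then have "\<not> eqv w'' (S d) (S (S d))" if "w' \<sqsubseteq> w''" for w''
      using S_inj[of w'' d "S d"] dom_mono(1)[OF that] unary_dom that by auto
    then show "force w' (S d \<rhd> (\<lambda>_. Zero)) (\<lambda>_. Succ) (\<^bold>\<not> NV 0 \<doteq> S (NV 0))" by simp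
  qed (use n in auto)
  then show ?thesis by simp
qed

text \<open>Induction over the intersection of the two domains: both are closed under predecessors,
  and on both the same recursion is obeyed.\<close>

lemma approx_unique:
  assumes "approx w x g \<chi> \<delta> n" "approx w x g \<chi>' \<delta>' n" "n \<in> dom_n w" "g \<in> dom_f w"
    "\<chi> \<in> dom_f w" "\<delta> \<in> dom_f w" "\<chi>' \<in> dom_f w" "\<delta>' \<in> dom_f w"
  shows "eqv w (Ap \<delta> n) (Ap \<delta>' n)"
proof -
  have w: "w \<in> worlds" using assms(3) dom_worlds by blast
  let ?A = "Ap (FV 1) (NV 0) \<doteq> Zero \<^bold>\<and> Ap (FV 3) (NV 0) \<doteq> Zero \<^bold>\<longrightarrow> Ap (FV 0) (NV 0) \<doteq> Ap (FV 2) (NV 0)"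
  let ?\<tau> = "\<delta> \<rhd> \<chi> \<rhd> \<delta>' \<rhd> \<chi>' \<rhd> (\<lambda>_. Succ)"
  have "force w (n \<rhd> (\<lambda>_. Zero)) ?\<tau> ?A"
  proof (rule induct_dom)
    show "env w (\<lambda>_. Zero) ?\<tau>" using assms env_base[OF w] by (simp add: env_push)
    have "eqv w (Ap \<delta> Zero) (Ap \<delta>' Zero)" using assms(1,2) unfolding approx_def by (blast intro: eqv_join)
    then show "force w (Zero \<rhd> (\<lambda>_. Zero)) ?\<tau> ?A" using eqv_mono by auto
  next
    fix w' d assume w': "w \<sqsubseteq> w'" "d \<in> dom_n w'" and IH: "force w' (d \<rhd> (\<lambda>_. Zero)) ?\<tau> ?A"
    have "eqv v (Ap \<delta> (S d)) (Ap \<delta>' (S d))"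
      if v: "w' \<sqsubseteq> v" "eqv v (Ap \<chi> (S d)) Zero" "eqv v (Ap \<chi>' (S d)) Zero" for v
    proof -
      have wv: "w \<sqsubseteq> v" and d: "d \<in> dom_n v" using w' v(1) acc_trans dom_mono by blast+
      have *: "eqv v (Ap \<chi> d) Zero" "eqv v (Ap \<delta> (S d)) (Ap g (J d (Ap \<delta> d)))"
        "eqv v (Ap \<chi>' d) Zero" "eqv v (Ap \<delta>' (S d)) (Ap g (J d (Ap \<delta>' d)))"
        using assms(1,2) wv d v(2,3) unfolding approx_def by blast+
      then have "eqv v (Ap \<delta> d) (Ap \<delta>' d)" using IH v(1) by simp
      from eqv_Ap[OF eqv_J[OF eqv_refl[OF d] this] dom_mono(2)[OF wv assms(4)]]
      show ?thesis by (rule eqv_trans[OF *(2) eqv_join[OF _ *(4)]])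
    qed
    then show "force w' (S d \<rhd> (\<lambda>_. Zero)) ?\<tau> ?A" by simp
  qed (use assms in auto)
  moreover have "w \<sqsubseteq> w" using w by (simp add: acc_refl)
  ultimately show ?thesis using assms(1,2) by (simp add: approx_def)
qed

text \<open>The domain consists of 0 alone, so the recursion clause is vacuous.\<close>

lemma approx_Zero:
  assumes x: "x \<in> dom_n w"
  shows "\<exists>\<chi>\<in>dom_f w. \<exists>\<delta>\<in>dom_f w. approx w x g \<chi> \<delta> Zero"
proof -
  have w: "w \<in> worlds" using x dom_worlds by blast
  have env: "env w (x \<rhd> (\<lambda>_. Zero)) (\<lambda>_. Succ)" using x env_base[OF w] by (simp add: env_push)
  obtain \<delta> where \<delta>: "\<delta> \<in> dom_f w" "\<And>w' z. w \<sqsubseteq> w' \<Longrightarrow> z \<in> dom_n w' \<Longrightarrow> eqv w' (Ap \<delta> z) x"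
    using explicit_definition[OF _ env, of "NV 1"] by auto
  obtain f where f: "f \<in> dom_f w" "\<And>w' z. w \<sqsubseteq> w' \<Longrightarrow> z \<in> dom_n w' \<Longrightarrow> eqv w' (Ap f z) One"
    using explicit_definition[OF _ env, of "One"] by auto
  obtain \<chi> where \<chi>: "\<chi> \<in> dom_f w" "eqv w (Ap \<chi> Zero) Zero"
    "\<And>w' z. w \<sqsubseteq> w' \<Longrightarrow> z \<in> dom_n w' \<Longrightarrow> eqv w' (Ap \<chi> (S z)) (Ap f z)"
    using cons_function[OF dom_intros(1)[OF w] f(1)] by blast
  have "\<not> eqv w' (Ap \<chi> (S k)) Zero" if "w \<sqsubseteq> w'" "k \<in> dom_n w'" for w' k
    using Zero_S[OF _ eqv_trans[OF \<chi>(3)[OF that] f(2)[OF that]] unary_dom(4)[OF that(2)]] by blast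
  then have "approx w x g \<chi> \<delta> Zero"
    unfolding approx_def using \<chi>(2) \<delta>(2)[of w Zero] w dom_intros(1)[OF w] by (simp add: acc_refl)
  then show ?thesis using \<chi>(1) \<delta>(1) by blast
qed

text \<open>If S n already lies in the domain nothing changes; otherwise domain and function are
  extended at S n by the value that the recursion prescribes.\<close>

lemma approx_S:
  assumes ap: "approx w x g \<chi> \<delta> n" and n: "n \<in> dom_n w"
    and g: "g \<in> dom_f w" and \<chi>: "\<chi> \<in> dom_f w" and \<delta>: "\<delta> \<in> dom_f w"
  shows "\<exists>\<chi>\<in>dom_f w. \<exists>\<delta>\<in>dom_f w. approx w x g \<chi> \<delta> (S n)"
proof -
  have w: "w \<in> worlds" using n dom_worlds by blast
  have Sn: "S n \<in> dom_n w" using n by (rule unary_dom)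
  have Z: "Zero \<in> dom_n w" using n by (rule unary_dom)
  have "eqv w (Ap \<chi> (S n)) Zero \<or> neqv w (Ap \<chi> (S n)) Zero"
    by (rule eqv_decidable) (simp_all add: dom_intros w Sn \<chi>)
  then show ?thesis
  proof
    assume "eqv w (Ap \<chi> (S n)) Zero"
    then have "approx w x g \<chi> \<delta> (S n)" using ap by (simp add: approx_def)
    then show ?thesis using \<chi> \<delta> by blast
  next
    assume new: "neqv w (Ap \<chi> (S n)) Zero"
    let ?v = "Ap g (J n (Ap \<delta> n))"
    have v: "?v \<in> dom_n w" by (simp add: dom_intros g n \<delta>)
    obtain \<chi>' where \<chi>': "\<chi>' \<in> dom_f w" "\<And>w' z. w \<sqsubseteq> w' \<Longrightarrow> z \<in> dom_n w' \<Longrightarrow> eqv w' z (S n) \<Longrightarrow> eqv w' (Ap \<chi>' z) Zero"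
      "\<And>w' z. w \<sqsubseteq> w' \<Longrightarrow> z \<in> dom_n w' \<Longrightarrow> neqv w' z (S n) \<Longrightarrow> eqv w' (Ap \<chi>' z) (Ap \<chi> z)"
      using update_function[OF \<chi> Sn Z] by blast
    obtain \<delta>' where \<delta>': "\<delta>' \<in> dom_f w" "\<And>w' z. w \<sqsubseteq> w' \<Longrightarrow> z \<in> dom_n w' \<Longrightarrow> eqv w' z (S n) \<Longrightarrow> eqv w' (Ap \<delta>' z) ?v"
      "\<And>w' z. w \<sqsubseteq> w' \<Longrightarrow> z \<in> dom_n w' \<Longrightarrow> neqv w' z (S n) \<Longrightarrow> eqv w' (Ap \<delta>' z) (Ap \<delta> z)"
      using update_function[OF \<delta> Sn v] by blast
    have ww: "w \<sqsubseteq> w" using w by (simp add: acc_refl)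
    have "approx w x g \<chi>' \<delta>' (S n)"
      unfolding approx_def
    proof (intro conjI HOL.allI HOL.impI)
      show "eqv w (Ap \<chi>' (S n)) Zero" by (rule \<chi>'(2)[OF ww Sn eqv_refl[OF Sn]])
      have "neqv w Zero (S n)"
      proof (intro HOL.allI HOL.impI notI)
        fix w' assume w': "w \<sqsubseteq> w'" "eqv w' Zero (S n)"
        show False using S_ne_Zero[OF dom_mono(1)[OF w'(1) n]] eqv_sym[OF w'(2)] by blast
      qed
      then have "eqv w (Ap \<delta>' Zero) (Ap \<delta> Zero)" by (rule \<delta>'(3)[OF ww Z])
      then show "eqv w (Ap \<delta>' Zero) x" by (rule eqv_trans) (use ap in \<open>simp add: approx_def\<close>)
      fix w' k assume w': "w \<sqsubseteq> w'" and k: "k \<in> dom_n w'" and *: "eqv w' (Ap \<chi>' (S k)) Zero"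
      have Sk: "S k \<in> dom_n w'" using k by (rule unary_dom)
      have n': "n \<in> dom_n w'" "S n \<in> dom_n w'" using w' n Sn dom_mono by blast+
      have g': "g \<in> dom_f w'" using dom_mono(2)[OF w' g] .
      have "eqv w' (S k) (S n) \<or> neqv w' (S k) (S n)" using Sk n'(2) by (rule eqv_decidable)
      then have "eqv w' (Ap \<chi>' k) Zero \<and> eqv w' (Ap \<delta>' (S k)) (Ap g (J k (Ap \<delta>' k)))"
      proof
        assume e: "eqv w' (S k) (S n)"
        then have kn: "eqv w' k n" using S_inj k n'(1) by blast
        \<comment> \<open>Here k = n, and n differs from S n, so the updated functions keep their
          old values at k.\<close>
        have "\<not> eqv u k (S n)" if u: "w' \<sqsubseteq> u" for u
          using ne_S[OF n'(1)] u eqv_euclid[OF eqv_mono[OF u kn]] by blast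
        then have kSn: "neqv w' k (S n)" by blast
        have c: "eqv w' (Ap \<chi>' k) (Ap \<chi> k)" by (rule \<chi>'(3)[OF w' k kSn])
        also have "eqv w' \<dots> (Ap \<chi> n)" by (rule eqv_Ap[OF kn dom_mono(2)[OF w' \<chi>]])
        also have "eqv w' \<dots> Zero" by (rule eqv_mono[OF w']) (use ap in \<open>simp add: approx_def\<close>)
        finally have 1: "eqv w' (Ap \<chi>' k) Zero" .
        have "eqv w' (Ap \<delta>' k) (Ap \<delta> k)" by (rule \<delta>'(3)[OF w' k kSn])
        also have "eqv w' \<dots> (Ap \<delta> n)" by (rule eqv_Ap[OF kn dom_mono(2)[OF w' \<delta>]])
        finally have "eqv w' (Ap g (J k (Ap \<delta>' k))) ?v" by (rule eqv_Ap[OF eqv_J[OF kn] g'])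
        then have "eqv w' (Ap \<delta>' (S k)) (Ap g (J k (Ap \<delta>' k)))"
          by (rule eqv_join[OF \<delta>'(2)[OF w' Sk e]])
        then show ?thesis using 1 by blast
      next
        assume e: "neqv w' (S k) (S n)"
        have "eqv w' (Ap \<chi> (S k)) Zero" by (rule eqv_euclid[OF \<chi>'(3)[OF w' Sk e] *])
        then have k1: "eqv w' (Ap \<chi> k) Zero" "eqv w' (Ap \<delta> (S k)) (Ap g (J k (Ap \<delta> k)))"
          using ap w' k unfolding approx_def by blast+
        \<comment> \<open>Here k lies in the old domain by closure under predecessors, whereas S n
          does not.\<close>
        have "\<not> eqv u k (S n)" if u: "w' \<sqsubseteq> u" for u
        proof
          assume "eqv u k (S n)"
          then have "eqv u (Ap \<chi> k) (Ap \<chi> (S n))"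
            by (rule eqv_Ap[OF _ dom_mono(2)[OF acc_trans[OF w' u] \<chi>]])
          from eqv_euclid[OF this eqv_mono[OF u k1(1)]] show False
            using new acc_trans[OF w' u] by blast
        qed
        then have kSn: "neqv w' k (S n)" by blast
        have "eqv w' (Ap \<delta>' k) (Ap \<delta> k)" by (rule \<delta>'(3)[OF w' k kSn])
        from eqv_Ap[OF eqv_J[OF eqv_refl[OF k] this] g']
        have "eqv w' (Ap \<delta>' (S k)) (Ap g (J k (Ap \<delta>' k)))"
          by (rule eqv_join[OF eqv_trans[OF \<delta>'(3)[OF w' Sk e] k1(2)]])
        moreover have "eqv w' (Ap \<chi>' k) Zero" by (rule eqv_trans[OF \<chi>'(3)[OF w' k kSn] k1(1)])
        ultimately show ?thesis by blast
      qed
      then show "eqv w' (Ap \<chi>' k) Zero" "eqv w' (Ap \<delta>' (S k)) (Ap g (J k (Ap \<delta>' k)))" by blast+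
    qed
    then show ?thesis using \<chi>'(1) \<delta>'(1) by blast
  qed
qed

lemma approx_ex:
  assumes x: "x \<in> dom_n w" and g: "g \<in> dom_f w" and n: "n \<in> dom_n w"
  shows "\<exists>\<chi>\<in>dom_f w. \<exists>\<delta>\<in>dom_f w. approx w x g \<chi> \<delta> n"
proof -
  have w: "w \<in> worlds" using x dom_worlds by blast
  have *: "force w' (n \<rhd> x \<rhd> (\<lambda>_. Zero)) (g \<rhd> (\<lambda>_. Succ)) (Ex (FEx (FEx approx_fm))) \<longleftrightarrow>
    (\<exists>\<chi>\<in>dom_f w'. \<exists>\<delta>\<in>dom_f w'. approx w' x g \<chi> \<delta> n)" if "n \<in> dom_n w'" for w' n
    unfolding force.simps force_approx_fm using eqv_refl[OF dom_intros(2)[OF _ that]] dom_intros(2)[OF _ that] by blast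
  have "force w (n \<rhd> x \<rhd> (\<lambda>_. Zero)) (g \<rhd> (\<lambda>_. Succ)) (Ex (FEx (FEx approx_fm)))"
  proof (rule induct_dom)
    show "Ex (FEx (FEx approx_fm)) \<in> formulas BIM" by (simp add: approx_fm_def)
    show "env w (x \<rhd> (\<lambda>_. Zero)) (g \<rhd> (\<lambda>_. Succ))" using x g env_base[OF w] by (simp add: env_push)
    show "force w (Zero \<rhd> x \<rhd> (\<lambda>_. Zero)) (g \<rhd> (\<lambda>_. Succ)) (Ex (FEx (FEx approx_fm)))"
      using * approx_Zero[OF x] dom_intros(1)[OF w] by blast
    show "force w' (S d \<rhd> x \<rhd> (\<lambda>_. Zero)) (g \<rhd> (\<lambda>_. Succ)) (Ex (FEx (FEx approx_fm)))"
      if "w \<sqsubseteq> w'" "d \<in> dom_n w'" "force w' (d \<rhd> x \<rhd> (\<lambda>_. Zero)) (g \<rhd> (\<lambda>_. Succ)) (Ex (FEx (FEx approx_fm)))" for w' d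
      using that(3) unfolding *[OF that(2)] *[OF unary_dom(1)[OF that(2)]]
      using approx_S[OF _ that(2) dom_mono(2)[OF that(1) g]] by blast
  qed (rule n)
  then show ?thesis using * n by blast
qed

text \<open>The value at n is that of any approximation reaching n; these agree by
  \<open>approx_unique\<close>, so unique choice collects them into one function.\<close>

lemma recursion:
  assumes x: "x \<in> dom_n w" and g: "g \<in> dom_f w"
  shows "\<exists>h\<in>dom_f w. eqv w (Ap h Zero) x \<and>
    (\<forall>w' n. w \<sqsubseteq> w' \<longrightarrow> n \<in> dom_n w' \<longrightarrow> eqv w' (Ap h (S n)) (Ap g (J n (Ap h n))))"
proof -
  have w: "w \<in> worlds" using x dom_worlds by blast
  let ?\<sigma> = "x \<rhd> (\<lambda>_. Zero)" and ?\<tau> = "g \<rhd> (\<lambda>_. Succ)"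
  have A: "force w' (y \<rhd> n \<rhd> ?\<sigma>) ?\<tau> (FEx (FEx approx_fm)) \<longleftrightarrow>
    (\<exists>\<chi>\<in>dom_f w'. \<exists>\<delta>\<in>dom_f w'. approx w' x g \<chi> \<delta> n \<and> eqv w' y (Ap \<delta> n))" for w' y n
    unfolding force.simps force_approx_fm ..
  have un: "eqv w' y y'" if w': "w \<sqsubseteq> w'" "n \<in> dom_n w'"
    and ch: "\<chi> \<in> dom_f w'" "\<delta> \<in> dom_f w'" "\<chi>' \<in> dom_f w'" "\<delta>' \<in> dom_f w'"
    and ap: "approx w' x g \<chi> \<delta> n" "approx w' x g \<chi>' \<delta>' n"
    and y: "eqv w' y (Ap \<delta> n)" "eqv w' y' (Ap \<delta>' n)" for w' n y y' \<chi> \<delta> \<chi>' \<delta>'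
    using eqv_join[OF eqv_trans[OF y(1) approx_unique[OF ap w'(2) dom_mono(2)[OF w'(1) g] ch]] y(2)] .
  have "\<exists>h\<in>dom_f w. \<forall>w' n. w \<sqsubseteq> w' \<longrightarrow> n \<in> dom_n w' \<longrightarrow> force w' (Ap h n \<rhd> n \<rhd> ?\<sigma>) ?\<tau> (FEx (FEx approx_fm))"
  proof (rule unique_choice)
    show "FEx (FEx approx_fm) \<in> formulas BIM" by (simp add: approx_fm_def)
    show "env w ?\<sigma> ?\<tau>" using x g env_base[OF w] by (simp add: env_push)
    show "\<exists>y\<in>dom_n w'. force w' (y \<rhd> n \<rhd> ?\<sigma>) ?\<tau> (FEx (FEx approx_fm))"
      if w': "w \<sqsubseteq> w'" "n \<in> dom_n w'" for w' n
      unfolding A using approx_ex[OF dom_mono(1)[OF w'(1) x] dom_mono(2)[OF w'(1) g] w'(2)]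
        eqv_refl[OF dom_intros(2)[OF _ w'(2)]] dom_intros(2)[OF _ w'(2)] by blast
  qed (use un in \<open>unfold A, blast\<close>)
  then obtain h where h: "h \<in> dom_f w" "\<And>w' n. w \<sqsubseteq> w' \<Longrightarrow> n \<in> dom_n w' \<Longrightarrow>
    \<exists>\<chi>\<in>dom_f w'. \<exists>\<delta>\<in>dom_f w'. approx w' x g \<chi> \<delta> n \<and> eqv w' (Ap h n) (Ap \<delta> n)"
    unfolding A by blast
  have ww: "w \<sqsubseteq> w" using w by (simp add: acc_refl)
  have "eqv w (Ap h Zero) x"
    using h(2)[OF ww dom_intros(1)[OF w]] unfolding approx_def by (meson eqv_trans)
  moreover have "eqv w' (Ap h (S n)) (Ap g (J n (Ap h n)))" if w': "w \<sqsubseteq> w'" "n \<in> dom_n w'" for w' n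
  proof -
    obtain \<chi> \<delta> where c: "\<chi> \<in> dom_f w'" "\<delta> \<in> dom_f w'" "approx w' x g \<chi> \<delta> (S n)" "eqv w' (Ap h (S n)) (Ap \<delta> (S n))"
      using h(2)[OF w'(1) unary_dom(1)[OF w'(2)]] by blast
    have "w' \<sqsubseteq> w'" using w'(1) by (simp add: acc_def)
    then have *: "eqv w' (Ap \<chi> n) Zero" "eqv w' (Ap \<delta> (S n)) (Ap g (J n (Ap \<delta> n)))"
      using c(3) w'(2) unfolding approx_def by blast+
    then have ap: "approx w' x g \<chi> \<delta> n" using c(3) unfolding approx_def by blast
    obtain \<chi>' \<delta>' where c': "\<chi>' \<in> dom_f w'" "\<delta>' \<in> dom_f w'" "approx w' x g \<chi>' \<delta>' n" "eqv w' (Ap h n) (Ap \<delta>' n)"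
      using h(2)[OF w'] by blast
    have "eqv w' (Ap h n) (Ap \<delta> n)"
      by (rule un[OF w' c'(1,2) c(1,2) c'(3) ap c'(4) eqv_refl[OF dom_intros(2)[OF c(2) w'(2)]]])
    from eqv_Ap[OF eqv_J[OF eqv_refl[OF w'(2)] this] dom_mono(2)[OF w'(1) g]]
    show ?thesis by (rule eqv_join[OF eqv_trans[OF c(4) *(2)]])
  qed
  ultimately show ?thesis using h(1) by blast
qed

definition rec_eqs :: "world \<Rightarrow> fnc \<Rightarrow> fnc \<Rightarrow> trm \<Rightarrow> fnc \<Rightarrow> bool" where
  "rec_eqs w \<alpha> \<beta> m h \<longleftrightarrow> eqv w (Ap h Zero) (Ap \<alpha> m) \<and>
    (\<forall>w' n. w \<sqsubseteq> w' \<longrightarrow> n \<in> dom_n w' \<longrightarrow> eqv w' (Ap h (S n)) (Ap \<beta> (J (J m n) (Ap h n))))"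

lemma rec_eqs_unique:
  assumes "rec_eqs w \<alpha> \<beta> m h" "rec_eqs w \<alpha> \<beta> m' h'" "eqv w m m'" "n \<in> dom_n w"
    "\<alpha> \<in> dom_f w" "\<beta> \<in> dom_f w" "h \<in> dom_f w" "h' \<in> dom_f w"
  shows "eqv w (Ap h n) (Ap h' n)"
proof (rule fun_eqv_induct[OF assms(7,8) _ _ assms(4)])
  show "eqv w (Ap h Zero) (Ap h' Zero)"
    using assms(1,2) eqv_join[OF eqv_trans[OF _ eqv_Ap[OF assms(3,5)]]] unfolding rec_eqs_def by blast
  fix w' n assume w': "w \<sqsubseteq> w'" "n \<in> dom_n w'" and IH: "eqv w' (Ap h n) (Ap h' n)"
  have *: "eqv w' (Ap h (S n)) (Ap \<beta> (J (J m n) (Ap h n)))" "eqv w' (Ap h' (S n)) (Ap \<beta> (J (J m' n) (Ap h' n)))"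
    using assms(1,2) w' unfolding rec_eqs_def by blast+
  have "eqv w' (Ap \<beta> (J (J m n) (Ap h n))) (Ap \<beta> (J (J m' n) (Ap h' n)))"
    by (rule eqv_Ap[OF eqv_J[OF eqv_J IH]])
      (use eqv_mono[OF w'(1) assms(3)] eqv_refl[OF w'(2)] dom_mono(2)[OF w'(1) assms(6)] in auto)
  from eqv_trans[OF *(1) this] show "eqv w' (Ap h (S n)) (Ap h' (S n))" by (rule eqv_join[OF _ *(2)])
qed

text \<open>The step function in \<open>recursion\<close> takes a single coded pair, so the
  parameter m is absorbed into g.\<close>

lemma rec_eqs_ex:
  assumes m: "m \<in> dom_n w" and \<alpha>: "\<alpha> \<in> dom_f w" and \<beta>: "\<beta> \<in> dom_f w"
  shows "\<exists>h\<in>dom_f w. rec_eqs w \<alpha> \<beta> m h"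
proof -
  have w: "w \<in> worlds" using m dom_worlds by blast
  have env: "env w (m \<rhd> (\<lambda>_. Zero)) (\<beta> \<rhd> (\<lambda>_. Succ))" using m \<beta> env_base[OF w] by (simp add: env_push)
  obtain g where g: "g \<in> dom_f w" "\<And>w' p. w \<sqsubseteq> w' \<Longrightarrow> p \<in> dom_n w' \<Longrightarrow>
      eqv w' (Ap g p) (Ap \<beta> (J (J m (Ap PK p)) (Ap PL p)))"
    using explicit_definition[OF _ env, of "Ap (FV 0) (J (J (NV 1) (Ap PK (NV 0))) (Ap PL (NV 0)))"] by auto
  obtain h where h: "h \<in> dom_f w" "eqv w (Ap h Zero) (Ap \<alpha> m)"
    "\<And>w' n. w \<sqsubseteq> w' \<Longrightarrow> n \<in> dom_n w' \<Longrightarrow> eqv w' (Ap h (S n)) (Ap g (J n (Ap h n)))"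
    using recursion[OF dom_intros(2)[OF \<alpha> m] g(1)] by blast
  have "eqv w' (Ap h (S n)) (Ap \<beta> (J (J m n) (Ap h n)))" if w': "w \<sqsubseteq> w'" "n \<in> dom_n w'" for w' n
  proof -
    have hn: "Ap h n \<in> dom_n w'" by (rule dom_intros(2)[OF dom_mono(2)[OF w'(1) h(1)] w'(2)])
    have "eqv w' (Ap g (J n (Ap h n))) (Ap \<beta> (J (J m (Ap PK (J n (Ap h n)))) (Ap PL (J n (Ap h n)))))"
      by (rule g(2)[OF w'(1)]) (simp add: dom_intros w'(2) hn)
    also have "eqv w' \<dots> (Ap \<beta> (J (J m n) (Ap h n)))"
      by (rule eqv_Ap[OF eqv_J[OF eqv_J[OF eqv_refl[OF dom_mono(1)[OF w'(1) m]] PK_J[OF w'(2) hn]] PL_J[OF w'(2) hn]]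
            dom_mono(2)[OF w'(1) \<beta>]])
    finally show ?thesis by (rule eqv_trans[OF h(3)[OF w']])
  qed
  then show ?thesis using h(1,2) unfolding rec_eqs_def by blast
qed

text \<open>For each parameter there is a function of n, unique up to extensional equality, and
  unique choice is applied to the coded pair z. The parameter enters as \<open>Ap PK z\<close>,
  which merely equals m; hence the two parameters in \<open>rec_eqs_unique\<close>.\<close>

lemma parameter_recursion:
  assumes \<alpha>: "\<alpha> \<in> dom_f w" and \<beta>: "\<beta> \<in> dom_f w"
  shows "\<exists>\<gamma>\<in>dom_f w. \<forall>w' m n. w \<sqsubseteq> w' \<longrightarrow> m \<in> dom_n w' \<longrightarrow> n \<in> dom_n w' \<longrightarrow>
    eqv w' (Ap \<gamma> (J m Zero)) (Ap \<alpha> m) \<and> eqv w' (Ap \<gamma> (J m (S n))) (Ap \<beta> (J (J m n) (Ap \<gamma> (J m n))))"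
proof -
  have w: "w \<in> worlds" using \<alpha> dom_worlds by blast
  let ?\<sigma> = "\<lambda>_. Zero" and ?\<tau> = "\<alpha> \<rhd> \<beta> \<rhd> (\<lambda>_. Succ)"
  let ?A = "FEx (Ap (FV 0) Zero \<doteq> Ap (FV 1) (Ap PK (NV 1)) \<^bold>\<and>
    All (Ap (FV 0) (S (NV 0)) \<doteq> Ap (FV 2) (J (J (Ap PK (NV 2)) (NV 0)) (Ap (FV 0) (NV 0)))) \<^bold>\<and>
    NV 0 \<doteq> Ap (FV 0) (Ap PL (NV 1)))"
  have A: "force w' (y \<rhd> z \<rhd> ?\<sigma>) ?\<tau> ?A \<longleftrightarrow> (\<exists>h\<in>dom_f w'. rec_eqs w' \<alpha> \<beta> (Ap PK z) h \<and> eqv w' y (Ap h (Ap PL z)))" for w' y z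
    by (auto simp: rec_eqs_def)
  have "\<exists>\<gamma>\<in>dom_f w. \<forall>w' z. w \<sqsubseteq> w' \<longrightarrow> z \<in> dom_n w' \<longrightarrow> force w' (Ap \<gamma> z \<rhd> z \<rhd> ?\<sigma>) ?\<tau> ?A"
  proof (rule unique_choice)
    show "env w ?\<sigma> ?\<tau>" using \<alpha> \<beta> env_base[OF w] by (simp add: env_push)
    show "\<exists>y\<in>dom_n w'. force w' (y \<rhd> z \<rhd> ?\<sigma>) ?\<tau> ?A" if w': "w \<sqsubseteq> w'" "z \<in> dom_n w'" for w' z
    proof -
      obtain h where h: "h \<in> dom_f w'" "rec_eqs w' \<alpha> \<beta> (Ap PK z) h"
        using rec_eqs_ex[OF unary_dom(2)[OF w'(2)] dom_mono(2)[OF w'(1) \<alpha>] dom_mono(2)[OF w'(1) \<beta>]] by blast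
      have "Ap h (Ap PL z) \<in> dom_n w'" by (rule dom_intros(2)[OF h(1) unary_dom(3)[OF w'(2)]])
      then show ?thesis unfolding A using h eqv_refl by blast
    qed
    fix w' y y' z assume w': "w \<sqsubseteq> w'" "z \<in> dom_n w'" "force w' (y \<rhd> z \<rhd> ?\<sigma>) ?\<tau> ?A" "force w' (y' \<rhd> z \<rhd> ?\<sigma>) ?\<tau> ?A"
    then obtain h h' where h: "h \<in> dom_f w'" "rec_eqs w' \<alpha> \<beta> (Ap PK z) h" "eqv w' y (Ap h (Ap PL z))"
      "h' \<in> dom_f w'" "rec_eqs w' \<alpha> \<beta> (Ap PK z) h'" "eqv w' y' (Ap h' (Ap PL z))" unfolding A by blast
    have "eqv w' (Ap h (Ap PL z)) (Ap h' (Ap PL z))"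
      by (rule rec_eqs_unique[OF h(2,5) eqv_refl[OF unary_dom(2)[OF w'(2)]] unary_dom(3)[OF w'(2)]
            dom_mono(2)[OF w'(1) \<alpha>] dom_mono(2)[OF w'(1) \<beta>] h(1,4)])
    then show "eqv w' y y'" by (rule eqv_join[OF eqv_trans[OF h(3)] h(6)])
  qed simp
  then obtain \<gamma> where \<gamma>: "\<gamma> \<in> dom_f w" "\<And>w' z. w \<sqsubseteq> w' \<Longrightarrow> z \<in> dom_n w' \<Longrightarrow>
    \<exists>h\<in>dom_f w'. rec_eqs w' \<alpha> \<beta> (Ap PK z) h \<and> eqv w' (Ap \<gamma> z) (Ap h (Ap PL z))"
    unfolding A by blast
  have val: "\<exists>h\<in>dom_f w'. rec_eqs w' \<alpha> \<beta> (Ap PK (J m n)) h \<and> eqv w' (Ap \<gamma> (J m n)) (Ap h n)"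
    if w': "w \<sqsubseteq> w'" "m \<in> dom_n w'" "n \<in> dom_n w'" for w' m n
  proof -
    obtain h where h: "h \<in> dom_f w'" "rec_eqs w' \<alpha> \<beta> (Ap PK (J m n)) h" "eqv w' (Ap \<gamma> (J m n)) (Ap h (Ap PL (J m n)))"
      using \<gamma>(2)[OF w'(1) dom_intros(3)[OF w'(2,3)]] by blast
    then show ?thesis using eqv_trans[OF h(3) eqv_Ap[OF PL_J[OF w'(2,3)] h(1)]] by blast
  qed
  have "eqv w' (Ap \<gamma> (J m Zero)) (Ap \<alpha> m) \<and> eqv w' (Ap \<gamma> (J m (S n))) (Ap \<beta> (J (J m n) (Ap \<gamma> (J m n))))"
    if w': "w \<sqsubseteq> w'" "m \<in> dom_n w'" "n \<in> dom_n w'" for w' m n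
  proof
    note [simp] = unary_dom[OF w'(3)]
    obtain h where h: "h \<in> dom_f w'" "rec_eqs w' \<alpha> \<beta> (Ap PK (J m Zero)) h" "eqv w' (Ap \<gamma> (J m Zero)) (Ap h Zero)"
      using val[OF w'(1,2), of Zero] by auto
    have "eqv w' (Ap \<gamma> (J m Zero)) (Ap \<alpha> (Ap PK (J m Zero)))"
      by (rule eqv_trans[OF h(3)]) (use h(2) in \<open>simp add: rec_eqs_def\<close>)
    also have "eqv w' \<dots> (Ap \<alpha> m)" by (rule eqv_Ap[OF PK_J[OF w'(2)] dom_mono(2)[OF w'(1) \<alpha>]]) simp
    finally show "eqv w' (Ap \<gamma> (J m Zero)) (Ap \<alpha> m)" .
    obtain h where h: "h \<in> dom_f w'" "rec_eqs w' \<alpha> \<beta> (Ap PK (J m (S n))) h" "eqv w' (Ap \<gamma> (J m (S n))) (Ap h (S n))"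
      using val[OF w'(1,2), of "S n"] by auto
    obtain h' where h': "h' \<in> dom_f w'" "rec_eqs w' \<alpha> \<beta> (Ap PK (J m n)) h'" "eqv w' (Ap \<gamma> (J m n)) (Ap h' n)"
      using val[OF w'] by auto
    have K: "eqv w' (Ap PK (J m (S n))) m" by (rule PK_J[OF w'(2)]) simp
    have "eqv w' (Ap h n) (Ap h' n)"
      by (rule rec_eqs_unique[OF h(2) h'(2) eqv_join[OF K PK_J[OF w'(2,3)]] w'(3)
            dom_mono(2)[OF w'(1) \<alpha>] dom_mono(2)[OF w'(1) \<beta>] h(1) h'(1)] eqv_refl)
    then have "eqv w' (Ap h n) (Ap \<gamma> (J m n))" by (rule eqv_join[OF _ h'(3)])
    from eqv_Ap[OF eqv_J[OF eqv_J[OF K eqv_refl[OF w'(3)]] this] dom_mono(2)[OF w'(1) \<beta>]]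
    have *: "eqv w' (Ap \<beta> (J (J (Ap PK (J m (S n))) n) (Ap h n))) (Ap \<beta> (J (J m n) (Ap \<gamma> (J m n))))" .
    have "w' \<sqsubseteq> w'" using w'(1) by (simp add: acc_def)
    then have "eqv w' (Ap h (S n)) (Ap \<beta> (J (J (Ap PK (J m (S n))) n) (Ap h n)))"
      using h(2) w'(3) unfolding rec_eqs_def by blast
    from eqv_trans[OF eqv_trans[OF h(3) this] *]
    show "eqv w' (Ap \<gamma> (J m (S n))) (Ap \<beta> (J (J m n) (Ap \<gamma> (J m n))))" .
  qed
  then show ?thesis using \<gamma>(1) by blast
qed

subsection \<open>Coded environments\<close>

lemma num_dom: "w \<in> worlds \<Longrightarrow> num n \<in> dom_n w"
  by (induction n) (simp_all add: dom_intros)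

text \<open>A function \<open>\<eta>\<close> codes an environment: \<open>\<eta>(0,n)\<close> is the value of number variable n and
  \<open>\<eta>(n + 1,x)\<close> is the value of function variable n at x.\<close>

definition codes :: "world \<Rightarrow> fnc \<Rightarrow> nat \<Rightarrow> nat \<Rightarrow> nsub \<Rightarrow> fsub \<Rightarrow> bool" where
  "codes w \<eta> k l \<sigma> \<tau> \<longleftrightarrow> (\<forall>n<k. eqv w (Ap \<eta> (J Zero (num n))) (\<sigma> n)) \<and>
    (\<forall>n<l. \<forall>w' x. w \<sqsubseteq> w' \<longrightarrow> x \<in> dom_n w' \<longrightarrow> eqv w' (Ap \<eta> (J (S (num n)) x)) (Ap (\<tau> n) x))"

text \<open>A relation between codes, since BIM has no term for the extended code: the number row is
  shifted by one place, the rows of the function variables stay.\<close>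

definition pushes :: "world \<Rightarrow> trm \<Rightarrow> fnc \<Rightarrow> fnc \<Rightarrow> bool" where
  "pushes w x \<eta> \<eta>' \<longleftrightarrow> eqv w (Ap \<eta>' (J Zero Zero)) x \<and>
    (\<forall>w' z. w \<sqsubseteq> w' \<longrightarrow> z \<in> dom_n w' \<longrightarrow> eqv w' (Ap \<eta>' (J Zero (S z))) (Ap \<eta> (J Zero z))) \<and>
    (\<forall>w' a v. w \<sqsubseteq> w' \<longrightarrow> a \<in> dom_n w' \<longrightarrow> v \<in> dom_n w' \<longrightarrow> eqv w' (Ap \<eta>' (J (S a) v)) (Ap \<eta> (J (S a) v)))"

lemma codes_mono: "codes w \<eta> k l \<sigma> \<tau> \<Longrightarrow> w \<sqsubseteq> w' \<Longrightarrow> codes w' \<eta> k l \<sigma> \<tau>"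
  unfolding codes_def using eqv_mono acc_trans by blast

lemma codes_push:
  assumes "pushes w x \<eta> \<eta>'" "codes w \<eta> k l \<sigma> \<tau>" "w \<in> worlds"
  shows "codes w \<eta>' (Suc k) l (x \<rhd> \<sigma>) \<tau>"
  unfolding codes_def
proof (intro conjI HOL.allI HOL.impI)
  have ww: "w \<sqsubseteq> w" using assms(3) by (simp add: acc_refl)
  show "eqv w (Ap \<eta>' (J Zero (num n))) ((x \<rhd> \<sigma>) n)" if "n < Suc k" for n
  proof (cases n)
    case (Suc m)
    then have "eqv w (Ap \<eta>' (J Zero (S (num m)))) (Ap \<eta> (J Zero (num m)))"
      "eqv w (Ap \<eta> (J Zero (num m))) (\<sigma> m)"
      using assms ww num_dom[OF assms(3)] that unfolding pushes_def codes_def by auto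
    from eqv_trans[OF this] show ?thesis by (simp add: Suc)
  qed (use assms(1) in \<open>simp add: pushes_def\<close>)
  show "eqv w' (Ap \<eta>' (J (S (num n)) z)) (Ap (\<tau> n) z)" if "n < l" "w \<sqsubseteq> w'" "z \<in> dom_n w'" for n w' z
  proof -
    have "num n \<in> dom_n w'" using that(3) num_dom dom_worlds by blast
    then have "eqv w' (Ap \<eta>' (J (S (num n)) z)) (Ap \<eta> (J (S (num n)) z))"
      "eqv w' (Ap \<eta> (J (S (num n)) z)) (Ap (\<tau> n) z)"
      using assms(1,2) that unfolding pushes_def codes_def by blast+
    then show ?thesis by (rule eqv_trans)
  qed
qed

lemma slice_numbers:
  assumes \<eta>: "\<eta> \<in> dom_f w" and t: "bim_trm t" "\<And>z. sub_trm t (z \<rhd> (\<lambda>_. Zero)) (\<eta> \<rhd> (\<lambda>_. Succ)) = s z"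
  shows "\<exists>f\<in>dom_f w. \<forall>w' z. w \<sqsubseteq> w' \<longrightarrow> z \<in> dom_n w' \<longrightarrow> eqv w' (Ap f z) (s z)"
proof -
  have "env w (\<lambda>_. Zero) (\<eta> \<rhd> (\<lambda>_. Succ))" using \<eta> env_base dom_worlds by (simp add: env_push)
  from explicit_definition[OF t(1) this] show ?thesis by (simp add: t(2))
qed

lemma slice_functions:
  assumes \<eta>: "\<eta> \<in> dom_f w"
  shows "\<exists>f\<in>dom_f w. \<forall>w' a v. w \<sqsubseteq> w' \<longrightarrow> a \<in> dom_n w' \<longrightarrow> v \<in> dom_n w' \<longrightarrow>
    eqv w' (Ap f (J a v)) (Ap \<eta> (J (S a) v))"
proof -
  obtain f where f: "f \<in> dom_f w" "\<And>w' z. w \<sqsubseteq> w' \<Longrightarrow> z \<in> dom_n w' \<Longrightarrow>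
      eqv w' (Ap f z) (Ap \<eta> (J (S (Ap PK z)) (Ap PL z)))"
    using slice_numbers[OF \<eta>, of "Ap (FV 0) (J (S (Ap PK (NV 0))) (Ap PL (NV 0)))" "\<lambda>z. Ap \<eta> (J (S (Ap PK z)) (Ap PL z))"] by auto
  have "eqv w' (Ap f (J a v)) (Ap \<eta> (J (S a) v))"
    if w': "w \<sqsubseteq> w'" "a \<in> dom_n w'" "v \<in> dom_n w'" for w' a v
    by (rule eqv_trans[OF f(2)[OF w'(1) dom_intros(3)[OF w'(2,3)]]
          eqv_Ap[OF eqv_J[OF eqv_S[OF PK_J[OF w'(2,3)]] PL_J[OF w'(2,3)]] dom_mono(2)[OF w'(1) \<eta>]]])
  then show ?thesis using f(1) by blast
qed

lemma push_number:
  assumes \<eta>: "\<eta> \<in> dom_f w" and x: "x \<in> dom_n w"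
  shows "\<exists>\<eta>'\<in>dom_f w. pushes w x \<eta> \<eta>'"
proof -
  have w: "w \<in> worlds" using x dom_worlds by blast
  obtain f where f: "f \<in> dom_f w" "\<And>w' z. w \<sqsubseteq> w' \<Longrightarrow> z \<in> dom_n w' \<Longrightarrow> eqv w' (Ap f z) (Ap \<eta> (J Zero z))"
    using slice_numbers[OF \<eta>, of "Ap (FV 0) (J Zero (NV 0))" "\<lambda>z. Ap \<eta> (J Zero z)"] by auto
  obtain f' where f': "f' \<in> dom_f w" "\<And>w' z. w \<sqsubseteq> w' \<Longrightarrow> z \<in> dom_n w' \<Longrightarrow> eqv w' (Ap f' (S z)) (Ap f z)"
    "eqv w (Ap f' Zero) x"
    using cons_function[OF x f(1)] by blast
  obtain g where g: "g \<in> dom_f w" "\<And>w' a v. w \<sqsubseteq> w' \<Longrightarrow> a \<in> dom_n w' \<Longrightarrow> v \<in> dom_n w' \<Longrightarrow>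
      eqv w' (Ap g (J a v)) (Ap \<eta> (J (S a) v))"
    using slice_functions[OF \<eta>] by blast
  obtain h where h: "h \<in> dom_f w" "\<And>w' z. w \<sqsubseteq> w' \<Longrightarrow> z \<in> dom_n w' \<Longrightarrow> eqv w' (Ap h (J Zero z)) (Ap f' z)"
    "\<And>w' a v. w \<sqsubseteq> w' \<Longrightarrow> a \<in> dom_n w' \<Longrightarrow> v \<in> dom_n w' \<Longrightarrow> eqv w' (Ap h (J (S a) v)) (Ap g (J a v))"
    using join_functions[OF f'(1) g(1)] by blast
  have "pushes w x \<eta> h"
    unfolding pushes_def
  proof (intro conjI HOL.allI HOL.impI)
    show "eqv w (Ap h (J Zero Zero)) x"
      by (rule eqv_trans[OF h(2) f'(3)]) (simp_all add: w acc_refl dom_intros)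
    show "eqv w' (Ap h (J Zero (S z))) (Ap \<eta> (J Zero z))" if "w \<sqsubseteq> w'" "z \<in> dom_n w'" for w' z
      by (rule eqv_trans[OF h(2)[OF that(1) unary_dom(1)[OF that(2)]] eqv_trans[OF f'(2)[OF that] f(2)[OF that]]])
    show "eqv w' (Ap h (J (S a) v)) (Ap \<eta> (J (S a) v))" if "w \<sqsubseteq> w'" "a \<in> dom_n w'" "v \<in> dom_n w'" for w' a v
      by (rule eqv_trans[OF h(3)[OF that] g(2)[OF that]])
  qed
  then show ?thesis using h(1) by blast
qed

text \<open>Serves to drop the recursion argument before the defining terms of a recursion are
  evaluated.\<close>

lemma pop_number:
  assumes \<eta>: "\<eta> \<in> dom_f w"
  shows "\<exists>\<eta>'\<in>dom_f w. pushes w (Ap \<eta> (J Zero Zero)) \<eta>' \<eta>"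
proof -
  have w: "w \<in> worlds" using \<eta> dom_worlds by blast
  obtain f where f: "f \<in> dom_f w" "\<And>w' z. w \<sqsubseteq> w' \<Longrightarrow> z \<in> dom_n w' \<Longrightarrow> eqv w' (Ap f z) (Ap \<eta> (J Zero (S z)))"
    using slice_numbers[OF \<eta>, of "Ap (FV 0) (J Zero (S (NV 0)))" "\<lambda>z. Ap \<eta> (J Zero (S z))"] by auto
  obtain g where g: "g \<in> dom_f w" "\<And>w' a v. w \<sqsubseteq> w' \<Longrightarrow> a \<in> dom_n w' \<Longrightarrow> v \<in> dom_n w' \<Longrightarrow>
      eqv w' (Ap g (J a v)) (Ap \<eta> (J (S a) v))"
    using slice_functions[OF \<eta>] by blast
  obtain h where h: "h \<in> dom_f w" "\<And>w' z. w \<sqsubseteq> w' \<Longrightarrow> z \<in> dom_n w' \<Longrightarrow> eqv w' (Ap h (J Zero z)) (Ap f z)"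
    "\<And>w' a v. w \<sqsubseteq> w' \<Longrightarrow> a \<in> dom_n w' \<Longrightarrow> v \<in> dom_n w' \<Longrightarrow> eqv w' (Ap h (J (S a) v)) (Ap g (J a v))"
    using join_functions[OF f(1) g(1)] by blast
  have "pushes w (Ap \<eta> (J Zero Zero)) h \<eta>"
    unfolding pushes_def
  proof (intro conjI HOL.allI HOL.impI)
    show "eqv w (Ap \<eta> (J Zero Zero)) (Ap \<eta> (J Zero Zero))"
      by (rule eqv_refl) (simp add: w \<eta> dom_intros)
    show "eqv w' (Ap \<eta> (J Zero (S z))) (Ap h (J Zero z))" if "w \<sqsubseteq> w'" "z \<in> dom_n w'" for w' z
      by (rule eqv_sym[OF eqv_trans[OF h(2)[OF that] f(2)[OF that]]])
    show "eqv w' (Ap \<eta> (J (S a) v)) (Ap h (J (S a) v))" if "w \<sqsubseteq> w'" "a \<in> dom_n w'" "v \<in> dom_n w'" for w' a v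
      by (rule eqv_sym[OF eqv_trans[OF h(3)[OF that] g(2)[OF that]]])
  qed
  then show ?thesis using h(1) by blast
qed

text \<open>Two joins: \<beta> goes in front of the function rows of \<eta>, and then an arbitrary
  number row, here \<eta> itself, goes in front of the result. The old number row is lost, hence no
  number variables are coded.\<close>

lemma push_function:
  assumes \<eta>: "\<eta> \<in> dom_f w" and \<beta>: "\<beta> \<in> dom_f w" and c: "codes w \<eta> 0 l \<sigma> \<tau>"
  shows "\<exists>\<eta>'\<in>dom_f w. codes w \<eta>' 0 (Suc l) \<sigma> (\<beta> \<rhd> \<tau>)"
proof -
  have w: "w \<in> worlds" using \<eta> dom_worlds by blast
  obtain g where g: "g \<in> dom_f w" "\<And>w' a v. w \<sqsubseteq> w' \<Longrightarrow> a \<in> dom_n w' \<Longrightarrow> v \<in> dom_n w' \<Longrightarrow>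
      eqv w' (Ap g (J a v)) (Ap \<eta> (J (S a) v))"
    using slice_functions[OF \<eta>] by blast
  obtain h where h: "h \<in> dom_f w" "\<And>w' z. w \<sqsubseteq> w' \<Longrightarrow> z \<in> dom_n w' \<Longrightarrow> eqv w' (Ap h (J Zero z)) (Ap \<beta> z)"
    "\<And>w' a v. w \<sqsubseteq> w' \<Longrightarrow> a \<in> dom_n w' \<Longrightarrow> v \<in> dom_n w' \<Longrightarrow> eqv w' (Ap h (J (S a) v)) (Ap g (J a v))"
    using join_functions[OF \<beta> g(1)] by blast
  obtain h' where h': "h' \<in> dom_f w" "\<And>w' a v. w \<sqsubseteq> w' \<Longrightarrow> a \<in> dom_n w' \<Longrightarrow> v \<in> dom_n w' \<Longrightarrow>
      eqv w' (Ap h' (J (S a) v)) (Ap h (J a v))"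
    using join_functions[OF \<eta> h(1)] by blast
  have "eqv w' (Ap h' (J (S (num n)) x)) (Ap ((\<beta> \<rhd> \<tau>) n) x)"
    if "n < Suc l" "w \<sqsubseteq> w'" "x \<in> dom_n w'" for n w' x
  proof -
    have d: "num m \<in> dom_n w'" for m using that(3) num_dom dom_worlds by blast
    note * = h'(2)[OF that(2) d that(3)]
    show ?thesis
    proof (cases n)
      case 0
      then show ?thesis using eqv_trans[OF *[of 0]] h(2)[OF that(2,3)] by simp
    next
      case (Suc m)
      have "eqv w' (Ap h' (J (S (num n)) x)) (Ap g (J (num m) x))"
        using eqv_trans[OF *[of n]] h(3)[OF that(2) d[of m] that(3)] Suc by simp
      also have "eqv w' \<dots> (Ap \<eta> (J (S (num m)) x))" by (rule g(2)[OF that(2) d that(3)])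
      also have "eqv w' \<dots> (Ap (\<tau> m) x)" using c that Suc by (simp add: codes_def)
      finally show ?thesis using Suc by simp
    qed
  qed
  then show ?thesis using h'(1) by (auto simp: codes_def)
qed

text \<open>Function variables are coded first and number variables afterwards, because
  \<open>push_function\<close> overwrites the number row.\<close>

lemma codes_ex:
  assumes "env w \<sigma> \<tau>" shows "\<exists>\<eta>\<in>dom_f w. codes w \<eta> k l \<sigma> \<tau>"
  using assms
proof (induction k arbitrary: \<sigma>)
  case 0
  then show ?case
  proof (induction l arbitrary: \<tau>)
    case 0
    then show ?case using env_dom(2)[of w \<sigma> \<tau> 0] by (auto simp: codes_def)
  next
    case (Suc l)
    have "env w \<sigma> (\<lambda>n. \<tau> (Suc n))" using Suc.prems by (simp add: env_def)
    then obtain \<eta> where \<eta>: "\<eta> \<in> dom_f w" "codes w \<eta> 0 l \<sigma> (\<lambda>n. \<tau> (Suc n))" using Suc.IH by blast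
    have "(\<tau> 0 \<rhd> (\<lambda>n. \<tau> (Suc n))) = \<tau>" by (auto simp: fun_eq_iff split: nat.splits)
    then show ?case using push_function[OF \<eta>(1) env_dom(2)[OF Suc.prems, of 0] \<eta>(2)] by simp
  qed
next
  case (Suc k)
  have "env w (\<lambda>n. \<sigma> (Suc n)) \<tau>" using Suc.prems by (simp add: env_def)
  then obtain \<eta> where \<eta>: "\<eta> \<in> dom_f w" "codes w \<eta> k l (\<lambda>n. \<sigma> (Suc n)) \<tau>" using Suc.IH by blast
  have "(\<sigma> 0 \<rhd> (\<lambda>n. \<sigma> (Suc n))) = \<sigma>" by (auto simp: fun_eq_iff split: nat.splits)
  then show ?case
    using push_number[OF \<eta>(1) env_dom(1)[OF Suc.prems, of 0]] codes_push[OF _ \<eta>(2)] env_worlds[OF Suc.prems] by metis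
qed

end

section \<open>The axioms of BIM and CFd in models with unique choice\<close>

context arith_model
begin

definition lt :: "world \<Rightarrow> trm \<Rightarrow> trm \<Rightarrow> bool" where
  "lt w a b \<longleftrightarrow> (\<exists>c\<in>dom_n w. \<exists>g\<in>dom_f w. eqv w (Ap g Zero) (S c) \<and>
    (\<forall>w' k. w \<sqsubseteq> w' \<longrightarrow> k \<in> dom_n w' \<longrightarrow> eqv w' (Ap g (S k)) (S (Ap g k))) \<and> eqv w (Ap g a) b)"

lemma force_less: "force w \<sigma> \<tau> (a \<^bold>< b) \<longleftrightarrow> lt w (sub_trm a \<sigma> \<tau>) (sub_trm b \<sigma> \<tau>)"
  by (auto simp: less_fm_def lt_def sub_ren comp_def)

lemma bim_less [simp]: "bim_trm a \<Longrightarrow> bim_trm b \<Longrightarrow> (a \<^bold>< b) \<in> formulas BIM"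
  by (simp add: less_fm_def bim_ren)

lemma not_lt_Zero: "a \<in> dom_n w \<Longrightarrow> \<not> lt w a Zero"
proof
  assume a: "a \<in> dom_n w" and "lt w a Zero"
  then obtain c g where g: "c \<in> dom_n w" "g \<in> dom_f w" "eqv w (Ap g Zero) (S c)"
    "\<And>w' k. w \<sqsubseteq> w' \<Longrightarrow> k \<in> dom_n w' \<Longrightarrow> eqv w' (Ap g (S k)) (S (Ap g k))" "eqv w (Ap g a) Zero"
    unfolding lt_def by blast
  have ww: "w \<sqsubseteq> w" using a dom_worlds by (simp add: acc_refl)
  from zero_or_succ[OF a] show False
  proof
    assume "eqv w a Zero"
    from eqv_trans[OF eqv_Ap[OF this g(2)] g(3)] show False using Zero_S[OF g(5) _ g(1)] by blast
  next
    assume "\<exists>d\<in>dom_n w. eqv w a (S d)"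
    then obtain d where d: "d \<in> dom_n w" "eqv w a (S d)" by blast
    from eqv_trans[OF eqv_Ap[OF d(2) g(2)] g(4)[OF ww d(1)]] show False
      using Zero_S[OF g(5) _ dom_intros(2)[OF g(2) d(1)]] by blast
  qed
qed

end

context choice_model
begin

lemma lt_add:
  assumes c: "c \<in> dom_n w"
  shows "\<exists>g\<in>dom_f w. eqv w (Ap g Zero) (S c) \<and>
    (\<forall>w' k. w \<sqsubseteq> w' \<longrightarrow> k \<in> dom_n w' \<longrightarrow> eqv w' (Ap g (S k)) (S (Ap g k)))"
proof -
  have w: "w \<in> worlds" using c dom_worlds by blast
  obtain f where f: "f \<in> dom_f w" "\<And>w' z. w \<sqsubseteq> w' \<Longrightarrow> z \<in> dom_n w' \<Longrightarrow> eqv w' (Ap f z) (S (Ap PL z))"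
    using explicit_definition[OF _ env_base[OF w], of "S (Ap PL (NV 0))"] by auto
  obtain g where g: "g \<in> dom_f w" "eqv w (Ap g Zero) (S c)"
    "\<And>w' n. w \<sqsubseteq> w' \<Longrightarrow> n \<in> dom_n w' \<Longrightarrow> eqv w' (Ap g (S n)) (Ap f (J n (Ap g n)))"
    using recursion[OF unary_dom(1)[OF c] f(1)] by blast
  have "eqv w' (Ap g (S k)) (S (Ap g k))" if w': "w \<sqsubseteq> w'" "k \<in> dom_n w'" for w' k
  proof -
    have d: "Ap g k \<in> dom_n w'" by (rule dom_intros(2)[OF dom_mono(2)[OF w'(1) g(1)] w'(2)])
    show ?thesis
      by (rule eqv_trans[OF g(3)[OF w'] eqv_trans[OF f(2)[OF w'(1)] eqv_S[OF PL_J[OF w'(2) d]]]])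
        (rule dom_intros(3)[OF w'(2) d])
  qed
  then show ?thesis using g(1,2) by blast
qed

text \<open>For c = 0 the function that adds S c is the successor itself.\<close>

lemma lt_S_self: assumes "eqv w a b" shows "lt w a (S b)"
proof -
  have w: "w \<in> worlds" using assms eqv_dom by blast
  have "eqv w (Ap Succ Zero) (S Zero)" "eqv w' (Ap Succ (S k)) (S (Ap Succ k))" if "k \<in> dom_n w'" for w' k
    using eqv_refl unary_dom that dom_intros(1)[OF w] by simp_all
  then show ?thesis
    unfolding lt_def using dom_intros(1,4)[OF w] eqv_S[OF assms] unary_dom(1) by blast
qed

text \<open>From S c + a = b one passes to S (S c) + a = S b; the witness function is g followed by
  the successor.\<close>

lemma lt_S: assumes "lt w a b" "a \<in> dom_n w" shows "lt w a (S b)"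
proof -
  obtain c g where g: "c \<in> dom_n w" "g \<in> dom_f w" "eqv w (Ap g Zero) (S c)"
    "\<And>w' k. w \<sqsubseteq> w' \<Longrightarrow> k \<in> dom_n w' \<Longrightarrow> eqv w' (Ap g (S k)) (S (Ap g k))" "eqv w (Ap g a) b"
    using assms(1) unfolding lt_def by blast
  have w: "w \<in> worlds" using g(1) dom_worlds by blast
  then have ww: "w \<sqsubseteq> w" by (simp add: acc_refl)
  obtain h where h: "h \<in> dom_f w" "\<And>w' z. w \<sqsubseteq> w' \<Longrightarrow> z \<in> dom_n w' \<Longrightarrow> eqv w' (Ap h z) (S (Ap g z))"
    using slice_numbers[OF g(2), of "S (Ap (FV 0) (NV 0))" "\<lambda>z. S (Ap g z)"] by auto
  have "eqv w (Ap h Zero) (S (S c))"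
    by (rule eqv_trans[OF h(2)[OF ww dom_intros(1)[OF w]] eqv_S[OF g(3)]])
  moreover have "eqv w' (Ap h (S k)) (S (Ap h k))" if "w \<sqsubseteq> w'" "k \<in> dom_n w'" for w' k
    by (rule eqv_trans[OF h(2)[OF that(1) unary_dom(1)[OF that(2)]]
          eqv_S[OF eqv_trans[OF g(4)[OF that] eqv_sym[OF h(2)[OF that]]]]])
  moreover have "eqv w (Ap h a) (S b)" by (rule eqv_trans[OF h(2)[OF ww assms(2)] eqv_S[OF g(5)]])
  ultimately show ?thesis unfolding lt_def using h(1) unary_dom(1)[OF g(1)] by blast
qed

text \<open>If S c + a = b, then either S a = b or S c' + S a = b where c = S c'.\<close>

lemma lt_split:
  assumes "lt w a b" "a \<in> dom_n w" shows "eqv w (S a) b \<or> lt w (S a) b"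
    and "\<And>d. d \<in> dom_n w \<Longrightarrow> eqv w b (S d) \<Longrightarrow> eqv w a d \<or> lt w a d"
proof -
  obtain c g where g: "c \<in> dom_n w" "g \<in> dom_f w" "eqv w (Ap g Zero) (S c)"
    "\<And>w' k. w \<sqsubseteq> w' \<Longrightarrow> k \<in> dom_n w' \<Longrightarrow> eqv w' (Ap g (S k)) (S (Ap g k))" "eqv w (Ap g a) b"
    using assms(1) unfolding lt_def by blast
  have w: "w \<in> worlds" using g(1) dom_worlds by blast
  then have ww: "w \<sqsubseteq> w" by (simp add: acc_refl)
  \<comment> \<open>The value of c decides: for c = 0 the function g is the successor, for c = S c'
    it is the successor of the function that adds S c'. In both cases the identity follows by
    induction on the argument.\<close>
  have "eqv w (S a) b \<or> (\<exists>c'\<in>dom_n w. \<exists>g'\<in>dom_f w. eqv w (Ap g' Zero) (S c') \<and>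
    (\<forall>w' k. w \<sqsubseteq> w' \<longrightarrow> k \<in> dom_n w' \<longrightarrow> eqv w' (Ap g' (S k)) (S (Ap g' k))) \<and> eqv w (S (Ap g' a)) b)"
    using zero_or_succ[OF g(1)]
  proof
    assume "eqv w c Zero"
    then have "eqv w (Ap g Zero) (Ap Succ Zero)" by (rule eqv_trans[OF g(3) eqv_S])
    then have "eqv w (Ap g a) (Ap Succ a)"
    proof (rule fun_eqv_induct[OF g(2) dom_intros(4)[OF w] _ _ assms(2)])
      show "eqv w' (Ap g (S n)) (S (S n))" if "w \<sqsubseteq> w'" "n \<in> dom_n w'" "eqv w' (Ap g n) (S n)" for w' n
        by (rule eqv_trans[OF g(4)[OF that(1,2)] eqv_S[OF that(3)]])
    qed
    then show ?thesis using eqv_euclid[OF _ g(5)] by blast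
  next
    assume "\<exists>c'\<in>dom_n w. eqv w c (S c')"
    then obtain c' where c': "c' \<in> dom_n w" "eqv w c (S c')" by blast
    obtain h where h: "h \<in> dom_f w" "eqv w (Ap h Zero) (S c')"
      "\<And>w' k. w \<sqsubseteq> w' \<Longrightarrow> k \<in> dom_n w' \<Longrightarrow> eqv w' (Ap h (S k)) (S (Ap h k))"
      using lt_add[OF c'(1)] by blast
    obtain f where f: "f \<in> dom_f w" "\<And>w' z. w \<sqsubseteq> w' \<Longrightarrow> z \<in> dom_n w' \<Longrightarrow> eqv w' (Ap f z) (S (Ap h z))"
      using slice_numbers[OF h(1), of "S (Ap (FV 0) (NV 0))" "\<lambda>z. S (Ap h z)"] by auto
    have "eqv w (Ap g a) (Ap f a)"
    proof (rule fun_eqv_induct[OF g(2) f(1) _ _ assms(2)])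
      show "eqv w (Ap g Zero) (Ap f Zero)"
        by (rule eqv_join[OF eqv_trans[OF g(3) eqv_S[OF c'(2)]]
              eqv_trans[OF f(2)[OF ww dom_intros(1)[OF w]] eqv_S[OF h(2)]]])
      show "eqv w' (Ap g (S n)) (Ap f (S n))" if "w \<sqsubseteq> w'" "n \<in> dom_n w'" "eqv w' (Ap g n) (Ap f n)" for w' n
        by (rule eqv_join[OF eqv_trans[OF g(4)[OF that(1,2)] eqv_S[OF eqv_trans[OF that(3) f(2)[OF that(1,2)]]]]
              eqv_trans[OF f(2)[OF that(1) unary_dom(1)[OF that(2)]] eqv_S[OF h(3)[OF that(1,2)]]]])
    qed
    from eqv_euclid[OF eqv_trans[OF this f(2)[OF ww assms(2)]] g(5)]
    show ?thesis using h c'(1) by blast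
  qed
  then consider (1) "eqv w (S a) b" | (2) c' g' where "c' \<in> dom_n w" "g' \<in> dom_f w" "eqv w (Ap g' Zero) (S c')"
    "\<And>w' k. w \<sqsubseteq> w' \<Longrightarrow> k \<in> dom_n w' \<Longrightarrow> eqv w' (Ap g' (S k)) (S (Ap g' k))" "eqv w (S (Ap g' a)) b"
    by blast
  note cases = this
  show "eqv w (S a) b \<or> lt w (S a) b"
  proof (cases rule: cases)
    case 2
    from eqv_trans[OF 2(4)[OF ww assms(2)] 2(5)] show ?thesis
      using 2(1-4) unfolding lt_def by blast
  qed simp
  show "eqv w a d \<or> lt w a d" if d: "d \<in> dom_n w" "eqv w b (S d)" for d
  proof (cases rule: cases)
    case 1
    from S_inj[OF eqv_trans[OF this d(2)] assms(2) d(1)] show ?thesis ..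
  next
    case 2
    from S_inj[OF eqv_trans[OF 2(5) d(2)] dom_intros(2)[OF 2(2) assms(2)] d(1)]
    show ?thesis using 2(1-4) unfolding lt_def by blast
  qed
qed

text \<open>Induction on b with a fixed; the three cases pass from b to S b by \<open>lt_S\<close>,
  \<open>lt_S_self\<close> and \<open>lt_split\<close>.\<close>

lemma lt_linear:
  assumes a: "a \<in> dom_n w" and b: "b \<in> dom_n w"
  shows "lt w a b \<or> eqv w a b \<or> lt w b a"
proof -
  have w: "w \<in> worlds" using a dom_worlds by blast
  let ?\<sigma> = "a \<rhd> (\<lambda>_. Zero)"
  have "force w (b \<rhd> ?\<sigma>) (\<lambda>_. Succ) (NV 1 \<^bold>< NV 0 \<^bold>\<or> NV 1 \<doteq> NV 0 \<^bold>\<or> NV 0 \<^bold>< NV 1)"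
  proof (rule induct_dom)
    show "env w ?\<sigma> (\<lambda>_. Succ)" using a env_base[OF w] by (simp add: env_push)
    have "eqv w a Zero \<or> lt w Zero a"
      using zero_or_succ[OF a]
    proof
      assume "\<exists>d\<in>dom_n w. eqv w a (S d)"
      then obtain d where d: "d \<in> dom_n w" "eqv w a (S d)" by blast
      obtain g where g: "g \<in> dom_f w" "eqv w (Ap g Zero) (S d)"
        "\<forall>w' k. w \<sqsubseteq> w' \<longrightarrow> k \<in> dom_n w' \<longrightarrow> eqv w' (Ap g (S k)) (S (Ap g k))"
        using lt_add[OF d(1)] by blast
      have "eqv w (Ap g Zero) a" by (rule eqv_join[OF g(2) d(2)])
      then show ?thesis unfolding lt_def using d(1) g by blast
    qed simp
    then show "force w (Zero \<rhd> ?\<sigma>) (\<lambda>_. Succ) (NV 1 \<^bold>< NV 0 \<^bold>\<or> NV 1 \<doteq> NV 0 \<^bold>\<or> NV 0 \<^bold>< NV 1)"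
      by (auto simp: force_less)
    fix w' d assume w': "w \<sqsubseteq> w'" "d \<in> dom_n w'"
      "force w' (d \<rhd> ?\<sigma>) (\<lambda>_. Succ) (NV 1 \<^bold>< NV 0 \<^bold>\<or> NV 1 \<doteq> NV 0 \<^bold>\<or> NV 0 \<^bold>< NV 1)"
    have a': "a \<in> dom_n w'" using dom_mono(1)[OF w'(1) a] .
    have "lt w' a d \<or> eqv w' a d \<or> lt w' d a" using w'(3) by (simp add: force_less)
    then have "lt w' a (S d) \<or> eqv w' a (S d) \<or> lt w' (S d) a"
      using lt_S[OF _ a'] lt_S_self lt_split(1)[OF _ w'(2)] eqv_sym by blast
    then show "force w' (S d \<rhd> ?\<sigma>) (\<lambda>_. Succ) (NV 1 \<^bold>< NV 0 \<^bold>\<or> NV 1 \<doteq> NV 0 \<^bold>\<or> NV 0 \<^bold>< NV 1)"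
      by (simp add: force_less)
  qed (use b in auto)
  then show ?thesis by (simp add: force_less)
qed

section \<open>The least number principle, search and characteristic functions\<close>

definition least_fm :: fm where
  "least_fm = (Ap (FV 0) (J (NV 1) (NV 0)) \<doteq> Zero \<^bold>\<and>
    All (NV 0 \<^bold>< NV 1 \<^bold>\<longrightarrow> \<^bold>\<not> Ap (FV 0) (J (NV 2) (NV 0)) \<doteq> Zero))"

definition nonzero_below :: "world \<Rightarrow> fnc \<Rightarrow> trm \<Rightarrow> trm \<Rightarrow> bool" where
  "nonzero_below w \<alpha> m y \<longleftrightarrow> (\<forall>w' n. w \<sqsubseteq> w' \<longrightarrow> n \<in> dom_n w' \<longrightarrow> lt w' n y \<longrightarrow> neqv w' (Ap \<alpha> (J m n)) Zero)"

lemma force_least_fm: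
  "force w (y \<rhd> m \<rhd> \<sigma>) (\<alpha> \<rhd> \<tau>) least_fm \<longleftrightarrow> eqv w (Ap \<alpha> (J m y)) Zero \<and> nonzero_below w \<alpha> m y"
  by (simp add: least_fm_def force_less nonzero_below_def All_Imp_iff)

text \<open>Induction on a bound z for the statement that there is no zero below z or a least zero
  exists. At z = S n the first alternative contradicts the zero at n.\<close>

lemma least_ex:
  assumes \<alpha>: "\<alpha> \<in> dom_f w" and m: "m \<in> dom_n w" and n: "n \<in> dom_n w" "eqv w (Ap \<alpha> (J m n)) Zero"
  shows "\<exists>y\<in>dom_n w. eqv w (Ap \<alpha> (J m y)) Zero \<and> nonzero_below w \<alpha> m y"
proof -
  have w: "w \<in> worlds" using m dom_worlds by blast
  let ?\<sigma> = "m \<rhd> (\<lambda>_. Zero)" and ?\<tau> = "\<alpha> \<rhd> (\<lambda>_. Succ)"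
  let ?B = "All (NV 0 \<^bold>< NV 1 \<^bold>\<longrightarrow> \<^bold>\<not> Ap (FV 0) (J (NV 2) (NV 0)) \<doteq> Zero)"
  let ?A = "?B \<^bold>\<or> Ex (sub least_fm (NV 0 \<rhd> (\<lambda>n. NV (Suc (Suc n)))) FV)"
  have A: "force w (z \<rhd> ?\<sigma>) ?\<tau> ?A \<longleftrightarrow> nonzero_below w \<alpha> m z \<or>
    (\<exists>y\<in>dom_n w. eqv w (Ap \<alpha> (J m y)) Zero \<and> nonzero_below w \<alpha> m y)" for w z
  proof -
    have "(\<lambda>n. sub_trm ((NV 0 \<rhd> (\<lambda>n. NV (Suc (Suc n)))) n) (y \<rhd> z \<rhd> ?\<sigma>) ?\<tau>) = (y \<rhd> ?\<sigma>)" for y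
      by (auto simp: fun_eq_iff split: nat.splits)
    moreover have "force w (z \<rhd> ?\<sigma>) ?\<tau> ?B \<longleftrightarrow> nonzero_below w \<alpha> m z"
      by (simp add: force_less nonzero_below_def All_Imp_iff)
    ultimately show ?thesis unfolding force.simps(4,7) force_sub by (simp add: force_least_fm)
  qed
  have "force w (S n \<rhd> ?\<sigma>) ?\<tau> ?A"
  proof (rule induct_dom)
    have "least_fm \<in> formulas BIM" by (simp add: least_fm_def)
    then show "?A \<in> formulas BIM"
      by (simp) (rule bim.sub_formulas, auto simp: bim.tsub_def split: nat.splits)
    show "env w ?\<sigma> ?\<tau>" using \<alpha> m env_base[OF w] by (simp add: env_push)
    show "force w (Zero \<rhd> ?\<sigma>) ?\<tau> ?A"
      unfolding A nonzero_below_def using not_lt_Zero by blast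
    fix w' d assume w': "w \<sqsubseteq> w'" "d \<in> dom_n w'" "force w' (d \<rhd> ?\<sigma>) ?\<tau> ?A"
    have d: "Ap \<alpha> (J m d) \<in> dom_n w'"
      by (rule dom_mono(1)[OF w'(1)] dom_intros(2)[OF dom_mono(2)[OF w'(1) \<alpha>] dom_intros(3)[OF dom_mono(1)[OF w'(1) m] w'(2)]])+
    \<comment> \<open>If the value at d is 0 then d is a least zero; otherwise the bound moves on to
      S d, because k < S d means k = d or k < d.\<close>
    have "nonzero_below w' \<alpha> m (S d) \<or> eqv w' (Ap \<alpha> (J m d)) Zero" if below: "nonzero_below w' \<alpha> m d"
    proof -
      have "eqv w' (Ap \<alpha> (J m d)) Zero \<or> neqv w' (Ap \<alpha> (J m d)) Zero"
        by (rule eqv_decidable[OF d unary_dom(4)[OF d]])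
      then show ?thesis
      proof
        assume ne: "neqv w' (Ap \<alpha> (J m d)) Zero"
        have "neqv w'' (Ap \<alpha> (J m k)) Zero" if k: "w' \<sqsubseteq> w''" "k \<in> dom_n w''" "lt w'' k (S d)" for w'' k
        proof -
          have d': "d \<in> dom_n w''" using dom_mono(1)[OF k(1) w'(2)] .
          from lt_split(2)[OF k(3,2) d' eqv_refl[OF unary_dom(1)[OF d']]] show ?thesis
          proof
            assume kd: "eqv w'' k d"
            show ?thesis
            proof (intro HOL.allI HOL.impI notI)
              fix u assume u: "w'' \<sqsubseteq> u" "eqv u (Ap \<alpha> (J m k)) Zero"
              have wu: "w \<sqsubseteq> u" "w' \<sqsubseteq> u" using acc_trans w'(1) k(1) u(1) by blast+
              have "eqv u (Ap \<alpha> (J m k)) (Ap \<alpha> (J m d))"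
                by (rule eqv_Ap[OF eqv_J[OF eqv_refl[OF dom_mono(1)[OF wu(1) m]] eqv_mono[OF u(1) kd]] dom_mono(2)[OF wu(1) \<alpha>]])
              from eqv_euclid[OF this u(2)] show False using ne wu(2) by blast
            qed
          next
            assume "lt w'' k d"
            then show ?thesis using below k(1,2) unfolding nonzero_below_def by blast
          qed
        qed
        then show ?thesis unfolding nonzero_below_def by blast
      qed simp
    qed
    then show "force w' (S d \<rhd> ?\<sigma>) ?\<tau> ?A" using w'(2,3) unfolding A by blast
  qed (rule unary_dom(1)[OF n(1)])
  then have "nonzero_below w \<alpha> m (S n) \<or> (\<exists>y\<in>dom_n w. eqv w (Ap \<alpha> (J m y)) Zero \<and> nonzero_below w \<alpha> m y)"
    unfolding A .
  moreover have "\<not> nonzero_below w \<alpha> m (S n)"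
    unfolding nonzero_below_def
    using lt_S_self[OF eqv_refl[OF n(1)]] n acc_refl[of w] w by blast
  ultimately show ?thesis by blast
qed

lemma least_unique:
  assumes "y \<in> dom_n w" "z \<in> dom_n w" "eqv w (Ap \<alpha> (J m y)) Zero" "nonzero_below w \<alpha> m y"
    "eqv w (Ap \<alpha> (J m z)) Zero" "nonzero_below w \<alpha> m z"
  shows "eqv w y z"
proof -
  have "w \<sqsubseteq> w" using assms(1) dom_worlds by (simp add: acc_refl)
  then have "\<not> lt w y z" "\<not> lt w z y" using assms unfolding nonzero_below_def by blast+
  then show ?thesis using lt_linear[OF assms(1,2)] by blast
qed

text \<open>Least zeros are unique by linearity of the order, so unique choice applies to
  them.\<close>

lemma force_search: assumes "env w \<sigma> \<tau>" shows "force w \<sigma> \<tau> search_axiom"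
proof -
  have *: "\<exists>\<gamma>\<in>dom_f w. \<forall>w'. w \<sqsubseteq> w' \<longrightarrow> (\<forall>m\<in>dom_n w'.
      eqv w' (Ap \<alpha> (J m (Ap \<gamma> m))) Zero \<and> nonzero_below w' \<alpha> m (Ap \<gamma> m))"
    if \<alpha>: "\<alpha> \<in> dom_f w" and ex: "\<And>w' m. w \<sqsubseteq> w' \<Longrightarrow> m \<in> dom_n w' \<Longrightarrow> \<exists>n\<in>dom_n w'. eqv w' (Ap \<alpha> (J m n)) Zero" for w \<alpha>
  proof -
    have w: "w \<in> worlds" using \<alpha> dom_worlds by blast
    let ?\<sigma> = "\<lambda>_. Zero" and ?\<tau> = "\<alpha> \<rhd> (\<lambda>_. Succ)"
    have "\<exists>\<gamma>\<in>dom_f w. \<forall>w' m. w \<sqsubseteq> w' \<longrightarrow> m \<in> dom_n w' \<longrightarrow> force w' (Ap \<gamma> m \<rhd> m \<rhd> ?\<sigma>) ?\<tau> least_fm"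
    proof (rule unique_choice)
      show "least_fm \<in> formulas BIM" by (simp add: least_fm_def)
      show "env w ?\<sigma> ?\<tau>" using \<alpha> env_base[OF w] by (simp add: env_push)
      show "\<exists>y\<in>dom_n w'. force w' (y \<rhd> m \<rhd> ?\<sigma>) ?\<tau> least_fm" if "w \<sqsubseteq> w'" "m \<in> dom_n w'" for w' m
        unfolding force_least_fm using least_ex[OF dom_mono(2)[OF that(1) \<alpha>] that(2)] ex[OF that] by blast
    qed (use least_unique in \<open>unfold force_least_fm, blast\<close>)
    then show ?thesis unfolding force_least_fm by blast
  qed
  show ?thesis
    unfolding search_axiom_def
  proof (simp add: force_less All_Imp_iff, intro HOL.allI HOL.impI ballI)
    fix w' \<alpha> w''
    assume \<alpha>: "\<alpha> \<in> dom_f w'" "w' \<sqsubseteq> w''"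
      and "\<forall>v. w'' \<sqsubseteq> v \<longrightarrow> (\<forall>m\<in>dom_n v. \<exists>n\<in>dom_n v. eqv v (Ap \<alpha> (J m n)) Zero)"
    then have "\<exists>\<gamma>\<in>dom_f w''. \<forall>w'. w'' \<sqsubseteq> w' \<longrightarrow> (\<forall>m\<in>dom_n w'.
      eqv w' (Ap \<alpha> (J m (Ap \<gamma> m))) Zero \<and> nonzero_below w' \<alpha> m (Ap \<gamma> m))"
      by (intro *) (auto intro: dom_mono(2))
    then show "\<exists>\<gamma>\<in>dom_f w''. \<forall>w'. w'' \<sqsubseteq> w' \<longrightarrow> (\<forall>m\<in>dom_n w'.
      eqv w' (Ap \<alpha> (J m (Ap \<gamma> m))) Zero \<and> (\<forall>w''. w' \<sqsubseteq> w'' \<longrightarrow> (\<forall>n. n \<in> dom_n w'' \<longrightarrow>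
        lt w'' n (Ap \<gamma> m) \<longrightarrow> neqv w'' (Ap \<alpha> (J m n)) Zero)))"
      by (simp add: nonzero_below_def)
  qed
qed

text \<open>The characteristic function is chosen by the formula that says B and y = 0, or not B and
  y = 1. It is total by the decidability of B, and single-valued because the mixed cases are
  contradictory.\<close>

lemma force_CFd:
  assumes B: "B \<in> formulas BIM" and env: "env w \<sigma> \<tau>"
  shows "force w \<sigma> \<tau> (CFd B)"
proof -
  let ?A = "(lift B \<^bold>\<and> NV 0 \<doteq> Zero) \<^bold>\<or> (\<^bold>\<not> lift B \<^bold>\<and> NV 0 \<doteq> One)"
  have A: "force w' (y \<rhd> x \<rhd> \<sigma>) \<tau> ?A \<longleftrightarrow> force w' (x \<rhd> \<sigma>) \<tau> B \<and> eqv w' y Zero \<or>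
     (\<forall>w''. w' \<sqsubseteq> w'' \<longrightarrow> \<not> force w'' (x \<rhd> \<sigma>) \<tau> B) \<and> eqv w' y One" for w' x y
    by (simp add: lift_def force_sub)
  have L: "force w' (x \<rhd> \<sigma>) (\<beta> \<rhd> \<tau>) (flift B) \<longleftrightarrow> force w' (x \<rhd> \<sigma>) \<tau> B" for w' x \<beta>
    by (simp add: flift_def force_sub)
  have main: "\<exists>\<beta>\<in>dom_f u. \<forall>w' x. u \<sqsubseteq> w' \<longrightarrow> x \<in> dom_n w' \<longrightarrow>
      (lt w' (Ap \<beta> x) One \<or> eqv w' (Ap \<beta> x) One) \<and> (eqv w' (Ap \<beta> x) Zero \<longleftrightarrow> force w' (x \<rhd> \<sigma>) \<tau> B)"
    if u: "w \<sqsubseteq> u" and dec: "\<And>w' x. u \<sqsubseteq> w' \<Longrightarrow> x \<in> dom_n w' \<Longrightarrow>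
      force w' (x \<rhd> \<sigma>) \<tau> B \<or> (\<forall>w''. w' \<sqsubseteq> w'' \<longrightarrow> \<not> force w'' (x \<rhd> \<sigma>) \<tau> B)" for u
  proof -
    have "\<exists>\<beta>\<in>dom_f u. \<forall>w' x. u \<sqsubseteq> w' \<longrightarrow> x \<in> dom_n w' \<longrightarrow> force w' (Ap \<beta> x \<rhd> x \<rhd> \<sigma>) \<tau> ?A"
    proof (rule unique_choice)
      show "?A \<in> formulas BIM" using B by simp
      show "env u \<sigma> \<tau>" using env_mono[OF u env] .
      show "\<exists>y\<in>dom_n w'. force w' (y \<rhd> x \<rhd> \<sigma>) \<tau> ?A" if w': "u \<sqsubseteq> w'" "x \<in> dom_n w'" for w' x
      proof -
        have "Zero \<in> dom_n w'" "One \<in> dom_n w'" using unary_dom[OF w'(2)] unary_dom(1) by blast+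
        then show ?thesis using dec[OF w'] unfolding A using eqv_refl by blast
      qed
      fix w' x y z assume w': "u \<sqsubseteq> w'" "x \<in> dom_n w'" "force w' (y \<rhd> x \<rhd> \<sigma>) \<tau> ?A" "force w' (z \<rhd> x \<rhd> \<sigma>) \<tau> ?A"
      have "w' \<sqsubseteq> w'" using w'(1) by (simp add: acc_def)
      then show "eqv w' y z" using w'(3,4) unfolding A by (blast intro: eqv_join)
    qed
    then obtain \<beta> where \<beta>: "\<beta> \<in> dom_f u" "\<And>w' x. u \<sqsubseteq> w' \<Longrightarrow> x \<in> dom_n w' \<Longrightarrow>
       force w' (x \<rhd> \<sigma>) \<tau> B \<and> eqv w' (Ap \<beta> x) Zero \<or>
       (\<forall>w''. w' \<sqsubseteq> w'' \<longrightarrow> \<not> force w'' (x \<rhd> \<sigma>) \<tau> B) \<and> eqv w' (Ap \<beta> x) One"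
      unfolding A by blast
    have "(lt w' (Ap \<beta> x) One \<or> eqv w' (Ap \<beta> x) One) \<and> (eqv w' (Ap \<beta> x) Zero \<longleftrightarrow> force w' (x \<rhd> \<sigma>) \<tau> B)"
      if w': "u \<sqsubseteq> w'" "x \<in> dom_n w'" for w' x
    proof -
      have ww: "w' \<sqsubseteq> w'" using w'(1) by (simp add: acc_def)
      have "Zero \<in> dom_n w'" using unary_dom[OF w'(2)] by blast
      then show ?thesis using \<beta>(2)[OF w'] lt_S_self[of w' "Ap \<beta> x" Zero] Zero_S[of w' "Ap \<beta> x" Zero] ww by blast
    qed
    then show ?thesis using \<beta>(1) by blast
  qed
  have "\<exists>\<beta>\<in>dom_f u. force u \<sigma> (\<beta> \<rhd> \<tau>)
      (All (Ap (FV 0) (NV 0) \<^bold>\<le> One \<^bold>\<and> (Ap (FV 0) (NV 0) \<doteq> Zero \<^bold>\<longleftrightarrow> flift B)))"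
    if u: "w \<sqsubseteq> u" and dec: "force u \<sigma> \<tau> (All (B \<^bold>\<or> \<^bold>\<not> B))" for u
  proof -
    obtain \<beta> where \<beta>: "\<beta> \<in> dom_f u" "\<And>w' x. u \<sqsubseteq> w' \<Longrightarrow> x \<in> dom_n w' \<Longrightarrow>
      (lt w' (Ap \<beta> x) One \<or> eqv w' (Ap \<beta> x) One) \<and> (eqv w' (Ap \<beta> x) Zero \<longleftrightarrow> force w' (x \<rhd> \<sigma>) \<tau> B)"
      using main[OF u] dec by auto
    have "eqv v (Ap \<beta> x) Zero \<longleftrightarrow> force v (x \<rhd> \<sigma>) \<tau> B" if "u \<sqsubseteq> w'" "x \<in> dom_n w'" "w' \<sqsubseteq> v" for w' x v
      using \<beta>(2) acc_trans[OF that(1,3)] dom_mono(1)[OF that(3,2)] by blast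
    then have "force u \<sigma> (\<beta> \<rhd> \<tau>) (All (Ap (FV 0) (NV 0) \<^bold>\<le> One \<^bold>\<and> (Ap (FV 0) (NV 0) \<doteq> Zero \<^bold>\<longleftrightarrow> flift B)))"
      using \<beta>(2) by (simp add: le_fm_def Iff_def force_less L)
    then show ?thesis using \<beta>(1) by blast
  qed
  then show ?thesis unfolding CFd_def force.simps(5,9) by blast
qed

text \<open>Holds for every system with unique choice; applied to Mj it shows that Mj extends BIM +
  CFd.\<close>

lemma BIM_CFd_theorem:
  assumes "A \<in> axioms BIM_CFd" "A \<in> formulas BIM_CFd" shows "T \<parallel> \<Gamma> \<turnstile> A"
proof -
  have "A \<in> formulas BIM" using assms(2) by (simp add: BIM_CFd_def formulas_def)
  then have AT: "A \<in> formulas T" by (rule bim_formulas)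
  have composition: "force w \<sigma> \<tau> composition_axiom" for w \<sigma> \<tau>
  proof -
    have "\<exists>\<gamma>\<in>dom_f w. \<forall>w' x. w \<sqsubseteq> w' \<longrightarrow> x \<in> dom_n w' \<longrightarrow> eqv w' (Ap \<gamma> x) (Ap \<alpha> (Ap \<beta> x))"
      if "\<alpha> \<in> dom_f w" "\<beta> \<in> dom_f w" for w \<alpha> \<beta>
      using explicit_definition[of "Ap (FV 0) (Ap (FV 1) (NV 0))" w "\<lambda>_. Zero" "\<alpha> \<rhd> \<beta> \<rhd> (\<lambda>_. Succ)"]
        that env_base dom_worlds(2)[OF that(1)] by (simp add: env_push)
    then show ?thesis unfolding composition_axiom_def by simp (meson dom_mono(2))
  qed
  have pairing: "force w \<sigma> \<tau> fun_pairing_axiom" for w \<sigma> \<tau>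
  proof -
    have "\<exists>\<gamma>\<in>dom_f w. \<forall>w' x. w \<sqsubseteq> w' \<longrightarrow> x \<in> dom_n w' \<longrightarrow> eqv w' (Ap \<gamma> x) (J (Ap \<alpha> x) (Ap \<beta> x))"
      if "\<alpha> \<in> dom_f w" "\<beta> \<in> dom_f w" for w \<alpha> \<beta>
      using explicit_definition[of "J (Ap (FV 0) (NV 0)) (Ap (FV 1) (NV 0))" w "\<lambda>_. Zero" "\<alpha> \<rhd> \<beta> \<rhd> (\<lambda>_. Succ)"]
        that env_base dom_worlds(2)[OF that(1)] by (simp add: env_push)
    then show ?thesis unfolding fun_pairing_axiom_def by simp (meson dom_mono(2))
  qed
  have param_rec: "force w \<sigma> \<tau> primrec_axiom" for w \<sigma> \<tau>
  proof (simp add: primrec_axiom_def, intro HOL.allI HOL.impI ballI)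
    fix w' w'' \<alpha> \<beta> assume "w' \<sqsubseteq> w''" "\<alpha> \<in> dom_f w'" "\<beta> \<in> dom_f w''"
    then obtain \<gamma> where \<gamma>: "\<gamma> \<in> dom_f w''" "\<And>u m n. w'' \<sqsubseteq> u \<Longrightarrow> m \<in> dom_n u \<Longrightarrow> n \<in> dom_n u \<Longrightarrow>
      eqv u (Ap \<gamma> (J m Zero)) (Ap \<alpha> m) \<and> eqv u (Ap \<gamma> (J m (S n))) (Ap \<beta> (J (J m n) (Ap \<gamma> (J m n))))"
      using parameter_recursion[of \<alpha> w'' \<beta>] dom_mono(2) by blast
    show "\<exists>\<gamma>\<in>dom_f w''. \<forall>u. w'' \<sqsubseteq> u \<longrightarrow> (\<forall>m\<in>dom_n u. \<forall>v. u \<sqsubseteq> v \<longrightarrow> (\<forall>n\<in>dom_n v.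
      eqv v (Ap \<gamma> (J m Zero)) (Ap \<alpha> m) \<and> eqv v (Ap \<gamma> (J m (S n))) (Ap \<beta> (J (J m n) (Ap \<gamma> (J m n))))))"
      using \<gamma>(2)[OF acc_trans _ _] dom_mono(1) by (intro bexI[OF _ \<gamma>(1)]) blast
  qed
  have forced: "T \<parallel> {} \<turnstile> A" if "\<And>w \<sigma> \<tau>. env w \<sigma> \<tau> \<Longrightarrow> force w \<sigma> \<tau> A"
    by (rule complete) (use AT that in auto)
  consider "A \<in> arith_axioms \<union> bim_constant_axioms" | "A = composition_axiom" | "A = fun_pairing_axiom"
    | "A = primrec_axiom" | "A = search_axiom" | B where "A = induction_axiom B" "B \<in> formulas BIM"
    | B where "A = CFd B" "B \<in> formulas BIM"
    using assms(1) by (auto simp: BIM_CFd_def BIM_def formulas_def)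
  then have "T \<parallel> {} \<turnstile> A"
  proof cases
    case 1 then show ?thesis by (rule arith_ax)
  next
    case 2 then show ?thesis using composition by (intro forced) simp
  next
    case 3 then show ?thesis using pairing by (intro forced) simp
  next
    case 4 then show ?thesis using param_rec by (intro forced) simp
  next
    case 5 then show ?thesis using force_search by (intro forced) simp
  next
    case 6 then show ?thesis using induction_ax by simp
  next
    case 7 then show ?thesis using force_CFd by (intro forced) simp
  qed
  then show ?thesis by (rule derives_weaken) simp
qed

end

lemma derives_transfer:
  assumes terms: "terms S1 \<subseteq> terms S2" "functors S1 \<subseteq> functors S2"
    and ax: "\<And>A \<Gamma>. A \<in> axioms S1 \<Longrightarrow> A \<in> formulas S1 \<Longrightarrow> S2 \<parallel> \<Gamma> \<turnstile> A"
    and d: "S1 \<parallel> \<Gamma> \<turnstile> E"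
  shows "S2 \<parallel> \<Gamma> \<turnstile> E"
proof -
  have f: "A \<in> formulas S2" if "A \<in> formulas S1" for A
    using that terms(1) unfolding formulas_def by (induction A) auto
  show ?thesis
    using d
  proof (induction rule: derives.induct)
    case (assm A \<Gamma>) then show ?case by (simp add: derives.assm f)
  next
    case (ax A \<Gamma>) then show ?case by (rule assms(3))
  next
    case (negI A \<Gamma> B) then show ?case by (meson derives.negI f)
  next
    case (negE \<Gamma> A B) then show ?case by (meson derives.negE f)
  next
    case (orI1 \<Gamma> A B) then show ?case by (meson derives.orI1 f)
  next
    case (orI2 \<Gamma> A B) then show ?case by (meson derives.orI2 f)
  next
    case (impI A \<Gamma> B) then show ?case by (meson derives.impI f)
  next
    case (exI \<Gamma> A t) then show ?case by (meson derives.exI f terms subsetD)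
  next
    case (fexI \<Gamma> A t) then show ?case by (meson derives.fexI f terms subsetD)
  next
    case (allE \<Gamma> A t) then show ?case by (meson derives.allE terms subsetD)
  next
    case (fallE \<Gamma> A t) then show ?case by (meson derives.fallE terms subsetD)
  qed (meson derives.intros)+
qed

section \<open>Unique choice in BIM with CFd\<close>

lemma BIM_CFd_simps [simp]: "terms BIM_CFd = {t. bim_trm t}" "functors BIM_CFd = {u. bim_fnc u}"
  "formulas BIM_CFd = formulas BIM"
  by (simp_all add: BIM_CFd_def formulas_def BIM_def)

lemma induction_axiom_formulas: "A \<in> formulas BIM \<Longrightarrow> induction_axiom A \<in> formulas BIM"
  by (auto simp: induction_axiom_def bim.tsub_def split: nat.splits intro!: bim.inst_formulas bim.sub_formulas)

lemma CFd_formulas: "B \<in> formulas BIM \<Longrightarrow> CFd B \<in> formulas BIM"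
  by (simp add: CFd_def le_fm_def less_fm_def Iff_def)

global_interpretation bimc: arith_model BIM_CFd
proof
  show "BIM_CFd \<parallel> {} \<turnstile> A" if "A \<in> arith_axioms \<union> bim_constant_axioms" for A
    using that by (intro derives.ax)
      (auto simp: BIM_CFd_def BIM_def arith_axioms_def bim_constant_axioms_def pairing_axioms_def formulas_def ZeroF_def IdF_def)
  show "BIM_CFd \<parallel> {} \<turnstile> induction_axiom A" if "A \<in> formulas BIM" for A
    using that induction_axiom_formulas[OF that]
    by (intro derives.ax) (auto simp: BIM_CFd_def BIM_def formulas_def)
qed (auto intro: bim_closed simp: ZeroF_def IdF_def)

lemma AC00u_formulas: "A \<in> formulas BIM \<Longrightarrow> AC00u A \<in> formulas BIM"
  by (auto simp: AC00u_def Ex1_def bim.tsub_def split: nat.splits intro!: bim.sub_formulas)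

context arith_model
begin

context
  assumes CFd_theorem: "\<And>B. B \<in> formulas BIM \<Longrightarrow> T \<parallel> {} \<turnstile> CFd B"
    and search_theorem: "T \<parallel> {} \<turnstile> search_axiom"
begin

lemma unique_choice_from_search:
  assumes A: "A \<in> formulas BIM" and env: "env u \<sigma> \<tau>"
    and un: "\<And>w' x. u \<sqsubseteq> w' \<Longrightarrow> x \<in> dom_n w' \<Longrightarrow> \<exists>y\<in>dom_n w'. force w' (y \<rhd> x \<rhd> \<sigma>) \<tau> A \<and>
      (\<forall>w'' z. w' \<sqsubseteq> w'' \<longrightarrow> z \<in> dom_n w'' \<longrightarrow> force w'' (z \<rhd> x \<rhd> \<sigma>) \<tau> A \<longrightarrow> eqv w'' y z)"
  shows "\<exists>f\<in>dom_f u. \<forall>w' x. u \<sqsubseteq> w' \<longrightarrow> x \<in> dom_n w' \<longrightarrow> force w' (Ap f x \<rhd> x \<rhd> \<sigma>) \<tau> A"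
proof -
  have uu: "u \<sqsubseteq> u" using env by (simp add: acc_refl env_worlds)
  \<comment> \<open>CFd speaks of one number variable, so x and y are packed into a pair and read
    off again by \<open>PK\<close> and \<open>PL\<close>.\<close>
  let ?B = "sub A (Ap PL (NV 0) \<rhd> Ap PK (NV 0) \<rhd> (\<lambda>n. NV (Suc n))) FV"
  have B: "?B \<in> formulas BIM"
    using A by (auto simp: bim.tsub_def split: nat.splits intro!: bim.sub_formulas)
  have fB: "force w' (z \<rhd> \<sigma>') \<tau>' ?B \<longleftrightarrow> force w' (Ap PL z \<rhd> Ap PK z \<rhd> \<sigma>') \<tau>' A" for w' z \<sigma>' \<tau>'
    by (simp add: force_sub sub_push)
  have cong: "force w' (y \<rhd> x \<rhd> \<sigma>) \<tau> A \<Longrightarrow> force w' (y' \<rhd> x' \<rhd> \<sigma>) \<tau> A"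
    if "u \<sqsubseteq> w'" "eqv w' y y'" "eqv w' x x'" for w' x x' y y'
    using force_cong[OF A enveq_push(1)[OF enveq_push(1)[OF enveq_refl[OF env_mono[OF that(1) env]] that(3)] that(2)]]
    by blast
  \<comment> \<open>The projections of a pair are its components only up to \<open>eqv\<close>,
    hence the appeal to congruence.\<close>
  have fJ: "force w' (J x y \<rhd> \<sigma>) \<tau> ?B \<longleftrightarrow> force w' (y \<rhd> x \<rhd> \<sigma>) \<tau> A"
    if "u \<sqsubseteq> w'" "x \<in> dom_n w'" "y \<in> dom_n w'" for w' x y
    unfolding fB using cong[OF that(1) PL_J[OF that(2,3)] PK_J[OF that(2,3)]]
      cong[OF that(1) eqv_sym[OF PL_J[OF that(2,3)]] eqv_sym[OF PK_J[OF that(2,3)]]] by blast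
  have dec: "force w' (z \<rhd> \<sigma>) \<tau> ?B \<or> (\<forall>w''. w' \<sqsubseteq> w'' \<longrightarrow> \<not> force w'' (z \<rhd> \<sigma>) \<tau> ?B)"
    if w': "u \<sqsubseteq> w'" "z \<in> dom_n w'" for w' z
  proof -
    obtain y where y: "y \<in> dom_n w'" "force w' (y \<rhd> Ap PK z \<rhd> \<sigma>) \<tau> A"
      "\<And>w'' v. w' \<sqsubseteq> w'' \<Longrightarrow> v \<in> dom_n w'' \<Longrightarrow> force w'' (v \<rhd> Ap PK z \<rhd> \<sigma>) \<tau> A \<Longrightarrow> eqv w'' y v"
      using un[OF w'(1) unary_dom(2)[OF w'(2)]] by blast
    from eqv_decidable[OF y(1) unary_dom(3)[OF w'(2)]] show ?thesis
    proof
      assume "eqv w' y (Ap PL z)"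
      then show ?thesis unfolding fB using cong[OF w'(1) _ eqv_refl[OF unary_dom(2)[OF w'(2)]]] y(2) by blast
    next
      assume "neqv w' y (Ap PL z)"
      then show ?thesis unfolding fB using y(3) unary_dom(3)[OF dom_mono(1)[OF _ w'(2)]] by blast
    qed
  qed
  have "force u \<sigma> \<tau> (CFd ?B)"
    by (rule sound[OF CFd_theorem[OF B] env])
  moreover have "force u \<sigma> \<tau> (All (?B \<^bold>\<or> \<^bold>\<not> ?B))"
    unfolding force.simps(2,4,6) using dec by blast
  ultimately obtain \<beta> where \<beta>: "\<beta> \<in> dom_f u"
    "force u \<sigma> (\<beta> \<rhd> \<tau>) (All (Ap (FV 0) (NV 0) \<^bold>\<le> One \<^bold>\<and> (Ap (FV 0) (NV 0) \<doteq> Zero \<^bold>\<longleftrightarrow> flift ?B)))"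
    unfolding CFd_def force.simps(5,9) using uu by blast
  have \<beta>B: "eqv w' (Ap \<beta> z) Zero \<longleftrightarrow> force w' (z \<rhd> \<sigma>) \<tau> ?B" if "u \<sqsubseteq> w'" "z \<in> dom_n w'" for w' z
  proof -
    have "w' \<sqsubseteq> w'" using that(1) by (simp add: acc_def)
    moreover have "force w'' (z \<rhd> \<sigma>) (\<beta> \<rhd> \<tau>) (flift ?B) \<longleftrightarrow> force w'' (z \<rhd> \<sigma>) \<tau> ?B" for w''
      by (simp add: flift_def force_sub[of _ _ _ "?B"])
    moreover have "force w' (z \<rhd> \<sigma>) (\<beta> \<rhd> \<tau>) (Ap (FV 0) (NV 0) \<doteq> Zero \<^bold>\<longleftrightarrow> flift ?B)"
      using \<beta>(2) that by simp
    ultimately show ?thesis unfolding Iff_def force.simps(3,5) by (simp add: fB) blast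
  qed
  have ex: "\<exists>n\<in>dom_n w'. eqv w' (Ap \<beta> (J m n)) Zero" if w': "u \<sqsubseteq> w'" "m \<in> dom_n w'" for w' m
  proof -
    obtain y where "y \<in> dom_n w'" "force w' (y \<rhd> m \<rhd> \<sigma>) \<tau> A" using un[OF w'] by blast
    then show ?thesis using \<beta>B[OF w'(1) dom_intros(3)[OF w'(2)]] fJ[OF w'] by blast
  qed
  let ?C = "All (NV 0 \<^bold>< Ap (FV 0) (NV 1) \<^bold>\<longrightarrow> \<^bold>\<not> Ap (FV 1) (J (NV 1) (NV 0)) \<doteq> Zero)"
  have "force u \<sigma> \<tau> search_axiom"
    by (rule sound[OF search_theorem env])
  then have "force u \<sigma> (\<beta> \<rhd> \<tau>) (All (Ex (Ap (FV 0) (J (NV 1) (NV 0)) \<doteq> Zero)) \<^bold>\<longrightarrow>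
     FEx (All (Ap (FV 1) (J (NV 0) (Ap (FV 0) (NV 0))) \<doteq> Zero \<^bold>\<and> ?C)))"
    using uu \<beta>(1) unfolding search_axiom_def force.simps(8) by blast
  moreover have "force u \<sigma> (\<beta> \<rhd> \<tau>) (All (Ex (Ap (FV 0) (J (NV 1) (NV 0)) \<doteq> Zero)))"
    using ex by simp
  ultimately have "force u \<sigma> (\<beta> \<rhd> \<tau>) (FEx (All (Ap (FV 1) (J (NV 0) (Ap (FV 0) (NV 0))) \<doteq> Zero \<^bold>\<and> ?C)))"
    using uu unfolding force.simps(5) by blast
  then obtain \<gamma> where \<gamma>: "\<gamma> \<in> dom_f u" "\<And>w' m. u \<sqsubseteq> w' \<Longrightarrow> m \<in> dom_n w' \<Longrightarrow> eqv w' (Ap \<beta> (J m (Ap \<gamma> m))) Zero"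
    unfolding force.simps(3,6,9) by auto
  have "force w' (Ap \<gamma> x \<rhd> x \<rhd> \<sigma>) \<tau> A" if w': "u \<sqsubseteq> w'" "x \<in> dom_n w'" for w' x
  proof -
    have d: "Ap \<gamma> x \<in> dom_n w'" by (rule dom_intros(2)[OF dom_mono(2)[OF w'(1) \<gamma>(1)] w'(2)])
    show ?thesis using \<gamma>(2)[OF w'] \<beta>B[OF w'(1) dom_intros(3)[OF w'(2) d]] fJ[OF w' d] by blast
  qed
  then show ?thesis using \<gamma>(1) by blast
qed

lemma AC00u_from_search:
  assumes A: "A \<in> formulas BIM" shows "T \<parallel> {} \<turnstile> AC00u A"
proof (rule complete)
  fix w \<sigma> \<tau> assume env: "env w \<sigma> \<tau>"
  have 1: "force w' (z \<rhd> y \<rhd> x \<rhd> \<sigma>) \<tau> (sub A (NV 0 \<rhd> (\<lambda>n. NV (Suc (Suc n)))) FV) \<longleftrightarrow> force w' (z \<rhd> x \<rhd> \<sigma>) \<tau> A"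
    for w' x y z by (simp add: force_sub sub_push)
  have 2: "force w' (x \<rhd> \<sigma>) (f \<rhd> \<tau>) (sub A (Ap (FV 0) (NV 0) \<rhd> NV) (\<lambda>n. FV (Suc n)))
    \<longleftrightarrow> force w' (Ap f x \<rhd> x \<rhd> \<sigma>) \<tau> A" for w' x f by (simp add: force_sub sub_push)
  have "force u \<sigma> \<tau> (FEx (All (sub A (Ap (FV 0) (NV 0) \<rhd> NV) (\<lambda>n. FV (Suc n)))))"
    if u: "w \<sqsubseteq> u" "force u \<sigma> \<tau> (All (Ex1 A))" for u
  proof -
    have "\<exists>y\<in>dom_n w'. force w' (y \<rhd> x \<rhd> \<sigma>) \<tau> A \<and>
      (\<forall>w'' z. w' \<sqsubseteq> w'' \<longrightarrow> z \<in> dom_n w'' \<longrightarrow> force w'' (z \<rhd> x \<rhd> \<sigma>) \<tau> A \<longrightarrow> eqv w'' y z)"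
      if w': "u \<sqsubseteq> w'" "x \<in> dom_n w'" for w' x
    proof -
      have "force w' (x \<rhd> \<sigma>) \<tau> (Ex1 A)" using u(2) w' by simp
      then obtain y where y: "y \<in> dom_n w'" "force w' (y \<rhd> x \<rhd> \<sigma>) \<tau> A"
        "\<And>w'' z v. w' \<sqsubseteq> w'' \<Longrightarrow> z \<in> dom_n w'' \<Longrightarrow> w'' \<sqsubseteq> v \<Longrightarrow> force v (z \<rhd> x \<rhd> \<sigma>) \<tau> A \<Longrightarrow> eqv v y z"
        unfolding Ex1_def force.simps 1 by auto
      have "eqv w'' y z" if "w' \<sqsubseteq> w''" "z \<in> dom_n w''" "force w'' (z \<rhd> x \<rhd> \<sigma>) \<tau> A" for w'' z
        by (rule y(3)[OF that(1,2) _ that(3)]) (use that(1) in \<open>simp add: acc_def\<close>)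
      then show ?thesis using y(1,2) by blast
    qed
    from unique_choice_from_search[OF A env_mono[OF u(1) env] this] show ?thesis
      unfolding force.simps 2 by blast
  qed
  then show "force w \<sigma> \<tau> (AC00u A)" unfolding AC00u_def force.simps(5) by blast
qed (use bim_formulas[OF AC00u_formulas[OF A]] in auto)

end

end

lemma search_axiom_formulas: "search_axiom \<in> formulas BIM"
  by (simp add: search_axiom_def less_fm_def)

text \<open>From here on every function constructed in \<open>choice_model\<close> exists in the
  models of BIM + CFd.\<close>

global_interpretation bimc: choice_model BIM_CFd
proof
  show "BIM_CFd \<parallel> {} \<turnstile> AC00u A" if "A \<in> formulas BIM" for A
    by (rule bimc.AC00u_from_search[OF _ _ that]; rule derives.ax)
      (use CFd_formulas search_axiom_formulas in \<open>auto simp: BIM_CFd_def formulas_def BIM_def\<close>)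
qed

section \<open>The translation\<close>

text \<open>The graph of a term is a formula about an environment function \<open>\<eta>\<close>, which is always FV 0, and a
  value, which is always NV 0; for a functor NV 1 is the argument. Since no other variables
  are free, subformulas never have to be renamed.\<close>

definition push_fm :: "fnc \<Rightarrow> fnc \<Rightarrow> trm \<Rightarrow> fm" where
  "push_fm e' e x = (Ap e' (J Zero Zero) \<doteq> x \<^bold>\<and>
    All (Ap e' (J Zero (S (NV 0))) \<doteq> Ap e (J Zero (NV 0))) \<^bold>\<and>
    All (All (Ap e' (J (S (NV 1)) (NV 0)) \<doteq> Ap e (J (S (NV 1)) (NV 0)))))"

text \<open>Graphs read their environment from FV 0. Where FV 0 is taken by the environment of a
  constant, a copy of the outer environment is quantified in front, which replaces a renaming of the
  graph.\<close>

definition copy_fm :: fm where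
  "copy_fm = All (Ap (FV 0) (NV 0) \<doteq> Ap (FV 2) (NV 0))"

text \<open>In the next two formulas FV 0 is the environment of a defined constant, whose entries
  from NV 0 on are to be the values of the arguments in the environment FV 1.\<close>

primrec argn_fm :: "fm list \<Rightarrow> fm" where
  "argn_fm [] = (Zero \<doteq> Zero)"
| "argn_fm (A # As) = (FEx (copy_fm \<^bold>\<and> Ex (A \<^bold>\<and> NV 0 \<doteq> Ap (FV 1) (J Zero (NV 1)))) \<^bold>\<and>
    Ex (NV 0 \<doteq> S (NV 1) \<^bold>\<and> argn_fm As))"

primrec argf_fm :: "fm list \<Rightarrow> fm" where
  "argf_fm [] = (Zero \<doteq> Zero)"
| "argf_fm (A # As) = (FEx (copy_fm \<^bold>\<and> All (Ex (A \<^bold>\<and> NV 0 \<doteq> Ap (FV 1) (J (S (NV 2)) (NV 1))))) \<^bold>\<and>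
    Ex (NV 0 \<doteq> S (NV 1) \<^bold>\<and> argf_fm As))"

text \<open>The formulas \<open>D i\<close> of the constants are a parameter, which keeps the
  recursion on terms apart from the recursion on definitions. In the clause for \<open>Cst\<close>
  the quantified function is the environment of argument values in which \<open>D i\<close> is
  read.\<close>

primrec graph :: "(nat \<Rightarrow> fm) \<Rightarrow> trm \<Rightarrow> fm" and graphf :: "(nat \<Rightarrow> fm) \<Rightarrow> fnc \<Rightarrow> fm" where
  "graph D (NV n) = (NV 0 \<doteq> Ap (FV 0) (J Zero (num n)))"
| "graph D Zero = (NV 0 \<doteq> Zero)"
| "graph D (Ap u t) = Ex (graph D t \<^bold>\<and> Ex (graphf D u \<^bold>\<and> NV 2 \<doteq> NV 0))"
| "graph D (J s t) = Ex (graph D s \<^bold>\<and> Ex (graph D t \<^bold>\<and> NV 2 \<doteq> J (NV 1) (NV 0)))"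
| "graph D (Cst i ts us) = FEx (Ex (NV 0 \<doteq> Zero \<^bold>\<and> argn_fm (map (graph D) ts)) \<^bold>\<and>
     Ex (NV 0 \<doteq> Zero \<^bold>\<and> argf_fm (map (graphf D) us)) \<^bold>\<and> D i)"
| "graphf D (FV n) = (NV 0 \<doteq> Ap (FV 0) (J (S (num n)) (NV 1)))"
| "graphf D Succ = (NV 0 \<doteq> S (NV 1))"
| "graphf D PK = (NV 0 \<doteq> Ap PK (NV 1))"
| "graphf D PL = (NV 0 \<doteq> Ap PL (NV 1))"
| "graphf D (Lam t) = FEx (push_fm (FV 0) (FV 1) (NV 1) \<^bold>\<and> graph D t)"

text \<open>In a recursion the outer quantifier introduces the function \<gamma> of the recursion
  argument alone, so that FV 1 is now the environment. A code of which the environment is the push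
  stands for its tail; on this tail the previous value and then the stage are pushed for r.\<close>

fun def_fm :: "(nat \<Rightarrow> fm) \<Rightarrow> prdef \<Rightarrow> fm" where
  "def_fm D (Expl k l p) = graph D p"
| "def_fm D (Rec k l q r) = FEx (
    FEx (push_fm (FV 2) (FV 0) (Ap (FV 2) (J Zero Zero)) \<^bold>\<and> Ex (graph D q \<^bold>\<and> NV 0 \<doteq> Ap (FV 1) Zero)) \<^bold>\<and>
    All (FEx (push_fm (FV 2) (FV 0) (Ap (FV 2) (J Zero Zero)) \<^bold>\<and>
      FEx (push_fm (FV 0) (FV 1) (Ap (FV 2) (NV 0)) \<^bold>\<and>
      FEx (push_fm (FV 0) (FV 1) (NV 0) \<^bold>\<and> Ex (graph D r \<^bold>\<and> NV 0 \<doteq> Ap (FV 3) (S (NV 1))))))) \<^bold>\<and>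
    NV 0 \<doteq> Ap (FV 0) (Ap (FV 1) (J Zero Zero)))"

text \<open>A definition refers to earlier constants only; cutting the family off at i makes this
  visible to the termination argument, and \<open>Zero \<doteq> Zero\<close> is a filler.\<close>

fun const_fm :: "prdef list \<Rightarrow> nat \<Rightarrow> fm" where
  "const_fm ds i = (if i < length ds then
    def_fm (\<lambda>j. if j < i then const_fm ds j else Zero \<doteq> Zero) (ds ! i) else Zero \<doteq> Zero)"

declare const_fm.simps [simp del]

text \<open>It stands under the quantifier for the code, so function variable n of the equation is
  \<open>FV (Suc n)\<close> here.\<close>

primrec env_fm :: "nat \<Rightarrow> fm" where
  "env_fm 0 = (Zero \<doteq> Zero)"
| "env_fm (Suc n) = (env_fm n \<^bold>\<and> Ap (FV 0) (J Zero (num n)) \<doteq> NV n \<^bold>\<and>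
    All (Ap (FV 0) (J (S (num n)) (NV 0)) \<doteq> Ap (FV (Suc n)) (NV 0)))"

text \<open>Equations of BIM are kept because the translation must be the identity on BIM. Otherwise
  the sum of the codes bounds every variable index in the two terms, so that many coded variables
  suffice, and the length is computable from the codes.\<close>

definition tr_eq :: "(nat \<Rightarrow> fm) \<Rightarrow> trm \<Rightarrow> trm \<Rightarrow> fm" where
  "tr_eq D s t = (if bim_trm s \<and> bim_trm t then s \<doteq> t
    else FEx (env_fm (Suc (code_trm s + code_trm t)) \<^bold>\<and>
      Ex (graph D s \<^bold>\<and> Ex (graph D t \<^bold>\<and> NV 1 \<doteq> NV 0))))"

primrec tr :: "(nat \<Rightarrow> fm) \<Rightarrow> fm \<Rightarrow> fm" where
  "tr D (s \<doteq> t) = tr_eq D s t"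
| "tr D (\<^bold>\<not> A) = (\<^bold>\<not> tr D A)"
| "tr D (A \<^bold>\<and> B) = (tr D A \<^bold>\<and> tr D B)"
| "tr D (A \<^bold>\<or> B) = (tr D A \<^bold>\<or> tr D B)"
| "tr D (A \<^bold>\<longrightarrow> B) = (tr D A \<^bold>\<longrightarrow> tr D B)"
| "tr D (All A) = All (tr D A)"
| "tr D (Ex A) = Ex (tr D A)"
| "tr D (FAll A) = FAll (tr D A)"
| "tr D (FEx A) = FEx (tr D A)"

lemma tr_bim: "A \<in> formulas BIM \<Longrightarrow> tr D A = A"
  by (induction A) (auto simp: tr_eq_def)

lemma args_bim [simp]:
  "argn_fm As \<in> formulas BIM \<longleftrightarrow> (\<forall>A\<in>set As. A \<in> formulas BIM)"
  "argf_fm As \<in> formulas BIM \<longleftrightarrow> (\<forall>A\<in>set As. A \<in> formulas BIM)"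
  by (induction As) (auto simp: copy_fm_def)

lemma push_fm_bim [simp]: "bim_fnc e' \<Longrightarrow> bim_fnc e \<Longrightarrow> bim_trm x \<Longrightarrow> push_fm e' e x \<in> formulas BIM"
  by (simp add: push_fm_def)

lemma env_fm_bim [simp]: "env_fm n \<in> formulas BIM"
  by (induction n) auto

context
  fixes D :: "nat \<Rightarrow> fm" assumes D: "\<And>i. D i \<in> formulas BIM"
begin

lemma graph_bim [simp]: "graph D t \<in> formulas BIM" "graphf D u \<in> formulas BIM"
  by (induction t and u) (auto simp: D)

lemma def_fm_bim: "def_fm D d \<in> formulas BIM"
  by (cases d) auto

lemma tr_formulas: "tr D A \<in> formulas BIM"
  by (induction A) (auto simp: tr_eq_def)

end

lemma const_fm_bim: "const_fm ds i \<in> formulas BIM"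
  by (induction ds i rule: const_fm.induct) (subst const_fm.simps, simp add: def_fm_bim)

section \<open>Bounds on free variables\<close>

primrec below_fm :: "fm \<Rightarrow> nat \<Rightarrow> nat \<Rightarrow> bool" where
  "below_fm (s \<doteq> t) k l = (below_trm s k l \<and> below_trm t k l)"
| "below_fm (\<^bold>\<not> A) k l = below_fm A k l"
| "below_fm (A \<^bold>\<and> B) k l = (below_fm A k l \<and> below_fm B k l)"
| "below_fm (A \<^bold>\<or> B) k l = (below_fm A k l \<and> below_fm B k l)"
| "below_fm (A \<^bold>\<longrightarrow> B) k l = (below_fm A k l \<and> below_fm B k l)"
| "below_fm (All A) k l = below_fm A (Suc k) l"
| "below_fm (Ex A) k l = below_fm A (Suc k) l"
| "below_fm (FAll A) k l = below_fm A k (Suc l)"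
| "below_fm (FEx A) k l = below_fm A k (Suc l)"

lemma below_mono:
  "below_trm t k l \<Longrightarrow> k \<le> k' \<Longrightarrow> l \<le> l' \<Longrightarrow> below_trm t k' l'"
  "below_fnc u k l \<Longrightarrow> k \<le> k' \<Longrightarrow> l \<le> l' \<Longrightarrow> below_fnc u k' l'"
proof (induction t and u arbitrary: k l k' l' and k l k' l')
  case (Lam t) then show ?case by simp
qed (auto simp: list_all_iff)

lemma below_fm_mono: "below_fm A k l \<Longrightarrow> k \<le> k' \<Longrightarrow> l \<le> l' \<Longrightarrow> below_fm A k' l'"
  by (induction A arbitrary: k l k' l') (auto intro: below_mono)

lemma below_sub:
  "below_trm t k l \<Longrightarrow> (\<And>n. n < k \<Longrightarrow> \<sigma> n = \<sigma>' n) \<Longrightarrow> (\<And>n. n < l \<Longrightarrow> \<tau> n = \<tau>' n) \<Longrightarrow>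
    sub_trm t \<sigma> \<tau> = sub_trm t \<sigma>' \<tau>'"
  "below_fnc u k l \<Longrightarrow> (\<And>n. n < k \<Longrightarrow> \<sigma> n = \<sigma>' n) \<Longrightarrow> (\<And>n. n < l \<Longrightarrow> \<tau> n = \<tau>' n) \<Longrightarrow>
    sub_fnc u \<sigma> \<tau> = sub_fnc u \<sigma>' \<tau>'"
proof (induction t and u arbitrary: k l \<sigma> \<tau> \<sigma>' \<tau>' and k l \<sigma> \<tau> \<sigma>' \<tau>')
  case (Lam t)
  have "sub_trm t (nn \<sigma>) (nf \<tau>) = sub_trm t (nn \<sigma>') (nf \<tau>')"
    by (rule Lam.IH[of "Suc k" l]) (use Lam.prems in \<open>auto simp: nn_def nf_def split: nat.splits\<close>)
  then show ?case by simp
next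
  case (Cst i ts us)
  have "sub_trm t \<sigma> \<tau> = sub_trm t \<sigma>' \<tau>'" if "t \<in> set ts" for t
    by (rule Cst.IH(1)[OF that, of k l]) (use Cst.prems that in \<open>auto simp: list_all_iff\<close>)
  moreover have "sub_fnc u \<sigma> \<tau> = sub_fnc u \<sigma>' \<tau>'" if "u \<in> set us" for u
    by (rule Cst.IH(2)[OF that, of k l]) (use Cst.prems that in \<open>auto simp: list_all_iff\<close>)
  ultimately show ?case by simp
next
  case (Ap u t)
  then show ?case by simp metis
next
  case (J s t)
  then show ?case by simp metis
qed auto

lemma below_num [simp]: "below_trm (num n) k l"
  by (induction n) auto

lemma below_args:
  "(\<And>A. A \<in> set As \<Longrightarrow> below_fm A 1 1) \<Longrightarrow> below_fm (argn_fm As) 1 2"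
  "(\<And>A. A \<in> set As \<Longrightarrow> below_fm A 2 1) \<Longrightarrow> below_fm (argf_fm As) 1 2"
  by (induction As) (auto simp: copy_fm_def intro: below_fm_mono[of _ 1 1] below_fm_mono[of _ 2 1] below_fm_mono[of _ 1 2])

text \<open>Licenses reading a graph unchanged under further binders, whatever values the remaining
  variables have.\<close>

lemma below_graph:
  assumes "\<And>i. below_fm (D i) 1 1"
  shows "below_fm (graph D t) 1 1" "below_fm (graphf D u) 2 1"
proof (induction t and u)
  case (Cst i ts us)
  have "below_fm (argn_fm (map (graph D) ts)) 1 2" "below_fm (argf_fm (map (graphf D) us)) 1 2"
    by (rule below_args; use Cst in auto)+
  then have "below_fm (argn_fm (map (graph D) ts)) 2 2" "below_fm (argf_fm (map (graphf D) us)) 2 2" "below_fm (D i) 1 2"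
    using assms[of i] by (auto elim: below_fm_mono)
  then show ?case by (simp add: numeral_2_eq_2)
qed (auto simp: push_fm_def elim: below_fm_mono)

lemma below_def_fm:
  assumes "\<And>i. below_fm (D i) 1 1"
  shows "below_fm (def_fm D d) 1 1"
proof -
  have "below_fm (graph D t) (Suc k) (Suc l)" for t k l
    by (rule below_fm_mono[OF below_graph(1)[OF assms]]) auto
  then show ?thesis by (cases d) (auto simp: push_fm_def)
qed

lemma below_const_fm: "below_fm (const_fm ds i) 1 1"
proof (induction i rule: less_induct)
  case (less i)
  have "below_fm (if j < i then const_fm ds j else Zero \<doteq> Zero) 1 1" for j
    using less by simp
  then have "below_fm (def_fm (\<lambda>j. if j < i then const_fm ds j else Zero \<doteq> Zero) d) 1 1" for d
    by (rule below_def_fm)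
  then show ?case by (subst const_fm.simps) simp
qed

lemma graph_cong:
  assumes "\<And>j. j < length ar \<Longrightarrow> D j = D' j"
  shows "ia_trm b ar t \<Longrightarrow> graph D t = graph D' t" "ia_fnc b ar u \<Longrightarrow> graphf D u = graphf D' u"
proof (induction t and u)
  case (Cst i ts us)
  then have "map (graph D) ts = map (graph D') ts" "map (graphf D) us = map (graphf D') us"
    by (auto simp: list_all_iff)
  then show ?case using Cst.prems assms by (simp only: graph.simps) simp
qed auto

text \<open>A definition accepted at place i mentions only constants below i, so the cut-off inside
  \<open>const_fm\<close> makes no difference.\<close>

lemma const_fm_eq:
  assumes "pr_definitions ds" "i < length ds"
  shows "const_fm ds i = def_fm (const_fm ds) (ds ! i)"
proof -
  let ?D = "\<lambda>j. if j < i then const_fm ds j else Zero \<doteq> Zero"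
  have "prdef_over (map arity (take i ds)) (ds ! i)" using assms by (simp add: pr_definitions_def)
  moreover have "graph ?D t = graph (const_fm ds) t" if "ia_trm False (map arity (take i ds)) t" for t
    by (rule graph_cong(1)[OF _ that]) simp
  ultimately have "def_fm ?D (ds ! i) = def_fm (const_fm ds) (ds ! i)" by (cases "ds ! i") auto
  then show ?thesis using assms by (subst const_fm.simps) simp
qed

lemma code_le: "m \<le> prod_encode (m, n)" "n \<le> prod_encode (m, n)"
  by (simp_all add: le_prod_encode_1 le_prod_encode_2)

lemma list_code_le: "x \<in> set xs \<Longrightarrow> x \<le> list_encode xs"
proof (induction xs)
  case (Cons a xs)
  then show ?case using code_le(1)[of a "list_encode xs"] code_le(2)[of "list_encode xs" a] by auto
qed simp

text \<open>The pairing function dominates its components, so every index in an expression is at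
  most its code; a binder only enlarges what is allowed.\<close>

lemma below_code:
  "code_trm t < N \<Longrightarrow> below_trm t N N" "code_fnc u < N \<Longrightarrow> below_fnc u N N"
proof (induction t and u)
  case (NV n) then show ?case using code_le(2)[of n 0] by simp
next
  case (FV n) then show ?case using code_le(2)[of n 0] by simp
next
  case (Ap u t)
  then have "code_fnc u < N" "code_trm t < N"
    using code_le(1)[of "code_fnc u" "code_trm t"] code_le(2)[of "code_trm t" "code_fnc u"] code_le(2)[of "prod_encode (code_fnc u, code_trm t)" 2] by simp_all
  then show ?case using Ap by simp
next
  case (J s t)
  then have "code_trm s < N" "code_trm t < N"
    using code_le(1)[of "code_trm s" "code_trm t"] code_le(2)[of "code_trm t" "code_trm s"] code_le(2)[of "prod_encode (code_trm s, code_trm t)" 3] by simp_all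
  then show ?case using J by simp
next
  case (Lam t)
  then have "code_trm t < N" using code_le(2)[of "code_trm t" 4] by simp
  then show ?case using Lam below_mono(1) by simp
next
  case (Cst i ts us)
  let ?a = "list_encode (map code_trm ts)" and ?b = "list_encode (map code_fnc us)"
  have "?a < N" "?b < N"
    using Cst.prems code_le(1)[of ?a ?b] code_le(2)[of ?b ?a] code_le(2)[of "prod_encode (?a, ?b)" i]
      code_le(2)[of "prod_encode (i, prod_encode (?a, ?b))" 4] by simp_all
  have "code_trm t < N" if "t \<in> set ts" for t
    using that \<open>?a < N\<close> list_code_le[of "code_trm t" "map code_trm ts"] by (simp add: le_less_trans)
  moreover have "code_fnc u < N" if "u \<in> set us" for u
    using that \<open>?b < N\<close> list_code_le[of "code_fnc u" "map code_fnc us"] by (simp add: le_less_trans)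
  ultimately show ?case using Cst.IH by (auto simp: list_all_iff)
qed auto

section \<open>Evaluation of terms in Kripke models\<close>

context choice_model
begin

lemma All_All_iff:
  "(\<forall>w'. w \<sqsubseteq> w' \<longrightarrow> (\<forall>a\<in>dom_n w'. \<forall>w''. w' \<sqsubseteq> w'' \<longrightarrow> (\<forall>v\<in>dom_n w''. P w'' a v))) \<longleftrightarrow>
   (\<forall>w' a v. w \<sqsubseteq> w' \<longrightarrow> a \<in> dom_n w' \<longrightarrow> v \<in> dom_n w' \<longrightarrow> P w' a v)"
  by (meson acc_refl acc_trans dom_mono(1) dom_worlds(1))

lemma force_push_fm:
  "force w \<sigma> \<tau> (push_fm (FV i) (FV j) x) \<longleftrightarrow> pushes w (sub_trm x \<sigma> \<tau>) (\<tau> j) (\<tau> i)"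
  by (auto simp: push_fm_def pushes_def All_All_iff)

lemma force_below:
  "below_fm A k l \<Longrightarrow> (\<And>n. n < k \<Longrightarrow> \<sigma> n = \<sigma>' n) \<Longrightarrow> (\<And>n. n < l \<Longrightarrow> \<tau> n = \<tau>' n) \<Longrightarrow>
    force w \<sigma> \<tau> A \<longleftrightarrow> force w \<sigma>' \<tau>' A"
proof (induction A arbitrary: w k l \<sigma> \<tau> \<sigma>' \<tau>')
  case (Eq s t)
  then show ?case using below_sub(1)[of _ k l \<sigma> \<sigma>' \<tau> \<tau>'] by simp
next
  case (All A)
  have "force w' (d \<rhd> \<sigma>) \<tau> A \<longleftrightarrow> force w' (d \<rhd> \<sigma>') \<tau>' A" for w' d
    by (rule All.IH[of "Suc k" l]) (use All.prems in \<open>auto split: nat.splits\<close>)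
  then show ?case by simp
next
  case (Ex A)
  have "force w' (d \<rhd> \<sigma>) \<tau> A \<longleftrightarrow> force w' (d \<rhd> \<sigma>') \<tau>' A" for w' d
    by (rule Ex.IH[of "Suc k" l]) (use Ex.prems in \<open>auto split: nat.splits\<close>)
  then show ?case by simp
next
  case (FAll A)
  have "force w' \<sigma> (d \<rhd> \<tau>) A \<longleftrightarrow> force w' \<sigma>' (d \<rhd> \<tau>') A" for w' d
    by (rule FAll.IH[of k "Suc l"]) (use FAll.prems in \<open>auto split: nat.splits\<close>)
  then show ?case by simp
next
  case (FEx A)
  have "force w' \<sigma> (d \<rhd> \<tau>) A \<longleftrightarrow> force w' \<sigma>' (d \<rhd> \<tau>') A" for w' d
    by (rule FEx.IH[of k "Suc l"]) (use FEx.prems in \<open>auto split: nat.splits\<close>)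
  then show ?case by simp
next
  case (Neg A)
  have "force w' \<sigma> \<tau> A \<longleftrightarrow> force w' \<sigma>' \<tau>' A" for w'
    by (rule Neg.IH[of k l]) (use Neg.prems in auto)
  then show ?case by simp
next
  case (And A B)
  have "force w' \<sigma> \<tau> A \<longleftrightarrow> force w' \<sigma>' \<tau>' A" "force w' \<sigma> \<tau> B \<longleftrightarrow> force w' \<sigma>' \<tau>' B" for w'
    by (rule And.IH[of k l]; use And.prems in auto)+
  then show ?case by simp
next
  case (Or A B)
  have "force w' \<sigma> \<tau> A \<longleftrightarrow> force w' \<sigma>' \<tau>' A" "force w' \<sigma> \<tau> B \<longleftrightarrow> force w' \<sigma>' \<tau>' B" for w'
    by (rule Or.IH[of k l]; use Or.prems in auto)+
  then show ?case by simp
next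
  case (Imp A B)
  have "force w' \<sigma> \<tau> A \<longleftrightarrow> force w' \<sigma>' \<tau>' A" "force w' \<sigma> \<tau> B \<longleftrightarrow> force w' \<sigma>' \<tau>' B" for w'
    by (rule Imp.IH[of k l]; use Imp.prems in auto)+
  then show ?case by simp
qed

lemma codes_pop:
  assumes "pushes w x \<eta> \<eta>'" "codes w \<eta>' (Suc k) l \<sigma> \<tau>" "w \<in> worlds"
  shows "codes w \<eta> k l (\<lambda>n. \<sigma> (Suc n)) \<tau>"
  unfolding codes_def
proof (intro conjI HOL.allI HOL.impI)
  have ww: "w \<sqsubseteq> w" using assms(3) by (simp add: acc_refl)
  show "eqv w (Ap \<eta> (J Zero (num n))) (\<sigma> (Suc n))" if "n < k" for n
  proof -
    have "eqv w (Ap \<eta>' (J Zero (S (num n)))) (Ap \<eta> (J Zero (num n)))"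
      using assms(1) ww num_dom[OF assms(3)] unfolding pushes_def by blast
    moreover have "eqv w (Ap \<eta>' (J Zero (S (num n)))) (\<sigma> (Suc n))"
      using assms(2) that unfolding codes_def by (metis Suc_mono num.simps(2))
    ultimately show ?thesis by (rule eqv_euclid)
  qed
  show "eqv w' (Ap \<eta> (J (S (num n)) z)) (Ap (\<tau> n) z)" if "n < l" "w \<sqsubseteq> w'" "z \<in> dom_n w'" for n w' z
  proof -
    have "num n \<in> dom_n w'" using that(3) num_dom dom_worlds by blast
    then have "eqv w' (Ap \<eta>' (J (S (num n)) z)) (Ap \<eta> (J (S (num n)) z))"
      "eqv w' (Ap \<eta>' (J (S (num n)) z)) (Ap (\<tau> n) z)"
      using assms(1,2) that unfolding pushes_def codes_def by blast+
    then show ?thesis by (rule eqv_euclid)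
  qed
qed

text \<open>The copies described by \<open>copy_fm\<close> are only extensionally equal to the
  original code.\<close>

lemma codes_exteq:
  assumes "exteq w \<eta> \<eta>'" "codes w \<eta> k l \<sigma> \<tau>"
  shows "codes w \<eta>' k l \<sigma> \<tau>"
  unfolding codes_def
proof (intro conjI HOL.allI HOL.impI)
  have w: "w \<in> worlds" using assms(1) unfolding exteq_def using dom_worlds by blast
  show "eqv w (Ap \<eta>' (J Zero (num n))) (\<sigma> n)" if "n < k" for n
  proof (rule eqv_euclid)
    show "eqv w (Ap \<eta> (J Zero (num n))) (Ap \<eta>' (J Zero (num n)))"
      by (rule exteq_Ap[OF assms(1) eqv_refl]) (simp add: dom_intros num_dom w)
    show "eqv w (Ap \<eta> (J Zero (num n))) (\<sigma> n)" using assms(2) that by (simp add: codes_def)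
  qed
  show "eqv w' (Ap \<eta>' (J (S (num n)) z)) (Ap (\<tau> n) z)" if "n < l" "w \<sqsubseteq> w'" "z \<in> dom_n w'" for n w' z
  proof (rule eqv_euclid)
    have "w' \<in> worlds" using that(3) dom_worlds by blast
    then show "eqv w' (Ap \<eta> (J (S (num n)) z)) (Ap \<eta>' (J (S (num n)) z))"
      by (intro exteq_Ap[OF exteq_mono[OF assms(1) that(2)] eqv_refl]) (simp add: dom_intros num_dom that(3))
    show "eqv w' (Ap \<eta> (J (S (num n)) z)) (Ap (\<tau> n) z)" using assms(2) that by (simp add: codes_def)
  qed
qed

text \<open>The meaning of the graphs with the code replaced by an environment. It is a relation
  because totality and uniqueness come later; constants still pass through a code since
  \<open>D i\<close> is a formula. Going through \<open>map\<close> keeps the recursion on argument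
  lists primitive.\<close>

primrec ev :: "(nat \<Rightarrow> fm) \<Rightarrow> trm \<Rightarrow> world \<Rightarrow> nsub \<Rightarrow> fsub \<Rightarrow> trm \<Rightarrow> bool"
    and evf :: "(nat \<Rightarrow> fm) \<Rightarrow> fnc \<Rightarrow> world \<Rightarrow> nsub \<Rightarrow> fsub \<Rightarrow> trm \<Rightarrow> trm \<Rightarrow> bool" where
  "ev D (NV n) w \<sigma> \<tau> y \<longleftrightarrow> eqv w y (\<sigma> n)"
| "ev D Zero w \<sigma> \<tau> y \<longleftrightarrow> eqv w y Zero"
| "ev D (Ap u t) w \<sigma> \<tau> y \<longleftrightarrow> (\<exists>x\<in>dom_n w. ev D t w \<sigma> \<tau> x \<and> evf D u w \<sigma> \<tau> x y)"
| "ev D (J s t) w \<sigma> \<tau> y \<longleftrightarrow> (\<exists>a\<in>dom_n w. \<exists>b\<in>dom_n w. ev D s w \<sigma> \<tau> a \<and> ev D t w \<sigma> \<tau> b \<and> eqv w y (J a b))"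
| "ev D (Cst i ts us) w \<sigma> \<tau> y \<longleftrightarrow> y \<in> dom_n w \<and> (\<exists>\<eta>\<in>dom_f w.
     (\<forall>j<length ts. (map (ev D) ts ! j) w \<sigma> \<tau> (Ap \<eta> (J Zero (num j)))) \<and>
     (\<forall>j<length us. \<forall>w' x. w \<sqsubseteq> w' \<longrightarrow> x \<in> dom_n w' \<longrightarrow>
       (map (evf D) us ! j) w' \<sigma> \<tau> x (Ap \<eta> (J (S (num j)) x))) \<and>
     force w (y \<rhd> (\<lambda>_. Zero)) (\<eta> \<rhd> (\<lambda>_. Succ)) (D i))"
| "evf D (FV n) w \<sigma> \<tau> x y \<longleftrightarrow> eqv w y (Ap (\<tau> n) x)"
| "evf D Succ w \<sigma> \<tau> x y \<longleftrightarrow> eqv w y (S x)"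
| "evf D PK w \<sigma> \<tau> x y \<longleftrightarrow> eqv w y (Ap PK x)"
| "evf D PL w \<sigma> \<tau> x y \<longleftrightarrow> eqv w y (Ap PL x)"
| "evf D (Lam t) w \<sigma> \<tau> x y \<longleftrightarrow> ev D t w (x \<rhd> \<sigma>) \<tau> y"

lemma ev_Cst:
  "ev D (Cst i ts us) w \<sigma> \<tau> y \<longleftrightarrow> y \<in> dom_n w \<and> (\<exists>\<eta>\<in>dom_f w.
     (\<forall>j<length ts. ev D (ts ! j) w \<sigma> \<tau> (Ap \<eta> (J Zero (num j)))) \<and>
     (\<forall>j<length us. \<forall>w' x. w \<sqsubseteq> w' \<longrightarrow> x \<in> dom_n w' \<longrightarrow> evf D (us ! j) w' \<sigma> \<tau> x (Ap \<eta> (J (S (num j)) x))) \<and>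
     force w (y \<rhd> (\<lambda>_. Zero)) (\<eta> \<rhd> (\<lambda>_. Succ)) (D i))"
  by simp

lemma ev_mono:
  "ev D t w \<sigma> \<tau> y \<Longrightarrow> w \<sqsubseteq> w' \<Longrightarrow> ev D t w' \<sigma> \<tau> y"
  "evf D u w \<sigma> \<tau> x y \<Longrightarrow> w \<sqsubseteq> w' \<Longrightarrow> evf D u w' \<sigma> \<tau> x y"
proof (induction t and u arbitrary: w w' \<sigma> \<tau> y and w w' \<sigma> \<tau> x y)
  case (Ap u t)
  then show ?case by simp (meson dom_mono(1))
next
  case (J s t)
  then show ?case by simp (meson dom_mono(1) eqv_mono)
next
  case (Cst i ts us)
  from Cst.prems(1) obtain \<eta> where \<eta>: "y \<in> dom_n w" "\<eta> \<in> dom_f w"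
    "\<And>j. j < length ts \<Longrightarrow> ev D (ts ! j) w \<sigma> \<tau> (Ap \<eta> (J Zero (num j)))"
    "\<And>j w' x. j < length us \<Longrightarrow> w \<sqsubseteq> w' \<Longrightarrow> x \<in> dom_n w' \<Longrightarrow> evf D (us ! j) w' \<sigma> \<tau> x (Ap \<eta> (J (S (num j)) x))"
    "force w (y \<rhd> (\<lambda>_. Zero)) (\<eta> \<rhd> (\<lambda>_. Succ)) (D i)" by auto
  have "ev D (ts ! j) w' \<sigma> \<tau> (Ap \<eta> (J Zero (num j)))" if "j < length ts" for j
    by (rule Cst.IH(1)[OF nth_mem[OF that] \<eta>(3)[OF that] Cst.prems(2)])
  moreover have "evf D (us ! j) w'' \<sigma> \<tau> x (Ap \<eta> (J (S (num j)) x))"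
    if "j < length us" "w' \<sqsubseteq> w''" "x \<in> dom_n w''" for j w'' x
    by (rule \<eta>(4)[OF that(1) acc_trans[OF Cst.prems(2) that(2)] that(3)])
  ultimately show ?case
    unfolding ev_Cst
    using dom_mono(1)[OF Cst.prems(2) \<eta>(1)] dom_mono(2)[OF Cst.prems(2) \<eta>(2)] force_mono[OF \<eta>(5) Cst.prems(2)]
    by blast
qed (auto intro: eqv_mono)

lemma ev_ren:
  "ev D (ren_trm t r q) w \<sigma> \<tau> y \<longleftrightarrow> ev D t w (\<lambda>n. \<sigma> (r n)) (\<lambda>n. \<tau> (q n)) y"
  "evf D (ren_fnc u r q) w \<sigma> \<tau> x y \<longleftrightarrow> evf D u w (\<lambda>n. \<sigma> (r n)) (\<lambda>n. \<tau> (q n)) x y"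
proof (induction t and u arbitrary: w \<sigma> \<tau> r q y and w \<sigma> \<tau> r q x y)
  case (Lam t)
  have "(\<lambda>n. (x \<rhd> \<sigma>) (up r n)) = (x \<rhd> (\<lambda>n. \<sigma> (r n)))"
    by (auto simp: up_def fun_eq_iff split: nat.splits)
  then show ?case by (simp add: Lam)
qed auto

text \<open>For terms of BIM evaluation is substitution; this reconciles the two cases of
  \<open>tr_eq\<close>.\<close>

lemma ev_bim:
  assumes "env w \<sigma> \<tau>"
  shows "bim_trm t \<Longrightarrow> ev D t w \<sigma> \<tau> y \<longleftrightarrow> eqv w y (sub_trm t \<sigma> \<tau>)"
    "bim_fnc u \<Longrightarrow> x \<in> dom_n w \<Longrightarrow> evf D u w \<sigma> \<tau> x y \<longleftrightarrow> eqv w y (Ap (sub_fnc u \<sigma> \<tau>) x)"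
proof (induction t and u arbitrary: y and x y)
  case (Ap u t)
  have t: "sub_trm t \<sigma> \<tau> \<in> dom_n w" using Ap.prems env_sub(4)[OF assms] bim_terms by simp
  have "eqv w (Ap (sub_fnc u \<sigma> \<tau>) x) (Ap (sub_fnc u \<sigma> \<tau>) x')" if "eqv w x x'" for x x'
    using Ap.prems that env_sub(5)[OF assms] bim_terms by (simp add: eqv_Ap)
  then show ?case using Ap t eqv_refl[OF t] by simp (meson eqv_trans eqv_dom(1))
next
  case (J s t)
  have "sub_trm s \<sigma> \<tau> \<in> dom_n w" "sub_trm t \<sigma> \<tau> \<in> dom_n w"
    using J.prems env_sub(4)[OF assms] bim_terms by simp_all
  then show ?case using J by simp (meson eqv_trans eqv_J eqv_refl)
next
  case (Lam t)
  then have "t = Zero \<or> t = NV 0" by (simp add: ZeroF_def IdF_def)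
  then show ?case
  proof
    assume t: "t = Zero"
    then show ?thesis
      using ZeroF_eq[OF Lam.prems(2)] by (simp add: ZeroF_def) (meson eqv_sym eqv_trans)
  next
    assume t: "t = NV 0"
    then show ?thesis
      using IdF_eq[OF Lam.prems(2)] by (simp add: IdF_def nn_def) (meson eqv_sym eqv_trans)
  qed
qed auto

context
  fixes D :: "nat \<Rightarrow> fm"
  assumes D_bim: "\<And>i. D i \<in> formulas BIM" and D_below: "\<And>i. below_fm (D i) 1 1"
begin

lemma ev_cong:
  "ev D t w \<sigma> \<tau> y \<Longrightarrow> enveq w \<sigma> \<tau> \<sigma>' \<tau>' \<Longrightarrow> eqv w y y' \<Longrightarrow> ev D t w \<sigma>' \<tau>' y'"
  "evf D u w \<sigma> \<tau> x y \<Longrightarrow> enveq w \<sigma> \<tau> \<sigma>' \<tau>' \<Longrightarrow> eqv w x x' \<Longrightarrow> eqv w y y' \<Longrightarrow> evf D u w \<sigma>' \<tau>' x' y'"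
proof (induction t and u arbitrary: w \<sigma> \<tau> \<sigma>' \<tau>' y y' and w \<sigma> \<tau> \<sigma>' \<tau>' x x' y y')
  case (NV n)
  then show ?case by (simp add: enveq_def) (meson eqv_sym eqv_trans)
next
  case Zero
  then show ?case by simp (meson eqv_euclid)
next
  case (Ap u t)
  then show ?case by simp (meson eqv_refl)
next
  case (J s t)
  then show ?case by simp (meson eqv_refl eqv_euclid)
next
  case (Cst i ts us)
  from Cst.prems(1) obtain \<eta> where \<eta>: "y \<in> dom_n w" "\<eta> \<in> dom_f w"
    "\<And>j. j < length ts \<Longrightarrow> ev D (ts ! j) w \<sigma> \<tau> (Ap \<eta> (J Zero (num j)))"
    "\<And>j w' x. j < length us \<Longrightarrow> w \<sqsubseteq> w' \<Longrightarrow> x \<in> dom_n w' \<Longrightarrow> evf D (us ! j) w' \<sigma> \<tau> x (Ap \<eta> (J (S (num j)) x))"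
    "force w (y \<rhd> (\<lambda>_. Zero)) (\<eta> \<rhd> (\<lambda>_. Succ)) (D i)" by auto
  have w: "w \<in> worlds" using \<eta>(1) dom_worlds by blast
  have "ev D (ts ! j) w \<sigma>' \<tau>' (Ap \<eta> (J Zero (num j)))" if "j < length ts" for j
    by (rule Cst.IH(1)[OF nth_mem[OF that] \<eta>(3)[OF that] Cst.prems(2) eqv_refl])
      (simp add: dom_intros num_dom w \<eta>(2))
  moreover have "evf D (us ! j) w'' \<sigma>' \<tau>' x (Ap \<eta> (J (S (num j)) x))"
    if "j < length us" "w \<sqsubseteq> w''" "x \<in> dom_n w''" for j w'' x
    by (rule Cst.IH(2)[OF nth_mem[OF that(1)] \<eta>(4)[OF that] enveq_mono[OF Cst.prems(2) that(2)] eqv_refl eqv_refl])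
      (use that(3) dom_worlds(1)[OF that(3)] dom_mono(2)[OF that(2) \<eta>(2)] in \<open>simp_all add: dom_intros num_dom\<close>)
  moreover have "force w (y' \<rhd> (\<lambda>_. Zero)) (\<eta> \<rhd> (\<lambda>_. Succ)) (D i)"
  proof (rule force_cong_imp[OF D_bim _ \<eta>(5)])
    have "env w (\<lambda>_. Zero) (\<eta> \<rhd> (\<lambda>_. Succ))" using env_base[OF w] \<eta>(2) by (simp add: env_push)
    then show "enveq w (y \<rhd> (\<lambda>_. Zero)) (\<eta> \<rhd> (\<lambda>_. Succ)) (y' \<rhd> (\<lambda>_. Zero)) (\<eta> \<rhd> (\<lambda>_. Succ))"
      by (rule enveq_push(1)[OF enveq_refl Cst.prems(3)])
  qed
  ultimately show ?case unfolding ev_Cst using \<eta>(2) eqv_dom(2)[OF Cst.prems(3)] by blast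
next
  case (FV n)
  then have "eqv w (Ap (\<tau> n) x) (Ap (\<tau>' n) x')" by (simp add: enveq_def exteq_Ap)
  then show ?case using FV by simp (meson eqv_sym eqv_trans)
next
  case Succ
  then show ?case using eqv_S[OF Succ(3)] by simp (meson eqv_sym eqv_trans)
next
  case PK
  then have "eqv w (Ap PK x) (Ap PK x')" using eqv_Ap dom_intros(5) eqv_dom(3) by blast
  then show ?case using PK by simp (meson eqv_sym eqv_trans)
next
  case PL
  then have "eqv w (Ap PL x) (Ap PL x')" using eqv_Ap dom_intros(6) eqv_dom(3) by blast
  then show ?case using PL by simp (meson eqv_sym eqv_trans)
next
  case (Lam t)
  then show ?case by simp (meson enveq_push(1))
qed

text \<open>The predicates Ps stand for evaluation of the arguments, so that the lemma can be
  applied inside the induction that proves the graphs correct. The counter starts at an arbitrary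
  numeral to permit induction on the list.\<close>

lemma force_args:
  assumes "length As = length Ps"
    and As: "\<And>i \<eta>0 y \<sigma>' \<tau>'. i < length As \<Longrightarrow> exteq w \<eta>0 \<eta> \<Longrightarrow> y \<in> dom_n w \<Longrightarrow>
      force w (y \<rhd> \<sigma>') (\<eta>0 \<rhd> \<tau>') (As ! i) \<longleftrightarrow> (Ps ! i) y"
    and Ps: "\<And>i y y'. i < length As \<Longrightarrow> eqv w y y' \<Longrightarrow> (Ps ! i) y \<Longrightarrow> (Ps ! i) y'"
    and \<eta>: "\<eta> \<in> dom_f w" "\<eta>' \<in> dom_f w" and d: "eqv w d (num j)"
  shows "force w (d \<rhd> \<sigma>) (\<eta>' \<rhd> \<eta> \<rhd> \<tau>) (argn_fm As) \<longleftrightarrow>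
    (\<forall>i<length As. (Ps ! i) (Ap \<eta>' (J Zero (num (j + i)))))"
  using assms(1,2,3) d
proof (induction As Ps arbitrary: j d \<sigma> rule: list_induct2)
  case Nil
  then show ?case using eqv_dom(3)[OF Nil(3)] by (simp add: eqv_refl dom_intros)
next
  case (Cons A As P Ps)
  have w: "w \<in> worlds" using eqv_dom(3)[OF Cons.prems(3)] .
  have dd: "d \<in> dom_n w" using eqv_dom(1)[OF Cons.prems(3)] .
  have val: "eqv w (Ap \<eta>' (J Zero d)) (Ap \<eta>' (J Zero (num j)))"
    by (rule eqv_Ap[OF eqv_J[OF eqv_refl Cons.prems(3)] \<eta>(2)]) (simp add: w dom_intros)
  have A: "force w (y \<rhd> \<sigma>') (\<eta>0 \<rhd> \<tau>') A \<longleftrightarrow> P y" if "exteq w \<eta>0 \<eta>" "y \<in> dom_n w" for \<eta>0 y \<sigma>' \<tau>'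
    using Cons.prems(1)[of 0] that by simp
  have P: "P y \<Longrightarrow> P y'" if "eqv w y y'" for y y'
    using Cons.prems(2)[of 0] that by simp
  have 1: "force w (d \<rhd> \<sigma>) (\<eta>' \<rhd> \<eta> \<rhd> \<tau>) (FEx (copy_fm \<^bold>\<and> Ex (A \<^bold>\<and> NV 0 \<doteq> Ap (FV 1) (J Zero (NV 1))))) \<longleftrightarrow>
    P (Ap \<eta>' (J Zero (num j)))" (is "?L \<longleftrightarrow> ?R")
  proof
    assume ?L
    then obtain \<eta>0 y where *: "exteq w \<eta>0 \<eta>" "y \<in> dom_n w" "force w (y \<rhd> d \<rhd> \<sigma>) (\<eta>0 \<rhd> \<eta>' \<rhd> \<eta> \<rhd> \<tau>) A"
      "eqv w y (Ap \<eta>' (J Zero d))"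
      using \<eta>(1) by (auto simp: copy_fm_def exteq_def)
    show ?R using P[OF eqv_trans[OF *(4) val]] A[OF *(1,2)] *(3) by blast
  next
    assume ?R
    then have "P (Ap \<eta>' (J Zero d))" using P[OF eqv_sym[OF val]] by blast
    then have "force w (Ap \<eta>' (J Zero d) \<rhd> d \<rhd> \<sigma>) (\<eta> \<rhd> \<eta>' \<rhd> \<eta> \<rhd> \<tau>) A"
      using A[OF exteq_refl[OF \<eta>(1)] eqv_dom(1)[OF val]] by blast
    then show ?L
      using exteq_refl[OF \<eta>(1)] eqv_dom(1)[OF val] eqv_refl[OF eqv_dom(1)[OF val]]
      by (auto simp: copy_fm_def exteq_def intro!: bexI[OF _ \<eta>(1)] bexI[of _ "Ap \<eta>' (J Zero d)"])
  qed
  have IH: "force w (d' \<rhd> d \<rhd> \<sigma>) (\<eta>' \<rhd> \<eta> \<rhd> \<tau>) (argn_fm As) \<longleftrightarrow>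
    (\<forall>i<length As. (Ps ! i) (Ap \<eta>' (J Zero (num (Suc j + i)))))" if d': "eqv w d' (S d)" for d'
  proof (rule Cons.IH)
    show "eqv w d' (num (Suc j))" using eqv_trans[OF d' eqv_S[OF Cons.prems(3)]] by simp
    show "force w (y \<rhd> \<sigma>') (\<eta>0 \<rhd> \<tau>') (As ! i) \<longleftrightarrow> (Ps ! i) y"
      if "i < length As" "exteq w \<eta>0 \<eta>" "y \<in> dom_n w" for i \<eta>0 y \<sigma>' \<tau>'
      using Cons.prems(1)[of "Suc i"] that by simp
    show "(Ps ! i) y'" if "i < length As" "eqv w y y'" "(Ps ! i) y" for i y y'
      using Cons.prems(2)[of "Suc i"] that by simp
  qed
  have Sd: "S d \<in> dom_n w" "eqv w (S d) (S d)" using dd unary_dom(1) eqv_refl by blast+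
  have 2: "force w (d \<rhd> \<sigma>) (\<eta>' \<rhd> \<eta> \<rhd> \<tau>) (Ex (NV 0 \<doteq> S (NV 1) \<^bold>\<and> argn_fm As)) \<longleftrightarrow>
    (\<forall>i<length As. (Ps ! i) (Ap \<eta>' (J Zero (num (Suc j + i)))))"
    using IH Sd by auto
  show ?case
    unfolding argn_fm.simps force.simps(3) 1 2 by (auto simp: All_less_Suc2)
qed

lemma force_fargs:
  assumes "length As = length Ps"
    and As: "\<And>i w' \<eta>0 x y \<sigma>' \<tau>'. i < length As \<Longrightarrow> w \<sqsubseteq> w' \<Longrightarrow> exteq w' \<eta>0 \<eta> \<Longrightarrow> x \<in> dom_n w' \<Longrightarrow> y \<in> dom_n w' \<Longrightarrow>
      force w' (y \<rhd> x \<rhd> \<sigma>') (\<eta>0 \<rhd> \<tau>') (As ! i) \<longleftrightarrow> (Ps ! i) w' x y"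
    and Ps: "\<And>i w' x y y'. i < length As \<Longrightarrow> x \<in> dom_n w' \<Longrightarrow> w \<sqsubseteq> w' \<Longrightarrow> eqv w' y y' \<Longrightarrow> (Ps ! i) w' x y \<Longrightarrow> (Ps ! i) w' x y'"
    and \<eta>: "\<eta> \<in> dom_f w" "\<eta>' \<in> dom_f w" and d: "eqv w d (num j)"
  shows "force w (d \<rhd> \<sigma>) (\<eta>' \<rhd> \<eta> \<rhd> \<tau>) (argf_fm As) \<longleftrightarrow>
    (\<forall>i<length As. \<forall>w' x. w \<sqsubseteq> w' \<longrightarrow> x \<in> dom_n w' \<longrightarrow> (Ps ! i) w' x (Ap \<eta>' (J (S (num (j + i))) x)))"
  using assms(1,2,3) d
proof (induction As Ps arbitrary: j d \<sigma> rule: list_induct2)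
  case Nil
  then show ?case using eqv_dom(3)[OF Nil(3)] by (simp add: eqv_refl dom_intros)
next
  case (Cons A As P Ps)
  have w: "w \<in> worlds" using eqv_dom(3)[OF Cons.prems(3)] .
  have dd: "d \<in> dom_n w" using eqv_dom(1)[OF Cons.prems(3)] .
  have val: "eqv w' (Ap \<eta>' (J (S d) x)) (Ap \<eta>' (J (S (num j)) x))" if "w \<sqsubseteq> w'" "x \<in> dom_n w'" for w' x
    by (rule eqv_Ap[OF eqv_J[OF eqv_S[OF eqv_mono[OF that(1) Cons.prems(3)]] eqv_refl[OF that(2)]] dom_mono(2)[OF that(1) \<eta>(2)]])
  have A: "force w' (y \<rhd> x \<rhd> \<sigma>') (\<eta>0 \<rhd> \<tau>') A \<longleftrightarrow> P w' x y"
    if "w \<sqsubseteq> w'" "exteq w' \<eta>0 \<eta>" "x \<in> dom_n w'" "y \<in> dom_n w'" for w' \<eta>0 x y \<sigma>' \<tau>'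
    using Cons.prems(1)[of 0] that by simp
  have P: "P w' x y \<Longrightarrow> P w' x y'" if "w \<sqsubseteq> w'" "x \<in> dom_n w'" "eqv w' y y'" for w' x y y'
    using Cons.prems(2)[of 0] that by simp
  have 1: "force w (d \<rhd> \<sigma>) (\<eta>' \<rhd> \<eta> \<rhd> \<tau>) (FEx (copy_fm \<^bold>\<and> All (Ex (A \<^bold>\<and> NV 0 \<doteq> Ap (FV 1) (J (S (NV 2)) (NV 1)))))) \<longleftrightarrow>
    (\<forall>w' x. w \<sqsubseteq> w' \<longrightarrow> x \<in> dom_n w' \<longrightarrow> P w' x (Ap \<eta>' (J (S (num j)) x)))" (is "?L \<longleftrightarrow> ?R")
  proof
    assume ?L
    then obtain \<eta>0 where \<eta>0: "\<eta>0 \<in> dom_f w" "force w (d \<rhd> \<sigma>) (\<eta>0 \<rhd> \<eta>' \<rhd> \<eta> \<rhd> \<tau>) copy_fm"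
      "force w (d \<rhd> \<sigma>) (\<eta>0 \<rhd> \<eta>' \<rhd> \<eta> \<rhd> \<tau>) (All (Ex (A \<^bold>\<and> NV 0 \<doteq> Ap (FV 1) (J (S (NV 2)) (NV 1)))))"
      unfolding force.simps(3,9) by blast
    have ex: "exteq w \<eta>0 \<eta>" using \<eta>(1) \<eta>0(1,2) by (simp add: copy_fm_def exteq_def)
    have all: "\<exists>y\<in>dom_n w'. force w' (y \<rhd> x \<rhd> d \<rhd> \<sigma>) (\<eta>0 \<rhd> \<eta>' \<rhd> \<eta> \<rhd> \<tau>) A \<and> eqv w' y (Ap \<eta>' (J (S d) x))"
      if "w \<sqsubseteq> w'" "x \<in> dom_n w'" for w' x
      using \<eta>0(3) that by simp
    show ?R
    proof (intro HOL.allI HOL.impI)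
      fix w' x assume w': "w \<sqsubseteq> w'" "x \<in> dom_n w'"
      obtain y where "y \<in> dom_n w'" "force w' (y \<rhd> x \<rhd> d \<rhd> \<sigma>) (\<eta>0 \<rhd> \<eta>' \<rhd> \<eta> \<rhd> \<tau>) A" "eqv w' y (Ap \<eta>' (J (S d) x))"
        using all[OF w'] by blast
      then show "P w' x (Ap \<eta>' (J (S (num j)) x))"
        using P[OF w' eqv_trans[OF _ val[OF w']]] A[OF w'(1) exteq_mono[OF ex w'(1)] w'(2)] by blast
    qed
  next
    assume R: ?R
    have "\<exists>y\<in>dom_n w'. force w' (y \<rhd> x \<rhd> d \<rhd> \<sigma>) (\<eta> \<rhd> \<eta>' \<rhd> \<eta> \<rhd> \<tau>) A \<and> eqv w' y (Ap \<eta>' (J (S d) x))"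
      if w': "w \<sqsubseteq> w'" "x \<in> dom_n w'" for w' x
    proof -
      have "P w' x (Ap \<eta>' (J (S d) x))" using R w' P[OF w' eqv_sym[OF val[OF w']]] by blast
      then show ?thesis
        using A[OF w'(1) exteq_refl[OF dom_mono(2)[OF w'(1) \<eta>(1)]] w'(2) eqv_dom(1)[OF val[OF w']]]
          eqv_dom(1)[OF val[OF w']] eqv_refl by blast
    qed
    then show ?L
      using exteq_refl[OF \<eta>(1)] by (auto simp: copy_fm_def exteq_def intro!: bexI[OF _ \<eta>(1)])
  qed
  have IH: "force w (d' \<rhd> d \<rhd> \<sigma>) (\<eta>' \<rhd> \<eta> \<rhd> \<tau>) (argf_fm As) \<longleftrightarrow>
    (\<forall>i<length As. \<forall>w' x. w \<sqsubseteq> w' \<longrightarrow> x \<in> dom_n w' \<longrightarrow> (Ps ! i) w' x (Ap \<eta>' (J (S (num (Suc j + i))) x)))"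
    if d': "eqv w d' (S d)" for d'
  proof (rule Cons.IH)
    show "eqv w d' (num (Suc j))" using eqv_trans[OF d' eqv_S[OF Cons.prems(3)]] by simp
    show "force w' (y \<rhd> x \<rhd> \<sigma>') (\<eta>0 \<rhd> \<tau>') (As ! i) \<longleftrightarrow> (Ps ! i) w' x y"
      if "i < length As" "w \<sqsubseteq> w'" "exteq w' \<eta>0 \<eta>" "x \<in> dom_n w'" "y \<in> dom_n w'" for i w' \<eta>0 x y \<sigma>' \<tau>'
      using Cons.prems(1)[of "Suc i"] that by simp
    show "(Ps ! i) w' x y'" if "i < length As" "x \<in> dom_n w'" "w \<sqsubseteq> w'" "eqv w' y y'" "(Ps ! i) w' x y" for i w' x y y'
      using Cons.prems(2)[of "Suc i"] that by simp
  qed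
  have Sd: "S d \<in> dom_n w" "eqv w (S d) (S d)" using dd unary_dom(1) eqv_refl by blast+
  have 2: "force w (d \<rhd> \<sigma>) (\<eta>' \<rhd> \<eta> \<rhd> \<tau>) (Ex (NV 0 \<doteq> S (NV 1) \<^bold>\<and> argf_fm As)) \<longleftrightarrow>
    (\<forall>i<length As. \<forall>w' x. w \<sqsubseteq> w' \<longrightarrow> x \<in> dom_n w' \<longrightarrow> (Ps ! i) w' x (Ap \<eta>' (J (S (num (Suc j + i))) x)))"
    using IH Sd by auto
  show ?case
    unfolding argf_fm.simps force.simps(3) 1 2 by (auto simp: All_less_Suc2)
qed

end

end

locale pr_model = choice_model +
  fixes ds :: "prdef list"
  assumes pr: "pr_definitions ds"
begin

abbreviation D :: "nat \<Rightarrow> fm" where "D \<equiv> const_fm ds"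

lemma ev_eqv:
  "ev D t w \<sigma> \<tau> y \<Longrightarrow> enveq w \<sigma> \<tau> \<sigma>' \<tau>' \<Longrightarrow> eqv w y y' \<Longrightarrow> ev D t w \<sigma>' \<tau>' y'"
  by (rule ev_cong(1)[of D, OF const_fm_bim below_const_fm])

lemma evf_eqv:
  "evf D u w \<sigma> \<tau> x y \<Longrightarrow> enveq w \<sigma> \<tau> \<sigma>' \<tau>' \<Longrightarrow> eqv w x x' \<Longrightarrow> eqv w y y' \<Longrightarrow> evf D u w \<sigma>' \<tau>' x' y'"
  by (rule ev_cong(2)[of D, OF const_fm_bim below_const_fm])

text \<open>Code and environment have to agree only below k and l, and arbitrary values \<sigma>'
  and \<tau>' may fill the remaining places; both freedoms are used when passing binders.\<close>

lemma force_graph: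
  "below_trm t k l \<Longrightarrow> env w \<sigma> \<tau> \<Longrightarrow> \<eta> \<in> dom_f w \<Longrightarrow> codes w \<eta> k l \<sigma> \<tau> \<Longrightarrow> y \<in> dom_n w \<Longrightarrow>
    force w (y \<rhd> \<sigma>') (\<eta> \<rhd> \<tau>') (graph D t) \<longleftrightarrow> ev D t w \<sigma> \<tau> y"
  "below_fnc u k l \<Longrightarrow> env w \<sigma> \<tau> \<Longrightarrow> \<eta> \<in> dom_f w \<Longrightarrow> codes w \<eta> k l \<sigma> \<tau> \<Longrightarrow> y \<in> dom_n w \<Longrightarrow>
    x \<in> dom_n w \<Longrightarrow> force w (y \<rhd> x \<rhd> \<sigma>') (\<eta> \<rhd> \<tau>') (graphf D u) \<longleftrightarrow> evf D u w \<sigma> \<tau> x y"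
proof (induction t and u arbitrary: k w \<sigma> \<tau> \<eta> y \<sigma>' \<tau>' and k w \<sigma> \<tau> \<eta> x y \<sigma>' \<tau>')
  case (NV n)
  then have "eqv w (Ap \<eta> (J Zero (num n))) (\<sigma> n)" by (simp add: codes_def)
  then show ?case by simp (meson eqv_trans eqv_join)
next
  case Zero then show ?case by simp
next
  case (Ap u t)
  have ww: "w \<in> worlds" using env_worlds[OF Ap.prems(2)] .
  have "force w (z \<rhd> x \<rhd> y \<rhd> \<sigma>') (\<eta> \<rhd> \<tau>') (graphf D u) \<longleftrightarrow> evf D u w \<sigma> \<tau> x z"
    "force w (x \<rhd> y \<rhd> \<sigma>') (\<eta> \<rhd> \<tau>') (graph D t) \<longleftrightarrow> ev D t w \<sigma> \<tau> x"
    if "x \<in> dom_n w" "z \<in> dom_n w" for x z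
    using Ap that by auto
  moreover have "(\<exists>z\<in>dom_n w. evf D u w \<sigma> \<tau> x z \<and> eqv w y z) \<longleftrightarrow> evf D u w \<sigma> \<tau> x y" if "x \<in> dom_n w" for x
    using evf_eqv[OF _ enveq_refl[OF Ap.prems(2)] eqv_refl[OF that] eqv_sym] eqv_refl[OF Ap.prems(5)] Ap.prems(5) by blast
  ultimately show ?case by auto
next
  case (J s t)
  have "force w (z \<rhd> x \<rhd> y \<rhd> \<sigma>') (\<eta> \<rhd> \<tau>') (graph D t) \<longleftrightarrow> ev D t w \<sigma> \<tau> z"
    "force w (x \<rhd> y \<rhd> \<sigma>') (\<eta> \<rhd> \<tau>') (graph D s) \<longleftrightarrow> ev D s w \<sigma> \<tau> x"
    if "x \<in> dom_n w" "z \<in> dom_n w" for x z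
    using J that by auto
  then show ?case by auto
next
  case (Cst i ts us)
  have w: "w \<in> worlds" "w \<sqsubseteq> w" using env_worlds[OF Cst.prems(2)] by (simp_all add: acc_refl)
  have Z: "eqv w Zero Zero" "Zero \<in> dom_n w" using w by (simp_all add: eqv_refl dom_intros)
  \<comment> \<open>The argument formulas are read at a copy of the code, and for function arguments
    also at later worlds.\<close>
  have cop: "codes w' \<eta>0 k l \<sigma> \<tau>" "\<eta>0 \<in> dom_f w'" "env w' \<sigma> \<tau>" if "w \<sqsubseteq> w'" "exteq w' \<eta>0 \<eta>" for w' \<eta>0
    using codes_exteq[OF exteq_sym[OF that(2)] codes_mono[OF Cst.prems(4) that(1)]]
      that env_mono[OF that(1) Cst.prems(2)] by (auto simp: exteq_def)
  have n: "force w (d \<rhd> \<sigma>'') (\<eta>' \<rhd> \<eta> \<rhd> \<tau>') (argn_fm (map (graph D) ts)) \<longleftrightarrow>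
    (\<forall>j<length ts. ev D (ts ! j) w \<sigma> \<tau> (Ap \<eta>' (J Zero (num j))))" if "\<eta>' \<in> dom_f w" "eqv w d Zero" for \<eta>' d \<sigma>''
  proof -
    have "force w (d \<rhd> \<sigma>'') (\<eta>' \<rhd> \<eta> \<rhd> \<tau>') (argn_fm (map (graph D) ts)) \<longleftrightarrow>
      (\<forall>j<length (map (graph D) ts). (map (\<lambda>t. ev D t w \<sigma> \<tau>) ts ! j) (Ap \<eta>' (J Zero (num (0 + j)))))"
    proof (rule force_args[where D=D and \<eta>=\<eta>, OF const_fm_bim below_const_fm])
      show "force w (y \<rhd> \<sigma>0) (\<eta>0 \<rhd> \<tau>0) (map (graph D) ts ! j) \<longleftrightarrow> (map (\<lambda>t. ev D t w \<sigma> \<tau>) ts ! j) y"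
        if "j < length (map (graph D) ts)" "exteq w \<eta>0 \<eta>" "y \<in> dom_n w" for j \<eta>0 y \<sigma>0 \<tau>0
        using Cst.IH(1)[of "ts ! j" k w \<sigma> \<tau> \<eta>0 y] cop[OF w(2) that(2)] that Cst.prems(1)
        by (simp add: list_all_iff)
      show "(map (\<lambda>t. ev D t w \<sigma> \<tau>) ts ! j) y'"
        if "j < length (map (graph D) ts)" "eqv w y y'" "(map (\<lambda>t. ev D t w \<sigma> \<tau>) ts ! j) y" for j y y'
        using that ev_eqv[OF _ enveq_refl[OF Cst.prems(2)] that(2)] by simp
    qed (use that Cst.prems(3) in auto)
    then show ?thesis by simp
  qed
  have f: "force w (d \<rhd> \<sigma>'') (\<eta>' \<rhd> \<eta> \<rhd> \<tau>') (argf_fm (map (graphf D) us)) \<longleftrightarrow>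
    (\<forall>j<length us. \<forall>w' x. w \<sqsubseteq> w' \<longrightarrow> x \<in> dom_n w' \<longrightarrow> evf D (us ! j) w' \<sigma> \<tau> x (Ap \<eta>' (J (S (num j)) x)))"
    if "\<eta>' \<in> dom_f w" "eqv w d Zero" for \<eta>' d \<sigma>''
  proof -
    have "force w (d \<rhd> \<sigma>'') (\<eta>' \<rhd> \<eta> \<rhd> \<tau>') (argf_fm (map (graphf D) us)) \<longleftrightarrow>
      (\<forall>j<length (map (graphf D) us). \<forall>w' x. w \<sqsubseteq> w' \<longrightarrow> x \<in> dom_n w' \<longrightarrow>
        (map (\<lambda>u w. evf D u w \<sigma> \<tau>) us ! j) w' x (Ap \<eta>' (J (S (num (0 + j))) x)))"
    proof (rule force_fargs[where D=D and \<eta>=\<eta>, OF const_fm_bim below_const_fm])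
      show "force w' (y \<rhd> x \<rhd> \<sigma>0) (\<eta>0 \<rhd> \<tau>0) (map (graphf D) us ! j) \<longleftrightarrow> (map (\<lambda>u w. evf D u w \<sigma> \<tau>) us ! j) w' x y"
        if "j < length (map (graphf D) us)" "w \<sqsubseteq> w'" "exteq w' \<eta>0 \<eta>" "x \<in> dom_n w'" "y \<in> dom_n w'" for j w' \<eta>0 x y \<sigma>0 \<tau>0
        using Cst.IH(2)[of "us ! j" k w' \<sigma> \<tau> \<eta>0 y x] cop[OF that(2,3)] that Cst.prems(1)
        by (simp add: list_all_iff)
      show "(map (\<lambda>u w. evf D u w \<sigma> \<tau>) us ! j) w' x y'"
        if "j < length (map (graphf D) us)" "x \<in> dom_n w'" "w \<sqsubseteq> w'" "eqv w' y y'"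
          "(map (\<lambda>u w. evf D u w \<sigma> \<tau>) us ! j) w' x y" for j w' x y y'
        using that evf_eqv[OF _ enveq_refl[OF env_mono[OF that(3) Cst.prems(2)]] eqv_refl[OF that(2)] that(4)] by simp
    qed (use that Cst.prems(3) in auto)
    then show ?thesis by simp
  qed
  have d: "force w (y \<rhd> \<sigma>') (\<eta>' \<rhd> \<eta> \<rhd> \<tau>') (D i) \<longleftrightarrow> force w (y \<rhd> (\<lambda>_. Zero)) (\<eta>' \<rhd> (\<lambda>_. Succ)) (D i)" for \<eta>'
    by (rule force_below[OF below_const_fm]) auto
  \<comment> \<open>In the formula the counter starts with some individual equal to 0 rather than
    with 0 itself.\<close>
  have ex: "(\<exists>d\<in>dom_n w. eqv w d Zero \<and> P d) \<longleftrightarrow> Q" if "\<And>d. eqv w d Zero \<Longrightarrow> P d \<longleftrightarrow> Q" for P Q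
    using that Z by blast
  have n': "force w (y \<rhd> \<sigma>') (\<eta>' \<rhd> \<eta> \<rhd> \<tau>') (Ex (NV 0 \<doteq> Zero \<^bold>\<and> argn_fm (map (graph D) ts))) \<longleftrightarrow>
    (\<forall>j<length ts. ev D (ts ! j) w \<sigma> \<tau> (Ap \<eta>' (J Zero (num j))))" if "\<eta>' \<in> dom_f w" for \<eta>'
    unfolding force.simps(1,3,7) using ex[OF n[OF that]] by simp
  have f': "force w (y \<rhd> \<sigma>') (\<eta>' \<rhd> \<eta> \<rhd> \<tau>') (Ex (NV 0 \<doteq> Zero \<^bold>\<and> argf_fm (map (graphf D) us))) \<longleftrightarrow>
    (\<forall>j<length us. \<forall>w' x. w \<sqsubseteq> w' \<longrightarrow> x \<in> dom_n w' \<longrightarrow> evf D (us ! j) w' \<sigma> \<tau> x (Ap \<eta>' (J (S (num j)) x)))" if "\<eta>' \<in> dom_f w" for \<eta>'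
    unfolding force.simps(1,3,7) using ex[OF f[OF that]] by simp
  show ?case
    unfolding ev_Cst graph.simps force.simps(9) force.simps(3)[of _ _ _ _ "_ \<^bold>\<and> _"] force.simps(3)[of _ _ _ "Ex _" "D _"]
    using n' f' d Cst.prems(5) by blast
next
  case (FV n)
  then have "eqv w (Ap \<eta> (J (S (num n)) x)) (Ap (\<tau> n) x)"
    using env_worlds[OF FV.prems(2)] by (simp add: codes_def acc_refl)
  then show ?case by simp (meson eqv_trans eqv_join)
next
  case (Lam t)
  have w: "w \<in> worlds" using env_worlds[OF Lam.prems(2)] .
  have env: "env w (x \<rhd> \<sigma>) \<tau>" using Lam.prems by (simp add: env_push)
  have *: "force w (y \<rhd> x \<rhd> \<sigma>') (\<eta>' \<rhd> \<eta> \<rhd> \<tau>') (graph D t) \<longleftrightarrow> ev D t w (x \<rhd> \<sigma>) \<tau> y"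
    if "\<eta>' \<in> dom_f w" "pushes w x \<eta> \<eta>'" for \<eta>'
    by (rule Lam.IH[OF _ env that(1) codes_push[OF that(2) Lam.prems(4) w] Lam.prems(5)]) (use Lam.prems(1) in simp)
  show ?case
    using * push_number[OF Lam.prems(3,6)] by (simp add: force_push_fm) blast
qed auto

section \<open>The meaning of a definition\<close>

fun dsem :: "prdef \<Rightarrow> world \<Rightarrow> nsub \<Rightarrow> fsub \<Rightarrow> trm \<Rightarrow> bool" where
  "dsem (Expl k l p) w \<sigma> \<tau> y \<longleftrightarrow> ev D p w \<sigma> \<tau> y"
| "dsem (Rec k l q r) w \<sigma> \<tau> y \<longleftrightarrow> (\<exists>\<gamma>\<in>dom_f w. ev D q w (\<lambda>n. \<sigma> (Suc n)) \<tau> (Ap \<gamma> Zero) \<and>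
     (\<forall>w' n. w \<sqsubseteq> w' \<longrightarrow> n \<in> dom_n w' \<longrightarrow> ev D r w' (n \<rhd> Ap \<gamma> n \<rhd> (\<lambda>n. \<sigma> (Suc n))) \<tau> (Ap \<gamma> (S n))) \<and>
     eqv w y (Ap \<gamma> (\<sigma> 0)))"

lemma env_tail: "env w \<sigma> \<tau> \<Longrightarrow> env w (\<lambda>n. \<sigma> (Suc n)) \<tau>"
  by (simp add: env_def)

lemma ev_ex_iff: "env w \<sigma> \<tau> \<Longrightarrow> z \<in> dom_n w \<Longrightarrow> (\<exists>v\<in>dom_n w. ev D t w \<sigma> \<tau> v \<and> eqv w v z) \<longleftrightarrow> ev D t w \<sigma> \<tau> z"
  using ev_eqv[OF _ enveq_refl] eqv_refl by blast

text \<open>The tail of the environment is given only as some code from which pushing leads to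
  \<eta>. All such codes evaluate alike, and \<open>pop_number\<close> supplies one.\<close>

lemma force_def_fm:
  assumes d: "prdef_over ar d" and c: "codes w \<eta> (fst (arity d)) (snd (arity d)) \<sigma> \<tau>"
    and env: "env w \<sigma> \<tau>" and \<eta>: "\<eta> \<in> dom_f w" and y: "y \<in> dom_n w"
  shows "force w (y \<rhd> \<sigma>') (\<eta> \<rhd> \<tau>') (def_fm D d) \<longleftrightarrow> dsem d w \<sigma> \<tau> y"
proof (cases d)
  case (Expl k l p)
  then show ?thesis using force_graph(1)[OF _ env \<eta> _ y, of p k l] d c by simp
next
  case (Rec k l q r)
  let ?\<sigma> = "\<lambda>n. \<sigma> (Suc n)" and ?x = "Ap \<eta> (J Zero Zero)"
  have w: "w \<in> worlds" using env_worlds[OF env] .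
  have c': "codes w \<eta> (Suc k) l \<sigma> \<tau>" and q: "below_trm q k l" and r: "below_trm r (k + 2) l"
    using c d Rec by simp_all
  have Q: "force w (y \<rhd> \<sigma>') (\<gamma> \<rhd> \<eta> \<rhd> \<tau>') (FEx (push_fm (FV 2) (FV 0) (Ap (FV 2) (J Zero Zero)) \<^bold>\<and>
      Ex (graph D q \<^bold>\<and> NV 0 \<doteq> Ap (FV 1) Zero))) \<longleftrightarrow> ev D q w ?\<sigma> \<tau> (Ap \<gamma> Zero)" if \<gamma>: "\<gamma> \<in> dom_f w" for \<gamma>
  proof -
    have z: "Ap \<gamma> Zero \<in> dom_n w" using \<gamma> w by (simp add: dom_intros)
    have "(\<exists>v\<in>dom_n w. force w (v \<rhd> y \<rhd> \<sigma>') (\<eta>0 \<rhd> \<gamma> \<rhd> \<eta> \<rhd> \<tau>') (graph D q) \<and> eqv w v (Ap \<gamma> Zero)) \<longleftrightarrow>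
      ev D q w ?\<sigma> \<tau> (Ap \<gamma> Zero)" if "\<eta>0 \<in> dom_f w" "pushes w ?x \<eta>0 \<eta>" for \<eta>0
      using force_graph(1)[OF q env_tail[OF env] that(1) codes_pop[OF that(2) c' w]] ev_ex_iff[OF env_tail[OF env] z, of q]
      by blast
    then show ?thesis using pop_number[OF \<eta>] by (simp add: force_push_fm) blast
  qed
  have R: "force w' (n \<rhd> y \<rhd> \<sigma>') (\<gamma> \<rhd> \<eta> \<rhd> \<tau>') (FEx (push_fm (FV 2) (FV 0) (Ap (FV 2) (J Zero Zero)) \<^bold>\<and>
      FEx (push_fm (FV 0) (FV 1) (Ap (FV 2) (NV 0)) \<^bold>\<and>
      FEx (push_fm (FV 0) (FV 1) (NV 0) \<^bold>\<and> Ex (graph D r \<^bold>\<and> NV 0 \<doteq> Ap (FV 3) (S (NV 1))))))) \<longleftrightarrow>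
      ev D r w' (n \<rhd> Ap \<gamma> n \<rhd> ?\<sigma>) \<tau> (Ap \<gamma> (S n))"
    if \<gamma>: "\<gamma> \<in> dom_f w'" and w': "w \<sqsubseteq> w'" and n: "n \<in> dom_n w'" for \<gamma> w' n
  proof -
    have ww: "w' \<in> worlds" using n dom_worlds by blast
    have \<eta>': "\<eta> \<in> dom_f w'" using dom_mono(2)[OF w' \<eta>] .
    have z: "Ap \<gamma> n \<in> dom_n w'" "Ap \<gamma> (S n) \<in> dom_n w'" using \<gamma> n by (simp_all add: dom_intros unary_dom)
    have e: "env w' (n \<rhd> Ap \<gamma> n \<rhd> ?\<sigma>) \<tau>" using env_mono[OF w' env_tail[OF env]] n z by (simp add: env_push)
    have c2: "codes w' \<eta>2 (k + 2) l (n \<rhd> Ap \<gamma> n \<rhd> ?\<sigma>) \<tau>"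
      if "pushes w' ?x \<eta>0 \<eta>" "pushes w' (Ap \<gamma> n) \<eta>0 \<eta>1" "pushes w' n \<eta>1 \<eta>2" for \<eta>0 \<eta>1 \<eta>2
      using codes_push[OF that(3) codes_push[OF that(2) codes_pop[OF that(1) codes_mono[OF c' w'] ww] ww] ww] by simp
    have "(\<exists>v\<in>dom_n w'. force w' (v \<rhd> n \<rhd> y \<rhd> \<sigma>') (\<eta>2 \<rhd> \<eta>1 \<rhd> \<eta>0 \<rhd> \<gamma> \<rhd> \<eta> \<rhd> \<tau>') (graph D r) \<and> eqv w' v (Ap \<gamma> (S n))) \<longleftrightarrow>
      ev D r w' (n \<rhd> Ap \<gamma> n \<rhd> ?\<sigma>) \<tau> (Ap \<gamma> (S n))"
      if "pushes w' ?x \<eta>0 \<eta>" "pushes w' (Ap \<gamma> n) \<eta>0 \<eta>1" "pushes w' n \<eta>1 \<eta>2" "\<eta>2 \<in> dom_f w'" for \<eta>0 \<eta>1 \<eta>2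
      using force_graph(1)[OF r e that(4) c2[OF that(1,2,3)]] ev_ex_iff[OF e z(2), of r] by blast
    note * = this
    obtain \<eta>0 where \<eta>0: "\<eta>0 \<in> dom_f w'" "pushes w' ?x \<eta>0 \<eta>" using pop_number[OF \<eta>'] by blast
    obtain \<eta>1 where \<eta>1: "\<eta>1 \<in> dom_f w'" "pushes w' (Ap \<gamma> n) \<eta>0 \<eta>1" using push_number[OF \<eta>0(1) z(1)] by blast
    obtain \<eta>2 where \<eta>2: "\<eta>2 \<in> dom_f w'" "pushes w' n \<eta>1 \<eta>2" using push_number[OF \<eta>1(1) n] by blast
    show ?thesis
      unfolding force.simps(3,7,9) force_push_fm using * \<eta>0 \<eta>1 \<eta>2 by simp blast
  qed
  have x: "eqv w ?x (\<sigma> 0)" using c' by (auto simp: codes_def)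
  have last: "eqv w y (Ap \<gamma> ?x) \<longleftrightarrow> eqv w y (Ap \<gamma> (\<sigma> 0))" if "\<gamma> \<in> dom_f w" for \<gamma>
    using eqv_Ap[OF x that] eqv_trans eqv_join by meson
  have R': "(\<forall>w'. w \<sqsubseteq> w' \<longrightarrow> (\<forall>n\<in>dom_n w'. force w' (n \<rhd> y \<rhd> \<sigma>') (\<gamma> \<rhd> \<eta> \<rhd> \<tau>') (FEx (push_fm (FV 2) (FV 0) (Ap (FV 2) (J Zero Zero)) \<^bold>\<and>
      FEx (push_fm (FV 0) (FV 1) (Ap (FV 2) (NV 0)) \<^bold>\<and>
      FEx (push_fm (FV 0) (FV 1) (NV 0) \<^bold>\<and> Ex (graph D r \<^bold>\<and> NV 0 \<doteq> Ap (FV 3) (S (NV 1)))))))))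
     \<longleftrightarrow> (\<forall>w' n. w \<sqsubseteq> w' \<longrightarrow> n \<in> dom_n w' \<longrightarrow> ev D r w' (n \<rhd> Ap \<gamma> n \<rhd> ?\<sigma>) \<tau> (Ap \<gamma> (S n)))"
    if "\<gamma> \<in> dom_f w" for \<gamma>
    using R dom_mono(2)[OF _ that] by blast
  show ?thesis
    unfolding Rec def_fm.simps(2) dsem.simps(2) force.simps(9)[of _ _ _ "_ \<^bold>\<and> _ \<^bold>\<and> _ \<doteq> _"]
      force.simps(3)[of _ _ _ _ "_ \<^bold>\<and> _ \<doteq> _"] force.simps(3)[of _ _ _ "All _" "_ \<doteq> _"] force.simps(6)
    using Q R' last by simp
qed

lemma force_const:
  assumes "i < length ds" "codes w \<eta> (fst (arity (ds ! i))) (snd (arity (ds ! i))) \<sigma> \<tau>"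
    "env w \<sigma> \<tau>" "\<eta> \<in> dom_f w" "y \<in> dom_n w"
  shows "force w (y \<rhd> \<sigma>') (\<eta> \<rhd> \<tau>') (D i) \<longleftrightarrow> dsem (ds ! i) w \<sigma> \<tau> y"
  using force_def_fm[OF _ assms(2-5)] const_fm_eq[OF pr assms(1)] pr assms(1)
  by (auto simp: pr_definitions_def)

end

lemma ia_ren:
  "ia_trm b ar t \<Longrightarrow> ia_trm b ar (ren_trm t r q)" "ia_fnc b ar u \<Longrightarrow> ia_fnc b ar (ren_fnc u r q)"
  by (induction t and u arbitrary: r q and r q) (auto simp: list_all_iff)

lemma ia_sub:
  "ia_trm b ar t \<Longrightarrow> (\<And>n. ia_trm b ar (\<rho> n)) \<Longrightarrow> (\<And>n. ia_fnc b ar (\<theta> n)) \<Longrightarrow> ia_trm b ar (sub_trm t \<rho> \<theta>)"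
  "ia_fnc b ar u \<Longrightarrow> (\<And>n. ia_trm b ar (\<rho> n)) \<Longrightarrow> (\<And>n. ia_fnc b ar (\<theta> n)) \<Longrightarrow> ia_fnc b ar (sub_fnc u \<rho> \<theta>)"
proof (induction t and u arbitrary: \<rho> \<theta> and \<rho> \<theta>)
  case (Lam t)
  have "ia_trm b ar (sub_trm t (nn \<rho>) (nf \<theta>))"
    by (rule Lam.IH) (use Lam.prems in \<open>auto simp: nn_def nf_def ia_ren split: nat.splits\<close>)
  then show ?case by simp
qed (auto simp: list_all_iff)

section \<open>Totality and uniqueness of values\<close>

context pr_model
begin

text \<open>Evaluation itself is no formula of BIM; the graph of u over a code of sufficiently many
  variables is one, and unique choice is applied to that.\<close>

lemma evf_choice:
  assumes env: "env w \<sigma> \<tau>"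
    and ex: "\<And>w' x. w \<sqsubseteq> w' \<Longrightarrow> x \<in> dom_n w' \<Longrightarrow> \<exists>y\<in>dom_n w'. evf D u w' \<sigma> \<tau> x y"
    and un: "\<And>w' x y y'. w \<sqsubseteq> w' \<Longrightarrow> x \<in> dom_n w' \<Longrightarrow> evf D u w' \<sigma> \<tau> x y \<Longrightarrow> evf D u w' \<sigma> \<tau> x y' \<Longrightarrow> eqv w' y y'"
  shows "\<exists>\<beta>\<in>dom_f w. \<forall>w' x. w \<sqsubseteq> w' \<longrightarrow> x \<in> dom_n w' \<longrightarrow> evf D u w' \<sigma> \<tau> x (Ap \<beta> x)"
proof -
  have w: "w \<in> worlds" using env_worlds[OF env] .
  let ?N = "Suc (code_fnc u)"
  obtain \<eta> where \<eta>: "\<eta> \<in> dom_f w" "codes w \<eta> ?N ?N \<sigma> \<tau>" using codes_ex[OF env] by blast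
  have G: "force w' (y \<rhd> x \<rhd> (\<lambda>_. Zero)) (\<eta> \<rhd> (\<lambda>_. Succ)) (graphf D u) \<longleftrightarrow> evf D u w' \<sigma> \<tau> x y"
    if "w \<sqsubseteq> w'" "x \<in> dom_n w'" "y \<in> dom_n w'" for w' x y
    using force_graph(2)[OF below_code(2) env_mono[OF that(1) env] dom_mono(2)[OF that(1) \<eta>(1)] codes_mono[OF \<eta>(2) that(1)] that(3,2)]
    by simp
  have "\<exists>\<beta>\<in>dom_f w. \<forall>w' x. w \<sqsubseteq> w' \<longrightarrow> x \<in> dom_n w' \<longrightarrow> force w' (Ap \<beta> x \<rhd> x \<rhd> (\<lambda>_. Zero)) (\<eta> \<rhd> (\<lambda>_. Succ)) (graphf D u)"
  proof (rule unique_choice)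
    show "graphf D u \<in> formulas BIM" by (rule graph_bim(2)[OF const_fm_bim])
    show "env w (\<lambda>_. Zero) (\<eta> \<rhd> (\<lambda>_. Succ))" using \<eta>(1) env_base[OF w] by (simp add: env_push)
  qed (use G ex un in blast)+
  then show ?thesis using G dom_intros(2)[OF dom_mono(2)] by blast
qed

definition functional :: "prdef \<Rightarrow> bool" where
  "functional d \<longleftrightarrow> (\<forall>w \<sigma> \<tau>. env w \<sigma> \<tau> \<longrightarrow> (\<exists>y\<in>dom_n w. dsem d w \<sigma> \<tau> y) \<and>
    (\<forall>y y'. dsem d w \<sigma> \<tau> y \<longrightarrow> dsem d w \<sigma> \<tau> y' \<longrightarrow> eqv w y y'))"

text \<open>Turns argument values given as an environment into the single code that the clause for
  \<open>Cst\<close> demands.\<close>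

lemma Cst_value:
  assumes i: "i < length ds" "arity (ds ! i) = (length ts, length us)"
    and env': "env w \<sigma>' \<tau>'" and y: "y \<in> dom_n w"
    and ts: "\<And>j. j < length ts \<Longrightarrow> ev D (ts ! j) w \<sigma> \<tau> (\<sigma>' j)"
    and us: "\<And>j w' x. j < length us \<Longrightarrow> w \<sqsubseteq> w' \<Longrightarrow> x \<in> dom_n w' \<Longrightarrow> evf D (us ! j) w' \<sigma> \<tau> x (Ap (\<tau>' j) x)"
    and env: "env w \<sigma> \<tau>" and d: "dsem (ds ! i) w \<sigma>' \<tau>' y"
  shows "ev D (Cst i ts us) w \<sigma> \<tau> y"
proof -
  have w: "w \<in> worlds" using env_worlds[OF env] .
  obtain \<eta> where \<eta>: "\<eta> \<in> dom_f w" "codes w \<eta> (length ts) (length us) \<sigma>' \<tau>'" using codes_ex[OF env'] by blast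
  have "ev D (ts ! j) w \<sigma> \<tau> (Ap \<eta> (J Zero (num j)))" if "j < length ts" for j
    by (rule ev_eqv[OF ts[OF that] enveq_refl[OF env] eqv_sym]) (use \<eta>(2) that in \<open>simp add: codes_def\<close>)
  moreover have "evf D (us ! j) w' \<sigma> \<tau> x (Ap \<eta> (J (S (num j)) x))"
    if "j < length us" "w \<sqsubseteq> w'" "x \<in> dom_n w'" for j w' x
    by (rule evf_eqv[OF us[OF that] enveq_refl[OF env_mono[OF that(2) env]] eqv_refl[OF that(3)] eqv_sym])
      (use \<eta>(2) that in \<open>simp add: codes_def\<close>)
  moreover have "force w (y \<rhd> (\<lambda>_. Zero)) (\<eta> \<rhd> (\<lambda>_. Succ)) (D i)"
    using force_const[OF i(1) _ env' \<eta>(1) y] \<eta>(2) i(2) d by simp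
  ultimately show ?thesis unfolding ev_Cst using y \<eta>(1) by blast
qed

lemma eqv_functional:
  "a \<in> dom_n w \<Longrightarrow> (\<exists>y\<in>dom_n w. eqv w y a) \<and> (\<forall>y y'. eqv w y a \<longrightarrow> eqv w y' a \<longrightarrow> eqv w y y')"
  using eqv_refl[of a w] eqv_join[of w _ a] by blast

text \<open>Relative to the first n definitions, so that it can serve at stage n of an induction on
  definitions. For a function argument pointwise values are not enough; \<open>evf_choice\<close>
  collects them into a function.\<close>

lemma terms_functional:
  assumes n: "n \<le> length ds" "\<And>i. i < n \<Longrightarrow> functional (ds ! i)"
  shows "ia_trm b (map arity (take n ds)) t \<Longrightarrow> env w \<sigma> \<tau> \<Longrightarrow>
      (\<exists>y\<in>dom_n w. ev D t w \<sigma> \<tau> y) \<and> (\<forall>y y'. ev D t w \<sigma> \<tau> y \<longrightarrow> ev D t w \<sigma> \<tau> y' \<longrightarrow> eqv w y y')"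
    "ia_fnc b (map arity (take n ds)) u \<Longrightarrow> env w \<sigma> \<tau> \<Longrightarrow> x \<in> dom_n w \<Longrightarrow>
      (\<exists>y\<in>dom_n w. evf D u w \<sigma> \<tau> x y) \<and> (\<forall>y y'. evf D u w \<sigma> \<tau> x y \<longrightarrow> evf D u w \<sigma> \<tau> x y' \<longrightarrow> eqv w y y')"
proof (induction t and u arbitrary: w \<sigma> \<tau> and w \<sigma> \<tau> x)
  case (NV n)
  show ?case unfolding ev.simps by (rule eqv_functional[OF env_dom(1)[OF NV.prems(2)]])
next
  case Zero
  show ?case unfolding ev.simps by (rule eqv_functional[OF dom_intros(1)[OF env_worlds[OF Zero.prems(2)]]])
next
  case (Ap u t)
  have t: "\<exists>x\<in>dom_n w. ev D t w \<sigma> \<tau> x" "\<And>y y'. ev D t w \<sigma> \<tau> y \<Longrightarrow> ev D t w \<sigma> \<tau> y' \<Longrightarrow> eqv w y y'"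
    using Ap.IH(2)[OF _ Ap.prems(2)] Ap.prems(1) by auto
  have u: "\<exists>y\<in>dom_n w. evf D u w \<sigma> \<tau> x y"
    "\<And>y y'. evf D u w \<sigma> \<tau> x y \<Longrightarrow> evf D u w \<sigma> \<tau> x y' \<Longrightarrow> eqv w y y'" if "x \<in> dom_n w" for x
    using Ap.IH(1)[OF _ Ap.prems(2) that] Ap.prems(1) by auto
  have "eqv w y y'" if x: "x \<in> dom_n w" "ev D t w \<sigma> \<tau> x" "evf D u w \<sigma> \<tau> x y"
    "x' \<in> dom_n w" "ev D t w \<sigma> \<tau> x'" "evf D u w \<sigma> \<tau> x' y'" for x x' y y'
  proof -
    obtain z where z: "z \<in> dom_n w" "evf D u w \<sigma> \<tau> x z" using u(1)[OF x(1)] by blast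
    then have "evf D u w \<sigma> \<tau> x' z"
      using evf_eqv[OF z(2) enveq_refl[OF Ap.prems(2)] t(2)[OF x(2,5)] eqv_refl[OF z(1)]] by blast
    from eqv_join[OF u(2)[OF x(1,3) z(2)] u(2)[OF x(4,6) this]] show ?thesis .
  qed
  then show ?case using t(1) u(1) by simp blast
next
  case (J s t)
  have t: "\<exists>y\<in>dom_n w. ev D t w \<sigma> \<tau> y" "\<And>y y'. ev D t w \<sigma> \<tau> y \<Longrightarrow> ev D t w \<sigma> \<tau> y' \<Longrightarrow> eqv w y y'"
    using J.IH(2)[OF _ J.prems(2)] J.prems(1) by auto
  have s: "\<exists>y\<in>dom_n w. ev D s w \<sigma> \<tau> y" "\<And>y y'. ev D s w \<sigma> \<tau> y \<Longrightarrow> ev D s w \<sigma> \<tau> y' \<Longrightarrow> eqv w y y'"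
    using J.IH(1)[OF _ J.prems(2)] J.prems(1) by auto
  have "eqv w y y'" if x: "ev D s w \<sigma> \<tau> a" "ev D t w \<sigma> \<tau> b" "eqv w y (J a b)"
    "ev D s w \<sigma> \<tau> a'" "ev D t w \<sigma> \<tau> b'" "eqv w y' (J a' b')" for a b a' b' y y'
    by (rule eqv_join[OF eqv_trans[OF x(3) eqv_J[OF s(2)[OF x(1,4)] t(2)[OF x(2,5)]]] x(6)])
  moreover obtain a b where ab: "a \<in> dom_n w" "b \<in> dom_n w" "ev D s w \<sigma> \<tau> a" "ev D t w \<sigma> \<tau> b"
    using s(1) t(1) by blast
  moreover have "J a b \<in> dom_n w" by (rule dom_intros(3)[OF ab(1,2)])
  ultimately show ?case unfolding ev.simps using eqv_refl[of "J a b" w] by blast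
next
  case (FV n)
  show ?case unfolding evf.simps by (rule eqv_functional[OF dom_intros(2)[OF env_dom(2)[OF FV.prems(2)] FV.prems(3)]])
next
  case Succ
  show ?case unfolding evf.simps by (rule eqv_functional[OF unary_dom(1)[OF Succ.prems(3)]])
next
  case PK
  show ?case unfolding evf.simps by (rule eqv_functional[OF unary_dom(2)[OF PK.prems(3)]])
next
  case PL
  show ?case unfolding evf.simps by (rule eqv_functional[OF unary_dom(3)[OF PL.prems(3)]])
next
  case (Lam t)
  have "ia_trm b (map arity (take n ds)) t" "env w (x \<rhd> \<sigma>) \<tau>" using Lam.prems by (simp_all add: env_push)
  from Lam.IH[OF this] show ?case unfolding evf.simps .
next
  case (Cst i ts us)
  have w: "w \<in> worlds" "w \<sqsubseteq> w" using env_worlds[OF Cst.prems(2)] by (simp_all add: acc_refl)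
  have i: "i < n" "i < length ds" "arity (ds ! i) = (length ts, length us)"
    using Cst.prems(1) n(1) by auto
  have ts: "\<exists>y\<in>dom_n w. ev D (ts ! j) w \<sigma> \<tau> y"
    "\<And>y y'. ev D (ts ! j) w \<sigma> \<tau> y \<Longrightarrow> ev D (ts ! j) w \<sigma> \<tau> y' \<Longrightarrow> eqv w y y'" if "j < length ts" for j
    using Cst.IH(1)[of "ts ! j", OF _ _ Cst.prems(2)] that Cst.prems(1) by (auto simp: list_all_iff)
  have us: "\<exists>y\<in>dom_n w'. evf D (us ! j) w' \<sigma> \<tau> x y"
    "\<And>y y'. evf D (us ! j) w' \<sigma> \<tau> x y \<Longrightarrow> evf D (us ! j) w' \<sigma> \<tau> x y' \<Longrightarrow> eqv w' y y'"
    if "j < length us" "w \<sqsubseteq> w'" "x \<in> dom_n w'" for j w' x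
    using Cst.IH(2)[of "us ! j", OF _ _ env_mono[OF that(2) Cst.prems(2)] that(3)] that(1) Cst.prems(1)
    by (auto simp: list_all_iff)
  have fi: "functional (ds ! i)" using n(2) i(1) .
  \<comment> \<open>Beyond the argument lists the environment is filled with arbitrary
    individuals.\<close>
  have "\<exists>a\<in>dom_n w. j < length ts \<longrightarrow> ev D (ts ! j) w \<sigma> \<tau> a" for j
    using ts(1)[of j] dom_intros(1)[OF w(1)] by blast
  then obtain \<sigma>' where \<sigma>': "\<And>j. \<sigma>' j \<in> dom_n w" "\<And>j. j < length ts \<Longrightarrow> ev D (ts ! j) w \<sigma> \<tau> (\<sigma>' j)" by metis
  have "\<exists>\<beta>\<in>dom_f w. j < length us \<longrightarrow> (\<forall>w' x. w \<sqsubseteq> w' \<longrightarrow> x \<in> dom_n w' \<longrightarrow> evf D (us ! j) w' \<sigma> \<tau> x (Ap \<beta> x))" for j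
  proof (cases "j < length us")
    case True
    have "\<exists>\<beta>\<in>dom_f w. \<forall>w' x. w \<sqsubseteq> w' \<longrightarrow> x \<in> dom_n w' \<longrightarrow> evf D (us ! j) w' \<sigma> \<tau> x (Ap \<beta> x)"
      by (rule evf_choice[OF Cst.prems(2) us(1)[OF True] us(2)[OF True]])
    then show ?thesis by blast
  qed (use dom_intros(4)[OF w(1)] in blast)
  then obtain \<tau>' where \<tau>': "\<And>j. \<tau>' j \<in> dom_f w"
    "\<And>j w' x. j < length us \<Longrightarrow> w \<sqsubseteq> w' \<Longrightarrow> x \<in> dom_n w' \<Longrightarrow> evf D (us ! j) w' \<sigma> \<tau> x (Ap (\<tau>' j) x)" by metis
  have env': "env w \<sigma>' \<tau>'" using \<sigma>'(1) \<tau>'(1) w by (simp add: env_def)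
  obtain y where y: "y \<in> dom_n w" "dsem (ds ! i) w \<sigma>' \<tau>' y" using fi env' unfolding functional_def by blast
  have ex: "\<exists>y\<in>dom_n w. ev D (Cst i ts us) w \<sigma> \<tau> y"
    using Cst_value[OF i(2,3) env' y(1) \<sigma>'(2) \<tau>'(2) Cst.prems(2) y(2)] y(1) by blast
  have un: "dsem (ds ! i) w \<sigma>' \<tau>' y" if y: "ev D (Cst i ts us) w \<sigma> \<tau> y" for y
  proof -
    obtain \<eta> where \<eta>: "y \<in> dom_n w" "\<eta> \<in> dom_f w"
      "\<And>j. j < length ts \<Longrightarrow> ev D (ts ! j) w \<sigma> \<tau> (Ap \<eta> (J Zero (num j)))"
      "\<And>j w' x. j < length us \<Longrightarrow> w \<sqsubseteq> w' \<Longrightarrow> x \<in> dom_n w' \<Longrightarrow> evf D (us ! j) w' \<sigma> \<tau> x (Ap \<eta> (J (S (num j)) x))"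
      "force w (y \<rhd> (\<lambda>_. Zero)) (\<eta> \<rhd> (\<lambda>_. Succ)) (D i)"
      using y unfolding ev_Cst by blast
    \<comment> \<open>By uniqueness of the argument values, every code that the clause admits codes
      the environment chosen above.\<close>
    have "codes w \<eta> (length ts) (length us) \<sigma>' \<tau>'"
      unfolding codes_def using ts(2)[OF _ \<eta>(3) \<sigma>'(2)] us(2)[OF _ _ _ \<eta>(4) \<tau>'(2)] by blast
    then show ?thesis using force_const[OF i(2) _ env' \<eta>(2,1)] i(3) \<eta>(5) by simp
  qed
  show ?case using ex un fi env' unfolding functional_def by blast
qed

text \<open>Existence for a recursion: the step r is total and single-valued at every pair of stage
  and previous value, hence given by a function g, which \<open>recursion\<close> iterates.
  Uniqueness is an induction on the recursion argument.\<close>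

lemma definitions_functional: "i < length ds \<Longrightarrow> functional (ds ! i)"
proof (induction i rule: less_induct)
  case (less i)
  have over: "prdef_over (map arity (take i ds)) (ds ! i)" using pr less.prems by (simp add: pr_definitions_def)
  have IH: "\<And>j. j < i \<Longrightarrow> functional (ds ! j)" using less by simp
  have tf: "(\<exists>y\<in>dom_n w. ev D t w \<sigma> \<tau> y) \<and> (\<forall>y y'. ev D t w \<sigma> \<tau> y \<longrightarrow> ev D t w \<sigma> \<tau> y' \<longrightarrow> eqv w y y')"
    if "ia_trm False (map arity (take i ds)) t" "env w \<sigma> \<tau>" for t w \<sigma> \<tau>
    by (rule terms_functional(1)[OF less_imp_le[OF less.prems] IH that])
  show ?case
  proof (cases "ds ! i")
    case (Expl k l p)
    then show ?thesis unfolding functional_def using tf[of p] over by simp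
  next
    case (Rec k l q r)
    have qr: "ia_trm False (map arity (take i ds)) q" "ia_trm False (map arity (take i ds)) r"
      "below_trm r (k + 2) l" using over Rec by auto
    show ?thesis
      unfolding functional_def
    proof (intro HOL.allI HOL.impI conjI)
      fix w \<sigma> \<tau> assume env: "env w \<sigma> \<tau>"
      let ?\<sigma> = "\<lambda>n. \<sigma> (Suc n)"
      have w: "w \<in> worlds" "w \<sqsubseteq> w" using env_worlds[OF env] by (simp_all add: acc_refl)
      have e: "env w' (n \<rhd> v \<rhd> ?\<sigma>) \<tau>" if "w \<sqsubseteq> w'" "n \<in> dom_n w'" "v \<in> dom_n w'" for w' n v
        using env_mono[OF that(1) env_tail[OF env]] that by (simp add: env_push)
      obtain x where x: "x \<in> dom_n w" "ev D q w ?\<sigma> \<tau> x" using tf[OF qr(1) env_tail[OF env]] by blast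
      obtain \<eta> where \<eta>: "\<eta> \<in> dom_f w" "codes w \<eta> k l ?\<sigma> \<tau>" using codes_ex[OF env_tail[OF env]] by blast
      \<comment> \<open>The input z pairs the stage with the previous value. Both are pushed on a
        code of the parameters, the previous value first, to match the order of variables in
        r.\<close>
      let ?A = "FEx (push_fm (FV 0) (FV 1) (Ap PL (NV 1)) \<^bold>\<and> FEx (push_fm (FV 0) (FV 1) (Ap PK (NV 1)) \<^bold>\<and> graph D r))"
      have A: "force w' (y \<rhd> z \<rhd> (\<lambda>_. Zero)) (\<eta> \<rhd> (\<lambda>_. Succ)) ?A \<longleftrightarrow> ev D r w' (Ap PK z \<rhd> Ap PL z \<rhd> ?\<sigma>) \<tau> y"
        if w': "w \<sqsubseteq> w'" and z: "z \<in> dom_n w'" and y: "y \<in> dom_n w'" for w' y z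
      proof -
        have kl: "Ap PK z \<in> dom_n w'" "Ap PL z \<in> dom_n w'" using z by (simp_all add: unary_dom)
        have ww: "w' \<in> worlds" using z dom_worlds by blast
        have "force w' (y \<rhd> z \<rhd> (\<lambda>_. Zero)) (\<eta>2 \<rhd> \<eta>1 \<rhd> \<eta> \<rhd> (\<lambda>_. Succ)) (graph D r) \<longleftrightarrow> ev D r w' (Ap PK z \<rhd> Ap PL z \<rhd> ?\<sigma>) \<tau> y"
          if "pushes w' (Ap PL z) \<eta> \<eta>1" "pushes w' (Ap PK z) \<eta>1 \<eta>2" "\<eta>2 \<in> dom_f w'" for \<eta>1 \<eta>2
          by (rule force_graph(1)[OF qr(3) e[OF w' kl] that(3) _ y])
            (use codes_push[OF that(2) codes_push[OF that(1) codes_mono[OF \<eta>(2) w'] ww] ww] in simp)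
        note * = this
        obtain \<eta>1 where \<eta>1: "\<eta>1 \<in> dom_f w'" "pushes w' (Ap PL z) \<eta> \<eta>1"
          using push_number[OF dom_mono(2)[OF w' \<eta>(1)] kl(2)] by blast
        obtain \<eta>2 where \<eta>2: "\<eta>2 \<in> dom_f w'" "pushes w' (Ap PK z) \<eta>1 \<eta>2" using push_number[OF \<eta>1(1) kl(1)] by blast
        show ?thesis unfolding force.simps(3,9) force_push_fm using * \<eta>1 \<eta>2 by simp blast
      qed
      have tr: "(\<exists>y\<in>dom_n w'. ev D r w' (Ap PK z \<rhd> Ap PL z \<rhd> ?\<sigma>) \<tau> y)"
        "\<And>y y'. ev D r w' (Ap PK z \<rhd> Ap PL z \<rhd> ?\<sigma>) \<tau> y \<Longrightarrow> ev D r w' (Ap PK z \<rhd> Ap PL z \<rhd> ?\<sigma>) \<tau> y' \<Longrightarrow> eqv w' y y'"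
        if "w \<sqsubseteq> w'" "z \<in> dom_n w'" for w' z
        using tf[OF qr(2) e[OF that(1) unary_dom(2)[OF that(2)] unary_dom(3)[OF that(2)]]] by blast+
      have "\<exists>g\<in>dom_f w. \<forall>w' z. w \<sqsubseteq> w' \<longrightarrow> z \<in> dom_n w' \<longrightarrow> force w' (Ap g z \<rhd> z \<rhd> (\<lambda>_. Zero)) (\<eta> \<rhd> (\<lambda>_. Succ)) ?A"
      proof (rule unique_choice)
        show "?A \<in> formulas BIM" by (simp add: graph_bim(1)[OF const_fm_bim])
        show "env w (\<lambda>_. Zero) (\<eta> \<rhd> (\<lambda>_. Succ))" using \<eta>(1) env_base[OF w(1)] by (simp add: env_push)
      qed (use A tr in blast)+
      then obtain g where g: "g \<in> dom_f w" "\<And>w' z. w \<sqsubseteq> w' \<Longrightarrow> z \<in> dom_n w' \<Longrightarrow>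
          ev D r w' (Ap PK z \<rhd> Ap PL z \<rhd> ?\<sigma>) \<tau> (Ap g z)"
        using A dom_intros(2)[OF dom_mono(2)] by blast
      obtain \<gamma> where \<gamma>: "\<gamma> \<in> dom_f w" "eqv w (Ap \<gamma> Zero) x"
        "\<And>w' n. w \<sqsubseteq> w' \<Longrightarrow> n \<in> dom_n w' \<Longrightarrow> eqv w' (Ap \<gamma> (S n)) (Ap g (J n (Ap \<gamma> n)))"
        using recursion[OF x(1) g(1)] by blast
      have "ev D q w ?\<sigma> \<tau> (Ap \<gamma> Zero)"
        by (rule ev_eqv[OF x(2) enveq_refl[OF env_tail[OF env]] eqv_sym[OF \<gamma>(2)]])
      moreover have "ev D r w' (n \<rhd> Ap \<gamma> n \<rhd> ?\<sigma>) \<tau> (Ap \<gamma> (S n))" if w': "w \<sqsubseteq> w'" "n \<in> dom_n w'" for w' n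
      proof -
        have d: "Ap \<gamma> n \<in> dom_n w'" by (rule dom_intros(2)[OF dom_mono(2)[OF w'(1) \<gamma>(1)] w'(2)])
        show ?thesis
          by (rule ev_eqv[OF g(2)[OF w'(1) dom_intros(3)[OF w'(2) d]] _ eqv_sym[OF \<gamma>(3)[OF w']]])
            (intro enveq_push(1) enveq_refl env_mono[OF w'(1) env_tail[OF env]] PK_J PL_J w'(2) d)
      qed
      moreover have "Ap \<gamma> (\<sigma> 0) \<in> dom_n w" by (rule dom_intros(2)[OF \<gamma>(1) env_dom(1)[OF env]])
      ultimately show "\<exists>y\<in>dom_n w. dsem (ds ! i) w \<sigma> \<tau> y"
        unfolding Rec dsem.simps using \<gamma>(1) eqv_refl by blast
    next
      fix w \<sigma> \<tau> y y' assume env: "env w \<sigma> \<tau>" and y: "dsem (ds ! i) w \<sigma> \<tau> y" "dsem (ds ! i) w \<sigma> \<tau> y'"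
      let ?\<sigma> = "\<lambda>n. \<sigma> (Suc n)"
      obtain \<gamma> where \<gamma>: "\<gamma> \<in> dom_f w" "ev D q w ?\<sigma> \<tau> (Ap \<gamma> Zero)"
        "\<And>w' n. w \<sqsubseteq> w' \<Longrightarrow> n \<in> dom_n w' \<Longrightarrow> ev D r w' (n \<rhd> Ap \<gamma> n \<rhd> ?\<sigma>) \<tau> (Ap \<gamma> (S n))" "eqv w y (Ap \<gamma> (\<sigma> 0))"
        using y(1) unfolding Rec dsem.simps by blast
      obtain \<gamma>' where \<gamma>': "\<gamma>' \<in> dom_f w" "ev D q w ?\<sigma> \<tau> (Ap \<gamma>' Zero)"
        "\<And>w' n. w \<sqsubseteq> w' \<Longrightarrow> n \<in> dom_n w' \<Longrightarrow> ev D r w' (n \<rhd> Ap \<gamma>' n \<rhd> ?\<sigma>) \<tau> (Ap \<gamma>' (S n))" "eqv w y' (Ap \<gamma>' (\<sigma> 0))"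
        using y(2) unfolding Rec dsem.simps by blast
      have "eqv w (Ap \<gamma> (\<sigma> 0)) (Ap \<gamma>' (\<sigma> 0))"
      proof (rule fun_eqv_induct[OF \<gamma>(1) \<gamma>'(1) _ _ env_dom(1)[OF env]])
        show "eqv w (Ap \<gamma> Zero) (Ap \<gamma>' Zero)" using tf[OF qr(1) env_tail[OF env]] \<gamma>(2) \<gamma>'(2) by blast
        fix w' n assume w': "w \<sqsubseteq> w'" "n \<in> dom_n w'" and eq: "eqv w' (Ap \<gamma> n) (Ap \<gamma>' n)"
        have en: "env w' (n \<rhd> Ap \<gamma>' n \<rhd> ?\<sigma>) \<tau>"
          using env_mono[OF w'(1) env_tail[OF env]] w'(2) eqv_dom(2)[OF eq] by (simp add: env_push)
        have "enveq w' (n \<rhd> Ap \<gamma> n \<rhd> ?\<sigma>) \<tau> (n \<rhd> Ap \<gamma>' n \<rhd> ?\<sigma>) \<tau>"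
          by (intro enveq_push(1) enveq_refl env_mono[OF w'(1) env_tail[OF env]] eq eqv_refl w'(2))
        moreover have "Ap \<gamma> (S n) \<in> dom_n w'"
          by (rule dom_intros(2)[OF dom_mono(2)[OF w'(1) \<gamma>(1)] unary_dom(1)[OF w'(2)]])
        ultimately have "ev D r w' (n \<rhd> Ap \<gamma>' n \<rhd> ?\<sigma>) \<tau> (Ap \<gamma> (S n))"
          using ev_eqv[OF \<gamma>(3)[OF w'] _ eqv_refl] by blast
        then show "eqv w' (Ap \<gamma> (S n)) (Ap \<gamma>' (S n))" using tf[OF qr(2) en] \<gamma>'(3)[OF w'] by blast
      qed
      then show "eqv w y y'" using eqv_join[OF eqv_trans[OF \<gamma>(4)] \<gamma>'(4)] by blast
    qed
  qed
qed

abbreviation mj_trm :: "trm \<Rightarrow> bool" where "mj_trm \<equiv> ia_trm True (map arity ds)"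
abbreviation mj_fnc :: "fnc \<Rightarrow> bool" where "mj_fnc \<equiv> ia_fnc True (map arity ds)"

lemma ev_total: "mj_trm t \<Longrightarrow> env w \<sigma> \<tau> \<Longrightarrow> \<exists>y\<in>dom_n w. ev D t w \<sigma> \<tau> y"
  and ev_unique: "mj_trm t \<Longrightarrow> env w \<sigma> \<tau> \<Longrightarrow> ev D t w \<sigma> \<tau> y \<Longrightarrow> ev D t w \<sigma> \<tau> y' \<Longrightarrow> eqv w y y'"
  using terms_functional(1)[of "length ds" True t w \<sigma> \<tau>, OF _ definitions_functional] by auto

lemma evf_total: "mj_fnc u \<Longrightarrow> env w \<sigma> \<tau> \<Longrightarrow> x \<in> dom_n w \<Longrightarrow> \<exists>y\<in>dom_n w. evf D u w \<sigma> \<tau> x y"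
  and evf_unique: "mj_fnc u \<Longrightarrow> env w \<sigma> \<tau> \<Longrightarrow> x \<in> dom_n w \<Longrightarrow> evf D u w \<sigma> \<tau> x y \<Longrightarrow> evf D u w \<sigma> \<tau> x y' \<Longrightarrow> eqv w y y'"
  using terms_functional(2)[of "length ds" True u w \<sigma> \<tau> x, OF _ definitions_functional] by auto

lemma evf_function:
  assumes "mj_fnc u" "env w \<sigma> \<tau>"
  shows "\<exists>\<beta>\<in>dom_f w. \<forall>w' x. w \<sqsubseteq> w' \<longrightarrow> x \<in> dom_n w' \<longrightarrow> evf D u w' \<sigma> \<tau> x (Ap \<beta> x)"
  by (rule evf_choice[OF assms(2)]) (use evf_total evf_unique assms env_mono in blast)+

lemma ev_iff: "mj_trm t \<Longrightarrow> env w \<sigma> \<tau> \<Longrightarrow> ev D t w \<sigma> \<tau> a \<Longrightarrow> ev D t w \<sigma> \<tau> y \<longleftrightarrow> eqv w a y"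
  using ev_unique ev_eqv[OF _ enveq_refl] by blast

section \<open>Substitution and values\<close>

definition arg_values :: "world \<Rightarrow> nsub \<Rightarrow> fsub \<Rightarrow> nat \<Rightarrow> nat \<Rightarrow> nsub \<Rightarrow> fsub \<Rightarrow> nsub \<Rightarrow> fsub \<Rightarrow> bool" where
  "arg_values w \<sigma> \<tau> k l \<rho> \<theta> \<sigma>' \<tau>' \<longleftrightarrow> (\<forall>j<k. ev D (\<rho> j) w \<sigma> \<tau> (\<sigma>' j)) \<and>
    (\<forall>j<l. \<forall>w' x. w \<sqsubseteq> w' \<longrightarrow> x \<in> dom_n w' \<longrightarrow> evf D (\<theta> j) w' \<sigma> \<tau> x (Ap (\<tau>' j) x))"

text \<open>Since values are unique, any environment of argument values determines the value of the
  constant.\<close>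

lemma ev_Cst_iff:
  assumes t: "mj_trm (Cst i ts us)" and env: "env w \<sigma> \<tau>" "env w \<sigma>' \<tau>'"
    and v: "arg_values w \<sigma> \<tau> (length ts) (length us) (nth ts) (nth us) \<sigma>' \<tau>'" and y: "y \<in> dom_n w"
  shows "ev D (Cst i ts us) w \<sigma> \<tau> y \<longleftrightarrow> dsem (ds ! i) w \<sigma>' \<tau>' y"
proof
  have i: "i < length ds" "arity (ds ! i) = (length ts, length us)" using t by auto
  show "dsem (ds ! i) w \<sigma>' \<tau>' y \<Longrightarrow> ev D (Cst i ts us) w \<sigma> \<tau> y"
    by (rule Cst_value[OF i env(2) y _ _ env(1)]) (use v in \<open>auto simp: arg_values_def\<close>)
  assume "ev D (Cst i ts us) w \<sigma> \<tau> y"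
  then obtain \<eta> where \<eta>: "\<eta> \<in> dom_f w"
    "\<And>j. j < length ts \<Longrightarrow> ev D (ts ! j) w \<sigma> \<tau> (Ap \<eta> (J Zero (num j)))"
    "\<And>j w' x. j < length us \<Longrightarrow> w \<sqsubseteq> w' \<Longrightarrow> x \<in> dom_n w' \<Longrightarrow> evf D (us ! j) w' \<sigma> \<tau> x (Ap \<eta> (J (S (num j)) x))"
    "force w (y \<rhd> (\<lambda>_. Zero)) (\<eta> \<rhd> (\<lambda>_. Succ)) (D i)" unfolding ev_Cst by blast
  have "codes w \<eta> (length ts) (length us) \<sigma>' \<tau>'"
    unfolding codes_def
  proof (intro conjI HOL.allI HOL.impI)
    fix j assume j: "j < length ts"
    then have "mj_trm (ts ! j)" using t by (simp add: list_all_length)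
    then show "eqv w (Ap \<eta> (J Zero (num j))) (\<sigma>' j)"
      by (rule ev_unique[OF _ env(1) \<eta>(2)[OF j]]) (use v j in \<open>simp add: arg_values_def\<close>)
  next
    fix j w' x assume j: "j < length us" and w': "w \<sqsubseteq> w'" "x \<in> dom_n w'"
    then have "mj_fnc (us ! j)" using t by (simp add: list_all_length)
    then show "eqv w' (Ap \<eta> (J (S (num j)) x)) (Ap (\<tau>' j) x)"
      by (rule evf_unique[OF _ env_mono[OF w'(1) env(1)] w'(2) \<eta>(3)[OF j w']]) (use v j w' in \<open>simp add: arg_values_def\<close>)
  qed
  then show "dsem (ds ! i) w \<sigma>' \<tau>' y" using force_const[OF i(1) _ env(2) \<eta>(1) y] i(2) \<eta>(4) by simp
qed

text \<open>Plays the part that composed substitutions play in \<open>force_sub\<close>: terms of Mj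
  need not be individuals of the model and act through their values.\<close>

definition interprets :: "world \<Rightarrow> nsub \<Rightarrow> fsub \<Rightarrow> nsub \<Rightarrow> fsub \<Rightarrow> nsub \<Rightarrow> fsub \<Rightarrow> bool" where
  "interprets w \<sigma> \<tau> \<rho> \<theta> \<sigma>' \<tau>' \<longleftrightarrow> env w \<sigma> \<tau> \<and> env w \<sigma>' \<tau>' \<and> (\<forall>n. mj_trm (\<rho> n)) \<and> (\<forall>n. mj_fnc (\<theta> n)) \<and>
    (\<forall>n. ev D (\<rho> n) w \<sigma> \<tau> (\<sigma>' n)) \<and>
    (\<forall>n w' x. w \<sqsubseteq> w' \<longrightarrow> x \<in> dom_n w' \<longrightarrow> evf D (\<theta> n) w' \<sigma> \<tau> x (Ap (\<tau>' n) x))"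

lemma interprets_mono:
  assumes "interprets w \<sigma> \<tau> \<rho> \<theta> \<sigma>' \<tau>'" "w \<sqsubseteq> w'" shows "interprets w' \<sigma> \<tau> \<rho> \<theta> \<sigma>' \<tau>'"
  using assms(1) env_mono[OF assms(2)] ev_mono(1)[OF _ assms(2)] acc_trans[OF assms(2)]
  unfolding interprets_def by simp

lemmas mj_ren = ia_ren[of True "map arity ds"] and mj_sub = ia_sub[of True "map arity ds"]

lemma interprets_nn:
  assumes i: "interprets w \<sigma> \<tau> \<rho> \<theta> \<sigma>' \<tau>'" and x: "x \<in> dom_n w"
  shows "interprets w (x \<rhd> \<sigma>) \<tau> (nn \<rho>) (nf \<theta>) (x \<rhd> \<sigma>') \<tau>'"
  using i x unfolding interprets_def
  by (auto simp: env_push nn_def nf_def ev_ren mj_ren eqv_refl split: nat.splits)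

lemma interprets_ff:
  assumes i: "interprets w \<sigma> \<tau> \<rho> \<theta> \<sigma>' \<tau>'" and f: "f \<in> dom_f w"
  shows "interprets w \<sigma> (f \<rhd> \<tau>) (fn \<rho>) (ff \<theta>) \<sigma>' (f \<rhd> \<tau>')"
  using i f unfolding interprets_def
  by (auto simp: env_push fn_def ff_def ev_ren mj_ren split: nat.splits
      intro!: eqv_refl dom_intros(2) intro: dom_mono(2))

text \<open>Uniqueness of values enters at the variables, where an arbitrary value of the
  substituted term is compared with the chosen one.\<close>

lemma ev_sub:
  "mj_trm t \<Longrightarrow> interprets w \<sigma> \<tau> \<rho> \<theta> \<sigma>' \<tau>' \<Longrightarrow> ev D (sub_trm t \<rho> \<theta>) w \<sigma> \<tau> y \<longleftrightarrow> ev D t w \<sigma>' \<tau>' y"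
  "mj_fnc u \<Longrightarrow> interprets w \<sigma> \<tau> \<rho> \<theta> \<sigma>' \<tau>' \<Longrightarrow> x \<in> dom_n w \<Longrightarrow> evf D (sub_fnc u \<rho> \<theta>) w \<sigma> \<tau> x y \<longleftrightarrow> evf D u w \<sigma>' \<tau>' x y"
proof (induction t and u arbitrary: w \<sigma> \<tau> \<rho> \<theta> \<sigma>' \<tau>' y and w \<sigma> \<tau> \<rho> \<theta> \<sigma>' \<tau>' x y)
  case (NV n)
  then have "mj_trm (\<rho> n)" "env w \<sigma> \<tau>" "ev D (\<rho> n) w \<sigma> \<tau> (\<sigma>' n)" by (auto simp: interprets_def)
  from ev_iff[OF this] show ?case using eqv_sym by simp blast
next
  case (FV n)
  then have f: "mj_fnc (\<theta> n)" "env w \<sigma> \<tau>" "evf D (\<theta> n) w \<sigma> \<tau> x (Ap (\<tau>' n) x)"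
    by (auto simp: interprets_def env_worlds acc_refl)
  show ?case
    using evf_unique[OF f(1,2) FV.prems(3) _ f(3)] evf_eqv[OF f(3) enveq_refl[OF f(2)] eqv_refl[OF FV.prems(3)] eqv_sym]
    by simp blast
next
  case (Ap u t) then show ?case by simp
next
  case (J s t) then show ?case by simp
next
  case (Lam t)
  then show ?case using Lam.IH[OF _ interprets_nn[OF Lam.prems(2,3)]] by simp
next
  case (Cst i ts us)
  have "ev D (sub_trm (ts ! j) \<rho> \<theta>) w \<sigma> \<tau> y \<longleftrightarrow> ev D (ts ! j) w \<sigma>' \<tau>' y" if "j < length ts" for j y
    using Cst.IH(1)[of "ts ! j", OF _ _ Cst.prems(2)] that Cst.prems(1) by (auto simp: list_all_length)
  moreover have "evf D (sub_fnc (us ! j) \<rho> \<theta>) w' \<sigma> \<tau> x y \<longleftrightarrow> evf D (us ! j) w' \<sigma>' \<tau>' x y"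
    if "j < length us" "w \<sqsubseteq> w'" "x \<in> dom_n w'" for j w' x y
    using Cst.IH(2)[of "us ! j", OF _ _ interprets_mono[OF Cst.prems(2) that(2)] that(3)] that(1) Cst.prems(1)
    by (auto simp: list_all_length)
  ultimately show ?case unfolding sub_trm.simps ev_Cst by (simp cong: conj_cong)
qed auto

subsection \<open>Forcing of translated formulas\<close>

lemma force_env_fm: "w \<in> worlds \<Longrightarrow> force w \<sigma> (\<eta> \<rhd> \<tau>) (env_fm N) \<longleftrightarrow> codes w \<eta> N N \<sigma> \<tau>"
  by (induction N) (auto simp: codes_def less_Suc_eq eqv_refl dom_intros)

text \<open>One characterization for both cases of the translation; the existential quantifier over
  codes is harmless because all codes of an environment give the same values.\<close>

lemma force_tr_eq:
  assumes env: "env w \<sigma> \<tau>" and st: "mj_trm s" "mj_trm t"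
  shows "force w \<sigma> \<tau> (tr D (s \<doteq> t)) \<longleftrightarrow> (\<exists>a\<in>dom_n w. ev D s w \<sigma> \<tau> a \<and> ev D t w \<sigma> \<tau> a)"
proof (cases "bim_trm s \<and> bim_trm t")
  case True
  then have "ev D s w \<sigma> \<tau> a \<longleftrightarrow> eqv w a (sub_trm s \<sigma> \<tau>)" "ev D t w \<sigma> \<tau> a \<longleftrightarrow> eqv w a (sub_trm t \<sigma> \<tau>)" for a
    using ev_bim(1)[OF env] by auto
  moreover have "sub_trm s \<sigma> \<tau> \<in> dom_n w" using True env_sub(4)[OF env] bim_terms by simp
  ultimately show ?thesis using True eqv_refl eqv_euclid by (simp add: tr_eq_def) blast
next
  case False
  let ?N = "Suc (code_trm s + code_trm t)"
  have w: "w \<in> worlds" using env_worlds[OF env] .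
  have b: "below_trm s ?N ?N" "below_trm t ?N ?N" by (auto intro: below_code)
  obtain \<eta> where \<eta>: "\<eta> \<in> dom_f w" "codes w \<eta> ?N ?N \<sigma> \<tau>" using codes_ex[OF env] by blast
  have "(\<exists>a\<in>dom_n w. force w (a \<rhd> \<sigma>) (\<eta> \<rhd> \<tau>) (graph D s) \<and>
      (\<exists>b\<in>dom_n w. force w (b \<rhd> a \<rhd> \<sigma>) (\<eta> \<rhd> \<tau>) (graph D t) \<and> eqv w a b)) \<longleftrightarrow>
    (\<exists>a\<in>dom_n w. ev D s w \<sigma> \<tau> a \<and> ev D t w \<sigma> \<tau> a)" if "\<eta> \<in> dom_f w" "codes w \<eta> ?N ?N \<sigma> \<tau>" for \<eta>
    using force_graph(1)[OF b(1) env that] force_graph(1)[OF b(2) env that] ev_eqv[OF _ enveq_refl[OF env] eqv_sym] eqv_refl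
    by blast
  then have *: "\<eta> \<in> dom_f w \<Longrightarrow> force w \<sigma> (\<eta> \<rhd> \<tau>) (env_fm ?N \<^bold>\<and> Ex (graph D s \<^bold>\<and> Ex (graph D t \<^bold>\<and> NV 1 \<doteq> NV 0))) \<longleftrightarrow>
    codes w \<eta> ?N ?N \<sigma> \<tau> \<and> (\<exists>a\<in>dom_n w. ev D s w \<sigma> \<tau> a \<and> ev D t w \<sigma> \<tau> a)" for \<eta>
    unfolding force.simps(3,7) force_env_fm[OF w] by auto
  have tr: "tr D (s \<doteq> t) = FEx (env_fm ?N \<^bold>\<and> Ex (graph D s \<^bold>\<and> Ex (graph D t \<^bold>\<and> NV 1 \<doteq> NV 0)))"
    using False unfolding tr.simps tr_eq_def by (simp only: if_False)
  show ?thesis unfolding tr force.simps(9) using * \<eta> by blast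
qed

abbreviation mj_fm :: "fm \<Rightarrow> bool" where "mj_fm \<equiv> over {t. mj_trm t}"

text \<open>Syntactically translation and substitution do not commute, as the length of the code and
  the case distinction depend on the terms; only forcing agrees.\<close>

lemma force_tr_sub:
  "mj_fm A \<Longrightarrow> interprets w \<sigma> \<tau> \<rho> \<theta> \<sigma>' \<tau>' \<Longrightarrow> force w \<sigma> \<tau> (tr D (sub A \<rho> \<theta>)) \<longleftrightarrow> force w \<sigma>' \<tau>' (tr D A)"
proof (induction A arbitrary: w \<sigma> \<tau> \<rho> \<theta> \<sigma>' \<tau>')
  case (Eq s t)
  have env: "env w \<sigma> \<tau>" "env w \<sigma>' \<tau>'" using Eq.prems(2) by (auto simp: interprets_def)
  have "mj_trm (sub_trm t \<rho> \<theta>)" if "mj_trm t" for t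
    using that Eq.prems(2) mj_sub by (simp add: interprets_def)
  then have "mj_trm (sub_trm s \<rho> \<theta>)" "mj_trm (sub_trm t \<rho> \<theta>)" using Eq.prems(1) by auto
  from force_tr_eq[OF env(1) this] show ?case
    unfolding sub.simps using force_tr_eq[OF env(2)] ev_sub(1)[OF _ Eq.prems(2)] Eq.prems(1) by simp
next
  case (Neg A) then show ?case by simp (meson interprets_mono)
next
  case (Imp A B) then show ?case by simp (meson interprets_mono)
next
  case (All A) then show ?case by simp (meson interprets_mono interprets_nn)
next
  case (Ex A) then show ?case by simp (meson interprets_nn)
next
  case (FAll A) then show ?case by simp (meson interprets_mono interprets_ff)
next
  case (FEx A) then show ?case by simp (meson interprets_ff)
qed (simp; meson)+

end

section \<open>Soundness of the translation\<close>

lemma ia_mono: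
  "ia_trm b (take i ar) t \<Longrightarrow> ia_trm True ar t" "ia_fnc b (take i ar) u \<Longrightarrow> ia_fnc True ar u"
  by (induction t and u) (auto simp: list_all_iff)

lemma Mj_simps [simp]: "terms (Mj ds) = {t. ia_trm True (map arity ds) t}"
  "functors (Mj ds) = {u. ia_fnc True (map arity ds) u}"
  by (simp_all add: Mj_def)

lemma Mj_lang: "lang (Mj ds)"
  by unfold_locales (auto simp: ZeroF_def IdF_def ia_sub)

lemma defining_axioms_formulas:
  assumes "pr_definitions ds" "i < length ds" "A \<in> defining_axioms i (ds ! i)"
  shows "A \<in> formulas (Mj ds)"
proof -
  have "prdef_over (take i (map arity ds)) (ds ! i)"
    using assms(1,2) by (simp add: pr_definitions_def take_map)
  then show ?thesis
    using assms(2,3) by (cases "ds ! i") (auto simp: formulas_def list_all_iff nth_append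
      intro: ia_mono intro!: ia_sub split: nat.splits)
qed

context pr_model
begin

lemma force_tr_eqI:
  assumes "mj_fm (s \<doteq> t)" "env w \<sigma> \<tau>" "y \<in> dom_n w" "ev D s w \<sigma> \<tau> y" "ev D t w \<sigma> \<tau> y"
  shows "force w \<sigma> \<tau> (tr D (s \<doteq> t))"
proof -
  have st: "mj_trm s" "mj_trm t" using assms(1) by auto
  show ?thesis unfolding force_tr_eq[OF assms(2) st] using assms(3-5) by blast
qed

lemma mj_formulas: "A \<in> formulas (Mj ds) \<longleftrightarrow> mj_fm A"
  by (simp add: formulas_def)

lemma evf_FV: "env w \<sigma> \<tau> \<Longrightarrow> w \<sqsubseteq> w' \<Longrightarrow> x \<in> dom_n w' \<Longrightarrow> evf D (FV n) w' \<sigma> \<tau> x (Ap (\<tau> n) x)"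
  by (simp add: eqv_refl dom_intros env_dom(2)[OF env_mono])

lemma interprets_inst:
  assumes "env w \<sigma> \<tau>" "mj_trm t" "ev D t w \<sigma> \<tau> d" "d \<in> dom_n w"
  shows "interprets w \<sigma> \<tau> (t \<rhd> NV) FV (d \<rhd> \<sigma>) \<tau>"
  using assms evf_FV[OF assms(1)] env_dom(1)[OF assms(1)]
  by (auto simp: interprets_def env_push eqv_refl split: nat.splits)

lemma interprets_finst:
  assumes "env w \<sigma> \<tau>" "mj_fnc u" "f \<in> dom_f w"
    "\<And>w' x. w \<sqsubseteq> w' \<Longrightarrow> x \<in> dom_n w' \<Longrightarrow> evf D u w' \<sigma> \<tau> x (Ap f x)"
  shows "interprets w \<sigma> \<tau> NV (u \<rhd> FV) \<sigma> (f \<rhd> \<tau>)"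
  using assms evf_FV[OF assms(1)] env_dom(1)[OF assms(1)]
  by (auto simp: interprets_def env_push eqv_refl split: nat.splits)

lemma interprets_shift:
  assumes "env w \<sigma> \<tau>"
  shows "interprets w \<sigma> \<tau> (\<lambda>n. NV (r n)) (\<lambda>n. FV (q n)) (\<lambda>n. \<sigma> (r n)) (\<lambda>n. \<tau> (q n))"
  using evf_FV[OF assms] env_dom[OF assms] env_worlds[OF assms] assms
  by (auto simp: interprets_def env_def eqv_refl)

lemma force_tr_lift:
  assumes "mj_fm A" "env w \<sigma> \<tau>"
  shows "d \<in> dom_n w \<Longrightarrow> force w (d \<rhd> \<sigma>) \<tau> (tr D (lift A)) \<longleftrightarrow> force w \<sigma> \<tau> (tr D A)"
    "f \<in> dom_f w \<Longrightarrow> force w \<sigma> (f \<rhd> \<tau>) (tr D (flift A)) \<longleftrightarrow> force w \<sigma> \<tau> (tr D A)"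
  using force_tr_sub[OF assms(1) interprets_shift, of w "d \<rhd> \<sigma>" \<tau> Suc "\<lambda>n. n"]
    force_tr_sub[OF assms(1) interprets_shift, of w \<sigma> "f \<rhd> \<tau>" "\<lambda>n. n" Suc] assms(2)
  by (auto simp: lift_def flift_def env_push)

section \<open>The axioms of Mj under the translation\<close>

lemma arg_values_NV:
  assumes "env w \<sigma> \<tau>" "\<And>j. j < k \<Longrightarrow> ev D (ts ! j) w \<sigma> \<tau> (\<sigma>' j)"
  shows "arg_values w \<sigma> \<tau> k l (nth ts) (nth (map FV [0..<l])) \<sigma>' \<tau>"
  using assms(2) evf_FV[OF assms(1)] by (simp add: arg_values_def)

lemma dsem_total: "i < length ds \<Longrightarrow> env w \<sigma> \<tau> \<Longrightarrow> \<exists>y\<in>dom_n w. dsem (ds ! i) w \<sigma> \<tau> y"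
  using definitions_functional unfolding functional_def by blast

text \<open>A value of the left side is obtained from \<open>dsem\<close>. For a recursion the
  function \<gamma> in it also yields the value at the preceding argument, to which the right side
  refers.\<close>

lemma force_tr_defining:
  assumes i: "i < length ds" and A: "A \<in> defining_axioms i (ds ! i)" and env: "env w \<sigma> \<tau>"
  shows "force w \<sigma> \<tau> (tr D A)"
proof -
  have mjA: "mj_fm A" using defining_axioms_formulas[OF pr i A] by (simp add: mj_formulas)
  have NV: "ev D (NV n) w \<sigma> \<tau> (\<sigma> n)" for n by (simp add: eqv_refl env_dom(1)[OF env])
  show ?thesis
  proof (cases "ds ! i")
    case (Expl k l p)
    then have A': "A = (Cst i (map NV [0..<k]) (map FV [0..<l]) \<doteq> p)" using A by simp
    obtain y where y: "y \<in> dom_n w" "dsem (ds ! i) w \<sigma> \<tau> y" using dsem_total[OF i env] by blast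
    have "ev D (Cst i (map NV [0..<k]) (map FV [0..<l])) w \<sigma> \<tau> y"
      by (subst ev_Cst_iff[OF _ env env]) (use mjA A' y arg_values_NV[OF env, of k "map NV [0..<k]" \<sigma> l] NV in auto)
    moreover have "ev D p w \<sigma> \<tau> y" using y(2) Expl by simp
    ultimately show ?thesis using force_tr_eqI[OF _ env y(1)] mjA unfolding A' by blast
  next
    case (Rec k l q r)
    let ?\<sigma> = "\<lambda>n. \<sigma> (Suc n)"
    have sig: "\<sigma> 0 \<rhd> ?\<sigma> = \<sigma>" by (auto simp: fun_eq_iff split: nat.splits)
    consider (0) "A = (Cst i (Zero # map NV [0..<k]) (map FV [0..<l]) \<doteq> q)"
      | (S) "A = (Cst i (S (NV 0) # map NV [1..<Suc k]) (map FV [0..<l]) \<doteq>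
       sub_trm r (NV 0 \<rhd> Cst i (NV 0 # map NV [1..<Suc k]) (map FV [0..<l]) \<rhd> (\<lambda>n. NV (Suc n))) FV)"
      using A Rec by auto
    then show ?thesis
    proof cases
      case 0
      have Z: "Zero \<in> dom_n w" "eqv w Zero Zero" using env_worlds[OF env] by (simp_all add: dom_intros eqv_refl)
      then have env': "env w (Zero \<rhd> \<sigma>) \<tau>" using env by (simp add: env_push)
      obtain y where y: "y \<in> dom_n w" "dsem (ds ! i) w (Zero \<rhd> \<sigma>) \<tau> y" using dsem_total[OF i env'] by blast
      have "ev D ((Zero # map NV [0..<k]) ! j) w \<sigma> \<tau> ((Zero \<rhd> \<sigma>) j)" if "j < Suc k" for j
        using that NV Z by (cases j) auto
      from arg_values_NV[OF env this]
      have "ev D (Cst i (Zero # map NV [0..<k]) (map FV [0..<l])) w \<sigma> \<tau> y"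
        by (subst ev_Cst_iff[OF _ env env']) (use mjA 0 y in auto)
      moreover have "ev D q w \<sigma> \<tau> y"
        using y(2) unfolding Rec using ev_eqv[OF _ enveq_refl[OF env] eqv_sym] by auto
      ultimately show ?thesis using force_tr_eqI[OF _ env y(1)] mjA unfolding 0 by blast
    next
      case S
      let ?c = "Cst i (NV 0 # map NV [1..<Suc k]) (map FV [0..<l])"
      have Sd: "S (\<sigma> 0) \<in> dom_n w" "eqv w (S (\<sigma> 0)) (S (\<sigma> 0))" using unary_dom(1)[OF env_dom(1)[OF env]] eqv_refl by blast+
      then have env': "env w (S (\<sigma> 0) \<rhd> ?\<sigma>) \<tau>" using env_tail[OF env] by (simp add: env_push)
      obtain y where y: "y \<in> dom_n w" "dsem (ds ! i) w (S (\<sigma> 0) \<rhd> ?\<sigma>) \<tau> y" using dsem_total[OF i env'] by blast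
      then obtain \<gamma> where \<gamma>: "\<gamma> \<in> dom_f w" "ev D q w ?\<sigma> \<tau> (Ap \<gamma> Zero)"
        "\<And>w' n. w \<sqsubseteq> w' \<Longrightarrow> n \<in> dom_n w' \<Longrightarrow> ev D r w' (n \<rhd> Ap \<gamma> n \<rhd> ?\<sigma>) \<tau> (Ap \<gamma> (S n))" "eqv w y (Ap \<gamma> (S (\<sigma> 0)))"
        unfolding Rec by auto
      have d: "Ap \<gamma> (\<sigma> 0) \<in> dom_n w" by (rule dom_intros(2)[OF \<gamma>(1) env_dom(1)[OF env]])
      have mjr: "mj_trm r" using pr i Rec ia_mono(1)[of False i "map arity ds" r]
        by (auto simp: pr_definitions_def take_map dest: spec[of _ i])
      have mjc: "mj_trm ?c" using mjA S by auto
      have "ev D ((S (NV 0) # map NV [1..<Suc k]) ! j) w \<sigma> \<tau> ((S (\<sigma> 0) \<rhd> ?\<sigma>) j)" if "j < Suc k" for j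
        using that NV[of "Suc 0"] NV Sd env_dom(1)[OF env] by (cases j) (auto simp del: upt_Suc intro!: bexI[of _ "\<sigma> 0"])
      from arg_values_NV[OF env this]
      have 1: "ev D (Cst i (S (NV 0) # map NV [1..<Suc k]) (map FV [0..<l])) w \<sigma> \<tau> y"
        by (subst ev_Cst_iff[OF _ env env']) (use mjA S y in \<open>auto simp del: upt_Suc\<close>)
      \<comment> \<open>The same \<gamma> witnesses the recursion at the predecessor.\<close>
      have "dsem (ds ! i) w \<sigma> \<tau> (Ap \<gamma> (\<sigma> 0))" unfolding Rec using \<gamma>(1-3) eqv_refl[OF d] by auto
      moreover have "ev D ((NV 0 # map NV [1..<Suc k]) ! j) w \<sigma> \<tau> (\<sigma> j)" if "j < Suc k" for j
        using that NV by (cases j) (auto simp del: upt_Suc)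
      ultimately have 2: "ev D ?c w \<sigma> \<tau> (Ap \<gamma> (\<sigma> 0))"
        using arg_values_NV[OF env, of "Suc k" "NV 0 # map NV [1..<Suc k]" \<sigma> l]
        by (subst ev_Cst_iff[OF mjc env env]) (auto simp del: upt_Suc simp: d)
      have "interprets w \<sigma> \<tau> (NV 0 \<rhd> ?c \<rhd> (\<lambda>n. NV (Suc n))) FV (\<sigma> 0 \<rhd> Ap \<gamma> (\<sigma> 0) \<rhd> ?\<sigma>) \<tau>"
        unfolding interprets_def using env env_tail[OF env] d env_dom(1)[OF env] mjc 2 NV evf_FV[OF env]
        by (auto simp: env_push split: nat.splits simp del: ev.simps ia_trm.simps(5))
      from ev_sub(1)[OF mjr this]
      have "ev D (sub_trm r (NV 0 \<rhd> ?c \<rhd> (\<lambda>n. NV (Suc n))) FV) w \<sigma> \<tau> (Ap \<gamma> (S (\<sigma> 0)))"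
        using \<gamma>(3)[of w "\<sigma> 0"] env_dom(1)[OF env] env_worlds[OF env] by (simp add: acc_refl)
      then have "ev D (sub_trm r (NV 0 \<rhd> ?c \<rhd> (\<lambda>n. NV (Suc n))) FV) w \<sigma> \<tau> y"
        by (rule ev_eqv[OF _ enveq_refl[OF env] eqv_sym[OF \<gamma>(4)]])
      with 1 show ?thesis using force_tr_eqI[OF _ env y(1)] mjA unfolding S by blast
    qed
  qed
qed

lemma force_tr_conversion:
  assumes A: "mj_fm (conversion_axiom s t)" and s: "mj_trm s" "mj_trm t" and env: "env w \<sigma> \<tau>"
  shows "force w \<sigma> \<tau> (tr D (conversion_axiom s t))"
proof -
  obtain d where d: "d \<in> dom_n w" "ev D t w \<sigma> \<tau> d" using ev_total[OF s(2) env] by blast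
  have env': "env w (d \<rhd> \<sigma>) \<tau>" using env d(1) by (simp add: env_push)
  obtain y where y: "y \<in> dom_n w" "ev D s w (d \<rhd> \<sigma>) \<tau> y" using ev_total[OF s(1) env'] by blast
  have "ev D (Ap (Lam s) t) w \<sigma> \<tau> y" using d y by auto
  moreover have "ev D (sub_trm s (t \<rhd> NV) FV) w \<sigma> \<tau> y"
    using ev_sub(1)[OF s(1) interprets_inst[OF env s(2) d(2,1)]] y(2) by simp
  ultimately show ?thesis
    using force_tr_eqI[OF _ env y(1)] A unfolding conversion_axiom_def by blast
qed

text \<open>The translated formula belongs to BIM, so its own induction axiom is available; what
  remains is to read the two substitution instances as environments. Unique choice below is treated
  in the same way.\<close>

lemma force_tr_induction:
  assumes A: "mj_fm A" and env: "env w \<sigma> \<tau>"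
  shows "force w \<sigma> \<tau> (tr D (induction_axiom A))"
proof -
  have Z: "force w' \<sigma> \<tau> (tr D (inst A Zero)) \<longleftrightarrow> force w' (Zero \<rhd> \<sigma>) \<tau> (tr D A)" if "w \<sqsubseteq> w'" for w'
    unfolding inst_def
    by (rule force_tr_sub[OF A interprets_inst])
      (use env_mono[OF that env] env_worlds[OF env_mono[OF that env]] in \<open>auto simp: dom_intros eqv_refl\<close>)
  have Sc: "force w' (d \<rhd> \<sigma>) \<tau> (tr D (sub A (S (NV 0) \<rhd> (\<lambda>n. NV (Suc n))) FV)) \<longleftrightarrow> force w' (S d \<rhd> \<sigma>) \<tau> (tr D A)"
    if "w \<sqsubseteq> w'" "d \<in> dom_n w'" for w' d
  proof (rule force_tr_sub[OF A])
    have e: "env w' \<sigma> \<tau>" by (rule env_mono[OF that(1) env])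
    show "interprets w' (d \<rhd> \<sigma>) \<tau> (S (NV 0) \<rhd> (\<lambda>n. NV (Suc n))) FV (S d \<rhd> \<sigma>) \<tau>"
      unfolding interprets_def using e that(2) env_dom(1)[OF e] evf_FV[of w' "d \<rhd> \<sigma>" \<tau>] unary_dom(1)[OF that(2)]
      by (auto simp: env_push eqv_refl split: nat.splits intro!: bexI[of _ d])
  qed
  have "force u \<sigma> \<tau> (All (tr D A))"
    if u: "w \<sqsubseteq> u" "force u \<sigma> \<tau> (tr D (inst A Zero))"
      "force u \<sigma> \<tau> (All (tr D A \<^bold>\<longrightarrow> tr D (sub A (S (NV 0) \<rhd> (\<lambda>n. NV (Suc n))) FV)))" for u
    unfolding force.simps(6)
  proof (intro HOL.allI HOL.impI ballI)
    fix v d assume v: "u \<sqsubseteq> v" "d \<in> dom_n v"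
    have wv: "w \<sqsubseteq> v" by (rule acc_trans[OF u(1) v(1)])
    show "force v (d \<rhd> \<sigma>) \<tau> (tr D A)"
    proof (rule induct_dom[OF _ env_mono[OF wv env] _ _ v(2)])
      show "tr D A \<in> formulas BIM" by (rule tr_formulas[OF const_fm_bim])
      show "force v (Zero \<rhd> \<sigma>) \<tau> (tr D A)" using force_mono[OF u(2) v(1)] Z[OF wv] by blast
      fix w' d assume w': "v \<sqsubseteq> w'" "d \<in> dom_n w'" "force w' (d \<rhd> \<sigma>) \<tau> (tr D A)"
      have uw: "u \<sqsubseteq> w'" "w \<sqsubseteq> w'" "w' \<sqsubseteq> w'"
        using acc_trans[OF v(1) w'(1)] acc_trans[OF wv w'(1)] w'(1) by (auto simp: acc_def)
      then show "force w' (S d \<rhd> \<sigma>) \<tau> (tr D A)"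
        using u(3) w'(2,3) Sc[OF uw(2) w'(2)] unfolding force.simps(5,6) by blast
    qed
  qed
  then show ?thesis unfolding induction_axiom_def tr.simps force.simps(3,5) by blast
qed

lemma force_tr_choice:
  assumes A: "mj_fm A" and env: "env w \<sigma> \<tau>"
  shows "force w \<sigma> \<tau> (tr D (AC00u A))"
proof -
  have 1: "force v (z \<rhd> y \<rhd> x \<rhd> \<sigma>) \<tau> (tr D (sub A (NV 0 \<rhd> (\<lambda>n. NV (Suc (Suc n)))) FV)) \<longleftrightarrow>
      force v (z \<rhd> x \<rhd> \<sigma>) \<tau> (tr D A)"
    if v: "w \<sqsubseteq> v" "x \<in> dom_n v" "y \<in> dom_n v" "z \<in> dom_n v" for v x y z
  proof -
    have "env v (z \<rhd> y \<rhd> x \<rhd> \<sigma>) \<tau>" using env_mono[OF v(1) env] v by (simp add: env_push)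
    from force_tr_sub[OF A interprets_shift[OF this], of "case_nat 0 (\<lambda>n. Suc (Suc n))" "\<lambda>n. n"]
    have "force v (z \<rhd> y \<rhd> x \<rhd> \<sigma>) \<tau> (tr D (sub A (\<lambda>n. NV (case_nat 0 (\<lambda>n. Suc (Suc n)) n)) FV)) \<longleftrightarrow>
      force v (\<lambda>n. (z \<rhd> y \<rhd> x \<rhd> \<sigma>) (case_nat 0 (\<lambda>n. Suc (Suc n)) n)) \<tau> (tr D A)" by simp
    moreover have "(\<lambda>n. NV (case_nat 0 (\<lambda>n. Suc (Suc n)) n)) = (NV 0 \<rhd> (\<lambda>n. NV (Suc (Suc n))))"
      "(\<lambda>n. (z \<rhd> y \<rhd> x \<rhd> \<sigma>) (case_nat 0 (\<lambda>n. Suc (Suc n)) n)) = (z \<rhd> x \<rhd> \<sigma>)"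
      by (auto simp: fun_eq_iff split: nat.splits)
    ultimately show ?thesis by simp
  qed
  have 2: "force v (x \<rhd> \<sigma>) (f \<rhd> \<tau>) (tr D (sub A (Ap (FV 0) (NV 0) \<rhd> NV) (\<lambda>n. FV (Suc n)))) \<longleftrightarrow>
      force v (Ap f x \<rhd> x \<rhd> \<sigma>) \<tau> (tr D A)"
    if v: "w \<sqsubseteq> v" "x \<in> dom_n v" "f \<in> dom_f v" for v x f
  proof (rule force_tr_sub[OF A])
    have e: "env v \<sigma> \<tau>" by (rule env_mono[OF v(1) env])
    have "Ap f x \<in> dom_n v" by (rule dom_intros(2)[OF v(3,2)])
    then show "interprets v (x \<rhd> \<sigma>) (f \<rhd> \<tau>) (Ap (FV 0) (NV 0) \<rhd> NV) (\<lambda>n. FV (Suc n)) (Ap f x \<rhd> x \<rhd> \<sigma>) \<tau>"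
      unfolding interprets_def using e v env_dom(1)[OF e] evf_FV[OF e]
      by (auto simp: env_push eqv_refl split: nat.splits intro!: bexI[of _ x])
  qed
  have "force u \<sigma> \<tau> (FEx (All (tr D (sub A (Ap (FV 0) (NV 0) \<rhd> NV) (\<lambda>n. FV (Suc n))))))"
    if u: "w \<sqsubseteq> u" "force u \<sigma> \<tau> (All (tr D (Ex1 A)))" for u
  proof -
    have y: "\<exists>y\<in>dom_n w'. force w' (y \<rhd> x \<rhd> \<sigma>) \<tau> (tr D A) \<and>
      (\<forall>z\<in>dom_n w'. force w' (z \<rhd> x \<rhd> \<sigma>) \<tau> (tr D A) \<longrightarrow> eqv w' y z)" if w': "u \<sqsubseteq> w'" "x \<in> dom_n w'" for w' x
    proof -
      have ww: "w' \<sqsubseteq> w'" "w \<sqsubseteq> w'" using w'(1) acc_trans[OF u(1) w'(1)] by (auto simp: acc_def)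
      have "force w' (x \<rhd> \<sigma>) \<tau> (tr D (Ex1 A))" using u(2) w' by simp
      then obtain y where y: "y \<in> dom_n w'" "force w' (y \<rhd> x \<rhd> \<sigma>) \<tau> (tr D A)"
        "force w' (y \<rhd> x \<rhd> \<sigma>) \<tau> (All (tr D (sub A (NV 0 \<rhd> (\<lambda>n. NV (Suc (Suc n)))) FV) \<^bold>\<longrightarrow> NV 1 \<doteq> NV 0))"
        unfolding Ex1_def by (auto simp: tr_eq_def)
      have "eqv w' y z" if "z \<in> dom_n w'" "force w' (z \<rhd> x \<rhd> \<sigma>) \<tau> (tr D A)" for z
        using y(3) that ww(1) 1[OF ww(2) w'(2) y(1) that(1)] by simp
      then show ?thesis using y(1,2) by blast
    qed
    have "\<exists>f\<in>dom_f u. \<forall>w' x. u \<sqsubseteq> w' \<longrightarrow> x \<in> dom_n w' \<longrightarrow> force w' (Ap f x \<rhd> x \<rhd> \<sigma>) \<tau> (tr D A)"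
    proof (rule unique_choice[OF _ env_mono[OF u(1) env]])
      show "tr D A \<in> formulas BIM" by (rule tr_formulas[OF const_fm_bim])
      show "\<exists>y\<in>dom_n w'. force w' (y \<rhd> x \<rhd> \<sigma>) \<tau> (tr D A)" if "u \<sqsubseteq> w'" "x \<in> dom_n w'" for w' x
        using y[OF that] by blast
      fix w' x a b assume *: "u \<sqsubseteq> w'" "x \<in> dom_n w'" "a \<in> dom_n w'" "b \<in> dom_n w'"
        "force w' (a \<rhd> x \<rhd> \<sigma>) \<tau> (tr D A)" "force w' (b \<rhd> x \<rhd> \<sigma>) \<tau> (tr D A)"
      obtain y where "eqv w' y a" "eqv w' y b" using y[OF *(1,2)] *(3-6) by blast
      then show "eqv w' a b" by (rule eqv_euclid)
    qed
    then show ?thesis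
      unfolding force.simps(6,9) using 2 acc_trans[OF u(1)] dom_mono(2) by blast
  qed
  then show ?thesis unfolding AC00u_def tr.simps force.simps(5) by blast
qed

text \<open>In the quantifier rules a term or functor of Mj is replaced by its value, an individual
  of the model. A derivation in Mj can use only assumptions in its language, hence the condition
  \<open>mj_fm A\<close>.\<close>

lemma translation_sound:
  "Mj ds \<parallel> \<Gamma> \<turnstile> E \<Longrightarrow> env w \<sigma> \<tau> \<Longrightarrow> (\<And>A. A \<in> \<Gamma> \<Longrightarrow> mj_fm A \<Longrightarrow> force w \<sigma> \<tau> (tr D A)) \<Longrightarrow> force w \<sigma> \<tau> (tr D E)"
proof (induction arbitrary: w \<sigma> \<tau> rule: derives.induct)
  case (assm A \<Gamma>) then show ?case by (simp add: mj_formulas)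
next
  case (ax A \<Gamma>)
  have mjA: "mj_fm A" using ax(2) by (simp add: mj_formulas)
  consider "A \<in> arith_axioms \<union> pairing_axioms" | i where "i < length ds" "A \<in> defining_axioms i (ds ! i)"
    | s t where "A = conversion_axiom s t" "mj_trm s" "mj_trm t" | B where "A = induction_axiom B" "mj_fm B"
    | B where "A = AC00u B" "mj_fm B"
    using ax(1) by (auto simp: Mj_def M_axioms_def IA1_axioms_def)
  then show ?case
  proof cases
    case 1
    then have "A \<in> formulas BIM" by (auto simp: arith_axioms_def pairing_axioms_def)
    then show ?thesis using 1 arith_force[OF _ ax(3)] by (simp add: tr_bim bim_constant_axioms_def)
  next
    case 2 then show ?thesis by (rule force_tr_defining[OF _ _ ax(3)])
  next
    case 3 then show ?thesis using force_tr_conversion[OF _ _ _ ax(3)] mjA by simp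
  next
    case 4 then show ?thesis using force_tr_induction[OF _ ax(3)] by simp
  next
    case 5 then show ?thesis using force_tr_choice[OF _ ax(3)] by simp
  qed
next
  case (negI A \<Gamma> B)
  show ?case
    unfolding tr.simps force.simps(2)
  proof (intro HOL.allI HOL.impI notI)
    fix w' assume w': "w \<sqsubseteq> w'" "force w' \<sigma> \<tau> (tr D A)"
    have "force w' \<sigma> \<tau> (tr D C)" if "C \<in> insert A \<Gamma>" "mj_fm C" for C
      using that w'(2) force_mono[OF negI.prems(2) w'(1)] by auto
    from negI.IH(1)[OF env_mono[OF w'(1) negI.prems(1)] this] negI.IH(2)[OF env_mono[OF w'(1) negI.prems(1)] this]
    show False using w'(1) by (auto simp: acc_def)
  qed
next
  case (negE \<Gamma> A B)
  then have "force w \<sigma> \<tau> (tr D (\<^bold>\<not> A))" "force w \<sigma> \<tau> (tr D A)" by blast+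
  moreover have "w \<sqsubseteq> w" using env_worlds[OF negE.prems(1)] by (simp add: acc_refl)
  ultimately show ?case by auto
next
  case (orE \<Gamma> A B C)
  have "force w \<sigma> \<tau> (tr D (A \<^bold>\<or> B))" using orE.IH(1) orE.prems by blast
  then consider "force w \<sigma> \<tau> (tr D A)" | "force w \<sigma> \<tau> (tr D B)" by auto
  then show ?case
  proof cases
    case 1 show ?thesis by (rule orE.IH(2)[OF orE.prems(1)]) (use 1 orE.prems(2) in auto)
  next
    case 2 show ?thesis by (rule orE.IH(3)[OF orE.prems(1)]) (use 2 orE.prems(2) in auto)
  qed
next
  case (impI A \<Gamma> B)
  show ?case
    unfolding tr.simps force.simps(5)
  proof (intro HOL.allI HOL.impI)
    fix w' assume w': "w \<sqsubseteq> w'" "force w' \<sigma> \<tau> (tr D A)"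
    show "force w' \<sigma> \<tau> (tr D B)"
      by (rule impI.IH[OF env_mono[OF w'(1) impI.prems(1)]]) (use w'(2) force_mono[OF impI.prems(2) w'(1)] in auto)
  qed
next
  case (impE \<Gamma> A B)
  then have "force w \<sigma> \<tau> (tr D (A \<^bold>\<longrightarrow> B))" "force w \<sigma> \<tau> (tr D A)" by blast+
  moreover have "w \<sqsubseteq> w" using env_worlds[OF impE.prems(1)] by (simp add: acc_refl)
  ultimately show ?case by auto
next
  case (allI \<Gamma> A)
  show ?case
    unfolding tr.simps force.simps(6)
  proof (intro HOL.allI HOL.impI ballI)
    fix w' d assume w': "w \<sqsubseteq> w'" "d \<in> dom_n w'"
    have e: "env w' \<sigma> \<tau>" by (rule env_mono[OF w'(1) allI.prems(1)])
    show "force w' (d \<rhd> \<sigma>) \<tau> (tr D A)"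
    proof (rule allI.IH)
      show "env w' (d \<rhd> \<sigma>) \<tau>" using e w'(2) by (simp add: env_push)
      fix B assume "B \<in> lift ` \<Gamma>" "mj_fm B"
      then obtain C where C: "B = lift C" "C \<in> \<Gamma>" by blast
      then have "mj_fm C" using \<open>mj_fm B\<close> lang.lift_formulas(1)[OF Mj_lang[of ds], of C] by (simp add: mj_formulas)
      then show "force w' (d \<rhd> \<sigma>) \<tau> (tr D B)"
        using force_tr_lift(1)[OF _ e w'(2), of C] force_mono[OF allI.prems(2) w'(1)] C by blast
    qed
  qed
next
  case (fallI \<Gamma> A)
  show ?case
    unfolding tr.simps force.simps(8)
  proof (intro HOL.allI HOL.impI ballI)
    fix w' f assume w': "w \<sqsubseteq> w'" "f \<in> dom_f w'"
    have e: "env w' \<sigma> \<tau>" by (rule env_mono[OF w'(1) fallI.prems(1)])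
    show "force w' \<sigma> (f \<rhd> \<tau>) (tr D A)"
    proof (rule fallI.IH)
      show "env w' \<sigma> (f \<rhd> \<tau>)" using e w'(2) by (simp add: env_push)
      fix B assume "B \<in> flift ` \<Gamma>" "mj_fm B"
      then obtain C where C: "B = flift C" "C \<in> \<Gamma>" by blast
      then have "mj_fm C" using \<open>mj_fm B\<close> lang.lift_formulas(2)[OF Mj_lang[of ds], of C] by (simp add: mj_formulas)
      then show "force w' \<sigma> (f \<rhd> \<tau>) (tr D B)"
        using force_tr_lift(2)[OF _ e w'(2), of C] force_mono[OF fallI.prems(2) w'(1)] C by blast
    qed
  qed
next
  case (allE \<Gamma> A t)
  have ww: "w \<sqsubseteq> w" using env_worlds[OF allE.prems(1)] by (simp add: acc_refl)
  have t: "mj_trm t" using allE.hyps(2) by simp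
  have A: "mj_fm A" using lang.derives_formulas[OF Mj_lang allE.hyps(1)] by (simp add: mj_formulas)
  obtain d where d: "d \<in> dom_n w" "ev D t w \<sigma> \<tau> d" using ev_total[OF t allE.prems(1)] by blast
  have "force w (d \<rhd> \<sigma>) \<tau> (tr D A)" using allE.IH[OF allE.prems] ww d(1) by auto
  then show ?case
    unfolding inst_def using force_tr_sub[OF A interprets_inst[OF allE.prems(1) t d(2,1)]] by simp
next
  case (fallE \<Gamma> A u)
  have ww: "w \<sqsubseteq> w" using env_worlds[OF fallE.prems(1)] by (simp add: acc_refl)
  have u: "mj_fnc u" using fallE.hyps(2) by simp
  have A: "mj_fm A" using lang.derives_formulas[OF Mj_lang fallE.hyps(1)] by (simp add: mj_formulas)
  obtain f where f: "f \<in> dom_f w" "\<And>w' x. w \<sqsubseteq> w' \<Longrightarrow> x \<in> dom_n w' \<Longrightarrow> evf D u w' \<sigma> \<tau> x (Ap f x)"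
    using evf_function[OF u fallE.prems(1)] by blast
  have "force w \<sigma> (f \<rhd> \<tau>) (tr D A)" using fallE.IH[OF fallE.prems] ww f(1) by auto
  then show ?case
    unfolding finst_def using force_tr_sub[OF A interprets_finst[OF fallE.prems(1) u f]] by simp
next
  case (exI \<Gamma> A t)
  have t: "mj_trm t" using exI.hyps(2) by simp
  have A: "mj_fm A" using exI.hyps(3) by (simp add: mj_formulas)
  obtain d where d: "d \<in> dom_n w" "ev D t w \<sigma> \<tau> d" using ev_total[OF t exI.prems(1)] by blast
  have "force w (d \<rhd> \<sigma>) \<tau> (tr D A)"
    using exI.IH[OF exI.prems] force_tr_sub[OF A interprets_inst[OF exI.prems(1) t d(2,1)]]
    unfolding inst_def by simp
  then show ?case using d(1) by auto
next
  case (fexI \<Gamma> A u)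
  have u: "mj_fnc u" using fexI.hyps(2) by simp
  have A: "mj_fm A" using fexI.hyps(3) by (simp add: mj_formulas)
  obtain f where f: "f \<in> dom_f w" "\<And>w' x. w \<sqsubseteq> w' \<Longrightarrow> x \<in> dom_n w' \<Longrightarrow> evf D u w' \<sigma> \<tau> x (Ap f x)"
    using evf_function[OF u fexI.prems(1)] by blast
  have "force w \<sigma> (f \<rhd> \<tau>) (tr D A)"
    using fexI.IH[OF fexI.prems] force_tr_sub[OF A interprets_finst[OF fexI.prems(1) u f]]
    unfolding finst_def by simp
  then show ?case using f(1) by auto
next
  case (exE \<Gamma> A C)
  have C: "mj_fm C"
    using lang.derives_formulas[OF Mj_lang exE.hyps(2)] lang.lift_formulas(1)[OF Mj_lang[of ds], of C] by (simp add: mj_formulas)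
  obtain d where d: "d \<in> dom_n w" "force w (d \<rhd> \<sigma>) \<tau> (tr D A)" using exE.IH(1)[OF exE.prems] by auto
  have "force w (d \<rhd> \<sigma>) \<tau> (tr D (lift C))"
  proof (rule exE.IH(2))
    show "env w (d \<rhd> \<sigma>) \<tau>" using exE.prems(1) d(1) by (simp add: env_push)
    fix B assume B: "B \<in> insert A (lift ` \<Gamma>)" "mj_fm B"
    show "force w (d \<rhd> \<sigma>) \<tau> (tr D B)"
    proof (cases "B = A")
      case False
      then obtain C where C: "B = lift C" "C \<in> \<Gamma>" using B(1) by blast
      then have "mj_fm C" using B(2) lang.lift_formulas(1)[OF Mj_lang[of ds], of C] by (simp add: mj_formulas)
      then show ?thesis using force_tr_lift(1)[OF _ exE.prems(1) d(1), of C] exE.prems(2) C by blast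
    qed (use d in simp)
  qed
  then show ?case using force_tr_lift(1)[OF C exE.prems(1) d(1)] by blast
next
  case (fexE \<Gamma> A C)
  have C: "mj_fm C"
    using lang.derives_formulas[OF Mj_lang fexE.hyps(2)] lang.lift_formulas(2)[OF Mj_lang[of ds], of C] by (simp add: mj_formulas)
  obtain f where f: "f \<in> dom_f w" "force w \<sigma> (f \<rhd> \<tau>) (tr D A)" using fexE.IH(1)[OF fexE.prems] by auto
  have "force w \<sigma> (f \<rhd> \<tau>) (tr D (flift C))"
  proof (rule fexE.IH(2))
    show "env w \<sigma> (f \<rhd> \<tau>)" using fexE.prems(1) f(1) by (simp add: env_push)
    fix B assume B: "B \<in> insert A (flift ` \<Gamma>)" "mj_fm B"
    show "force w \<sigma> (f \<rhd> \<tau>) (tr D B)"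
    proof (cases "B = A")
      case False
      then obtain C where C: "B = flift C" "C \<in> \<Gamma>" using B(1) by blast
      then have "mj_fm C" using B(2) lang.lift_formulas(2)[OF Mj_lang[of ds], of C] by (simp add: mj_formulas)
      then show ?thesis using force_tr_lift(2)[OF _ fexE.prems(1) f(1), of C] fexE.prems(2) C by blast
    qed (use f in simp)
  qed
  then show ?case using force_tr_lift(2)[OF C fexE.prems(1) f(1)] by blast
next
  case (andE1 \<Gamma> A B) then show ?case by (metis force.simps(3) tr.simps(3))
next
  case (andE2 \<Gamma> A B) then show ?case by (metis force.simps(3) tr.simps(3))
qed simp_all

end

section \<open>The translation inside the extended system\<close>

lemma Mj_axiom: "A \<in> M_axioms True ds \<union> pairing_axioms \<Longrightarrow> A \<in> formulas (Mj ds) \<Longrightarrow> Mj ds \<parallel> \<Gamma> \<turnstile> A"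
  by (rule derives.ax) (simp_all add: Mj_def)

lemma bim_mj_formulas: "A \<in> formulas BIM \<Longrightarrow> over {t. ia_trm True (map arity ds) t} A"
  using lang.bim_formulas[OF Mj_lang[of ds], of A] by (simp add: formulas_def)

lemma Mj_conversion:
  assumes "ia_trm True (map arity ds) s" "ia_trm True (map arity ds) t"
  shows "Mj ds \<parallel> \<Gamma> \<turnstile> conversion_axiom s t"
  by (rule Mj_axiom) (use assms in \<open>auto simp: M_axioms_def IA1_axioms_def conversion_axiom_def
    formulas_def intro!: ia_sub split: nat.splits\<close>)

lemma Mj_choice_model: "choice_model (Mj ds)"
proof -
  interpret lang "Mj ds" by (rule Mj_lang)
  show ?thesis
  proof
    fix A :: fm
    show "Mj ds \<parallel> {} \<turnstile> A" if A: "A \<in> arith_axioms \<union> bim_constant_axioms"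
    proof -
      \<comment> \<open>\<open>ZeroF\<close> and \<open>IdF\<close> are abstractions, so in Mj their
        defining equations are instances of conversion.\<close>
      consider "A \<in> arith_axioms \<union> pairing_axioms" | "A = conversion_axiom Zero (NV 0)" | "A = conversion_axiom (NV 0) (NV 0)"
        using A by (auto simp: bim_constant_axioms_def conversion_axiom_def ZeroF_def IdF_def)
      then show ?thesis
      proof cases
        case 1
        then have "A \<in> formulas BIM" by (auto simp: arith_axioms_def pairing_axioms_def)
        then show ?thesis using 1 bim_formulas by (intro Mj_axiom) (auto simp: M_axioms_def IA1_axioms_def)
      qed (simp_all add: Mj_conversion)
    qed
    assume A: "A \<in> formulas BIM"
    show "Mj ds \<parallel> {} \<turnstile> induction_axiom A"
      using bim_formulas[OF induction_axiom_formulas[OF A]] bim_mj_formulas[OF A]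
      by (intro Mj_axiom) (auto simp: M_axioms_def IA1_axioms_def)
    show "Mj ds \<parallel> {} \<turnstile> AC00u A"
      using bim_formulas[OF AC00u_formulas[OF A]] bim_mj_formulas[OF A]
      by (intro Mj_axiom) (auto simp: M_axioms_def)
  qed
qed

locale mj_model = pr_model "Mj ds" ds for ds
begin

lemma force_axiom: "A \<in> defining_axioms i (ds ! i) \<Longrightarrow> i < length ds \<Longrightarrow> env w \<sigma> \<tau> \<Longrightarrow> force w \<sigma> \<tau> A"
  using defining_axioms_formulas[OF pr]
  by (intro sound[OF Mj_axiom]) (auto simp: M_axioms_def IA1_axioms_def)

lemma mj_dom:
  "env w \<sigma> \<tau> \<Longrightarrow> mj_trm t \<Longrightarrow> sub_trm t \<sigma> \<tau> \<in> dom_n w"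
  "env w \<sigma> \<tau> \<Longrightarrow> mj_fnc u \<Longrightarrow> sub_fnc u \<sigma> \<tau> \<in> dom_f w"
  using env_sub(4,5)[of w \<sigma> \<tau>] by simp_all

text \<open>The conversion axiom knows no environment. It is applied to the body shifted past one
  variable and to \<open>NV 0\<close>, in the environment with x pushed; this brings \<sigma> and
  \<tau> under the abstraction.\<close>

lemma beta:
  assumes t: "mj_trm t" and env: "env w \<sigma> \<tau>" and x: "x \<in> dom_n w"
  shows "eqv w (Ap (sub_fnc (Lam t) \<sigma> \<tau>) x) (sub_trm t (x \<rhd> \<sigma>) \<tau>)"
proof -
  let ?s = "ren_trm t (up Suc) id"
  have "mj_trm ?s" using t mj_ren by simp
  then have "Mj ds \<parallel> {} \<turnstile> conversion_axiom ?s (NV 0)" by (intro Mj_conversion) auto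
  then have "force w (x \<rhd> \<sigma>) \<tau> (conversion_axiom ?s (NV 0))" by (rule sound) (use env x in \<open>simp add: env_push\<close>)
  moreover have "sub_fnc (Lam ?s) (x \<rhd> \<sigma>) \<tau> = sub_fnc (Lam t) \<sigma> \<tau>" using sub_Suc(2)[of "Lam t" x \<sigma> \<tau>] by simp
  moreover have "sub_trm (sub_trm ?s (NV 0 \<rhd> NV) FV) (x \<rhd> \<sigma>) \<tau> = sub_trm t (x \<rhd> \<sigma>) \<tau>"
    unfolding sub_sub(1) sub_ren(1)
    by (rule arg_cong2[where f="sub_trm t"]) (auto simp: fun_eq_iff up_def split: nat.splits)
  ultimately show ?thesis by (simp add: conversion_axiom_def del: sub_fnc.simps(5))
qed

definition cst :: "nat \<Rightarrow> nsub \<Rightarrow> fsub \<Rightarrow> trm" where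
  "cst i \<sigma> \<tau> = Cst i (map \<sigma> [0..<fst (arity (ds ! i))]) (map \<tau> [0..<snd (arity (ds ! i))])"

definition represents :: "nat \<Rightarrow> bool" where
  "represents i \<longleftrightarrow> (\<forall>w \<sigma> \<tau>. env w \<sigma> \<tau> \<longrightarrow> dsem (ds ! i) w \<sigma> \<tau> (cst i \<sigma> \<tau>))"

text \<open>In Mj the terms are individuals, and each is its own value. Again relative to the first
  n definitions, for an induction on them.\<close>

lemma ev_self:
  assumes n: "n \<le> length ds" and rep: "\<And>i. i < n \<Longrightarrow> represents i"
  shows "ia_trm b (take n (map arity ds)) t \<Longrightarrow> env w \<sigma> \<tau> \<Longrightarrow> ev D t w \<sigma> \<tau> (sub_trm t \<sigma> \<tau>)"
    "ia_fnc b (take n (map arity ds)) u \<Longrightarrow> env w \<sigma> \<tau> \<Longrightarrow> x \<in> dom_n w \<Longrightarrow> evf D u w \<sigma> \<tau> x (Ap (sub_fnc u \<sigma> \<tau>) x)"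
proof (induction t and u arbitrary: w \<sigma> \<tau> and w \<sigma> \<tau> x)
  case (NV n) then show ?case by (simp add: eqv_refl env_dom)
next
  case Zero then show ?case by (simp add: eqv_refl dom_intros env_worlds)
next
  case (Ap u t)
  have "sub_trm t \<sigma> \<tau> \<in> dom_n w" using ia_mono(1)[OF Ap.prems(1)] by (intro mj_dom(1)[OF Ap.prems(2)]) simp
  then show ?case using Ap by (auto intro!: bexI[of _ "sub_trm t \<sigma> \<tau>"])
next
  case (J s t)
  have *: "sub_trm s \<sigma> \<tau> \<in> dom_n w" "sub_trm t \<sigma> \<tau> \<in> dom_n w" using ia_mono(1)[OF J.prems(1)] by (auto intro!: mj_dom(1)[OF J.prems(2)])
  then have e: "eqv w (J (sub_trm s \<sigma> \<tau>) (sub_trm t \<sigma> \<tau>)) (J (sub_trm s \<sigma> \<tau>) (sub_trm t \<sigma> \<tau>))"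
    by (simp add: eqv_refl dom_intros)
  have "ia_trm b (take n (map arity ds)) s" "ia_trm b (take n (map arity ds)) t"
    using J.prems(1) unfolding ia_trm.simps by iprover+
  from J.IH(1)[OF this(1) J.prems(2)] J.IH(2)[OF this(2) J.prems(2)]
  have "ev D s w \<sigma> \<tau> (sub_trm s \<sigma> \<tau>)" "ev D t w \<sigma> \<tau> (sub_trm t \<sigma> \<tau>)" by iprover+
  then show ?case
    unfolding ev.simps sub_trm.simps
    using * e by blast
next
  case (FV n) then show ?case by (simp add: eqv_refl dom_intros env_dom)
next
  case Succ then show ?case by (simp add: eqv_refl unary_dom)
next
  case PK then show ?case by (simp add: eqv_refl unary_dom)
next
  case PL then show ?case by (simp add: eqv_refl unary_dom)
next
  case (Lam t)
  have env: "env w (x \<rhd> \<sigma>) \<tau>" using Lam.prems by (simp add: env_push)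
  have t: "mj_trm t" using ia_mono(2)[OF Lam.prems(1)] by simp
  have "ev D t w (x \<rhd> \<sigma>) \<tau> (sub_trm t (x \<rhd> \<sigma>) \<tau>)" using Lam.IH[OF _ env] Lam.prems(1) by simp
  then have "ev D t w (x \<rhd> \<sigma>) \<tau> (Ap (sub_fnc (Lam t) \<sigma> \<tau>) x)"
    by (rule ev_eqv[OF _ enveq_refl[OF env] eqv_sym[OF beta[OF t Lam.prems(2,3)]]])
  then show ?case by simp
next
  case (Cst i ts us)
  have i: "i < n" "i < length ds" "arity (ds ! i) = (length ts, length us)" using Cst.prems(1) n by auto
  have c: "mj_trm (Cst i ts us)" by (rule ia_mono(1)[OF Cst.prems(1)])
  then have tu: "\<And>j. j < length ts \<Longrightarrow> mj_trm (ts ! j)" "\<And>j. j < length us \<Longrightarrow> mj_fnc (us ! j)"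
    by (auto simp: list_all_length)
  \<comment> \<open>Filled up with constants beyond the argument lists in order to have a full
    environment.\<close>
  define \<sigma>' where "\<sigma>' j = (if j < length ts then sub_trm (ts ! j) \<sigma> \<tau> else Zero)" for j
  define \<tau>' where "\<tau>' j = (if j < length us then sub_fnc (us ! j) \<sigma> \<tau> else Succ)" for j
  have env': "env w \<sigma>' \<tau>'"
    using mj_dom[OF Cst.prems(2)] tu env_worlds[OF Cst.prems(2)]
    by (auto simp: env_def \<sigma>'_def \<tau>'_def dom_intros)
  have "cst i \<sigma>' \<tau>' = sub_trm (Cst i ts us) \<sigma> \<tau>"
    by (auto simp: cst_def i(3) \<sigma>'_def \<tau>'_def intro!: nth_equalityI)
  moreover have "dsem (ds ! i) w \<sigma>' \<tau>' (cst i \<sigma>' \<tau>')" using rep[OF i(1)] env' by (simp add: represents_def)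
  moreover have av: "arg_values w \<sigma> \<tau> (length ts) (length us) (nth ts) (nth us) \<sigma>' \<tau>'"
    unfolding arg_values_def
  proof (intro conjI HOL.allI HOL.impI)
    fix j assume j: "j < length ts"
    then have "ia_trm b (take n (map arity ds)) (ts ! j)" using Cst.prems(1) by (simp add: list_all_length)
    then show "ev D (ts ! j) w \<sigma> \<tau> (\<sigma>' j)" using Cst.IH(1)[OF nth_mem[OF j] _ Cst.prems(2)] j by (simp add: \<sigma>'_def)
  next
    fix j w' x assume j: "j < length us" and w': "acc w w'" "x \<in> dom_n w'"
    then have "ia_fnc b (take n (map arity ds)) (us ! j)" using Cst.prems(1) by (simp add: list_all_length)
    then show "evf D (us ! j) w' \<sigma> \<tau> x (Ap (\<tau>' j) x)"
      using Cst.IH(2)[OF nth_mem[OF j] _ env_mono[OF w'(1) Cst.prems(2)] w'(2)] j by (simp add: \<tau>'_def)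
  qed
  ultimately show ?case
    using ev_Cst_iff[OF c Cst.prems(2) env' av mj_dom(1)[OF Cst.prems(2) c]] by (simp only:)
qed

text \<open>For a recursion the function \<gamma> that the meaning asks for is the constant
  abstracted over its first argument; through \<open>beta\<close> its defining equations become the
  recursion equations.\<close>

lemma represents: "i < length ds \<Longrightarrow> represents i"
proof (induction i rule: less_induct)
  case (less i)
  have self: "ev D t w \<sigma> \<tau> (sub_trm t \<sigma> \<tau>)" if "ia_trm b (take i (map arity ds)) t" "env w \<sigma> \<tau>" for b t w \<sigma> \<tau>
    by (rule ev_self(1)[OF _ _ that]) (use less in auto)
  have d: "prdef_over (take i (map arity ds)) (ds ! i)" using pr less.prems by (simp add: pr_definitions_def take_map)
  have ax: "force w \<sigma> \<tau> A" if "A \<in> defining_axioms i (ds ! i)" "env w \<sigma> \<tau>" for A w \<sigma> \<tau>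
    by (rule force_axiom[OF that(1) less.prems that(2)])
  show ?case
    unfolding represents_def
  proof (intro HOL.allI HOL.impI)
    fix w \<sigma> \<tau> assume env: "env w \<sigma> \<tau>"
    show "dsem (ds ! i) w \<sigma> \<tau> (cst i \<sigma> \<tau>)"
    proof (cases "ds ! i")
      case (Expl k l p)
      have "ev D p w \<sigma> \<tau> (sub_trm p \<sigma> \<tau>)" using self[OF _ env] d Expl by auto
      moreover have "eqv w (cst i \<sigma> \<tau>) (sub_trm p \<sigma> \<tau>)"
        using ax[OF _ env] Expl by (simp add: cst_def comp_def)
      ultimately have "ev D p w \<sigma> \<tau> (cst i \<sigma> \<tau>)" by (rule ev_eqv[OF _ enveq_refl[OF env] eqv_sym])
      then show ?thesis using Expl by simp
    next
      case (Rec k l q r)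
      let ?\<rho> = "\<lambda>n. \<sigma> (Suc n)"
      let ?s = "Cst i (NV 0 # map (\<lambda>j. NV (Suc j)) [0..<k]) (map FV [0..<l])"
      let ?\<gamma> = "sub_fnc (Lam ?s) ?\<rho> \<tau>"
      have env': "env w ?\<rho> \<tau>" by (rule env_tail[OF env])
      have s: "mj_trm ?s" using less.prems Rec by (auto simp: list_all_iff)
      have subs: "sub_trm ?s (x \<rhd> ?\<rho>) \<tau> = cst i (x \<rhd> ?\<rho>) \<tau>" for x
        by (simp add: cst_def Rec comp_def upt_conv_Cons map_Suc_upt[symmetric] del: upt_Suc)
      have \<gamma>: "?\<gamma> \<in> dom_f w" using mj_dom(2)[OF env', of "Lam ?s"] s by simp
      have b: "eqv w' (Ap ?\<gamma> x) (cst i (x \<rhd> ?\<rho>) \<tau>)" if "acc w w'" "x \<in> dom_n w'" for w' x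
        using beta[OF s env_mono[OF that(1) env'] that(2)] unfolding subs .
      have w: "acc w w" "Zero \<in> dom_n w" using env_worlds[OF env] by (simp_all add: acc_refl dom_intros)
      have "force w ?\<rho> \<tau> (Cst i (Zero # map NV [0..<k]) (map FV [0..<l]) \<doteq> q)" by (rule ax[OF _ env']) (simp add: Rec)
      then have "eqv w (cst i (Zero \<rhd> ?\<rho>) \<tau>) (sub_trm q ?\<rho> \<tau>)"
        by (simp add: cst_def Rec comp_def upt_conv_Cons map_Suc_upt[symmetric] del: upt_Suc)
      from eqv_trans[OF b[OF w] this] have "eqv w (Ap ?\<gamma> Zero) (sub_trm q ?\<rho> \<tau>)" .
      moreover have "ev D q w ?\<rho> \<tau> (sub_trm q ?\<rho> \<tau>)" using self[OF _ env'] d Rec by auto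
      ultimately have q: "ev D q w ?\<rho> \<tau> (Ap ?\<gamma> Zero)" using ev_eqv[OF _ enveq_refl[OF env'] eqv_sym] by blast
      have r: "ev D r w' (n \<rhd> Ap ?\<gamma> n \<rhd> ?\<rho>) \<tau> (Ap ?\<gamma> (S n))" if w': "acc w w'" "n \<in> dom_n w'" for w' n
      proof -
        let ?c = "cst i (n \<rhd> ?\<rho>) \<tau>"
        have e: "env w' ?\<rho> \<tau>" by (rule env_mono[OF w'(1) env'])
        then have e1: "env w' (n \<rhd> ?\<rho>) \<tau>" using w' by (simp add: env_push)
        have e2: "env w' (n \<rhd> ?c \<rhd> ?\<rho>) \<tau>" using e w' eqv_dom(2)[OF b[OF w']] by (simp add: env_push)
        have "force w' (n \<rhd> ?\<rho>) \<tau> (Cst i (S (NV 0) # map NV [1..<Suc k]) (map FV [0..<l]) \<doteq>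
          sub_trm r (NV 0 \<rhd> Cst i (NV 0 # map NV [1..<Suc k]) (map FV [0..<l]) \<rhd> (\<lambda>n. NV (Suc n))) FV)"
          by (rule ax[OF _ e1]) (simp add: Rec)
        moreover have "sub_trm (sub_trm r (NV 0 \<rhd> Cst i (NV 0 # map NV [1..<Suc k]) (map FV [0..<l]) \<rhd> (\<lambda>n. NV (Suc n))) FV) (n \<rhd> ?\<rho>) \<tau>
          = sub_trm r (n \<rhd> ?c \<rhd> ?\<rho>) \<tau>"
          unfolding sub_sub(1) sub_push
          by (simp add: cst_def Rec comp_def upt_conv_Cons map_Suc_upt[symmetric] del: upt_Suc)
        ultimately have "eqv w' (cst i (S n \<rhd> ?\<rho>) \<tau>) (sub_trm r (n \<rhd> ?c \<rhd> ?\<rho>) \<tau>)"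
          by (simp add: cst_def Rec comp_def upt_conv_Cons map_Suc_upt[symmetric] del: upt_Suc)
        from eqv_trans[OF b[OF w'(1) unary_dom(1)[OF w'(2)]] this]
        have "eqv w' (sub_trm r (n \<rhd> ?c \<rhd> ?\<rho>) \<tau>) (Ap ?\<gamma> (S n))" by (rule eqv_sym)
        moreover have "ev D r w' (n \<rhd> ?c \<rhd> ?\<rho>) \<tau> (sub_trm r (n \<rhd> ?c \<rhd> ?\<rho>) \<tau>)" using self[OF _ e2] d Rec by auto
        moreover have "enveq w' (n \<rhd> ?c \<rhd> ?\<rho>) \<tau> (n \<rhd> Ap ?\<gamma> n \<rhd> ?\<rho>) \<tau>"
          by (intro enveq_push(1) enveq_refl e eqv_sym[OF b[OF w']] eqv_refl w'(2))
        ultimately show ?thesis using ev_eqv by blast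
      qed
      have "(\<sigma> 0 \<rhd> ?\<rho>) = \<sigma>" by (auto simp: fun_eq_iff split: nat.splits)
      then have "eqv w (cst i \<sigma> \<tau>) (Ap ?\<gamma> (\<sigma> 0))" using eqv_sym[OF b[OF w(1) env_dom(1)[OF env, of 0]]] by (simp only:)
      with \<gamma> q r show ?thesis unfolding Rec dsem.simps by blast
    qed
  qed
qed

text \<open>Each side of an equation is its own value up to equality, so the existence of a common
  value says that the sides are equal.\<close>

lemma force_tr_iff: "mj_fm A \<Longrightarrow> env w \<sigma> \<tau> \<Longrightarrow> force w \<sigma> \<tau> (tr D A) \<longleftrightarrow> force w \<sigma> \<tau> A"
proof (induction A arbitrary: w \<sigma> \<tau>)
  case (Eq s t)
  have "ev D t w \<sigma> \<tau> y \<longleftrightarrow> eqv w (sub_trm t \<sigma> \<tau>) y" if "mj_trm t" for t y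
    by (rule ev_iff[OF that Eq.prems(2)], rule ev_self(1)[of "length ds" True]) (use that represents Eq.prems(2) in auto)
  then have "force w \<sigma> \<tau> (tr D (s \<doteq> t)) \<longleftrightarrow>
    (\<exists>a\<in>dom_n w. eqv w (sub_trm s \<sigma> \<tau>) a \<and> eqv w (sub_trm t \<sigma> \<tau>) a)"
    using force_tr_eq[OF Eq.prems(2)] Eq.prems(1) by simp
  also have "\<dots> \<longleftrightarrow> eqv w (sub_trm s \<sigma> \<tau>) (sub_trm t \<sigma> \<tau>)"
    using eqv_join eqv_refl eqv_dom(2) by blast
  finally show ?case by simp
next
  case (Neg A)
  then show ?case using env_mono[OF _ Neg.prems(2)] by simp
next
  case (Imp A B)
  then show ?case using env_mono[OF _ Imp.prems(2)] by simp
next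
  case (All A)
  have "env w' (d \<rhd> \<sigma>) \<tau>" if "acc w w'" "d \<in> dom_n w'" for w' d
    using env_mono[OF that(1) All.prems(2)] that(2) by (simp add: env_push)
  then show ?case using All by simp
next
  case (Ex A) then show ?case by (simp add: env_push)
next
  case (FAll A)
  have "env w' \<sigma> (d \<rhd> \<tau>)" if "acc w w'" "d \<in> dom_f w'" for w' d
    using env_mono[OF that(1) FAll.prems(2)] that(2) by (simp add: env_push)
  then show ?case using FAll by simp
next
  case (FEx A) then show ?case by (simp add: env_push)
qed auto

lemma tr_equivalent: "A \<in> formulas (Mj ds) \<Longrightarrow> Mj ds \<parallel> {} \<turnstile> tr D A \<^bold>\<longleftrightarrow> A"
  using force_tr_iff env_mono bim_formulas[OF tr_formulas[OF const_fm_bim[of ds]]]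
  by (intro complete) (auto simp: Iff_def mj_formulas)

end

section \<open>Effectivity of the translation\<close>

text \<open>The inductive definition of recursive functions fixes their values on argument lists of every
  length; only those of the right length matter.\<close>

definition computable :: "nat \<Rightarrow> (nat list \<Rightarrow> nat) \<Rightarrow> bool" where
  "computable n f \<longleftrightarrow> (\<exists>g. recursive n g \<and> (\<forall>xs. length xs = n \<longrightarrow> g xs = f xs))"

section \<open>Closure properties of computable functions\<close>

lemma computable_cong: "computable n f \<Longrightarrow> (\<And>xs. length xs = n \<Longrightarrow> f xs = g xs) \<Longrightarrow> computable n g"
  by (auto simp: computable_def)

lemma computable_compose:
  assumes "computable k f" "\<And>i. i < k \<Longrightarrow> computable n (\<lambda>xs. h xs i)"
  shows "computable n (\<lambda>xs. f (map (h xs) [0..<k]))"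
proof -
  obtain f' where f': "recursive k f'" "\<And>xs. length xs = k \<Longrightarrow> f' xs = f xs"
    using assms(1) by (auto simp: computable_def)
  obtain h' where h': "\<And>i. i < k \<Longrightarrow> recursive n (h' i)" "\<And>i xs. i < k \<Longrightarrow> length xs = n \<Longrightarrow> h' i xs = h xs i"
    using assms(2) unfolding computable_def by metis
  have "recursive n (\<lambda>xs. f' (map (\<lambda>g. g xs) (map h' [0..<k])))"
    by (rule recursive.comp) (use f' h' in auto)
  moreover have "f' (map (\<lambda>g. g xs) (map h' [0..<k])) = f (map (h xs) [0..<k])" if "length xs = n" for xs
  proof -
    have m: "map (\<lambda>g. g xs) (map h' [0..<k]) = map (h xs) [0..<k]" using h'(2)[OF _ that] by simp
    show ?thesis unfolding m using f'(2) by simp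
  qed
  ultimately show ?thesis unfolding computable_def by blast
qed

lemma computable_nth: "i < n \<Longrightarrow> computable n (\<lambda>xs. xs ! i)"
  and computable_drop: "i + k < n \<Longrightarrow> computable n (\<lambda>xs. drop k xs ! i)"
  using recursive.proj[of i n] recursive.proj[of "k + i" n] unfolding computable_def by fastforce+

lemma computable_unary:
  assumes "computable 1 (\<lambda>xs. F (xs ! 0))" "computable n f"
  shows "computable n (\<lambda>xs. F (f xs))"
  using computable_compose[OF assms(1), of n "\<lambda>xs i. f xs"] assms(2) by simp

lemma computable_binary:
  assumes "computable 2 (\<lambda>xs. F (xs ! 0) (xs ! 1))" "computable n f" "computable n g"
  shows "computable n (\<lambda>xs. F (f xs) (g xs))"
  using computable_compose[OF assms(1), of n "\<lambda>xs i. (if i = 0 then f else g) xs"] assms(2,3)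
  by (simp add: numeral_2_eq_2)

lemma computable_Suc: "computable n f \<Longrightarrow> computable n (\<lambda>xs. Suc (f xs))"
  by (rule computable_unary) (use recursive.succ in \<open>auto simp: computable_def\<close>)

lemma computable_const: "computable n (\<lambda>xs. c)"
proof (induction c)
  case 0 show ?case using recursive.zero by (auto simp: computable_def)
qed (rule computable_Suc)

text \<open>The rule \<open>prec\<close> recurses on the head of the list with the tail as
  parameters; prefixing the value of h to the whole list brings every recursion into that
  form.\<close>

lemma computable_rec:
  assumes "computable n a" "computable (n + 2) (\<lambda>zs. g (zs ! 0) (zs ! 1) (drop 2 zs))" "computable n h"
  shows "computable n (\<lambda>xs. rec_nat (a xs) (\<lambda>y v. g y v xs) (h xs))"
proof -
  obtain a' where a': "recursive n a'" "\<And>xs. length xs = n \<Longrightarrow> a' xs = a xs"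
    using assms(1) by (auto simp: computable_def)
  obtain g' where g': "recursive (n + 2) g'" "\<And>zs. length zs = n + 2 \<Longrightarrow> g' zs = g (zs ! 0) (zs ! 1) (drop 2 zs)"
    using assms(2) by (auto simp: computable_def)
  have "computable (Suc n) (\<lambda>xs. rec_nat (a' (tl xs)) (\<lambda>y v. g' (y # v # tl xs)) (hd xs))"
    using recursive.prec[OF a'(1) g'(1)] by (auto simp: computable_def)
  from computable_compose[OF this, of n "\<lambda>xs i. case i of 0 \<Rightarrow> h xs | Suc j \<Rightarrow> xs ! j"]
  show ?thesis
  proof (rule computable_cong, goal_cases)
    case (1 i) then show ?case using assms(3) computable_nth by (cases i) auto
  next
    case (2 xs)
    have m: "map (\<lambda>i. case i of 0 \<Rightarrow> h xs | Suc j \<Rightarrow> xs ! j) [0..<Suc n] = h xs # xs"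
      using 2 by (simp add: upt_conv_Cons map_Suc_upt[symmetric] comp_def map_nth del: upt_Suc) (metis map_nth)
    show ?case unfolding m using 2 a'(2) g'(2) by simp
  qed
qed

lemmas computable_basic = computable_const computable_nth computable_drop computable_Suc

lemma computable_pred: "computable n f \<Longrightarrow> computable n (\<lambda>xs. f xs - 1)"
proof (rule computable_unary[where F = "\<lambda>x. x - 1"])
  have "computable 1 (\<lambda>xs. rec_nat 0 (\<lambda>y v. y) (xs ! 0))"
    by (intro computable_rec computable_basic) simp_all
  moreover have "rec_nat 0 (\<lambda>y v. y) x = x - 1" for x :: nat by (cases x) auto
  ultimately show "computable 1 (\<lambda>xs. xs ! 0 - 1)" by simp
qed

lemma computable_arith:
  assumes "computable n f" "computable n g"
  shows "computable n (\<lambda>xs. f xs + g xs)" "computable n (\<lambda>xs. f xs - g xs)"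
proof -
  have "computable 2 (\<lambda>xs. rec_nat (xs ! 0) (\<lambda>y v. Suc v) (xs ! 1))"
    "computable 2 (\<lambda>xs. rec_nat (xs ! 0) (\<lambda>y v. v - 1) (xs ! 1))"
    by (intro computable_rec computable_basic computable_pred; simp)+
  moreover have "rec_nat x (\<lambda>y v. Suc v) y = x + y" "rec_nat x (\<lambda>y v. v - 1) y = x - y" for x y :: nat
    by (induction y) auto
  ultimately have "computable 2 (\<lambda>xs. xs ! 0 + xs ! 1)" "computable 2 (\<lambda>xs. xs ! 0 - xs ! 1)" by simp_all
  from computable_binary[OF this(1) assms] computable_binary[OF this(2) assms]
  show "computable n (\<lambda>xs. f xs + g xs)" "computable n (\<lambda>xs. f xs - g xs)" .
qed

lemma computable_if:
  assumes "computable n f" "computable n g" "computable n h" "computable n k"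
  shows "computable n (\<lambda>xs. if f xs = g xs then h xs else k xs)"
proof -
  have k: "computable (n + 2) (\<lambda>zs. k (drop 2 zs))"
    using computable_compose[OF assms(4), of "n + 2" "\<lambda>zs i. drop 2 zs ! i"]
    by (rule computable_cong[OF _ arg_cong[where f = k]]) (auto intro!: computable_basic nth_equalityI)
  \<comment> \<open>The sum of the two cut-off differences is 0 exactly for equal values, and a
    recursion on it selects the branch.\<close>
  have "computable n (\<lambda>xs. rec_nat (h xs) (\<lambda>y v. k xs) ((f xs - g xs) + (g xs - f xs)))"
    by (intro computable_rec computable_arith assms k)
  moreover have "rec_nat (h xs) (\<lambda>y v. k xs) ((f xs - g xs) + (g xs - f xs)) = (if f xs = g xs then h xs else k xs)" for xs
    by (cases "(f xs - g xs) + (g xs - f xs)") auto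
  ultimately show ?thesis by simp
qed

lemma computable_triangle: "computable n f \<Longrightarrow> computable n (\<lambda>xs. triangle (f xs))"
proof (rule computable_unary[where F = triangle])
  have "computable 1 (\<lambda>xs. rec_nat 0 (\<lambda>y v. v + Suc y) (xs ! 0))"
    by (intro computable_rec computable_arith computable_basic) simp_all
  moreover have "rec_nat 0 (\<lambda>y v. v + Suc y) x = triangle x" for x by (induction x) auto
  ultimately show "computable 1 (\<lambda>xs. triangle (xs ! 0))" by simp
qed

lemma computable_prod_encode:
  "computable n f \<Longrightarrow> computable n g \<Longrightarrow> computable n (\<lambda>xs. prod_encode (f xs, g xs))"
  unfolding prod_encode_def by (simp add: computable_arith computable_triangle)

lemma computable_prod_decode:
  assumes "computable n f"
  shows "computable n (\<lambda>xs. fst (prod_decode (f xs)))" "computable n (\<lambda>xs. snd (prod_decode (f xs)))"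
proof -
  \<comment> \<open>The index of the diagonal that contains z: the largest v with
    \<open>triangle v \<le> z\<close>, raised whenever z reaches the next triangular number.\<close>
  define d where "d = rec_nat 0 (\<lambda>y v. if Suc y = triangle (Suc v) then Suc v else v)"
  have *: "triangle (d z) \<le> z \<and> z < triangle (Suc (d z))" for z
    by (induction z) (auto simp: d_def)
  have "prod_decode z = (z - triangle (d z), d z - (z - triangle (d z)))" for z
  proof -
    obtain k where "z = triangle (d z) + k" using *[of z] le_Suc_ex by blast
    moreover from this have "k \<le> d z" using *[of z] by simp
    ultimately have "prod_encode (z - triangle (d z), d z - (z - triangle (d z))) = z"
      by (simp add: prod_encode_def)
    then show ?thesis by (metis prod_encode_inverse)
  qed
  moreover have d: "computable n (\<lambda>xs. d (f xs))"
    unfolding d_def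
    by (rule computable_unary[OF _ assms])
      (intro computable_rec computable_if computable_triangle computable_basic; simp)
  ultimately show "computable n (\<lambda>xs. fst (prod_decode (f xs)))" "computable n (\<lambda>xs. snd (prod_decode (f xs)))"
    by (simp_all add: computable_arith computable_triangle assms)
qed

text \<open>Finitely many values are patched in one by one. This covers the formulas of the
  constants, a finite list continued by one fixed formula.\<close>

lemma computable_table:
  assumes "\<And>i. N \<le> i \<Longrightarrow> h i = c" "computable n f"
  shows "computable n (\<lambda>xs. h (f xs))"
  using assms(1)
proof (induction N arbitrary: h)
  case 0 then show ?case by (simp add: computable_const)
next
  case (Suc N)
  have "computable n (\<lambda>xs. (h(N := c)) (f xs))" by (rule Suc.IH) (use Suc.prems in auto)
  from computable_if[OF assms(2) computable_const[of n N] computable_const[of n "h N"] this]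
  show ?case by (rule computable_cong) auto
qed


subsection \<open>Course-of-values recursion\<close>

abbreviation pfst :: "nat \<Rightarrow> nat" where "pfst n \<equiv> fst (prod_decode n)"
abbreviation psnd :: "nat \<Rightarrow> nat" where "psnd n \<equiv> snd (prod_decode n)"

text \<open>Nested pairs ending in 0, so that a history grows by a single pairing.\<close>

definition tuple :: "nat list \<Rightarrow> nat" where "tuple xs = foldr (\<lambda>a v. prod_encode (a, v)) xs 0"
definition sel :: "nat \<Rightarrow> nat \<Rightarrow> nat" where "sel k v = pfst ((psnd ^^ k) v)"

lemma sel_tuple [simp]: "k < length xs \<Longrightarrow> sel k (tuple xs) = xs ! k"
proof (induction xs arbitrary: k)
  case (Cons x xs) then show ?case by (cases k) (auto simp: sel_def tuple_def funpow_Suc_right simp del: funpow.simps(2))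
qed simp

lemma computable_sel:
  assumes "computable n f" "computable n g" shows "computable n (\<lambda>xs. sel (f xs) (g xs))"
proof -
  have "(psnd ^^ k) v = rec_nat v (\<lambda>_. psnd) k" for k v by (induction k) auto
  then show ?thesis
    unfolding sel_def by (simp only:) (intro computable_prod_decode computable_rec computable_basic assms; simp)
qed

text \<open>A history has its latest value in front, which puts the value at m in place n - Suc
  m.\<close>

definition recall :: "nat \<Rightarrow> nat \<Rightarrow> nat \<Rightarrow> nat" where "recall v n m = sel (n - Suc m) v"

text \<open>The history at n is the tuple of the values at n - 1, ..., 0.\<close>

definition history :: "(nat \<Rightarrow> (nat \<Rightarrow> nat) \<Rightarrow> nat) \<Rightarrow> nat \<Rightarrow> nat" where
  "history G n = rec_nat 0 (\<lambda>n v. prod_encode (G n (recall v n), v)) n"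
definition before :: "(nat \<Rightarrow> (nat \<Rightarrow> nat) \<Rightarrow> nat) \<Rightarrow> nat \<Rightarrow> nat \<Rightarrow> nat" where
  "before G n = recall (history G n) n"
definition course :: "(nat \<Rightarrow> (nat \<Rightarrow> nat) \<Rightarrow> nat) \<Rightarrow> nat \<Rightarrow> nat" where
  "course G n = G n (before G n)"

lemma before: "m < n \<Longrightarrow> before G n m = course G m"
proof -
  have "history G n = tuple (map (course G) (rev [0..<n]))"
    by (induction n) (simp_all add: history_def course_def before_def tuple_def)
  then show "m < n \<Longrightarrow> ?thesis" by (simp add: before_def recall_def rev_nth)
qed

text \<open>Computability is asked of the step as a function of its argument and the coded history,
  because a recursive function takes no function as argument.\<close>

lemma computable_course:
  assumes "computable 2 (\<lambda>xs. G (xs ! 0) (recall (xs ! 1) (xs ! 0)))" "computable n f"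
  shows "computable n (\<lambda>xs. course G (f xs))"
  unfolding course_def before_def history_def
  by (intro computable_binary[where F = "\<lambda>n v. G n (recall v n)", OF assms(1)]
      computable_rec computable_prod_encode computable_basic assms(2); simp)

lemma computable_recall:
  "computable n f \<Longrightarrow> computable n g \<Longrightarrow> computable n h \<Longrightarrow> computable n (\<lambda>xs. recall (f xs) (g xs) (h xs))"
  unfolding recall_def by (intro computable_sel computable_arith computable_Suc)

lemmas computable_intros = computable_if computable_prod_encode computable_prod_decode computable_sel
  computable_recall computable_arith computable_basic

subsection \<open>The translation on codes\<close>

text \<open>\<open>cand\<close> and \<open>cap\<close> have the same body: terms and formulas are
  coded independently and their tags overlap.\<close>

definition cex :: "nat \<Rightarrow> nat" where "cex a = prod_encode (6, a)"
definition cfex :: "nat \<Rightarrow> nat" where "cfex a = prod_encode (8, a)"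
definition cand :: "nat \<Rightarrow> nat \<Rightarrow> nat" where "cand a b = prod_encode (2, prod_encode (a, b))"
definition cap :: "nat \<Rightarrow> nat \<Rightarrow> nat" where "cap a b = prod_encode (2, prod_encode (a, b))"
definition cj :: "nat \<Rightarrow> nat \<Rightarrow> nat" where "cj a b = prod_encode (3, prod_encode (a, b))"
definition ceq :: "nat \<Rightarrow> nat \<Rightarrow> nat" where "ceq a b = prod_encode (0, prod_encode (a, b))"
definition cnum :: "nat \<Rightarrow> nat" where "cnum n = rec_nat (code_trm Zero) (\<lambda>_. cap (code_fnc Succ)) n"

lemmas code_defs = cex_def cfex_def cand_def cap_def cj_def ceq_def

lemma cnum: "cnum n = code_trm (num n)"
  by (induction n) (auto simp: cnum_def cap_def)

lemma computable_code:
  "computable n f \<Longrightarrow> computable n (\<lambda>xs. cex (f xs))"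
  "computable n f \<Longrightarrow> computable n (\<lambda>xs. cfex (f xs))"
  "computable n f \<Longrightarrow> computable n (\<lambda>xs. cnum (f xs))"
  "computable n f \<Longrightarrow> computable n g \<Longrightarrow> computable n (\<lambda>xs. cand (f xs) (g xs))"
  "computable n f \<Longrightarrow> computable n g \<Longrightarrow> computable n (\<lambda>xs. cap (f xs) (g xs))"
  "computable n f \<Longrightarrow> computable n g \<Longrightarrow> computable n (\<lambda>xs. cj (f xs) (g xs))"
  "computable n f \<Longrightarrow> computable n g \<Longrightarrow> computable n (\<lambda>xs. ceq (f xs) (g xs))"
  unfolding code_defs cnum_def by (intro computable_intros computable_rec; simp)+

text \<open>One course-of-values recursion on c computes the codes of the graphs of the term, of the functor, and of
  the lists of arguments with code c, and whether that term and that functor are in the language of BIM.\<close>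

definition graph_step :: "(nat \<Rightarrow> fm) \<Rightarrow> nat \<Rightarrow> (nat \<Rightarrow> nat) \<Rightarrow> nat" where
  "graph_step D c F = tuple
    [if pfst c = 0 then ceq (code_trm (NV 0)) (cap (code_fnc (FV 0)) (cj (code_trm Zero) (cnum (psnd c))))
     else if pfst c = 1 then code_fm (NV 0 \<doteq> Zero)
     else if pfst c = 2 then cex (cand (sel 0 (F (psnd (psnd c)))) (cex (cand (sel 1 (F (pfst (psnd c)))) (code_fm (NV 2 \<doteq> NV 0)))))
     else if pfst c = 3 then cex (cand (sel 0 (F (pfst (psnd c)))) (cex (cand (sel 0 (F (psnd (psnd c)))) (code_fm (NV 2 \<doteq> J (NV 1) (NV 0))))))
     else cfex (cand (cex (cand (code_fm (NV 0 \<doteq> Zero)) (sel 2 (F (pfst (psnd (psnd c)))))))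
       (cand (cex (cand (code_fm (NV 0 \<doteq> Zero)) (sel 3 (F (psnd (psnd (psnd c)))))))
         (code_fm (D (pfst (psnd c)))))),
     if pfst c = 0 then ceq (code_trm (NV 0)) (cap (code_fnc (FV 0)) (cj (cap (code_fnc Succ) (cnum (psnd c))) (code_trm (NV 1))))
     else if pfst c = 1 then code_fm (NV 0 \<doteq> S (NV 1))
     else if pfst c = 2 then code_fm (NV 0 \<doteq> Ap PK (NV 1))
     else if pfst c = 3 then code_fm (NV 0 \<doteq> Ap PL (NV 1))
     else cfex (cand (code_fm (push_fm (FV 0) (FV 1) (NV 1))) (sel 0 (F (psnd c)))),
     if c = 0 then code_fm (Zero \<doteq> Zero)
     else cand (cfex (cand (code_fm copy_fm) (cex (cand (sel 0 (F (pfst (c - 1)))) (code_fm (NV 0 \<doteq> Ap (FV 1) (J Zero (NV 1))))))))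
       (cex (cand (code_fm (NV 0 \<doteq> S (NV 1))) (sel 2 (F (psnd (c - 1)))))),
     if c = 0 then code_fm (Zero \<doteq> Zero)
     else cand (cfex (cand (code_fm copy_fm) (prod_encode (5, cex (cand (sel 1 (F (pfst (c - 1))))
         (code_fm (NV 0 \<doteq> Ap (FV 1) (J (S (NV 2)) (NV 1)))))))))
       (cex (cand (code_fm (NV 0 \<doteq> S (NV 1))) (sel 3 (F (psnd (c - 1)))))),
     if pfst c = 0 then 1 else if pfst c = 1 then 1
     else if pfst c = 2 then (if sel 5 (F (pfst (psnd c))) = 1 then sel 4 (F (psnd (psnd c))) else 0)
     else if pfst c = 3 then (if sel 4 (F (pfst (psnd c))) = 1 then sel 4 (F (psnd (psnd c))) else 0) else 0,
     if pfst c = 4 then (if psnd c = code_trm Zero then 1 else if psnd c = code_trm (NV 0) then 1 else 0) else 1]"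

text \<open>A positive tag makes the code strictly larger than its components, whereas tag 0 need
  not. All calls to earlier values go through positive tags, or through list codes, which are
  successors.\<close>

lemma tag_bounds: "0 < a \<Longrightarrow> m \<le> b \<Longrightarrow> m < prod_encode (a, b)" "m \<le> a \<Longrightarrow> m \<le> prod_encode (a, b)" "m \<le> b \<Longrightarrow> m \<le> prod_encode (a, b)"
proof -
  have "triangle k \<ge> k" for k by (induction k) auto
  from this[of "a + b"] show "0 < a \<Longrightarrow> m \<le> b \<Longrightarrow> m < prod_encode (a, b)"
    "m \<le> a \<Longrightarrow> m \<le> prod_encode (a, b)" "m \<le> b \<Longrightarrow> m \<le> prod_encode (a, b)"
    by (auto simp: prod_encode_def)
qed

definition graphs :: "(nat \<Rightarrow> fm) \<Rightarrow> nat \<Rightarrow> nat" where "graphs D = course (graph_step D)"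
definition graphs_before :: "(nat \<Rightarrow> fm) \<Rightarrow> nat \<Rightarrow> nat \<Rightarrow> nat" where "graphs_before D = before (graph_step D)"

lemma graphs_unfold: "graphs D n = graph_step D n (graphs_before D n)"
  and graphs_before: "m < n \<Longrightarrow> graphs_before D n m = graphs D m"
  unfolding graphs_def graphs_before_def by (rule course_def, rule before)

lemma computable_graphs:
  assumes "computable 2 (\<lambda>xs. code_fm (D (pfst (psnd (xs ! 0)))))" "computable n f"
  shows "computable n (\<lambda>xs. graphs D (f xs))"
  unfolding graphs_def
proof (rule computable_course[OF _ assms(2)])
  show "computable 2 (\<lambda>xs. graph_step D (xs ! 0) (recall (xs ! 1) (xs ! 0)))"
    unfolding graph_step_def tuple_def foldr.simps comp_def id_def
    by (intro computable_intros computable_code assms(1); simp)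
qed

text \<open>Correctness is assumed for the members only, so that the lemma fits inside the induction
  on terms.\<close>

lemma graphs_args:
  "(\<And>t. t \<in> set ts \<Longrightarrow> sel 0 (graphs D (code_trm t)) = code_fm (graph D t)) \<Longrightarrow>
    sel 2 (graphs D (list_encode (map code_trm ts))) = code_fm (argn_fm (map (graph D) ts))"
  "(\<And>u. u \<in> set us \<Longrightarrow> sel 1 (graphs D (code_fnc u)) = code_fm (graphf D u)) \<Longrightarrow>
    sel 3 (graphs D (list_encode (map code_fnc us))) = code_fm (argf_fm (map (graphf D) us))"
proof (induction ts)
  case Nil
  { case 1 show ?case by (simp add: graphs_unfold graph_step_def) }
  { case 2 then show ?case
    proof (induction us)
      case Nil show ?case by (simp add: graphs_unfold graph_step_def)
    next
      case (Cons u us)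
      then show ?case
        by (subst graphs_unfold) (simp add: graph_step_def graphs_before less_Suc_eq_le tag_bounds code_defs)
    qed }
next
  case (Cons t ts)
  { case 1 with Cons.IH(1) show ?case
      by (subst graphs_unfold) (simp add: graph_step_def graphs_before less_Suc_eq_le tag_bounds code_defs) }
  { case 2 then show ?case by (rule Cons.IH(2)) }
qed

lemma graphs_correct:
  "sel 0 (graphs D (code_trm t)) = code_fm (graph D t)" "sel 4 (graphs D (code_trm t)) = (if bim_trm t then 1 else 0)"
  "sel 1 (graphs D (code_fnc u)) = code_fm (graphf D u)" "sel 5 (graphs D (code_fnc u)) = (if bim_fnc u then 1 else 0)"
proof (induction t and u)
  case (Ap u t)
  { case 1 show ?case using Ap by (subst graphs_unfold) (simp add: graph_step_def graphs_before tag_bounds code_defs) }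
  { case 2 show ?case using Ap by (subst graphs_unfold) (simp add: graph_step_def graphs_before tag_bounds code_defs) }
next
  case (J s t)
  { case 1 show ?case using J by (subst graphs_unfold) (simp add: graph_step_def graphs_before tag_bounds code_defs) }
  { case 2 show ?case using J by (subst graphs_unfold) (simp add: graph_step_def graphs_before tag_bounds code_defs) }
next
  case (Cst i ts us)
  { case 1 show ?case using graphs_args(1)[of ts D] graphs_args(2)[of us D] Cst
      by (subst graphs_unfold) (simp add: graph_step_def graphs_before tag_bounds code_defs) }
  { case 2 show ?case by (subst graphs_unfold) (simp add: graph_step_def) }
next
  case (Lam t)
  { case 1 show ?case using Lam by (subst graphs_unfold) (simp add: graph_step_def graphs_before tag_bounds code_defs) }
  { case 2 
    \<comment> \<open>The two abstractions of BIM are recognized by the codes of their bodies, which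
      no other term shares.\<close>
    have "t = Zero \<longleftrightarrow> code_trm t = code_trm Zero" "t = NV 0 \<longleftrightarrow> code_trm t = code_trm (NV 0)"
      by (cases t; simp)+
    then show ?case by (subst graphs_unfold) (simp add: graph_step_def ZeroF_def IdF_def) }
qed (simp_all add: graphs_unfold graph_step_def code_defs cnum)

definition cenv :: "nat \<Rightarrow> nat" where
  "cenv N = rec_nat (code_fm (Zero \<doteq> Zero)) (\<lambda>n v. cand v (cand
    (ceq (cap (code_fnc (FV 0)) (cj (code_trm Zero) (cnum n))) (prod_encode (0, n)))
    (prod_encode (5, ceq (cap (code_fnc (FV 0)) (cj (cap (code_fnc Succ) (cnum n)) (code_trm (NV 0))))
      (cap (prod_encode (0, Suc n)) (code_trm (NV 0))))))) N"

lemma cenv: "cenv N = code_fm (env_fm N)"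
  by (induction N) (simp_all add: cenv_def code_defs cnum)

lemma computable_cenv: "computable n f \<Longrightarrow> computable n (\<lambda>xs. cenv (f xs))"
  unfolding cenv_def by (intro computable_rec computable_intros computable_code; simp)

text \<open>At tag 0 the components are codes of terms, so the finished function
  \<open>graphs\<close> is called there instead of the history. The last case covers negation and
  the four quantifiers, which keep their tag.\<close>

definition tr_step :: "(nat \<Rightarrow> fm) \<Rightarrow> nat \<Rightarrow> (nat \<Rightarrow> nat) \<Rightarrow> nat" where
  "tr_step D c F =
    (if pfst c = 0 then
       (if (if sel 4 (graphs D (pfst (psnd c))) = 1 then sel 4 (graphs D (psnd (psnd c))) else 0) = 1 then c
        else cfex (cand (cenv (Suc (pfst (psnd c) + psnd (psnd c))))
          (cex (cand (sel 0 (graphs D (pfst (psnd c)))) (cex (cand (sel 0 (graphs D (psnd (psnd c)))) (code_fm (NV 1 \<doteq> NV 0))))))))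
     else if pfst c = 2 then cand (F (pfst (psnd c))) (F (psnd (psnd c)))
     else if pfst c = 3 then prod_encode (3, prod_encode (F (pfst (psnd c)), F (psnd (psnd c))))
     else if pfst c = 4 then prod_encode (4, prod_encode (F (pfst (psnd c)), F (psnd (psnd c))))
     else prod_encode (pfst c, F (psnd c)))"

definition ctr :: "(nat \<Rightarrow> fm) \<Rightarrow> nat \<Rightarrow> nat" where "ctr D = course (tr_step D)"
definition ctr_before :: "(nat \<Rightarrow> fm) \<Rightarrow> nat \<Rightarrow> nat \<Rightarrow> nat" where "ctr_before D = before (tr_step D)"

lemma ctr_unfold: "ctr D n = tr_step D n (ctr_before D n)"
  and ctr_before: "m < n \<Longrightarrow> ctr_before D n m = ctr D m"
  unfolding ctr_def ctr_before_def by (rule course_def, rule before)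

lemma ctr: "ctr D (code_fm A) = code_fm (tr D A)"
proof (induction A)
  case (Eq s t)
  show ?case
    by (subst ctr_unfold) (simp add: tr_step_def tr_eq_def graphs_correct cenv code_defs del: env_fm.simps)
qed (subst ctr_unfold, simp add: tr_step_def ctr_before tag_bounds code_defs)+

lemma tr_effective: "effective_on X (tr (const_fm ds))"
proof -
  \<comment> \<open>A table of finitely many codes, so the passage from a definition to its formula
    never has to be computed.\<close>
  have D: "computable n (\<lambda>xs. code_fm (const_fm ds (f xs)))" if "computable n f" for n f
    by (rule computable_table[of "length ds" "\<lambda>i. code_fm (const_fm ds i)", OF _ that]) (simp add: const_fm.simps)
  have "computable 2 (\<lambda>xs. tr_step (const_fm ds) (xs ! 0) (recall (xs ! 1) (xs ! 0)))"
    unfolding tr_step_def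
    by (intro computable_intros computable_code computable_cenv computable_graphs D; simp)
  then have "computable 1 (\<lambda>xs. ctr (const_fm ds) (xs ! 0))"
    unfolding ctr_def by (rule computable_course) (simp add: computable_nth)
  then obtain F where "recursive 1 F" "\<forall>xs. length xs = 1 \<longrightarrow> F xs = ctr (const_fm ds) (xs ! 0)"
    unfolding computable_def by blast
  then show ?thesis unfolding effective_on_def by (auto simp: ctr intro!: HOL.exI[of _ F])
qed

theorem theorem7p2:
  fixes ds :: "prdef list"
  assumes "kleene_constants ds"
  shows "definitional_extension (Mj ds) BIM_CFd"
proof -
  have pr: "pr_definitions ds" using assms by (simp add: kleene_constants_def)
  \<comment> \<open>Evaluation is used in two kinds of models: those of BIM + CFd for the soundness
    of the translation, those of Mj for the equivalence of a formula with its translation.\<close>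
  interpret b: pr_model BIM_CFd ds by unfold_locales (rule pr)
  interpret m: choice_model "Mj ds" by (rule Mj_choice_model)
  interpret mj_model ds by unfold_locales (rule pr)
  let ?tr = "tr (const_fm ds)"
  have tr_bimf: "?tr A \<in> formulas BIM" for A by (rule tr_formulas[OF const_fm_bim])
  have "extends (Mj ds) BIM_CFd"
    unfolding extends_def
  proof (intro conjI HOL.allI HOL.impI)
    show sub: "terms BIM_CFd \<subseteq> terms (Mj ds)" "functors BIM_CFd \<subseteq> functors (Mj ds)"
      using m.bim_terms by auto
    show "Mj ds \<parallel> \<Gamma> \<turnstile> E" if "BIM_CFd \<parallel> \<Gamma> \<turnstile> E" for \<Gamma> E
      by (rule derives_transfer[OF sub m.BIM_CFd_theorem that])
  qed
  \<comment> \<open>At every world of BIM + CFd that forces the translated assumptions the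
    translated conclusion is forced too; completeness turns this into a derivation.\<close>
  moreover have "BIM_CFd \<parallel> ?tr ` \<Gamma> \<turnstile> ?tr E" if "Mj ds \<parallel> \<Gamma> \<turnstile> E" for \<Gamma> E
    by (rule bimc.complete) (use tr_bimf b.translation_sound[OF that] in auto)
  ultimately show ?thesis
    unfolding definitional_extension_def
    using tr_effective tr_bimf tr_bim tr_equivalent
    by (intro conjI HOL.exI[of _ ?tr]) (auto simp: commutes_with_logic_def)
qed

end
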